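(* Let $\mathcal S_{m+1}$ be a compact star graph with one central vertex and $m\ge1$ leaf vertices, with every edge oriented from the centre to the leaf, and let $\mathscr L:\mathcal S_{m+1}\times T\mathbb R^d\to\mathbb R$ be a Lagrangian function satisfying conditions (i), (ii), (L1), (L2) of the context. Let $x$ be a critical point of the Lagrangian action functional for the Bolza problem with fixed endpoints at the $m$ leaf vertices and Kirchhoff condition at the central vertex. Then $$\mathrm n_-(x,\mathcal S_{m+1})-\mu^{\mathrm{CLM}}(x,\mathcal S_{m+1})=-(m-1)\,d .$$
   Context: **Setting.** The edges are compact intervals $I_j=[a_j,b_j]$, $j=1,\dots,m$; all $a_j$ correspond to the central vertex, and $b_j$ to the $j$-th leaf. Conditions: (i) $\mathscr L$ is continuous; (ii) $\mathscr L_j:=\mathscr L|_{I_j}\in C^2(I_j\times T\mathbb R^d,\mathbb R)$; (L1) $\partial^2_{vv}\mathscr L_j>0$; (L2) $\mathscr L_j$ is exactly quadratic in the velocities. The action is $A(x)=\sum_j\int_{a_j}^{b_j}\mathscr L_j(t,x_j,x_j')\,dt$ on families $x=(x_j)$, $x_j\in W^{1,2}(I_j;\mathbb R^d)$, that are continuous on the graph (so $x_1(a_1)=\dots=x_m(a_m)$) and have prescribed values at the leaves. Critical points solve the Euler–Lagrange equation on each edge together with the Kirchhoff condition $\sum_j\partial_v\mathscr L_j(a_j,x_j(a_j),x_j'(a_j))=0$. **Morse index.** Put $P_j=\partial^2_{vv}\mathscr L_j$, $Q_j=\partial^2_{qv}\mathscr L_j$, $R_j=\partial^2_{qq}\mathscr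 L_j$ evaluated along $(t,x_j,x_j')$. $\mathrm n_-(x,\mathcal S_{m+1})$ is the Morse index (maximal dimension of a negative definite subspace) of the index form $$\mathcal I(\xi,\eta)=\sum_j\int_{a_j}^{b_j}\big[\langle P_j\xi_j'+Q_j\xi_j,\eta_j'\rangle+\langle Q_j^{\top}\xi_j',\eta_j\rangle+\langle R_j\xi_j,\eta_j\rangle\big]dt$$ on the space of $W^{1,2}$ families $\xi$ with $\xi_1(a_1)=\dots=\xi_m(a_m)$ and $\xi_j(b_j)=0$ for all $j$. **Maslov index.** With $J=\begin{pmatrix}0&-I_d\\ I_d&0\end{pmatrix}$ and $\Omega(z,w)=\langle Jz,w\rangle$ on $\mathbb R^{2d}$ with coordinates $z=(p,q)$, $p=P q'+Qq$, the linearized Hamiltonian system on edge $j$ is $z'=JB_jz$ with $$B_j=\begin{pmatrix}P_j^{-1}&-P_j^{-1}Q_j\\ -Q_j^{\top}P_j^{-1}&Q_j^{\top}P_j^{-1}Q_j-R_j\end{pmatrix};$$ $\gamma_j:[a_j,b_j]\to\mathrm{Sp}(2d)$ is its fundamental solution with $\gamma_j(a_j)=I$. In the symplectic space $\bigoplus_{j=1}^m(\mathbb R^{2d}\oplus\mathbb R^{2d},-\Omega\oplus\Omega)$ (first copy: value at $a_j$; second copy: value at $b_j$), let $\lambda(\tau)=\bigoplus_j\{(z,\gamma_j(a_j+\tau(b_j-a_j))z):z\in\mathbb R^{2d}\}$, $\tau\in[0,1]$, and let $\Lambda_0$ be the Lagrangian subspace of the boundary conditions: all vectors with components $(p_j^a,q_j^a,p_j^b,q_j^b)$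 satisfying $q_j^b=0$ for all $j$, $q_1^a=\dots=q_m^a$, $\sum_jp_j^a=0$. Then $\mu^{\mathrm{CLM}}(x,\mathcal S_{m+1}):=\mu^{\mathrm{CLM}}(\Lambda_0,\lambda(\tau);\tau\in[0,1])$. **CLM index.** In a finite-dimensional symplectic space $(V,\omega)$, for a $C^1$ Lagrangian path $\ell$ and $v\in\ell(t)$ set $Q(\ell(t),\dot\ell(t))[v]=\frac{d}{d\tau}|_{\tau=t}\,\omega(v,w(\tau))$, where $W$ is a fixed Lagrangian complement of $\ell(t)$ and $w(\tau)\in W$ satisfies $v+w(\tau)\in\ell(\tau)$. The crossing form is $\Gamma(\ell_2,\ell_1,t)=(Q(\ell_2(t),\dot\ell_2(t))-Q(\ell_1(t),\dot\ell_1(t)))|_{\ell_1(t)\cap\ell_2(t)}$. $\mu^{\mathrm{CLM}}(\ell_1,\ell_2;t\in[a,b])$ is the integer-valued invariant of continuous pairs of Lagrangian paths that is invariant under homotopy with fixed endpoints, additive under concatenation, and satisfies for $C^1$ pairs with only nondegenerate crossing forms $$\mu^{\mathrm{CLM}}(\ell_1,\ell_2)=\mathrm n_+\Gamma(\ell_2,\ell_1,a)+\sum_{a<t<b}\mathrm{sgn}\,\Gamma(\ell_2,\ell_1,t)-\mathrm n_-\Gamma(\ell_2,\ell_1,b).$$ *)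

theory Defs
  imports "HOL-Analysis.Analysis" "HOL-Library.Function_Algebras" "HOL-Library.Extended_Nat"
begin

section \<open>Functions as vectors, and indices of quadratic forms\<close>

text \<open>With the pointwise operations, \<open>subspace\<close> and \<open>dim\<close> apply to spaces of vector-valued
  functions.\<close>

instantiation "fun" :: (type, real_vector) real_vector
begin

definition scaleR_fun_def: "c *\<^sub>R f = (\<lambda>x. c *\<^sub>R f x)"

instance
  by standard (simp_all add: scaleR_fun_def fun_eq_iff scaleR_add_right scaleR_add_left)

end

lemma scaleR_fun_apply [simp]: "(c *\<^sub>R f) x = c *\<^sub>R f x"
  by (simp add: scaleR_fun_def)

text \<open>Maximal dimension of a subspace of \<open>H\<close> on which \<open>q\<close> is negative definite, \<open>\<infinity>\<close> if
  there is no bound.  (\<open>dim V = 0\<close> for an infinite-dimensional \<open>V\<close>, but such a \<open>V\<close> has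
  subspaces of every finite dimension, so the supremum is \<open>\<infinity>\<close> as it should be.)\<close>

definition neg_index :: "('v::real_vector \<Rightarrow> real) \<Rightarrow> 'v set \<Rightarrow> enat" where
  "neg_index q H = Sup {enat (dim V) | V. subspace V \<and> V \<subseteq> H \<and> (\<forall>v\<in>V. v \<noteq> 0 \<longrightarrow> q v < 0)}"

definition n_minus :: "('v::euclidean_space \<Rightarrow> real) \<Rightarrow> 'v set \<Rightarrow> int" where
  "n_minus q U = int (the_enat (neg_index q U))"

definition n_plus :: "('v::euclidean_space \<Rightarrow> real) \<Rightarrow> 'v set \<Rightarrow> int" where
  "n_plus q U = n_minus (\<lambda>v. - q v) U"

definition form_signature :: "('v::euclidean_space \<Rightarrow> real) \<Rightarrow> 'v set \<Rightarrow> int" where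
  "form_signature q U = n_plus q U - n_minus q U"

text \<open>\<open>q (u + v) - q u - q v\<close> is twice the polar bilinear form of \<open>q\<close>.\<close>

definition nondegenerate_form :: "('v::euclidean_space \<Rightarrow> real) \<Rightarrow> 'v set \<Rightarrow> bool" where
  "nondegenerate_form q U \<longleftrightarrow> (\<forall>u\<in>U. (\<forall>v\<in>U. q (u + v) - q u - q v = 0) \<longrightarrow> u = 0)"


section \<open>Lagrangian paths and the CLM index\<close>

definition lagrangian_subspace :: "('v::euclidean_space \<Rightarrow> 'v \<Rightarrow> real) \<Rightarrow> 'v set \<Rightarrow> bool" where
  "lagrangian_subspace \<omega> U \<longleftrightarrow> subspace U \<and> U = {v. \<forall>u\<in>U. \<omega> v u = 0}"

text \<open>The topology (and the smooth structure) of the Lagrangian Grassmannian is the one induced by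
  \<open>U \<mapsto> \<close> orthogonal projection onto \<open>U\<close>; this projection is \<open>closest_point U\<close>.\<close>

definition continuous_lagrangian_family ::
    "('v::euclidean_space \<Rightarrow> 'v \<Rightarrow> real) \<Rightarrow> 'p::topological_space set \<Rightarrow> ('p \<Rightarrow> 'v set) \<Rightarrow> bool" where
  "continuous_lagrangian_family \<omega> S l \<longleftrightarrow>
     (\<forall>s\<in>S. lagrangian_subspace \<omega> (l s)) \<and>
     (\<forall>v. continuous_on S (\<lambda>s. closest_point (l s) v))"

definition C1_lagrangian_path ::
    "('v::euclidean_space \<Rightarrow> 'v \<Rightarrow> real) \<Rightarrow> real \<Rightarrow> real \<Rightarrow> (real \<Rightarrow> 'v set) \<Rightarrow> bool" where
  "C1_lagrangian_path \<omega> a b l \<longleftrightarrow>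
     (\<forall>t\<in>{a..b}. lagrangian_subspace \<omega> (l t)) \<and>
     (\<forall>v. \<exists>D. continuous_on {a..b} D \<and>
        (\<forall>t\<in>{a..b}. ((\<lambda>s. closest_point (l s) v) has_vector_derivative D t) (at t within {a..b})))"

text \<open>\<open>Q(l(t), l'(t))[v]\<close> for a path on \<open>[a,b]\<close> (one-sided derivatives at the endpoints).  For
  \<open>s\<close> near \<open>t\<close> the vector \<open>w(s)\<close> is unique; the value does not depend on the complement \<open>W\<close>.\<close>

definition lagrangian_velocity_form ::
    "('v::euclidean_space \<Rightarrow> 'v \<Rightarrow> real) \<Rightarrow> real \<Rightarrow> real \<Rightarrow> (real \<Rightarrow> 'v set) \<Rightarrow> real \<Rightarrow> 'v \<Rightarrow> real" where
  "lagrangian_velocity_form \<omega> a b l t v =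
     (let W = (SOME W. lagrangian_subspace \<omega> W \<and> W \<inter> l t = {0});
          w = (\<lambda>s. THE w. w \<in> W \<and> v + w \<in> l s)
      in vector_derivative (\<lambda>s. \<omega> v (w s)) (at t within {a..b}))"

text \<open>\<open>\<Gamma>(l\<^sub>2, l\<^sub>1, t)\<close>, to be restricted to \<open>l\<^sub>1 t \<inter> l\<^sub>2 t\<close>.\<close>

definition crossing_form ::
    "('v::euclidean_space \<Rightarrow> 'v \<Rightarrow> real) \<Rightarrow> real \<Rightarrow> real \<Rightarrow> (real \<Rightarrow> 'v set) \<Rightarrow> (real \<Rightarrow> 'v set)
      \<Rightarrow> real \<Rightarrow> 'v \<Rightarrow> real" where
  "crossing_form \<omega> a b l\<^sub>2 l\<^sub>1 t v =
     lagrangian_velocity_form \<omega> a b l\<^sub>2 t v - lagrangian_velocity_form \<omega> a b l\<^sub>1 t v"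

text \<open>\<open>\<mu> a b l\<^sub>1 l\<^sub>2\<close> stands for the CLM index of the pair \<open>(l\<^sub>1, l\<^sub>2)\<close> over \<open>[a,b]\<close> in the symplectic
  space \<open>('v, \<omega>)\<close>.  For a symplectic form \<open>\<omega>\<close> the three defining properties hold for exactly one assignment on continuous
  pairs of Lagrangian paths: by genericity each pair is homotopic with fixed endpoints to a
  \<open>C\<^sup>1\<close> pair with only nondegenerate crossings.\<close>

definition is_clm_index ::
    "('v::euclidean_space \<Rightarrow> 'v \<Rightarrow> real)
      \<Rightarrow> (real \<Rightarrow> real \<Rightarrow> (real \<Rightarrow> 'v set) \<Rightarrow> (real \<Rightarrow> 'v set) \<Rightarrow> int) \<Rightarrow> bool" where
  "is_clm_index \<omega> \<mu> \<longleftrightarrow>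
     \<comment> \<open>homotopy invariance with fixed endpoints\<close>
     (\<forall>a b. \<forall>h\<^sub>1 h\<^sub>2 :: real \<times> real \<Rightarrow> 'v set.
        a < b \<and>
        continuous_lagrangian_family \<omega> ({0..1} \<times> {a..b}) h\<^sub>1 \<and>
        continuous_lagrangian_family \<omega> ({0..1} \<times> {a..b}) h\<^sub>2 \<and>
        (\<forall>s\<in>{0..1}. h\<^sub>1 (s, a) = h\<^sub>1 (0, a) \<and> h\<^sub>1 (s, b) = h\<^sub>1 (0, b) \<and>
                     h\<^sub>2 (s, a) = h\<^sub>2 (0, a) \<and> h\<^sub>2 (s, b) = h\<^sub>2 (0, b))
        \<longrightarrow> \<mu> a b (\<lambda>t. h\<^sub>1 (0, t)) (\<lambda>t. h\<^sub>2 (0, t)) = \<mu> a b (\<lambda>t. h\<^sub>1 (1, t)) (\<lambda>t. h\<^sub>2 (1, t))) \<and>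
     \<comment> \<open>additivity under concatenation\<close>
     (\<forall>a c b l\<^sub>1 l\<^sub>2.
        a < c \<and> c < b \<and>
        continuous_lagrangian_family \<omega> {a..b} l\<^sub>1 \<and> continuous_lagrangian_family \<omega> {a..b} l\<^sub>2
        \<longrightarrow> \<mu> a b l\<^sub>1 l\<^sub>2 = \<mu> a c l\<^sub>1 l\<^sub>2 + \<mu> c b l\<^sub>1 l\<^sub>2) \<and>
     \<comment> \<open>crossing formula\<close>
     (\<forall>a b l\<^sub>1 l\<^sub>2.
        a < b \<and> C1_lagrangian_path \<omega> a b l\<^sub>1 \<and> C1_lagrangian_path \<omega> a b l\<^sub>2 \<and>
        (\<forall>t\<in>{a..b}. nondegenerate_form (crossing_form \<omega> a b l\<^sub>2 l\<^sub>1 t) (l\<^sub>1 t \<inter> l\<^sub>2 t))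
        \<longrightarrow> \<mu> a b l\<^sub>1 l\<^sub>2 =
            n_plus (crossing_form \<omega> a b l\<^sub>2 l\<^sub>1 a) (l\<^sub>1 a \<inter> l\<^sub>2 a)
            + (\<Sum>t | a < t \<and> t < b \<and> l\<^sub>1 t \<inter> l\<^sub>2 t \<noteq> {0}.
                 form_signature (crossing_form \<omega> a b l\<^sub>2 l\<^sub>1 t) (l\<^sub>1 t \<inter> l\<^sub>2 t))
            - n_minus (crossing_form \<omega> a b l\<^sub>2 l\<^sub>1 b) (l\<^sub>1 b \<inter> l\<^sub>2 b))"


section \<open>Lagrangian functions on a star graph\<close>

text \<open>The edges are indexed by a finite type \<open>'m\<close> (so there are \<open>CARD('m) \<ge> 1\<close> of them); edge \<open>j\<close>
  is \<open>[a j, b j]\<close> and all \<open>a j\<close> are glued to the central vertex.  A function on the graph is a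
  family of functions on the edges which agree at the central vertex.\<close>

text \<open>\<open>C\<^sup>2\<close> on a set such as \<open>[a,b] \<times> \<real>\<^sup>d \<times> \<real>\<^sup>d\<close>, with one-sided derivatives at the boundary.\<close>

definition C2_on :: "'a::real_normed_vector set \<Rightarrow> ('a \<Rightarrow> real) \<Rightarrow> bool" where
  "C2_on S f \<longleftrightarrow>
     (\<exists>(f' :: 'a \<Rightarrow> 'a \<Rightarrow>\<^sub>L real) (f'' :: 'a \<Rightarrow> 'a \<Rightarrow>\<^sub>L ('a \<Rightarrow>\<^sub>L real)).
        (\<forall>z\<in>S. (f has_derivative blinfun_apply (f' z)) (at z within S)) \<and>
        (\<forall>z\<in>S. (f' has_derivative blinfun_apply (f'' z)) (at z within S)) \<and>
        continuous_on S f'')"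

definition grad :: "(real^'d::finite \<Rightarrow> real) \<Rightarrow> real^'d \<Rightarrow> real^'d" where
  "grad f x = (\<chi> i. frechet_derivative f (at x) (axis i 1))"

type_synonym 'd edge_lagrangian = "real \<Rightarrow> real^'d \<Rightarrow> real^'d \<Rightarrow> real"  \<comment> \<open>arguments \<open>t\<close>, \<open>q\<close>, \<open>v\<close>\<close>

definition D_q :: "'d::finite edge_lagrangian \<Rightarrow> real \<Rightarrow> real^'d \<Rightarrow> real^'d \<Rightarrow> real^'d" where
  "D_q L t q v = grad (\<lambda>y. L t y v) q"

definition D_v :: "'d::finite edge_lagrangian \<Rightarrow> real \<Rightarrow> real^'d \<Rightarrow> real^'d \<Rightarrow> real^'d" where
  "D_v L t q v = grad (\<lambda>w. L t q w) v"

definition D_vv :: "'d::finite edge_lagrangian \<Rightarrow> real \<Rightarrow> real^'d \<Rightarrow> real^'d \<Rightarrow> real^'d^'d" where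
  "D_vv L t q v = jacobian (\<lambda>w. D_v L t q w) (at v)"

text \<open>Row \<open>i\<close>, column \<open>k\<close> is \<open>\<partial>\<^sup>2L/\<partial>v\<^sub>i\<partial>q\<^sub>k\<close>, as required by \<open>p = P q' + Q q\<close>.\<close>

definition D_qv :: "'d::finite edge_lagrangian \<Rightarrow> real \<Rightarrow> real^'d \<Rightarrow> real^'d \<Rightarrow> real^'d^'d" where
  "D_qv L t q v = jacobian (\<lambda>y. D_v L t y v) (at q)"

definition D_qq :: "'d::finite edge_lagrangian \<Rightarrow> real \<Rightarrow> real^'d \<Rightarrow> real^'d \<Rightarrow> real^'d^'d" where
  "D_qq L t q v = jacobian (\<lambda>y. D_q L t y v) (at q)"

definition star_lagrangian ::
    "('m::finite \<Rightarrow> real) \<Rightarrow> ('m \<Rightarrow> real) \<Rightarrow> ('m \<Rightarrow> 'd::finite edge_lagrangian) \<Rightarrow> bool" where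
  "star_lagrangian a b L \<longleftrightarrow>
     \<comment> \<open>(i): continuity on the graph\<close>
     (\<forall>j. continuous_on ({a j..b j} \<times> UNIV) (\<lambda>(t, q, v). L j t q v)) \<and>
     (\<forall>i j q v. L i (a i) q v = L j (a j) q v) \<and>
     \<comment> \<open>(ii)\<close>
     (\<forall>j. C2_on ({a j..b j} \<times> UNIV) (\<lambda>(t, q, v). L j t q v)) \<and>
     \<comment> \<open>(L1)\<close>
     (\<forall>j. \<forall>t\<in>{a j..b j}. \<forall>q v w. w \<noteq> 0 \<longrightarrow> (D_vv (L j) t q v *v w) \<bullet> w > 0) \<and>
     \<comment> \<open>(L2)\<close>
     (\<forall>j. \<forall>t\<in>{a j..b j}. \<forall>q. \<exists>(A :: real^'d^'d) B c. \<forall>v. L j t q v = (A *v v) \<bullet> v + B \<bullet> v + c)"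


section \<open>Action functional and index form\<close>

definition edge_deriv :: "real \<Rightarrow> real \<Rightarrow> (real \<Rightarrow> 'a::real_normed_vector) \<Rightarrow> real \<Rightarrow> 'a" where
  "edge_deriv a b u t = vector_derivative u (at t within {a..b})"

text \<open>\<open>W\<^sup>1\<^sup>,\<^sup>2([a,b])\<close> through its absolutely continuous representatives: \<open>u\<close> is differentiable almost
  everywhere, with square integrable derivative \<open>g\<close>, and is the integral of \<open>g\<close>.\<close>

definition W12_on :: "real \<Rightarrow> real \<Rightarrow> (real \<Rightarrow> 'a::euclidean_space) \<Rightarrow> bool" where
  "W12_on a b u \<longleftrightarrow>
     (\<exists>g N. negligible N \<and>
        (\<forall>t\<in>{a..b} - N. (u has_vector_derivative g t) (at t within {a..b})) \<and>
        g absolutely_integrable_on {a..b} \<and>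
        (\<lambda>t. (norm (g t))\<^sup>2) integrable_on {a..b} \<and>
        (\<forall>t\<in>{a..b}. u t = u a + integral {a..t} g))"

definition bolza_paths ::
    "('m::finite \<Rightarrow> real) \<Rightarrow> ('m \<Rightarrow> real) \<Rightarrow> ('m \<Rightarrow> real^'d::finite) \<Rightarrow> ('m \<Rightarrow> real \<Rightarrow> real^'d) set" where
  "bolza_paths a b y =
     {x. (\<forall>j. W12_on (a j) (b j) (x j)) \<and> (\<forall>i j. x i (a i) = x j (a j)) \<and> (\<forall>j. x j (b j) = y j)}"

text \<open>Elements are extended by \<open>0\<close> off the edges, so that a vector of this space is determined by
  its values on the graph.\<close>

definition bolza_variations ::
    "('m::finite \<Rightarrow> real) \<Rightarrow> ('m \<Rightarrow> real) \<Rightarrow> ('m \<Rightarrow> real \<Rightarrow> real^'d::finite) set" where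
  "bolza_variations a b = {\<xi> \<in> bolza_paths a b (\<lambda>_. 0). \<forall>j. \<forall>t. t \<notin> {a j..b j} \<longrightarrow> \<xi> j t = 0}"

definition lagrangian_action ::
    "('m::finite \<Rightarrow> real) \<Rightarrow> ('m \<Rightarrow> real) \<Rightarrow> ('m \<Rightarrow> 'd::finite edge_lagrangian)
      \<Rightarrow> ('m \<Rightarrow> real \<Rightarrow> real^'d) \<Rightarrow> real" where
  "lagrangian_action a b L x =
     (\<Sum>j\<in>UNIV. integral {a j..b j} (\<lambda>t. L j t (x j t) (edge_deriv (a j) (b j) (x j) t)))"

text \<open>The Kirchhoff condition at the centre is the natural boundary condition of this variational
  problem: variations are free, apart from continuity, at the central vertex.\<close>

definition bolza_critical_point ::
    "('m::finite \<Rightarrow> real) \<Rightarrow> ('m \<Rightarrow> real) \<Rightarrow> ('m \<Rightarrow> 'd::finite edge_lagrangian) \<Rightarrow> ('m \<Rightarrow> real^'d)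
      \<Rightarrow> ('m \<Rightarrow> real \<Rightarrow> real^'d) \<Rightarrow> bool" where
  "bolza_critical_point a b L y x \<longleftrightarrow>
     x \<in> bolza_paths a b y \<and>
     (\<forall>\<xi>\<in>bolza_variations a b.
        ((\<lambda>\<epsilon>. lagrangian_action a b L (x + \<epsilon> *\<^sub>R \<xi>)) has_real_derivative 0) (at 0))"

text \<open>Evaluation along \<open>x\<close> of a matrix \<open>D\<close> of second derivatives, on the edge \<open>[a,b]\<close>.  A critical
  point is \<open>C\<^sup>1\<close> up to the endpoints of each edge, so this makes sense for every \<open>t \<in> [a,b]\<close>.\<close>

definition along ::
    "(real \<Rightarrow> real^'d::finite \<Rightarrow> real^'d \<Rightarrow> real^'d^'d) \<Rightarrow> real \<Rightarrow> real \<Rightarrow> (real \<Rightarrow> real^'d)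
      \<Rightarrow> real \<Rightarrow> real^'d^'d" where
  "along D a b u t = D t (u t) (edge_deriv a b u t)"

definition index_form ::
    "('m::finite \<Rightarrow> real) \<Rightarrow> ('m \<Rightarrow> real) \<Rightarrow> ('m \<Rightarrow> 'd::finite edge_lagrangian)
      \<Rightarrow> ('m \<Rightarrow> real \<Rightarrow> real^'d)
      \<Rightarrow> ('m \<Rightarrow> real \<Rightarrow> real^'d) \<Rightarrow> ('m \<Rightarrow> real \<Rightarrow> real^'d) \<Rightarrow> real" where
  "index_form a b L x \<xi> \<eta> =
     (\<Sum>j\<in>UNIV. integral {a j..b j} (\<lambda>t.
        let P = along (D_vv (L j)) (a j) (b j) (x j) t;
            Q = along (D_qv (L j)) (a j) (b j) (x j) t;
            R = along (D_qq (L j)) (a j) (b j) (x j) t;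
            \<xi>' = edge_deriv (a j) (b j) (\<xi> j) t;
            \<eta>' = edge_deriv (a j) (b j) (\<eta> j) t
        in (P *v \<xi>' + Q *v \<xi> j t) \<bullet> \<eta>' + (transpose Q *v \<xi>') \<bullet> \<eta> j t + (R *v \<xi> j t) \<bullet> \<eta> j t))"

definition morse_index ::
    "('m::finite \<Rightarrow> real) \<Rightarrow> ('m \<Rightarrow> real) \<Rightarrow> ('m \<Rightarrow> 'd::finite edge_lagrangian)
      \<Rightarrow> ('m \<Rightarrow> real \<Rightarrow> real^'d) \<Rightarrow> enat" where
  "morse_index a b L x = neg_index (\<lambda>\<xi>. index_form a b L x \<xi> \<xi>) (bolza_variations a b)"


section \<open>Linearized Hamiltonian systems and the Maslov index\<close>

text \<open>Elements of \<open>\<real>\<^sup>2\<^sup>d\<close> are pairs \<open>(p, q)\<close>.\<close>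

type_synonym 'd phase = "(real^'d) \<times> (real^'d)"

definition sympl_J :: "'d::finite phase \<Rightarrow> 'd phase" where
  "sympl_J z = (- snd z, fst z)"

definition sympl_\<Omega> :: "'d::finite phase \<Rightarrow> 'd phase \<Rightarrow> real" where
  "sympl_\<Omega> z w = sympl_J z \<bullet> w"

definition hamiltonian_matrix ::
    "'d::finite edge_lagrangian \<Rightarrow> real \<Rightarrow> real \<Rightarrow> (real \<Rightarrow> real^'d) \<Rightarrow> real \<Rightarrow> 'd phase \<Rightarrow> 'd phase" where
  "hamiltonian_matrix L a b u t = (\<lambda>(p, q).
     let P = along (D_vv L) a b u t;
         Q = along (D_qv L) a b u t;
         R = along (D_qq L) a b u t
     in (matrix_inv P *v p - (matrix_inv P ** Q) *v q,
         - ((transpose Q ** matrix_inv P) *v p) + (transpose Q ** matrix_inv P ** Q - R) *v q))"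

definition is_fundamental_solution ::
    "real \<Rightarrow> real \<Rightarrow> (real \<Rightarrow> 'd::finite phase \<Rightarrow> 'd phase) \<Rightarrow> (real \<Rightarrow> 'd phase \<Rightarrow> 'd phase) \<Rightarrow> bool" where
  "is_fundamental_solution a b B \<gamma> \<longleftrightarrow>
     (\<forall>t\<in>{a..b}. linear (\<gamma> t)) \<and>
     \<gamma> a = id \<and>
     (\<forall>z. \<forall>t\<in>{a..b}.
        ((\<lambda>s. \<gamma> s z) has_vector_derivative sympl_J (B t (\<gamma> t z))) (at t within {a..b}))"

text \<open>The \<open>j\<close>-th component of \<open>'d phase \<times> 'd phase\<close> is (value at \<open>a j\<close>, value at \<open>b j\<close>).\<close>

type_synonym ('d, 'm) star_space = "('d phase \<times> 'd phase)^'m"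

definition star_form :: "('d::finite, 'm::finite) star_space \<Rightarrow> ('d, 'm) star_space \<Rightarrow> real" where
  "star_form u w =
     (\<Sum>j\<in>UNIV. - sympl_\<Omega> (fst (u $ j)) (fst (w $ j)) + sympl_\<Omega> (snd (u $ j)) (snd (w $ j)))"

definition star_boundary_space :: "('d::finite, 'm::finite) star_space set" where
  "star_boundary_space =
     {u. \<exists>pa qa pb qb. u = (\<chi> j. ((pa j, qa j), (pb j, qb j))) \<and>
         (\<forall>j. qb j = 0) \<and> (\<forall>i j. qa i = qa j) \<and> (\<Sum>j\<in>UNIV. pa j) = 0}"

definition star_graph_path ::
    "('m::finite \<Rightarrow> real) \<Rightarrow> ('m \<Rightarrow> real) \<Rightarrow> ('m \<Rightarrow> real \<Rightarrow> 'd::finite phase \<Rightarrow> 'd phase)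
      \<Rightarrow> real \<Rightarrow> ('d, 'm) star_space set" where
  "star_graph_path a b \<gamma> \<tau> =
     {u. \<exists>z. u = (\<chi> j. (z j, \<gamma> j (a j + \<tau> * (b j - a j)) (z j)))}"

definition maslov_index ::
    "(real \<Rightarrow> real \<Rightarrow> (real \<Rightarrow> ('d::finite, 'm::finite) star_space set)
        \<Rightarrow> (real \<Rightarrow> ('d, 'm) star_space set) \<Rightarrow> int)
      \<Rightarrow> ('m \<Rightarrow> real) \<Rightarrow> ('m \<Rightarrow> real) \<Rightarrow> ('m \<Rightarrow> real \<Rightarrow> 'd phase \<Rightarrow> 'd phase) \<Rightarrow> int" where
  "maslov_index \<mu> a b \<gamma> = \<mu> 0 1 (\<lambda>_. star_boundary_space) (star_graph_path a b \<gamma>)"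

end

theory Submission
  imports Defs
begin

text \<open>
  At a crossing the graph path moves with velocity form \<open>\<langle>P u', u'\<rangle>\<close>, so every crossing form is positive
  definite and the crossing formula reduces the Maslov index to the sum of \<open>dim (\<Lambda>\<^sub>0 \<inter> \<lambda>(\<tau>))\<close>
  over \<open>0 \<le> \<tau> < 1\<close>; at \<open>\<tau> = 0\<close> this dimension is \<open>(m - 1) d\<close>.  What remains is a Morse index
  theorem: the Morse index is the sum over \<open>0 < \<tau> < 1\<close>.

  Rescaling all edges to \<open>[0,1]\<close> turns the star into a single Hamiltonian system on \<open>(\<real>\<^sup>d)\<^sup>m\<close> with
  separated boundary conditions.  The Jacobi fields which satisfy the condition at \<open>0\<close> and vanish at some
  \<open>\<tau> \<in> (0,1)\<close>, continued by \<open>0\<close> after \<open>\<tau>\<close>, span an isotropic subspace for the index form, and tilting it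
  towards a dual family yields a negative definite subspace of the same dimension.  Conversely, the variations
  \<open>u\<close> such that \<open>u s\<close> is for every \<open>s\<close> the value of an admissible Jacobi field form a subspace
  whose codimension is the same number, and on it the index form is nonnegative: on short intervals this
  is coercivity, and it is propagated past \<open>t\<close> by subtracting from \<open>u\<close> a Jacobi field
  through \<open>u t\<close>.  A critical point is \<open>C\<^sup>1\<close>, hence the coefficients are continuous, by the lemma of
  du Bois-Reymond.
\<close>

section \<open>Sobolev functions on an interval\<close>

text \<open>Both halves of the index theorem count the same spaces. \<open>fibre t\<close> holds the
  momenta at \<open>t\<close> of the admissible Jacobi fields that vanish there,
  \<open>shadow t\<close> the values at \<open>t\<close> of all admissible Jacobi fields. Because
  the flow is symplectic and the initial condition Lagrangian, a vector orthogonal to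
  \<open>fibre t\<close> lies in \<open>shadow t\<close>. So the constraint
  \<open>u t \<in> shadow t\<close> costs at most \<open>dim (fibre t)\<close> linear equations at a
  conjugate instant and none at the other times in between. It is also stable under subtraction of
  an admissible Jacobi field, which lets nonnegativity pass through conjugate instants. The obstacle
  is finiteness of the set of conjugate instants, without which neither the sum nor the limit
  argument makes sense. It comes from the Morse index itself: the form is nonnegative on functions
  that vanish on a fine grid, so the index is finite, and each conjugate instant consumes at least
  one dimension of it. Finiteness in turn makes \<open>shadow\<close> the whole space just before
  any given time, so that cut-off functions satisfy the constraint there.\<close>

definition primitive_on :: "real \<Rightarrow> real \<Rightarrow> (real \<Rightarrow> 'a::euclidean_space) \<Rightarrow> (real \<Rightarrow> 'a) \<Rightarrow> bool" where
  "primitive_on a b u g \<longleftrightarrow>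
     g absolutely_integrable_on {a..b} \<and> (\<forall>t\<in>{a..b}. u t = u a + integral {a..t} g)"

lemma primitive_onD:
  assumes "primitive_on a b u g"
  shows "g absolutely_integrable_on {a..b}" "\<And>t. t \<in> {a..b} \<Longrightarrow> u t = u a + integral {a..t} g"
  using assms unfolding primitive_on_def by blast+

lemma primitive_on_diff:
  assumes "primitive_on a b u g" "a \<le> s" "s \<le> t" "t \<le> b"
  shows "u t - u s = integral {s..t} g"
proof -
  have "g integrable_on {a..t}"
    using assms unfolding primitive_on_def
    by (meson integrable_on_subinterval set_lebesgue_integral_eq_integral(1) atLeastatMost_subset_iff order_refl)
  then have "integral {a..s} g + integral {s..t} g = integral {a..t} g"
    using assms by (intro Henstock_Kurzweil_Integration.integral_combine) auto
  moreover have "u s = u a + integral {a..s} g" "u t = u a + integral {a..t} g"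
    by (rule primitive_onD(2)[OF assms(1)]; use assms(2-4) in simp)+
  ultimately show ?thesis by (simp add: algebra_simps)
qed

lemma primitive_on_subinterval:
  assumes "primitive_on a b u g" "a \<le> s" "t \<le> b"
  shows "primitive_on s t u g"
  unfolding primitive_on_def
proof
  show "g absolutely_integrable_on {s..t}"
    using assms unfolding primitive_on_def
    by (meson absolutely_integrable_on_subinterval atLeastatMost_subset_iff)
  show "\<forall>r\<in>{s..t}. u r = u s + integral {s..r} g"
  proof
    fix r assume "r \<in> {s..t}"
    then have "u r - u s = integral {s..r} g"
      using primitive_on_diff[OF assms(1)] assms(2,3) by auto
    then show "u r = u s + integral {s..r} g" by (simp add: algebra_simps)
  qed
qed

lemma primitive_on_continuous:
  assumes "primitive_on a b u g"
  shows "continuous_on {a..b} u"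
proof -
  have "g integrable_on {a..b}"
    using assms unfolding primitive_on_def using set_lebesgue_integral_eq_integral(1) by blast
  then have "continuous_on {a..b} (\<lambda>t. u a + integral {a..t} g)"
    by (intro continuous_intros indefinite_integral_continuous_1)
  then show ?thesis
    by (rule continuous_on_eq) (rule primitive_onD(2)[OF assms, symmetric])
qed

lemma primitive_on_C1:
  assumes "\<And>t. t \<in> {a..b} \<Longrightarrow> (u has_vector_derivative g t) (at t within {a..b})"
    and "continuous_on {a..b} g"
  shows "primitive_on a b u g"
  unfolding primitive_on_def
proof
  show "g absolutely_integrable_on {a..b}"
    using assms(2) absolutely_integrable_continuous_real by blast
  show "\<forall>t\<in>{a..b}. u t = u a + integral {a..t} g"
  proof
    fix t assume t: "t \<in> {a..b}"
    have "(g has_integral (u t - u a)) {a..t}"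
    proof (rule fundamental_theorem_of_calculus)
      fix r assume "r \<in> {a..t}"
      then show "(u has_vector_derivative g r) (at r within {a..t})"
        using assms(1)[of r] t by (auto elim: has_vector_derivative_within_subset)
    qed (use t in auto)
    then show "u t = u a + integral {a..t} g" by (simp add: integral_unique)
  qed
qed

lemma absolutely_integrable_inner_continuous:
  fixes g p :: "real \<Rightarrow> 'a::euclidean_space"
  assumes "continuous_on {a..b} p" "g absolutely_integrable_on {a..b}"
  shows "(\<lambda>t. p t \<bullet> g t) absolutely_integrable_on {a..b}"
proof (rule absolutely_integrable_bounded_measurable_product[where h="(\<bullet>)"])
  show "bilinear ((\<bullet>) :: 'a \<Rightarrow> _)"
    using bounded_bilinear_inner bilinear_conv_bounded_bilinear by blast
  show "p \<in> borel_measurable (lebesgue_on {a..b})"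
    using assms(1) by (simp add: continuous_imp_measurable_on_sets_lebesgue)
  show "bounded (p ` {a..b})"
    using assms(1) compact_continuous_image compact_imp_bounded by blast
qed (use assms in auto)

text \<open>The difference quotients of the defect between the two sides are at most
  \<open>2 C (\<integral>\<^sub>s\<^sup>t |g|)\<close>, so the defect has derivative \<open>0\<close> everywhere, although \<open>u\<close>
  need not be differentiable.\<close>

lemma integration_by_parts_primitive:
  fixes u g p p' :: "real \<Rightarrow> 'a::euclidean_space"
  assumes ab: "a \<le> b" and prim: "primitive_on a b u g"
    and dp: "\<And>t. t \<in> {a..b} \<Longrightarrow> (p has_vector_derivative p' t) (at t within {a..b})"
    and cp': "continuous_on {a..b} p'"
  shows "((\<lambda>t. p' t \<bullet> u t + p t \<bullet> g t) has_integral (p b \<bullet> u b - p a \<bullet> u a)) {a..b}"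
proof -
  let ?h = "\<lambda>t. p' t \<bullet> u t + p t \<bullet> g t"
  have cu: "continuous_on {a..b} u" using primitive_on_continuous[OF prim] .
  have cp: "continuous_on {a..b} p"
    using dp by (meson continuous_on_eq_continuous_within has_vector_derivative_continuous)
  have gi: "g absolutely_integrable_on {a..b}" using primitive_onD(1)[OF prim] .
  have ng: "(\<lambda>t. norm (g t)) integrable_on {a..b}"
    using gi absolutely_integrable_on_def by blast
  have h: "?h integrable_on {a..b}"
    by (intro integrable_add integrable_continuous_real continuous_on_inner cp' cu
        set_lebesgue_integral_eq_integral(1) absolutely_integrable_inner_continuous cp gi)
  obtain C where C: "C > 0" "\<And>t. t \<in> {a..b} \<Longrightarrow> norm (p' t) \<le> C"
    using compact_imp_bounded[OF compact_continuous_image[OF cp' compact_Icc]]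
    unfolding bounded_pos by (auto simp: ball_simps)
  define G where "G = (\<lambda>t. integral {a..t} (\<lambda>t. norm (g t)))"
  have cG: "continuous_on {a..b} G"
    unfolding G_def using ng by (rule indefinite_integral_continuous_1)
  define D where "D = (\<lambda>t. p t \<bullet> u t - integral {a..t} ?h)"
  have pp: "primitive_on a b p p'" using primitive_on_C1[OF dp cp'] by blast
  have *: "\<bar>D t - D s\<bar> \<le> 2 * C * (t - s) * (G t - G s)" if st: "a \<le> s" "s \<le> t" "t \<le> b" for s t
  proof -
    have sub: "{s..t} \<subseteq> {a..b}" using st by auto
    have gist: "g integrable_on {s..t}"
      using gi sub integrable_on_subinterval set_lebesgue_integral_eq_integral(1) by blast
    have ngst: "(\<lambda>t. norm (g t)) integrable_on {s..t}"
      using ng sub integrable_on_subinterval by blast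
    have p'st: "p' integrable_on {s..t}"
      using cp' sub continuous_on_subset integrable_continuous_real by blast
    have hst: "?h integrable_on {s..t}" using h sub integrable_on_subinterval by blast
    have Gd: "G t - G s = integral {s..t} (\<lambda>t. norm (g t))"
    proof -
      have "(\<lambda>t. norm (g t)) integrable_on {a..t}"
        using ng st integrable_on_subinterval[of _ "{a..b}"] by auto
      then have "G s + integral {s..t} (\<lambda>t. norm (g t)) = G t"
        unfolding G_def using st by (intro Henstock_Kurzweil_Integration.integral_combine) auto
      then show ?thesis by simp
    qed
    have hd: "integral {a..t} ?h - integral {a..s} ?h = integral {s..t} ?h"
    proof -
      have "?h integrable_on {a..t}"
        using h st integrable_on_subinterval[of _ "{a..b}"] by auto
      then have "integral {a..s} ?h + integral {s..t} ?h = integral {a..t} ?h"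
        using st by (intro Henstock_Kurzweil_Integration.integral_combine) auto
      then show ?thesis by simp
    qed
    have pd: "p t - p s = integral {s..t} p'" using primitive_on_diff[OF pp] st by auto
    have ud: "u t - u s = integral {s..t} g" using primitive_on_diff[OF prim] st by auto
    have b1: "norm (u t - u r) \<le> G t - G s" if r: "r \<in> {s..t}" for r
    proof -
      have "norm (u t - u r) = norm (integral {r..t} g)"
        using primitive_on_diff[OF prim, of r t] r st by auto
      also have "\<dots> \<le> integral {r..t} (\<lambda>t. norm (g t))"
        using gi r st
        by (intro integral_norm_bound_integral integrable_on_subinterval[OF gist]
             integrable_on_subinterval[OF ngst]) auto
      also have "\<dots> \<le> G t - G s"
        unfolding Gd by (intro integral_subset_le integrable_on_subinterval[OF ngst] ngst) (use r in auto)
      finally show ?thesis .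
    qed
    have b2: "norm (p s - p r) \<le> C * (t - s)" if r: "r \<in> {s..t}" for r
    proof -
      have "norm (p r - p s) = norm (integral {s..r} p')"
        using primitive_on_diff[OF pp, of s r] r st by auto
      also have "\<dots> \<le> integral {s..r} (\<lambda>_. C)"
        using r st C by (intro integral_norm_bound_integral integrable_on_subinterval[OF p'st]) auto
      also have "\<dots> \<le> C * (t - s)" using r C by (auto simp: algebra_simps)
      finally show ?thesis by (simp add: norm_minus_commute)
    qed
    \<comment> \<open>Freezing \<open>u\<close> at the right end and \<open>p\<close> at the left
      end makes the integrand exact: its integral is
      \<open>p t \<bullet> u t - p s \<bullet> u s\<close>. What remains to be estimated is the
      error of the freezing.\<close>
    have i0: "((\<lambda>r. p' r \<bullet> u t + p s \<bullet> g r) has_integral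
        ((p t - p s) \<bullet> u t + p s \<bullet> (u t - u s))) {s..t}"
      unfolding pd ud
      using has_integral_add[OF
          has_integral_linear[OF integrable_integral[OF p'st] bounded_linear_inner_left[of "u t"]]
          has_integral_linear[OF integrable_integral[OF gist] bounded_linear_inner_right[of "p s"]]]
      by (simp add: o_def)
    then have i1: "(\<lambda>r. p' r \<bullet> u t + p s \<bullet> g r) integrable_on {s..t}" by blast
    have "D t - D s = (p t - p s) \<bullet> u t + p s \<bullet> (u t - u s) - integral {s..t} ?h"
      unfolding D_def hd[symmetric] by (simp add: inner_diff_left inner_diff_right)
    also have "\<dots> = integral {s..t} (\<lambda>r. (p' r \<bullet> u t + p s \<bullet> g r) - ?h r)"
      using integral_diff[OF i1 hst] integral_unique[OF i0] by simp
    finally have Deq: "D t - D s = integral {s..t} (\<lambda>r. (p' r \<bullet> u t + p s \<bullet> g r) - ?h r)" .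
    have "norm (D t - D s) \<le> integral {s..t} (\<lambda>r. C * (G t - G s) + C * (t - s) * norm (g r))"
      unfolding Deq
    proof (rule integral_norm_bound_integral)
      show "(\<lambda>r. (p' r \<bullet> u t + p s \<bullet> g r) - ?h r) integrable_on {s..t}"
        by (rule integrable_diff[OF i1 hst])
      show "(\<lambda>r. C * (G t - G s) + C * (t - s) * norm (g r)) integrable_on {s..t}"
        by (intro integrable_add integrable_const_ivl integrable_on_mult_right ngst)
      fix r assume r: "r \<in> {s..t}"
      have "norm ((p' r \<bullet> u t + p s \<bullet> g r) - ?h r) = norm (p' r \<bullet> (u t - u r) + (p s - p r) \<bullet> g r)"
        by (simp add: inner_diff_left inner_diff_right algebra_simps)
      also have "\<dots> \<le> norm (p' r) * norm (u t - u r) + norm (p s - p r) * norm (g r)"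
        by (intro norm_triangle_le add_mono) (auto simp: Cauchy_Schwarz_ineq2)
      also have "\<dots> \<le> C * (G t - G s) + C * (t - s) * norm (g r)"
        using C(2)[of r] b1[OF r] b2[OF r] sub r C(1)
        by (intro add_mono mult_mono mult_right_mono) (auto intro: order_trans[OF norm_ge_zero])
      finally show "norm ((p' r \<bullet> u t + p s \<bullet> g r) - ?h r) \<le> C * (G t - G s) + C * (t - s) * norm (g r)" .
    qed
    also have "\<dots> = C * (G t - G s) * (t - s) + C * (t - s) * (G t - G s)"
      unfolding Gd using st ngst
      by (subst integral_add) (auto intro: integrable_on_mult_right)
    finally show ?thesis by (simp add: algebra_simps)
  qed
  have "(D has_derivative (\<lambda>h. 0)) (at t within {a..b})" if t: "t \<in> {a..b}" for t
  proof (rule has_derivativeI_sandwich[of 1])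
    show "((\<lambda>y. 2 * C * \<bar>G y - G t\<bar>) \<longlongrightarrow> 0) (at t within {a..b})"
    proof -
      have "((\<lambda>y. 2 * C * \<bar>G y - G t\<bar>) \<longlongrightarrow> 2 * C * \<bar>G t - G t\<bar>) (at t within {a..b})"
        using cG t by (intro tendsto_intros) (auto simp: continuous_on_def)
      then show ?thesis by simp
    qed
    fix y assume y: "y \<in> {a..b}" "y \<noteq> t"
    have "\<bar>D y - D t\<bar> \<le> 2 * C * \<bar>y - t\<bar> * \<bar>G y - G t\<bar>"
    proof (cases "t \<le> y")
      case True
      have "\<bar>D y - D t\<bar> \<le> 2 * C * (y - t) * (G y - G t)" using * True y t by auto
      also have "\<dots> \<le> 2 * C * (y - t) * \<bar>G y - G t\<bar>" using True C by (intro mult_left_mono) auto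
      finally show ?thesis using True by simp
    next
      case False
      have "\<bar>D t - D y\<bar> \<le> 2 * C * (t - y) * (G t - G y)" using * False y t by auto
      also have "\<dots> \<le> 2 * C * (t - y) * \<bar>G t - G y\<bar>" using False C by (intro mult_left_mono) auto
      finally show ?thesis using False by (simp add: abs_minus_commute)
    qed
    then show "norm (D y - D t - 0) / norm (y - t) \<le> 2 * C * \<bar>G y - G t\<bar>"
      using y by (simp add: divide_le_eq mult_ac)
  qed (auto intro: bounded_linear_zero)
  then have "D a = D b"
    using has_derivative_zero_unique[of "{a..b}" D b a] ab by auto
  then have "integral {a..b} ?h = p b \<bullet> u b - p a \<bullet> u a"
    unfolding D_def by simp
  with h show ?thesis by (simp add: has_integral_iff)
qed

text \<open>The derivative is a second argument and not a function of \<open>u\<close>: any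
  representative of its almost everywhere class may be used, which makes gluing, differences and
  linear images immediate. Pointwise differentiability enters only with
  \<open>w12_rep\<close>.\<close>

definition w12_pair :: "real \<Rightarrow> real \<Rightarrow> (real \<Rightarrow> 'a::euclidean_space) \<Rightarrow> (real \<Rightarrow> 'a) \<Rightarrow> bool" where
  "w12_pair a b u g \<longleftrightarrow> primitive_on a b u g \<and> (\<lambda>t. (norm (g t))\<^sup>2) integrable_on {a..b}"

lemma w12_pairD:
  assumes "w12_pair a b u g"
  shows "primitive_on a b u g" "(\<lambda>t. (norm (g t))\<^sup>2) integrable_on {a..b}"
    "g absolutely_integrable_on {a..b}" "g \<in> borel_measurable (lebesgue_on {a..b})"
    "continuous_on {a..b} u" "u \<in> borel_measurable (lebesgue_on {a..b})"
proof -
  show 1: "primitive_on a b u g" "(\<lambda>t. (norm (g t))\<^sup>2) integrable_on {a..b}"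
    using assms unfolding w12_pair_def by blast+
  show 2: "g absolutely_integrable_on {a..b}" using primitive_onD(1)[OF 1(1)] .
  then show "g \<in> borel_measurable (lebesgue_on {a..b})"
    by (simp add: absolutely_integrable_imp_borel_measurable)
  show 3: "continuous_on {a..b} u" using primitive_on_continuous[OF 1(1)] .
  then show "u \<in> borel_measurable (lebesgue_on {a..b})"
    by (simp add: continuous_imp_measurable_on_sets_lebesgue)
qed

lemma w12_pair_subinterval:
  assumes "w12_pair a b u g" "a \<le> s" "t \<le> b"
  shows "w12_pair s t u g"
  using assms primitive_on_subinterval integrable_on_subinterval[of _ "{a..b}"]
  unfolding w12_pair_def by (metis atLeastatMost_subset_iff)

lemma square_norm_add_le: "(norm (x + y))\<^sup>2 \<le> 2 * (norm x)\<^sup>2 + 2 * (norm (y::'a::real_normed_vector))\<^sup>2"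
proof -
  have "(norm (x + y))\<^sup>2 \<le> (norm x + norm y)\<^sup>2" by (simp add: norm_triangle_ineq power_mono)
  also have "\<dots> \<le> 2 * (norm x)\<^sup>2 + 2 * (norm y)\<^sup>2"
    using sum_squares_bound[of "norm x" "norm y"] by (simp add: power2_sum)
  finally show ?thesis .
qed

lemma w12_pair_add_scaleR:
  assumes u: "w12_pair a b u g" and w: "w12_pair a b w h"
  shows "w12_pair a b (\<lambda>t. u t + c *\<^sub>R w t) (\<lambda>t. g t + c *\<^sub>R h t)"
  unfolding w12_pair_def primitive_on_def
proof (intro conjI ballI)
  note gi = w12_pairD(3)[OF u] and hi = w12_pairD(3)[OF w]
  show i: "(\<lambda>t. g t + c *\<^sub>R h t) absolutely_integrable_on {a..b}"
    using gi hi by (intro set_integral_add absolutely_integrable_scaleR_left)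
  show "u t + c *\<^sub>R w t = u a + c *\<^sub>R w a + integral {a..t} (\<lambda>t. g t + c *\<^sub>R h t)"
    if t: "t \<in> {a..b}" for t
  proof -
    have "g integrable_on {a..t}" "h integrable_on {a..t}"
      using gi hi t integrable_on_subinterval[of _ "{a..b}"] set_lebesgue_integral_eq_integral(1)
      by (metis atLeastAtMost_iff atLeastatMost_subset_iff order_refl)+
    then have "integral {a..t} (\<lambda>t. g t + c *\<^sub>R h t) = integral {a..t} g + c *\<^sub>R integral {a..t} h"
      by (subst integral_add) (auto intro: integrable_cmul)
    then show ?thesis
      using primitive_onD(2)[OF w12_pairD(1)[OF u] t] primitive_onD(2)[OF w12_pairD(1)[OF w] t]
      by (simp add: algebra_simps)
  qed
  show "(\<lambda>t. (norm (g t + c *\<^sub>R h t))\<^sup>2) integrable_on {a..b}"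
  proof (rule measurable_bounded_by_integrable_imp_integrable)
    have "(\<lambda>t. g t + c *\<^sub>R h t) \<in> borel_measurable (lebesgue_on {a..b})"
      using i by (simp add: absolutely_integrable_imp_borel_measurable)
    then show "(\<lambda>t. (norm (g t + c *\<^sub>R h t))\<^sup>2) \<in> borel_measurable (lebesgue_on {a..b})" by measurable
    show "(\<lambda>t. 2 * (norm (g t))\<^sup>2 + 2 * (c\<^sup>2 * (norm (h t))\<^sup>2)) integrable_on {a..b}"
      using w12_pairD(2)[OF u] w12_pairD(2)[OF w]
      by (intro integrable_add integrable_on_mult_right)
    show "norm ((norm (g t + c *\<^sub>R h t))\<^sup>2) \<le> 2 * (norm (g t))\<^sup>2 + 2 * (c\<^sup>2 * (norm (h t))\<^sup>2)" for t
      using square_norm_add_le[of "g t" "c *\<^sub>R h t"] by (simp add: power_mult_distrib)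
  qed auto
qed

lemma w12_pair_C1:
  assumes "\<And>t. t \<in> {a..b} \<Longrightarrow> (u has_vector_derivative g t) (at t within {a..b})"
    and "continuous_on {a..b} g"
  shows "w12_pair a b u g"
  unfolding w12_pair_def
  using primitive_on_C1[OF assms] assms(2) by (auto intro!: integrable_continuous_real continuous_intros)

lemma has_integral_glue:
  fixes f h :: "real \<Rightarrow> 'a::euclidean_space"
  assumes "a \<le> c" "c \<le> b" "(f has_integral i) {a..c}" "(h has_integral j) {c..b}"
  shows "((\<lambda>t. if t \<le> c then f t else h t) has_integral (i + j)) {a..b}"
proof (rule Henstock_Kurzweil_Integration.has_integral_combine[OF assms(1,2)])
  show "((\<lambda>t. if t \<le> c then f t else h t) has_integral i) {a..c}"
    using assms(3) by (rule has_integral_eq[rotated]) auto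
  show "((\<lambda>t. if t \<le> c then f t else h t) has_integral j) {c..b}"
    using assms(4) by (rule has_integral_spike_finite[of "{c}", rotated 2]) auto
qed

lemma integrable_glue:
  fixes f h :: "real \<Rightarrow> 'a::euclidean_space"
  assumes "a \<le> c" "c \<le> b" "f integrable_on {a..c}" "h integrable_on {c..b}"
  shows "(\<lambda>t. if t \<le> c then f t else h t) integrable_on {a..b}"
  using has_integral_glue assms unfolding integrable_on_def by blast

text \<open>Equality of the values at \<open>c\<close> lets the two primitives continue each other;
  a corner is invisible to the integral. All broken test functions arise in this way: truncated
  Jacobi fields, linear cut-offs and tents.\<close>

lemma w12_pair_glue:
  assumes c: "a \<le> c" "c \<le> b" and u: "w12_pair a c u g" and w: "w12_pair c b w h" and eq: "u c = w c"
  shows "w12_pair a b (\<lambda>t. if t \<le> c then u t else w t) (\<lambda>t. if t \<le> c then g t else h t)"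
  unfolding w12_pair_def primitive_on_def
proof (intro conjI ballI)
  note gi = w12_pairD(3)[OF u] and hi = w12_pairD(3)[OF w]
  have "(\<lambda>t. if t \<le> c then norm (g t) else norm (h t)) integrable_on {a..b}"
    using gi hi c absolutely_integrable_on_def by (intro integrable_glue) blast+
  then have "(\<lambda>t. norm (if t \<le> c then g t else h t)) integrable_on {a..b}"
    by (simp add: if_distrib[of norm])
  moreover have "(\<lambda>t. if t \<le> c then g t else h t) integrable_on {a..b}"
    using gi hi c absolutely_integrable_on_def by (intro integrable_glue) blast+
  ultimately show "(\<lambda>t. if t \<le> c then g t else h t) absolutely_integrable_on {a..b}"
    unfolding absolutely_integrable_on_def by blast
  have "(\<lambda>t. if t \<le> c then (norm (g t))\<^sup>2 else (norm (h t))\<^sup>2) integrable_on {a..b}"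
    using w12_pairD(2)[OF u] w12_pairD(2)[OF w] c by (intro integrable_glue)
  then show "(\<lambda>t. (norm (if t \<le> c then g t else h t))\<^sup>2) integrable_on {a..b}"
    by (simp add: if_distrib[of norm] if_distrib[of "\<lambda>x. x\<^sup>2"])
  fix t assume t: "t \<in> {a..b}"
  show "(if t \<le> c then u t else w t) = (if a \<le> c then u a else w a) + integral {a..t} (\<lambda>t. if t \<le> c then g t else h t)"
  proof (cases "t \<le> c")
    case True
    then have "integral {a..t} (\<lambda>t. if t \<le> c then g t else h t) = integral {a..t} g"
      by (intro integral_cong) auto
    with True c t show ?thesis using primitive_onD(2)[OF w12_pairD(1)[OF u], of t] by auto
  next
    case False
    have "g integrable_on {a..c}" "h integrable_on {c..t}"
      using gi w12_pairD(3)[OF w12_pair_subinterval[OF w, of c t]] t set_lebesgue_integral_eq_integral(1) by auto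
    then have "((\<lambda>t. if t \<le> c then g t else h t) has_integral (integral {a..c} g + integral {c..t} h)) {a..t}"
      using False c by (intro has_integral_glue) (auto simp: has_integral_integral)
    then have "integral {a..t} (\<lambda>t. if t \<le> c then g t else h t) = integral {a..c} g + integral {c..t} h"
      by (rule integral_unique)
    moreover have "u c = u a + integral {a..c} g" "w t = w c + integral {c..t} h"
      by (rule primitive_onD(2)[OF w12_pairD(1)[OF u]] primitive_onD(2)[OF w12_pairD(1)[OF w]]; use c t False in simp)+
    ultimately show ?thesis using False c eq by (simp add: algebra_simps)
  qed
qed

lemma W12_onI:
  assumes "w12_pair a b u g" "negligible N"
    "\<And>t. t \<in> {a..b} - N \<Longrightarrow> (u has_vector_derivative g t) (at t within {a..b})"
  shows "W12_on a b u"
  using assms unfolding W12_on_def w12_pair_def primitive_on_def by blast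

text \<open>\<open>W12_on\<close> only asserts that some derivative exists. Off the null set it
  coincides with \<open>edge_deriv\<close>, by uniqueness of derivatives within an interval, and the
  integral conditions do not see the null set.\<close>

lemma W12_on_edge_deriv:
  assumes "a < b" "W12_on a b u"
  shows "w12_pair a b u (edge_deriv a b u)"
    and "\<exists>N. negligible N \<and> (\<forall>t\<in>{a..b} - N. (u has_vector_derivative edge_deriv a b u t) (at t within {a..b}))"
proof -
  obtain g N where N: "negligible N"
    and d: "\<And>t. t \<in> {a..b} - N \<Longrightarrow> (u has_vector_derivative g t) (at t within {a..b})"
    and g: "g absolutely_integrable_on {a..b}" "(\<lambda>t. (norm (g t))\<^sup>2) integrable_on {a..b}"
    and u: "\<And>t. t \<in> {a..b} \<Longrightarrow> u t = u a + integral {a..t} g"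
    using assms(2) unfolding W12_on_def by blast
  have e: "edge_deriv a b u t = g t" if "t \<in> {a..b} - N" for t
    unfolding edge_deriv_def
    using that assms(1) d[OF that] by (intro vector_derivative_within_cbox[of a b, unfolded cbox_interval]) auto
  show "\<exists>N. negligible N \<and> (\<forall>t\<in>{a..b} - N. (u has_vector_derivative edge_deriv a b u t) (at t within {a..b}))"
    using N d e by (intro exI[of _ N]) auto
  show "w12_pair a b u (edge_deriv a b u)"
    unfolding w12_pair_def primitive_on_def
  proof (intro conjI ballI)
    show "edge_deriv a b u absolutely_integrable_on {a..b}"
      using g(1) N by (rule absolutely_integrable_spike) (use e in auto)
    show "(\<lambda>t. (norm (edge_deriv a b u t))\<^sup>2) integrable_on {a..b}"
      using g(2) by (rule integrable_spike[OF _ N]) (use e in auto)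
    fix t assume t: "t \<in> {a..b}"
    have "integral {a..t} (edge_deriv a b u) = integral {a..t} g"
      by (rule integral_spike[OF N]) (use e t in auto)
    then show "u t = u a + integral {a..t} (edge_deriv a b u)" using u[OF t] by simp
  qed
qed

text \<open>A Poincare estimate: as \<open>u t = 0\<close>, the value \<open>u r\<close> is minus
  the integral of \<open>g\<close> over \<open>{r..t}\<close>, and Cauchy-Schwarz applies. It is the
  source of every smallness of short intervals below.\<close>

lemma norm_square_le_integral_deriv:
  assumes w: "w12_pair a b u g" and st: "a \<le> s" "s \<le> r" "r \<le> t" "t \<le> b" and "u t = 0"
  shows "(norm (u r))\<^sup>2 \<le> (t - s) * integral {s..t} (\<lambda>x. (norm (g x))\<^sup>2)"
proof (cases "r = t")
  case True
  have "0 \<le> integral {s..t} (\<lambda>x. (norm (g x))\<^sup>2)"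
    by (rule integral_nonneg) (use w12_pairD(2)[OF w12_pair_subinterval[OF w, of s t]] st in auto)
  with True assms show ?thesis by simp
next
  case False
  define h where "h = t - r"
  have h: "h > 0" using False st by (simp add: h_def)
  note wr = w12_pair_subinterval[OF w, of r t] and ws = w12_pair_subinterval[OF w, of s t]
  define G where "G = integral {r..t} (\<lambda>x. (norm (g x))\<^sup>2)"
  define m where "m = integral {r..t} (\<lambda>x. norm (g x))"
  have gi: "(\<lambda>x. (norm (g x))\<^sup>2) integrable_on {r..t}" using w12_pairD(2)[OF wr] st by auto
  have ni: "(\<lambda>x. norm (g x)) integrable_on {r..t}" "g integrable_on {r..t}"
    using w12_pairD(3)[OF wr] st unfolding absolutely_integrable_on_def by auto
  have "u t - u r = integral {r..t} g"
    using primitive_on_diff[OF w12_pairD(1)[OF w]] st by auto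
  then have um: "norm (u r) \<le> m"
    using integral_norm_bound_integral[OF ni(2,1)] \<open>u t = 0\<close> unfolding m_def
    by (metis diff_0 norm_minus_cancel order_refl)
  \<comment> \<open>Cauchy-Schwarz by hand: integrate the square of
    \<open>norm (g x) - m / h\<close>, where \<open>m / h\<close> is the mean of
    \<open>norm (g x)\<close> over \<open>{r..t}\<close>.\<close>
  have hi: "((\<lambda>x. (norm (g x))\<^sup>2 - 2 * (m / h) * norm (g x) + (m / h)\<^sup>2) has_integral
      (G - 2 * (m / h) * m + (m/h)\<^sup>2 * h)) {r..t}"
  proof -
    have "((\<lambda>x. (m/h)\<^sup>2) has_integral ((m/h)\<^sup>2 * h)) {r..t}"
      using has_integral_const_real[of "(m/h)\<^sup>2" r t] st by (simp add: h_def mult.commute)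
    then show ?thesis
      unfolding G_def m_def
      by (intro has_integral_add has_integral_diff has_integral_mult_right integrable_integral gi ni)
  qed
  have "0 \<le> G - 2 * (m / h) * m + (m/h)\<^sup>2 * h"
  proof (rule has_integral_nonneg[OF hi])
    fix x
    have "0 \<le> (norm (g x) - m / h)\<^sup>2" by simp
    then show "0 \<le> (norm (g x))\<^sup>2 - 2 * (m / h) * norm (g x) + (m / h)\<^sup>2"
      by (simp add: power2_diff algebra_simps)
  qed
  then have "m\<^sup>2 \<le> h * G" using h by (simp add: power2_eq_square field_simps)
  moreover have "(norm (u r))\<^sup>2 \<le> m\<^sup>2" using um by (simp add: power_mono)
  moreover have "h * G \<le> (t - s) * integral {s..t} (\<lambda>x. (norm (g x))\<^sup>2)"
  proof (rule mult_mono)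
    show "G \<le> integral {s..t} (\<lambda>x. (norm (g x))\<^sup>2)"
      unfolding G_def by (rule integral_subset_le) (use gi w12_pairD(2)[OF ws] st in auto)
    show "0 \<le> G" unfolding G_def using gi by (rule integral_nonneg) auto
  qed (use st h in \<open>auto simp: h_def\<close>)
  ultimately show ?thesis by linarith
qed

lemma borel_measurable_blinfun_apply_continuous:
  fixes A :: "real \<Rightarrow> 'a::euclidean_space \<Rightarrow>\<^sub>L 'b::euclidean_space"
  assumes A: "continuous_on {a..b} A" and f: "f \<in> borel_measurable (lebesgue_on {a..b})"
  shows "(\<lambda>t. A t (f t)) \<in> borel_measurable (lebesgue_on {a..b})"
proof -
  have "A t (f t) = (\<Sum>i\<in>Basis. (f t \<bullet> i) *\<^sub>R A t i)" for t
  proof -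
    have "A t (f t) = A t (\<Sum>i\<in>Basis. (f t \<bullet> i) *\<^sub>R i)" by (simp add: euclidean_representation)
    then show ?thesis by (simp add: blinfun.sum_right blinfun.scaleR_right)
  qed
  moreover have "(\<lambda>t. A t i) \<in> borel_measurable (lebesgue_on {a..b})" for i
    using A by (intro continuous_imp_measurable_on_sets_lebesgue continuous_intros) auto
  moreover have "(\<lambda>t. f t \<bullet> i) \<in> borel_measurable (lebesgue_on {a..b})" for i
    using f by measurable
  ultimately show ?thesis
    using borel_measurable_sum[of Basis "\<lambda>i t. (f t \<bullet> i) *\<^sub>R A t i"] borel_measurable_scaleR by (simp add: cong: measurable_cong)
qed

section \<open>Negative indices\<close>

text \<open>Stated for arbitrary real vector spaces, since it is applied to spaces of functions as
  well as to Euclidean spaces.\<close>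

lemma dim_image_inj_on:
  fixes T :: "'v::real_vector \<Rightarrow> 'w::real_vector"
  assumes "linear T" "subspace V" "inj_on T V"
  shows "dim (T ` V) = dim V"
proof -
  obtain B where B: "B \<subseteq> V" "independent B" "V \<subseteq> span B" "card B = dim V"
    using basis_exists by blast
  have V: "V = span B" using B(1,3) span_minimal[OF B(1) assms(2)] by blast
  have "independent (T ` B)"
    using linear_independent_injective_image[OF assms(1) B(2)] assms(3) V by simp
  moreover have "span (T ` B) = T ` V" using linear_span_image[OF assms(1)] V by simp
  moreover have "card (T ` B) = card B" using assms(3) B(1) card_image inj_on_subset by blast
  ultimately show ?thesis using B(4) dim_span_eq_card_independent by metis
qed

lemma sum_fun_apply: "(\<Sum>i\<in>A. f i) x = (\<Sum>i\<in>A. f i x)"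
  by (induction A rule: infinite_finite_induct) auto

text \<open>The functionals embed \<open>V\<close> into the functions supported on \<open>X\<close>,
  which are spanned by \<open>card X\<close> unit functions. This bounds a Morse index from above:
  if vanishing of the functionals forces nonnegativity, then a negative definite \<open>V\<close>
  meets their common kernel only in \<open>0\<close>.\<close>

lemma dim_le_card_functionals:
  fixes \<phi> :: "'i \<Rightarrow> 'v::real_vector \<Rightarrow> real"
  assumes X: "finite X" and lin: "\<And>i. i \<in> X \<Longrightarrow> linear (\<phi> i)" and V: "subspace V"
    and inj: "\<And>v. v \<in> V \<Longrightarrow> (\<And>i. i \<in> X \<Longrightarrow> \<phi> i v = 0) \<Longrightarrow> v = 0"
  shows "dim V \<le> card X"
proof -
  define T where "T v = (\<lambda>i. if i \<in> X then \<phi> i v else 0)" for v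
  define e :: "'i \<Rightarrow> 'i \<Rightarrow> real" where "e i = (\<lambda>j. if j = i then 1 else 0)" for i
  have T: "linear T"
    by (rule linearI) (auto simp: T_def fun_eq_iff linear_add[OF lin] linear_scale[OF lin])
  have injT: "inj_on T V"
    unfolding linear_injective_on_subspace_0[OF T V]
    using inj by (auto simp: T_def fun_eq_iff zero_fun_def)
  have "T ` V \<subseteq> span (e ` X)"
  proof safe
    fix v assume "v \<in> V"
    have "T v = (\<Sum>i\<in>X. \<phi> i v *\<^sub>R e i)"
    proof
      fix j
      have "(\<Sum>i\<in>X. \<phi> i v *\<^sub>R e i) j = (\<Sum>i\<in>X. if i = j then \<phi> i v else 0)"
        unfolding sum_fun_apply by (intro sum.cong) (auto simp: e_def)
      then show "T v j = (\<Sum>i\<in>X. \<phi> i v *\<^sub>R e i) j" using X by (simp add: T_def)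
    qed
    then show "T v \<in> span (e ` X)"
      by (metis (no_types, lifting) imageI span_base span_scale span_sum)
  qed
  then have "dim (T ` V) \<le> card (e ` X)" using X by (intro dim_le_card) auto
  also have "\<dots> \<le> card X" using X by (rule card_image_le)
  finally show ?thesis using dim_image_inj_on[OF T V injT] by simp
qed

lemma neg_index_ge:
  assumes "subspace V" "V \<subseteq> H" "\<And>v. v \<in> V \<Longrightarrow> v \<noteq> 0 \<Longrightarrow> q v < 0"
  shows "enat (dim V) \<le> neg_index q H"
  unfolding neg_index_def by (rule Sup_upper) (use assms in blast)

lemma neg_index_le:
  assumes "\<And>V. subspace V \<Longrightarrow> V \<subseteq> H \<Longrightarrow> (\<And>v. v \<in> V \<Longrightarrow> v \<noteq> 0 \<Longrightarrow> q v < 0) \<Longrightarrow> dim V \<le> n"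
  shows "neg_index q H \<le> enat n"
  unfolding neg_index_def
proof (rule Sup_least, clarify)
  fix V assume "subspace V" "V \<subseteq> H" "\<forall>v\<in>V. v \<noteq> 0 \<longrightarrow> q v < 0"
  then show "enat (dim V) \<le> enat n" using assms[of V] by simp
qed

text \<open>Preimages and images under \<open>T\<close> match the negative definite subspaces on
  both sides. It carries the Morse index from the rescaled system back to the star.\<close>

lemma neg_index_linear_image:
  fixes T :: "'v::real_vector \<Rightarrow> 'w::real_vector"
  assumes T: "linear T" and H: "subspace H" and inj: "inj_on T H"
    and q: "\<And>v. v \<in> H \<Longrightarrow> q' (T v) = q v"
  shows "neg_index q' (T ` H) = neg_index q H"
proof -
  have *: "(\<exists>V'. d = enat (dim V') \<and> subspace V' \<and> V' \<subseteq> T ` H \<and> (\<forall>v\<in>V'. v \<noteq> 0 \<longrightarrow> q' v < 0)) \<longleftrightarrow>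
      (\<exists>V. d = enat (dim V) \<and> subspace V \<and> V \<subseteq> H \<and> (\<forall>v\<in>V. v \<noteq> 0 \<longrightarrow> q v < 0))" (is "?L \<longleftrightarrow> ?R") for d
  proof
    assume ?L
    then obtain V' where V': "d = enat (dim V')" "subspace V'" "V' \<subseteq> T ` H" "\<forall>v\<in>V'. v \<noteq> 0 \<longrightarrow> q' v < 0"
      by (elim exE conjE)
    define V where "V = H \<inter> T -` V'"
    have sV: "subspace V" unfolding V_def by (intro subspace_inter H linear_subspace_vimage T V'(2))
    have im: "T ` V = V'" using V'(3) by (auto simp: V_def)
    have injV: "inj_on T V" using inj by (rule inj_on_subset) (auto simp: V_def)
    have "q v < 0" if "v \<in> V" "v \<noteq> 0" for v
    proof -
      have "T v \<noteq> 0" using injV that linear_injective_on_subspace_0[OF T sV] by blast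
      then show ?thesis using bspec[OF V'(4), of "T v"] q[of v] that by (auto simp: V_def)
    qed
    then show ?R using V'(1) sV im dim_image_inj_on[OF T sV injV] by (intro exI[of _ V]) (auto simp: V_def)
  next
    assume ?R
    then obtain V where V: "d = enat (dim V)" "subspace V" "V \<subseteq> H" "\<forall>v\<in>V. v \<noteq> 0 \<longrightarrow> q v < 0"
      by (elim exE conjE)
    have "inj_on T V" using inj V(3) by (rule inj_on_subset)
    then show ?L
      using V(1,3,4) q linear_0[OF T]
      by (intro exI[of _ "T ` V"] conjI linear_subspace_image[OF T V(2)])
        (force simp: dim_image_inj_on[OF T V(2)])+
  qed
  show ?thesis unfolding neg_index_def using * by presburger
qed

text \<open>An isotropic family \<open>e\<close> with a dual family \<open>f\<close> spans, together with \<open>f\<close>, a hyperbolic space: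
  the form is negative definite on the span of the \<open>f i - c e i\<close> for large \<open>c\<close>.\<close>

lemma neg_index_ge_isotropic:
  fixes I :: "'v::real_vector \<Rightarrow> 'v \<Rightarrow> real"
  assumes X: "finite X" and H: "subspace H" and eH: "\<And>i. i \<in> X \<Longrightarrow> e i \<in> H" and fH: "\<And>i. i \<in> X \<Longrightarrow> f i \<in> H"
    and lin: "\<And>u v w c. u \<in> H \<Longrightarrow> v \<in> H \<Longrightarrow> w \<in> H \<Longrightarrow> I (u + c *\<^sub>R v) w = I u w + c * I v w"
    and sym: "\<And>u v. u \<in> H \<Longrightarrow> v \<in> H \<Longrightarrow> I u v = I v u"
    and ee: "\<And>i j. i \<in> X \<Longrightarrow> j \<in> X \<Longrightarrow> I (e i) (e j) = 0"
    and ef: "\<And>i j. i \<in> X \<Longrightarrow> j \<in> X \<Longrightarrow> I (e i) (f j) = (if i = j then 1 else 0)"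
  shows "enat (card X) \<le> neg_index (\<lambda>v. I v v) H"
proof -
  have I0: "I 0 w = 0" if "w \<in> H" for w
    using lin[of 0 0 w 1] that subspace_0[OF H] by simp
  define M where "M = (\<Sum>i\<in>X. \<Sum>j\<in>X. \<bar>I (f i) (f j)\<bar>)"
  \<comment> \<open>On a combination of the \<open>g i\<close> whose coefficients have sum of
    squares \<open>s\<close>, the form is at most \<open>(M - 2 * c) * s\<close>; every
    \<open>c\<close> larger than \<open>M / 2\<close> would do.\<close>
  define c where "c = M + 1"
  have M0: "M \<ge> 0" unfolding M_def by (intro sum_nonneg) auto
  define g where "g i = f i + (- c) *\<^sub>R e i" for i
  have gH: "g i \<in> H" if "i \<in> X" for i
    unfolding g_def using that eH fH H by (intro subspace_add subspace_scale)
  have sumH: "(\<Sum>i\<in>Y. x i *\<^sub>R g i) \<in> H" if "Y \<subseteq> X" for Y x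
    using that gH H by (intro subspace_sum subspace_scale) auto
  have lin_sum: "I (\<Sum>i\<in>Y. x i *\<^sub>R g i) w = (\<Sum>i\<in>Y. x i * I (g i) w)" if "Y \<subseteq> X" "w \<in> H" for Y x w
    using finite_subset[OF that(1) X] that(1)
  proof (induction Y rule: finite_induct)
    case empty then show ?case using I0[OF that(2)] by simp
  next
    case (insert i Y)
    then show ?case
      using lin[of "\<Sum>i\<in>Y. x i *\<^sub>R g i" "g i" w "x i"] sumH[of Y x] gH[of i] that(2) by (simp add: add.commute)
  qed
  have gg: "I (g i) (g j) = I (f i) (f j) - (if i = j then 2 * c else 0)" if "i \<in> X" "j \<in> X" for i j
  proof -
    note m = eH[OF that(1)] eH[OF that(2)] fH[OF that(1)] fH[OF that(2)] gH[OF that(1)] gH[OF that(2)]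
    have "I (g i) (g j) = I (f i) (g j) - c * I (e i) (g j)"
      using lin[of "f i" "e i" "g j" "- c"] m by (simp add: g_def)
    also have "I (f i) (g j) = I (f i) (f j) - c * I (f i) (e j)"
      using sym[of "f i" "g j"] lin[of "f j" "e j" "f i" "- c"] sym[of "f i" "f j"] sym[of "f i" "e j"] m by (simp add: g_def)
    also have "I (f i) (e j) = (if i = j then 1 else 0)" using sym[of "f i" "e j"] ef[of j i] m that by auto
    also have "I (e i) (g j) = I (e i) (f j)"
      using sym[of "e i" "g j"] lin[of "f j" "e j" "e i" "- c"] sym[of "e i" "f j"] sym[of "e i" "e j"] ee[of i j] m that by (simp add: g_def)
    also have "\<dots> = (if i = j then 1 else 0)" using ef that by simp
    finally show ?thesis by auto
  qed
  have neg: "I (\<Sum>i\<in>X. x i *\<^sub>R g i) (\<Sum>i\<in>X. x i *\<^sub>R g i) < 0" if "\<exists>i\<in>X. x i \<noteq> 0" for x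
  proof -
    define s where "s = (\<Sum>i\<in>X. (x i)\<^sup>2)"
    have s: "s > 0" unfolding s_def using that X by (metis sum_pos2 zero_le_power2 zero_less_power2)
    let ?u = "\<Sum>i\<in>X. x i *\<^sub>R g i"
    have "I ?u ?u = (\<Sum>i\<in>X. x i * I (g i) ?u)" using lin_sum[of X ?u x] sumH[of X x] by simp
    also have "\<dots> = (\<Sum>i\<in>X. x i * (\<Sum>j\<in>X. x j * I (g j) (g i)))"
    proof (rule sum.cong[OF refl])
      fix i assume i: "i \<in> X"
      have "I (g i) ?u = I ?u (g i)" using sym[of "g i" ?u] gH[OF i] sumH[of X x] by simp
      then show "x i * I (g i) ?u = x i * (\<Sum>j\<in>X. x j * I (g j) (g i))" using lin_sum[of X "g i" x] gH[OF i] by simp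
    qed
    also have "\<dots> = (\<Sum>i\<in>X. (\<Sum>j\<in>X. x i * x j * I (f j) (f i)) - 2 * c * (x i)\<^sup>2)"
    proof (rule sum.cong[OF refl])
      fix i assume i: "i \<in> X"
      have "x i * (\<Sum>j\<in>X. x j * I (g j) (g i)) = (\<Sum>j\<in>X. x i * x j * I (f j) (f i) - (if j = i then x i * x i * (2 * c) else 0))"
        unfolding sum_distrib_left by (rule sum.cong[OF refl]) (use i in \<open>auto simp: gg algebra_simps\<close>)
      also have "\<dots> = (\<Sum>j\<in>X. x i * x j * I (f j) (f i)) - x i * x i * (2 * c)"
        using i X by (simp add: sum_subtractf)
      finally show "x i * (\<Sum>j\<in>X. x j * I (g j) (g i)) = (\<Sum>j\<in>X. x i * x j * I (f j) (f i)) - 2 * c * (x i)\<^sup>2"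
        by (simp add: power2_eq_square mult_ac)
    qed
    also have "\<dots> = (\<Sum>i\<in>X. \<Sum>j\<in>X. x i * x j * I (f j) (f i)) - 2 * c * s"
      by (simp add: sum_subtractf s_def sum_distrib_left)
    also have "(\<Sum>i\<in>X. \<Sum>j\<in>X. x i * x j * I (f j) (f i)) \<le> (\<Sum>i\<in>X. \<Sum>j\<in>X. s * \<bar>I (f i) (f j)\<bar>)"
    proof (intro sum_mono)
      fix i j assume ij: "i \<in> X" "j \<in> X"
      have 1: "(x i)\<^sup>2 \<le> s" "(x j)\<^sup>2 \<le> s" unfolding s_def using ij X by (auto intro!: member_le_sum)
      have "2 * \<bar>x i\<bar> * \<bar>x j\<bar> \<le> (x i)\<^sup>2 + (x j)\<^sup>2" using sum_squares_bound[of "\<bar>x i\<bar>" "\<bar>x j\<bar>"] by simp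
      then have "\<bar>x i * x j\<bar> \<le> s" using 1 by (simp add: abs_mult)
      then have "\<bar>x i * x j\<bar> * \<bar>I (f j) (f i)\<bar> \<le> s * \<bar>I (f j) (f i)\<bar>" by (rule mult_right_mono) simp
      then have "x i * x j * I (f j) (f i) \<le> s * \<bar>I (f j) (f i)\<bar>"
        by (metis abs_ge_self abs_mult order_trans)
      then show "x i * x j * I (f j) (f i) \<le> s * \<bar>I (f i) (f j)\<bar>" using sym ij fH by metis
    qed
    also have "\<dots> = s * M" unfolding M_def by (simp add: sum_distrib_left)
    finally have "I ?u ?u \<le> s * M - 2 * c * s" by simp
    also have "\<dots> < 0" using s mult_nonneg_nonneg[OF less_imp_le[OF s] M0] unfolding c_def by (simp add: algebra_simps)
    finally show ?thesis .
  qed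
  have indep: "x i = 0" if "(\<Sum>i\<in>X. x i *\<^sub>R g i) = 0" "i \<in> X" for x i
    \<comment> \<open>Linear independence of the \<open>g i\<close> is a by-product of definiteness:
      a nontrivial combination has a negative value, so it is not \<open>0\<close>.\<close>
    using neg[of x] that I0[OF subspace_0[OF H]] by fastforce
  have inj: "inj_on g X"
  proof (rule inj_onI)
    fix i j assume ij: "i \<in> X" "j \<in> X" "g i = g j"
    show "i = j"
    proof (rule ccontr)
      assume ne: "i \<noteq> j"
      let ?x = "\<lambda>k. (if k = i then 1 else 0) - (if k = j then 1 else 0 :: real)"
      have "(\<Sum>k\<in>X. ?x k *\<^sub>R g k) = g i - g j"
        using ij(1,2) X by (simp add: scaleR_left_diff_distrib sum_subtractf if_distrib[of "\<lambda>c. c *\<^sub>R _"] cong: if_cong)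
      then show False using indep[of ?x i] ij ne by simp
    qed
  qed
  have gX: "finite (g ` X)" using X by simp
  have ind: "independent (g ` X)"
    unfolding dependent_finite[OF gX] sum.reindex[OF inj]
    using indep[of "\<lambda>i. u (g i)" for u] by (auto simp: o_def)
  have "enat (dim (span (g ` X))) \<le> neg_index (\<lambda>v. I v v) H"
  proof (rule neg_index_ge)
    show "subspace (span (g ` X))" by simp
    show "span (g ` X) \<subseteq> H" using gH H by (intro span_minimal) auto
    fix v assume v: "v \<in> span (g ` X)" "v \<noteq> 0"
    then obtain y where y: "v = (\<Sum>w\<in>g ` X. y w *\<^sub>R w)" using span_finite[OF gX] by auto
    then have v': "v = (\<Sum>i\<in>X. y (g i) *\<^sub>R g i)" by (simp add: sum.reindex[OF inj])
    have "\<exists>i\<in>X. y (g i) \<noteq> 0" using v(2) v' by (metis (no_types, lifting) scaleR_eq_0_iff sum.neutral)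
    then show "I v v < 0" using neg[of "\<lambda>i. y (g i)"] v' by simp
  qed
  moreover have "dim (span (g ` X)) = card X"
    using dim_span_eq_card_independent[OF ind] card_image[OF inj] by simp
  ultimately show ?thesis by simp
qed

section \<open>Index forms and Jacobi fields\<close>

locale sturm_form =
  fixes P Q R :: "real \<Rightarrow> 'e::euclidean_space \<Rightarrow>\<^sub>L 'e"
  assumes P_cont: "continuous_on {0..1} P" and Q_cont: "continuous_on {0..1} Q" and R_cont: "continuous_on {0..1} R"
    and P_sym: "\<And>t u v. t \<in> {0..1} \<Longrightarrow> P t u \<bullet> v = P t v \<bullet> u"
    and P_pos: "\<And>t v. t \<in> {0..1} \<Longrightarrow> v \<noteq> 0 \<Longrightarrow> 0 < P t v \<bullet> v"
    and R_sym: "\<And>t u v. t \<in> {0..1} \<Longrightarrow> R t u \<bullet> v = R t v \<bullet> u"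
begin

text \<open>The polarized integrand of the index form. The term \<open>g \<bullet> Q t w\<close>
  stands for the transposed one, so that no adjoint of \<open>Q t\<close> appears.\<close>

definition density :: "real \<Rightarrow> 'e \<Rightarrow> 'e \<Rightarrow> 'e \<Rightarrow> 'e \<Rightarrow> real" where
  "density t u g w h = (P t g + Q t u) \<bullet> h + g \<bullet> Q t w + R t u \<bullet> w"

definition form :: "real \<Rightarrow> real \<Rightarrow> (real \<Rightarrow> 'e) \<Rightarrow> (real \<Rightarrow> 'e) \<Rightarrow> (real \<Rightarrow> 'e) \<Rightarrow> (real \<Rightarrow> 'e) \<Rightarrow> real" where
  "form s t u g w h = integral {s..t} (\<lambda>r. density r (u r) (g r) (w r) (h r))"

lemma density_add_scaleR:
  "density t (u + c *\<^sub>R u') (g + c *\<^sub>R g') w h = density t u g w h + c * density t u' g' w h"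
  by (simp add: density_def blinfun.add_right blinfun.scaleR_right inner_add_left inner_add_right algebra_simps)

lemma density_zero [simp]: "density t 0 0 w h = 0" "density t u g 0 0 = 0"
  by (simp_all add: density_def)

lemma density_sym: "t \<in> {0..1} \<Longrightarrow> density t u g w h = density t w h u g"
  using P_sym[of t g h] R_sym[of t u w]
  by (simp add: density_def inner_add_left inner_add_right inner_commute)

lemma density_bound:
  obtains M where "M > 0"
    "\<And>t u g w h. t \<in> {0..1} \<Longrightarrow> \<bar>density t u g w h\<bar> \<le> M * ((norm u)\<^sup>2 + (norm g)\<^sup>2 + (norm w)\<^sup>2 + (norm h)\<^sup>2)"
    "\<And>t. t \<in> {0..1} \<Longrightarrow> norm (P t) \<le> M \<and> norm (Q t) \<le> M \<and> norm (R t) \<le> M"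
proof -
  have "bounded (P ` {0..1} \<union> Q ` {0..1} \<union> R ` {0..1})"
    using P_cont Q_cont R_cont compact_continuous_image[of "{0..1::real}"]
    by (auto intro!: compact_imp_bounded)
  then obtain M where M: "M > 0" "\<And>A. A \<in> P ` {0..1} \<union> Q ` {0..1} \<union> R ` {0..1} \<Longrightarrow> norm A \<le> M"
    unfolding bounded_pos by blast
  have N: "norm (P t) \<le> M \<and> norm (Q t) \<le> M \<and> norm (R t) \<le> M" if "t \<in> {0..1}" for t
    using that M(2) by auto
  have ap: "norm (A x) \<le> M * norm x" if "norm A \<le> M" for A :: "'e \<Rightarrow>\<^sub>L 'e" and x
    using norm_blinfun[of A x] mult_right_mono[OF that, of "norm x"] by simp
  have "\<bar>density t u g w h\<bar> \<le> M * ((norm u)\<^sup>2 + (norm g)\<^sup>2 + (norm w)\<^sup>2 + (norm h)\<^sup>2)" if t: "t \<in> {0..1}" for t u g w h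
  proof -
    note n = N[OF t]
    have in1: "\<bar>A x \<bullet> y\<bar> \<le> M * norm x * norm y" if "norm A \<le> M" for A :: "'e \<Rightarrow>\<^sub>L 'e" and x y
      using Cauchy_Schwarz_ineq2[of "A x" y] mult_right_mono[OF ap[OF that, of x], of "norm y"] by simp
    have "density t u g w h = P t g \<bullet> h + Q t u \<bullet> h + Q t w \<bullet> g + R t u \<bullet> w"
      by (simp add: density_def inner_add_left inner_add_right inner_commute)
    then have "\<bar>density t u g w h\<bar> \<le> M * norm g * norm h + M * norm u * norm h + M * norm w * norm g + M * norm u * norm w"
      using in1[of "P t" g h] in1[of "Q t" u h] in1[of "Q t" w g] in1[of "R t" u w] n by linarith
    also have "\<dots> = M * (norm g * norm h + norm u * norm h + norm w * norm g + norm u * norm w)"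
      by (simp add: algebra_simps)
    also have "\<dots> \<le> M * ((norm u)\<^sup>2 + (norm g)\<^sup>2 + (norm w)\<^sup>2 + (norm h)\<^sup>2)"
      using M(1) sum_squares_bound[of "norm g" "norm h"] sum_squares_bound[of "norm u" "norm h"]
        sum_squares_bound[of "norm w" "norm g"] sum_squares_bound[of "norm u" "norm w"]
      by (intro mult_left_mono) auto
    finally show ?thesis .
  qed
  then show ?thesis using that M(1) N by blast
qed

text \<open>A Garding inequality. \<open>P\<close> is uniformly positive by compactness of
  \<open>{0..1}\<close> times the unit sphere, and part of that positivity absorbs the mixed term by
  Young's inequality.\<close>

lemma density_lower_bound:
  obtains c C where "c > 0" "C \<ge> 0"
    "\<And>t u g. t \<in> {0..1} \<Longrightarrow> c * (norm g)\<^sup>2 - C * (norm u)\<^sup>2 \<le> density t u g u g"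
proof -
  obtain M where M: "M > 0" "\<And>t. t \<in> {0..1} \<Longrightarrow> norm (P t) \<le> M \<and> norm (Q t) \<le> M \<and> norm (R t) \<le> M"
    using density_bound by metis
  let ?K = "{0..1::real} \<times> sphere (0::'e) 1"
  have K: "compact ?K" by (intro compact_Times) auto
  obtain b :: 'e where b: "b \<in> Basis" using nonempty_Basis by blast
  have ne: "?K \<noteq> {}" using norm_Basis[OF b] by (auto intro!: exI[of _ b])
  have cf: "continuous_on ?K (\<lambda>(t, v). P t v \<bullet> v)"
    unfolding case_prod_beta
    by (intro continuous_intros continuous_on_compose2[OF P_cont]) auto
  obtain k where k: "k \<in> ?K" "\<And>z. z \<in> ?K \<Longrightarrow> (\<lambda>(t, v). P t v \<bullet> v) k \<le> (\<lambda>(t, v). P t v \<bullet> v) z"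
    using continuous_attains_inf[OF K ne cf] by blast
  \<comment> \<open>Half of the minimum of \<open>P\<close> on unit vectors: the other half is spent
    on the mixed term.\<close>
  define c where "c = (\<lambda>(t, v). P t v \<bullet> v) k / 2"
  have c: "c > 0" using k(1) P_pos unfolding c_def by (auto simp: norm_eq_zero split: prod.splits) (metis norm_zero zero_neq_one)
  have Pc: "2 * c * (norm g)\<^sup>2 \<le> P t g \<bullet> g" if t: "t \<in> {0..1}" for t g
  proof (cases "g = 0")
    case False
    have "2 * c \<le> P t (g /\<^sub>R norm g) \<bullet> (g /\<^sub>R norm g)"
      using k(2)[of "(t, g /\<^sub>R norm g)"] t False unfolding c_def by simp
    then show ?thesis using False
      by (simp add: blinfun.scaleR_right power2_eq_square field_simps)
  qed simp
  \<comment> \<open>The summand \<open>M\<^sup>2 / c\<close> comes from Young's inequality for the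
    mixed term, the summand \<open>M\<close> from \<open>R\<close>.\<close>
  define C where "C = M\<^sup>2 / c + M"
  have "c * (norm g)\<^sup>2 - C * (norm u)\<^sup>2 \<le> density t u g u g" if t: "t \<in> {0..1}" for t u g
  proof -
    have q: "\<bar>Q t u \<bullet> g\<bar> \<le> M * norm u * norm g"
      using Cauchy_Schwarz_ineq2[of "Q t u" g] norm_blinfun[of "Q t" u] M(2)[OF t]
        mult_right_mono[of "norm (Q t u)" "M * norm u" "norm g"] mult_right_mono[of "norm (Q t)" M "norm u"] by simp
    have r: "\<bar>R t u \<bullet> u\<bar> \<le> M * norm u * norm u"
      using Cauchy_Schwarz_ineq2[of "R t u" u] norm_blinfun[of "R t" u] M(2)[OF t]
        mult_right_mono[of "norm (R t u)" "M * norm u" "norm u"] mult_right_mono[of "norm (R t)" M "norm u"] by simp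
    have "0 \<le> (c * norm g - M * norm u)\<^sup>2 / c" using c by simp
    also have "\<dots> = c * (norm g)\<^sup>2 - 2 * M * norm u * norm g + M\<^sup>2 / c * (norm u)\<^sup>2"
      using c by (simp add: power2_diff power_mult_distrib divide_simps) (simp add: power2_eq_square algebra_simps)
    finally have "2 * (M * norm u * norm g) \<le> c * (norm g)\<^sup>2 + M\<^sup>2 / c * (norm u)\<^sup>2" by simp
    moreover have "density t u g u g = P t g \<bullet> g + 2 * (Q t u \<bullet> g) + R t u \<bullet> u"
      by (simp add: density_def inner_add_left inner_add_right inner_commute)
    ultimately show ?thesis
      using Pc[OF t, of g] q r unfolding C_def by (simp add: power2_eq_square algebra_simps)
  qed
  moreover have "C \<ge> 0" unfolding C_def using c M(1) by simp
  ultimately show ?thesis using that c by blast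
qed

lemma density_integrable:
  assumes "w12_pair 0 1 u g" "w12_pair 0 1 w h" "0 \<le> s" "t \<le> 1"
  shows "(\<lambda>r. density r (u r) (g r) (w r) (h r)) integrable_on {s..t}"
proof -
  note m = w12_pairD[OF assms(1)] w12_pairD[OF assms(2)]
  obtain M where M: "M > 0"
    "\<And>t u g w h. t \<in> {0..1} \<Longrightarrow> \<bar>density t u g w h\<bar> \<le> M * ((norm u)\<^sup>2 + (norm g)\<^sup>2 + (norm w)\<^sup>2 + (norm h)\<^sup>2)"
    using density_bound by metis
  have "(\<lambda>r. density r (u r) (g r) (w r) (h r)) integrable_on {0..1}"
  proof (rule measurable_bounded_by_integrable_imp_integrable)
    note b = borel_measurable_blinfun_apply_continuous
    show "(\<lambda>r. density r (u r) (g r) (w r) (h r)) \<in> borel_measurable (lebesgue_on {0..1})"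
      unfolding density_def
      using m b[OF P_cont, of g] b[OF Q_cont, of u] b[OF Q_cont, of w] b[OF R_cont, of u]
      by (intro borel_measurable_add borel_measurable_inner) auto
    have "(\<lambda>r. (norm (u r))\<^sup>2) integrable_on {0..1}" "(\<lambda>r. (norm (w r))\<^sup>2) integrable_on {0..1}"
      using m by (auto intro!: integrable_continuous_real continuous_intros)
    then show "(\<lambda>r. M * ((norm (u r))\<^sup>2 + (norm (g r))\<^sup>2 + (norm (w r))\<^sup>2 + (norm (h r))\<^sup>2)) integrable_on {0..1}"
      using m by (intro integrable_on_mult_right integrable_add)
  qed (use M(2) in auto)
  then show ?thesis by (rule integrable_on_subinterval) (use assms in auto)
qed

lemma form_add_scaleR:
  assumes "w12_pair 0 1 u g" "w12_pair 0 1 u' g'" "w12_pair 0 1 w h" "0 \<le> s" "t \<le> 1"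
  shows "form s t (\<lambda>r. u r + c *\<^sub>R u' r) (\<lambda>r. g r + c *\<^sub>R g' r) w h = form s t u g w h + c * form s t u' g' w h"
  unfolding form_def density_add_scaleR
  using density_integrable[OF assms(1,3-5)] density_integrable[OF assms(2-5)]
  by (subst integral_add) (auto intro: integrable_on_mult_right)

lemma form_sym: "0 \<le> s \<Longrightarrow> t \<le> 1 \<Longrightarrow> form s t u g w h = form s t w h u g"
  unfolding form_def by (rule integral_cong, rule density_sym) auto

lemma form_combine:
  assumes "w12_pair 0 1 u g" "w12_pair 0 1 w h" "0 \<le> s" "s \<le> r" "r \<le> t" "t \<le> 1"
  shows "form s t u g w h = form s r u g w h + form r t u g w h"
  unfolding form_def
  by (rule Henstock_Kurzweil_Integration.integral_combine[symmetric]) (use assms density_integrable in auto)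

lemma form_cong:
  assumes "\<And>r. r \<in> {s..t} \<Longrightarrow> u r = u' r" "\<And>r. r \<in> {s..t} \<Longrightarrow> w r = w' r"
    and "negligible N" "\<And>r. r \<in> {s..t} - N \<Longrightarrow> g r = g' r" "\<And>r. r \<in> {s..t} - N \<Longrightarrow> h r = h' r"
  shows "form s t u g w h = form s t u' g' w' h'"
  unfolding form_def by (rule integral_spike[OF assms(3)]) (use assms in auto)

lemma form_square_diff:
  assumes u: "w12_pair 0 1 u g" and z: "w12_pair 0 1 z k" and st: "0 \<le> s" "t \<le> 1"
  defines "w \<equiv> \<lambda>r. u r + (-1) *\<^sub>R z r" and "h \<equiv> \<lambda>r. g r + (-1) *\<^sub>R k r"
  shows "form s t u g u g = form s t w h w h + 2 * form s t z k w h + form s t z k z k"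
proof -
  have w: "w12_pair 0 1 w h" unfolding w_def h_def by (rule w12_pair_add_scaleR[OF u z])
  have ug: "u = (\<lambda>r. w r + 1 *\<^sub>R z r)" "g = (\<lambda>r. h r + 1 *\<^sub>R k r)" by (auto simp: w_def h_def)
  have a: "form s t u g y l = form s t w h y l + form s t z k y l" if "w12_pair 0 1 y l" for y l
    using form_add_scaleR[OF w z that st, of 1] unfolding ug[symmetric] by simp
  show ?thesis
    using a[OF u] a[OF w] a[OF z] form_sym[OF st, of w h u g] form_sym[OF st, of z k u g] form_sym[OF st, of w h z k]
    by simp
qed

text \<open>On a short interval the Poincare estimate makes the negative part of the Garding
  inequality small against the integral of the squared derivative. The surplus
  \<open>K * (norm (u s))\<^sup>2\<close> is there to pay for the boundary term of a Jacobi field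
  subtracted to the left of \<open>s\<close>.\<close>

lemma form_short_interval:
  assumes "K \<ge> 0"
  obtains \<delta> where "\<delta> > 0"
    "\<And>s t u g. w12_pair 0 1 u g \<Longrightarrow> 0 \<le> s \<Longrightarrow> s \<le> t \<Longrightarrow> t \<le> 1 \<Longrightarrow> t - s \<le> \<delta> \<Longrightarrow> u t = 0
      \<Longrightarrow> K * (norm (u s))\<^sup>2 \<le> form s t u g u g"
proof -
  obtain c C where c: "c > 0" "C \<ge> 0"
    and lb: "\<And>t u g. t \<in> {0..1} \<Longrightarrow> c * (norm g)\<^sup>2 - C * (norm u)\<^sup>2 \<le> density t u g u g"
    using density_lower_bound by metis
  \<comment> \<open>With \<open>G\<close> the integral of the squared derivative and
    \<open>h \<le> \<delta>\<close> the length, the potential costs at most \<open>C * h * G\<close>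
    (here \<open>\<delta> \<le> 1\<close> is used) and the surplus at most \<open>K * h * G\<close>,
    so \<open>(C + K) * \<delta> \<le> c\<close> is the requirement.\<close>
  define \<delta> where "\<delta> = min 1 (c / (C + K + 1))"
  have \<delta>: "\<delta> > 0" "\<delta> \<le> 1" "(C + K) * \<delta> \<le> c"
  proof -
    show "\<delta> > 0" "\<delta> \<le> 1" using c assms by (auto simp: \<delta>_def)
    have "(C + K) * \<delta> \<le> (C + K + 1) * (c / (C + K + 1))"
      using c assms unfolding \<delta>_def by (intro mult_mono) auto
    then show "(C + K) * \<delta> \<le> c" using c assms by simp
  qed
  have "K * (norm (u s))\<^sup>2 \<le> form s t u g u g"
    if u: "w12_pair 0 1 u g" and st: "0 \<le> s" "s \<le> t" "t \<le> 1" "t - s \<le> \<delta>" and ut: "u t = 0" for s t u g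
  proof -
    define G where "G = integral {s..t} (\<lambda>x. (norm (g x))\<^sup>2)"
    define h where "h = t - s"
    have h: "0 \<le> h" "h \<le> \<delta>" "h \<le> 1" using st \<delta> by (auto simp: h_def)
    note us = w12_pair_subinterval[OF u, of s t]
    have gi: "(\<lambda>x. (norm (g x))\<^sup>2) integrable_on {s..t}" using w12_pairD(2)[OF us] st by auto
    have ui: "(\<lambda>x. (norm (u x))\<^sup>2) integrable_on {s..t}"
      using w12_pairD(5)[OF us] st by (auto intro!: integrable_continuous_real continuous_intros)
    have G0: "G \<ge> 0" unfolding G_def using gi by (rule integral_nonneg) auto
    have ur: "(norm (u r))\<^sup>2 \<le> h * G" if "r \<in> {s..t}" for r
      using norm_square_le_integral_deriv[OF u, of s r t] that st ut unfolding h_def G_def by auto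
    have "integral {s..t} (\<lambda>x. (norm (u x))\<^sup>2) \<le> integral {s..t} (\<lambda>x. h * G)"
      by (rule integral_le[OF ui]) (use ur in auto)
    then have U: "integral {s..t} (\<lambda>x. (norm (u x))\<^sup>2) \<le> h * (h * G)" using st by (simp add: h_def)
    have "c * G - C * integral {s..t} (\<lambda>x. (norm (u x))\<^sup>2)
        = integral {s..t} (\<lambda>x. c * (norm (g x))\<^sup>2 - C * (norm (u x))\<^sup>2)"
      unfolding G_def using gi ui by (subst integral_diff) (auto intro: integrable_on_mult_right)
    also have "\<dots> \<le> form s t u g u g"
      unfolding form_def
      by (rule integral_le) (use lb st density_integrable[OF u u] gi ui in \<open>auto intro!: integrable_diff integrable_on_mult_right\<close>)
    finally have 1: "c * G - C * (h * (h * G)) \<le> form s t u g u g"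
      using mult_left_mono[OF U c(2)] by linarith
    have "K * (norm (u s))\<^sup>2 \<le> K * (h * G)" using ur[of s] st assms by (intro mult_left_mono) auto
    moreover have "C * (h * (h * G)) \<le> C * (1 * (h * G))"
      using c(2) h G0 by (intro mult_left_mono mult_right_mono) auto
    moreover have "(C + K) * h * G \<le> c * G"
    proof (rule mult_right_mono[OF _ G0])
      have "(C + K) * h \<le> (C + K) * \<delta>" using h c(2) assms by (intro mult_left_mono) auto
      with \<delta>(3) show "(C + K) * h \<le> c" by linarith
    qed
    ultimately show ?thesis using 1 by (simp add: algebra_simps)
  qed
  with \<delta>(1) show ?thesis using that by blast
qed

text \<open>The Jacobi equation in momentum form, with explicit derivatives. The equation for
  \<open>p'\<close> is tested against all \<open>e\<close>, which expresses the adjoint of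
  \<open>Q t\<close> without forming it.\<close>

definition solution :: "(real \<Rightarrow> 'e) \<Rightarrow> (real \<Rightarrow> 'e) \<Rightarrow> (real \<Rightarrow> 'e) \<Rightarrow> (real \<Rightarrow> 'e) \<Rightarrow> bool" where
  "solution p q p' q' \<longleftrightarrow> continuous_on {0..1} p' \<and> continuous_on {0..1} q' \<and>
    (\<forall>t\<in>{0..1}. (p has_vector_derivative p' t) (at t within {0..1}) \<and>
       (q has_vector_derivative q' t) (at t within {0..1}) \<and>
       p t = P t (q' t) + Q t (q t) \<and> (\<forall>e. p' t \<bullet> e = q' t \<bullet> Q t e + R t (q t) \<bullet> e))"

lemma solution_w12_pair: "solution p q p' q' \<Longrightarrow> w12_pair 0 1 q q'"
  unfolding solution_def by (intro w12_pair_C1) auto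

text \<open>Along a Jacobi field the density is the formal derivative of
  \<open>p r \<bullet> u r\<close>, so only boundary terms survive. As \<open>u\<close> is merely a
  Sobolev function, integration by parts for primitives is required.\<close>

lemma form_solution:
  assumes sol: "solution p q p' q'" and u: "w12_pair 0 1 u g" and st: "0 \<le> s" "s \<le> t" "t \<le> 1"
  shows "form s t q q' u g = p t \<bullet> u t - p s \<bullet> u s"
proof -
  have "((\<lambda>r. p' r \<bullet> u r + p r \<bullet> g r) has_integral (p t \<bullet> u t - p s \<bullet> u s)) {s..t}"
  proof (rule integration_by_parts_primitive)
    show "primitive_on s t u g" using primitive_on_subinterval[OF w12_pairD(1)[OF u]] st by auto
    show "continuous_on {s..t} p'"
      using sol st unfolding solution_def by (auto intro: continuous_on_subset)
    fix r assume "r \<in> {s..t}"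
    then have "(p has_vector_derivative p' r) (at r within {0..1})" using sol st unfolding solution_def by auto
    then show "(p has_vector_derivative p' r) (at r within {s..t})"
      by (rule has_vector_derivative_within_subset) (use st in auto)
  qed (rule st)
  moreover have "density r (q r) (q' r) (u r) (g r) = p' r \<bullet> u r + p r \<bullet> g r" if "r \<in> {s..t}" for r
    using sol that st unfolding solution_def density_def by auto
  ultimately have "((\<lambda>r. density r (q r) (q' r) (u r) (g r)) has_integral (p t \<bullet> u t - p s \<bullet> u s)) {s..t}"
    using has_integral_eq by (smt (verit))
  then show ?thesis unfolding form_def by (rule integral_unique)
qed

end

section \<open>The Jacobi flow and its conjugate instants\<close>

locale sturm_flow = sturm_form P Q R
  for P Q R :: "real \<Rightarrow> 'e::euclidean_space \<Rightarrow>\<^sub>L 'e" +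
  fixes \<Phi> D :: "real \<Rightarrow> 'e \<times> 'e \<Rightarrow> 'e \<times> 'e" and \<Delta> :: "'e set"
  assumes flow_linear: "\<And>t. t \<in> {0..1} \<Longrightarrow> linear (\<Phi> t)"
    and flow_0: "\<And>z. \<Phi> 0 z = z"
    and flow_deriv: "\<And>t z. t \<in> {0..1} \<Longrightarrow> ((\<lambda>s. \<Phi> s z) has_vector_derivative D t z) (at t within {0..1})"
    and D_cont: "\<And>z. continuous_on {0..1} (\<lambda>t. D t z)"
    and D_snd: "\<And>t z. t \<in> {0..1} \<Longrightarrow> fst (\<Phi> t z) = P t (snd (D t z)) + Q t (snd (\<Phi> t z))"
    and D_fst: "\<And>t z e. t \<in> {0..1} \<Longrightarrow>
      fst (D t z) \<bullet> e = snd (D t z) \<bullet> Q t e + R t (snd (\<Phi> t z)) \<bullet> e"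
    and subspace_\<Delta>: "subspace \<Delta>"
begin

text \<open>The conormal space of \<open>\<Delta>\<close>, a Lagrangian subspace: positions in
  \<open>\<Delta>\<close> together with the corresponding natural boundary condition. For the star
  this is continuity at the centre and the Kirchhoff condition.\<close>

definition L0 :: "('e \<times> 'e) set" where
  "L0 = {z. snd z \<in> \<Delta> \<and> (\<forall>e\<in>\<Delta>. fst z \<bullet> e = 0)}"

text \<open>Its dimension is the multiplicity of \<open>t\<close> as a conjugate instant, because
  \<open>\<Phi> t\<close> is injective.\<close>

definition fibre :: "real \<Rightarrow> 'e set" where
  "fibre t = {p. \<exists>z\<in>L0. \<Phi> t z = (p, 0)}"

definition shadow :: "real \<Rightarrow> 'e set" where
  "shadow t = {snd (\<Phi> t z) | z. z \<in> L0}"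

lemma subspace_L0: "subspace L0"
  using subspace_\<Delta> unfolding L0_def subspace_def by (auto simp: inner_add_left)

lemma shadow_mem: "z \<in> L0 \<Longrightarrow> snd (\<Phi> t z) \<in> shadow t"
  by (auto simp: shadow_def simp del: split_paired_Ex)

lemma flow_solution: "solution (\<lambda>t. fst (\<Phi> t z)) (\<lambda>t. snd (\<Phi> t z)) (\<lambda>t. fst (D t z)) (\<lambda>t. snd (D t z))"
  unfolding solution_def
proof (intro conjI ballI allI)
  show "continuous_on {0..1} (\<lambda>t. fst (D t z))" "continuous_on {0..1} (\<lambda>t. snd (D t z))"
    using D_cont[of z] by (auto intro: continuous_intros)
  fix t assume t: "t \<in> {0..1::real}"
  show "((\<lambda>t. fst (\<Phi> t z)) has_vector_derivative fst (D t z)) (at t within {0..1})"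
    "((\<lambda>t. snd (\<Phi> t z)) has_vector_derivative snd (D t z)) (at t within {0..1})"
    using bounded_linear.has_vector_derivative[OF bounded_linear_fst flow_deriv[OF t, of z]]
      bounded_linear.has_vector_derivative[OF bounded_linear_snd flow_deriv[OF t, of z]] by auto
  show "fst (\<Phi> t z) = P t (snd (D t z)) + Q t (snd (\<Phi> t z))" using D_snd[OF t] .
  show "fst (D t z) \<bullet> e = snd (D t z) \<bullet> Q t e + R t (snd (\<Phi> t z)) \<bullet> e" for e using D_fst[OF t] .
qed

lemmas flow_pair = solution_w12_pair[OF flow_solution]

text \<open>The conserved Wronskian, obtained without differentiating it:
  \<open>form_solution\<close> evaluates the form of two Jacobi fields in both orders, and the form
  is symmetric.\<close>

lemma flow_symplectic:
  assumes t: "t \<in> {0..1}"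
  shows "fst (\<Phi> t z) \<bullet> snd (\<Phi> t w) - fst (\<Phi> t w) \<bullet> snd (\<Phi> t z) = fst z \<bullet> snd w - fst w \<bullet> snd z"
proof -
  have "form 0 t (\<lambda>t. snd (\<Phi> t z)) (\<lambda>t. snd (D t z)) (\<lambda>t. snd (\<Phi> t w)) (\<lambda>t. snd (D t w))
      = fst (\<Phi> t z) \<bullet> snd (\<Phi> t w) - fst z \<bullet> snd w"
    using form_solution[OF flow_solution flow_pair, of 0 t z w] t by (simp add: flow_0)
  moreover have "form 0 t (\<lambda>t. snd (\<Phi> t w)) (\<lambda>t. snd (D t w)) (\<lambda>t. snd (\<Phi> t z)) (\<lambda>t. snd (D t z))
      = fst (\<Phi> t w) \<bullet> snd (\<Phi> t z) - fst w \<bullet> snd z"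
    using form_solution[OF flow_solution flow_pair, of 0 t w z] t by (simp add: flow_0)
  ultimately show ?thesis using form_sym[of 0 t] t by simp
qed

text \<open>Pairing \<open>z\<close> with \<open>(- snd z, fst z)\<close> turns the invariant
  symplectic form at time \<open>0\<close> into the squared norm of \<open>z\<close>.\<close>

lemma flow_inj:
  assumes t: "t \<in> {0..1}" and "\<Phi> t z = 0"
  shows "z = 0"
proof -
  have "fst z \<bullet> fst z + snd z \<bullet> snd z = 0"
    using flow_symplectic[OF t, of z "(- snd z, fst z)"] assms(2) by simp
  then have "fst z = 0" "snd z = 0"
    by (metis add_nonneg_eq_0_iff inner_eq_zero_iff inner_ge_zero)+
  then show ?thesis by (simp add: prod_eq_iff)
qed

text \<open>Test vectors \<open>(0, e)\<close> with \<open>e \<in> \<Delta>\<close> return the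
  momentum condition; test vectors \<open>(p, 0)\<close> with \<open>p\<close> orthogonal to
  \<open>\<Delta>\<close> put the position into the double orthogonal complement of
  \<open>\<Delta>\<close>.\<close>

lemma L0_maximal:
  assumes "\<And>w. w \<in> L0 \<Longrightarrow> fst z \<bullet> snd w - fst w \<bullet> snd z = 0"
  shows "z \<in> L0"
proof -
  have "fst z \<bullet> e = 0" if "e \<in> \<Delta>" for e
    using assms[of "(0, e)"] that by (simp add: L0_def)
  moreover have "snd z \<in> \<Delta>"
  proof -
    have "p \<bullet> snd z = 0" if "\<And>e. e \<in> \<Delta> \<Longrightarrow> p \<bullet> e = 0" for p
      using assms[of "(p, 0)"] that subspace_0[OF subspace_\<Delta>] by (simp add: L0_def)
    then have "snd z \<in> orthogonal_comp (orthogonal_comp \<Delta>)"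
      unfolding orthogonal_comp_def orthogonal_def by (auto simp: inner_commute)
    then show ?thesis using orthogonal_comp_self[OF subspace_\<Delta>] by simp
  qed
  ultimately show ?thesis by (simp add: L0_def)
qed

text \<open>Pull \<open>(p, 0)\<close> back along the flow. The symplectic pairing of the result
  with \<open>w \<in> L0\<close> equals \<open>p\<close> paired with the value of the Jacobi field
  of \<open>w\<close> at \<open>t\<close>; it vanishes, and \<open>L0\<close> is maximal
  isotropic.\<close>

lemma fibreI:
  assumes t: "t \<in> {0..1}" and p: "\<And>q. q \<in> shadow t \<Longrightarrow> p \<bullet> q = 0"
  shows "p \<in> fibre t"
proof -
  have "inj (\<Phi> t)" using flow_inj[OF t] linear_injective_0[OF flow_linear[OF t]] by blast
  then have "surj (\<Phi> t)" using linear_injective_imp_surjective flow_linear[OF t] by blast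
  then obtain z where z: "\<Phi> t z = (p, 0)" by (metis surjD)
  have "z \<in> L0"
  proof (rule L0_maximal)
    fix w assume "w \<in> L0"
    then have "snd (\<Phi> t w) \<in> shadow t" by (rule shadow_mem)
    then show "fst z \<bullet> snd w - fst w \<bullet> snd z = 0"
      using flow_symplectic[OF t, of z w] p z by simp
  qed
  with z show ?thesis by (auto simp: fibre_def)
qed

lemma subspace_shadow: "t \<in> {0..1} \<Longrightarrow> subspace (shadow t)"
proof -
  assume t: "t \<in> {0..1}"
  have "linear (\<lambda>z. snd (\<Phi> t z))"
    using linear_compose[OF flow_linear[OF t] bounded_linear.linear[OF bounded_linear_snd]] by (simp add: o_def)
  then have "subspace ((\<lambda>z. snd (\<Phi> t z)) ` L0)" using subspace_L0 by (rule linear_subspace_image)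
  then show ?thesis unfolding shadow_def by (simp add: image_def conj_commute Bex_def)
qed

lemma subspace_fibre:
  assumes t: "t \<in> {0..1}"
  shows "subspace (fibre t)"
proof (rule subspaceI)
  note lin = flow_linear[OF t]
  show "0 \<in> fibre t"
    using linear_0[OF lin] subspace_0[OF subspace_L0] by (auto simp: fibre_def zero_prod_def intro!: bexI[of _ 0])
  show "x + y \<in> fibre t" if xy: "x \<in> fibre t" "y \<in> fibre t" for x y
  proof -
    obtain z w where "z \<in> L0" "\<Phi> t z = (x, 0)" "w \<in> L0" "\<Phi> t w = (y, 0)" using xy by (auto simp: fibre_def)
    then show ?thesis
      unfolding fibre_def using linear_add[OF lin, of z w] subspace_add[OF subspace_L0, of z w] by (auto intro!: bexI[of _ "z + w"])
  qed
  show "c *\<^sub>R x \<in> fibre t" if x: "x \<in> fibre t" for c x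
  proof -
    obtain z where "z \<in> L0" "\<Phi> t z = (x, 0)" using x by (auto simp: fibre_def)
    then show ?thesis
      unfolding fibre_def using linear_scale[OF lin, of c z] subspace_scale[OF subspace_L0, of z c] by (auto intro!: bexI[of _ "c *\<^sub>R z"])
  qed
qed

lemma shadow_0: "shadow 0 = \<Delta>"
proof
  show "shadow 0 \<subseteq> \<Delta>" by (auto simp: shadow_def L0_def flow_0)
  have "q \<in> shadow 0" if "q \<in> \<Delta>" for q
    using shadow_mem[of "(0, q)" 0] that by (simp add: L0_def flow_0)
  then show "\<Delta> \<subseteq> shadow 0" by blast
qed

text \<open>The dual of \<open>fibreI\<close> through the double orthogonal complement. It turns
  membership in \<open>shadow t\<close> into \<open>dim (fibre t)\<close> linear equations.\<close>

lemma shadowI: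
  assumes t: "t \<in> {0..1}" and q: "\<And>p. p \<in> fibre t \<Longrightarrow> p \<bullet> q = 0"
  shows "q \<in> shadow t"
proof -
  have "q \<in> orthogonal_comp (orthogonal_comp (shadow t))"
    unfolding orthogonal_comp_def orthogonal_def
    using q fibreI[OF t] by (auto simp: inner_commute)
  then show ?thesis using orthogonal_comp_self[OF subspace_shadow[OF t]] by simp
qed

text \<open>A linear right inverse in finite dimension is bounded. The constant \<open>C\<close>
  controls the momentum of the chosen Jacobi field through \<open>q\<close>, hence the boundary term
  it produces.\<close>

lemma shadow_lift:
  assumes t: "t \<in> {0..1}"
  obtains C where "C \<ge> 0"
    "\<And>q. q \<in> shadow t \<Longrightarrow> \<exists>z\<in>L0. snd (\<Phi> t z) = q \<and> norm (fst (\<Phi> t z)) \<le> C * norm q"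
proof -
  let ?f = "\<lambda>z. snd (\<Phi> t z)"
  have "linear ?f"
    using linear_compose[OF flow_linear[OF t] bounded_linear.linear[OF bounded_linear_snd]] by (simp add: o_def)
  from linear_exists_right_inverse_on[OF this subspace_L0]
  obtain g where g: "range g \<subseteq> L0" "linear g" "\<forall>v\<in>?f ` L0. ?f (g v) = v" by blast
  have "linear (\<lambda>q. fst (\<Phi> t (g q)))"
    using linear_compose[OF linear_compose[OF g(2) flow_linear[OF t]] bounded_linear.linear[OF bounded_linear_fst]]
    by (simp add: o_def)
  from linear_bounded_pos[OF this]
  obtain C where "C > 0" "\<And>q. norm (fst (\<Phi> t (g q))) \<le> C * norm q" by blast
  moreover have "g q \<in> L0 \<and> ?f (g q) = q" if "q \<in> shadow t" for q
    using that g(1,3) by (auto simp: shadow_def)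
  ultimately show ?thesis using that[of C] by (metis less_imp_le)
qed

text \<open>Nonnegativity of the form on \<open>[0,t]\<close>, after imposing at every time the linear
  conditions that make a subtraction of a Jacobi field from \<open>L0\<close> possible.\<close>

definition nonneg_upto :: "real \<Rightarrow> bool" where
  "nonneg_upto t \<longleftrightarrow> (\<forall>u g. w12_pair 0 1 u g \<longrightarrow> u t = 0 \<longrightarrow> (\<forall>s. 0 \<le> s \<longrightarrow> s < t \<longrightarrow> u s \<in> shadow s)
     \<longrightarrow> 0 \<le> form 0 t u g u g)"

lemma nonneg_upto_0: "nonneg_upto 0"
  by (simp add: nonneg_upto_def form_def)

text \<open>Before \<open>t0\<close>, subtract from \<open>u\<close> an admissible Jacobi field
  \<open>y\<close> through \<open>u t0\<close>. The difference vanishes at \<open>t0\<close> and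
  obeys the constraints, so \<open>good\<close> applies; the mixed term vanishes by the two boundary
  conditions; and \<open>y\<close> alone contributes \<open>p t0 \<bullet> u t0\<close>, at least
  \<open>- C * (norm (u t0))\<^sup>2\<close>. The short interval after \<open>t0\<close> was chosen
  to pay exactly this.\<close>

lemma nonneg_upto_step:
  assumes t0: "0 \<le> t0" "t0 < 1" and good: "nonneg_upto t0"
  shows "\<exists>\<delta>>0. \<forall>t. t0 \<le> t \<longrightarrow> t \<le> t0 + \<delta> \<longrightarrow> t \<le> 1 \<longrightarrow> nonneg_upto t"
proof -
  have t0': "t0 \<in> {0..1}" using t0 by simp
  obtain C where C: "C \<ge> 0" "\<And>q. q \<in> shadow t0 \<Longrightarrow> \<exists>z\<in>L0. snd (\<Phi> t0 z) = q \<and> norm (fst (\<Phi> t0 z)) \<le> C * norm q"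
    using shadow_lift[OF t0'] by metis
  obtain \<delta> where \<delta>: "\<delta> > 0"
    "\<And>s t u g. w12_pair 0 1 u g \<Longrightarrow> 0 \<le> s \<Longrightarrow> s \<le> t \<Longrightarrow> t \<le> 1 \<Longrightarrow> t - s \<le> \<delta> \<Longrightarrow> u t = 0
      \<Longrightarrow> C * (norm (u s))\<^sup>2 \<le> form s t u g u g"
    using form_short_interval[OF C(1)] by metis
  have "nonneg_upto t" if t: "t0 \<le> t" "t \<le> t0 + \<delta>" "t \<le> 1" for t
  proof (cases "t = t0")
    case True then show ?thesis using good by simp
  next
    case False
    show ?thesis unfolding nonneg_upto_def
    proof (intro allI impI)
      fix u g assume u: "w12_pair 0 1 u g" and ut: "u t = 0" and sh: "\<forall>s. 0 \<le> s \<longrightarrow> s < t \<longrightarrow> u s \<in> shadow s"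
      \<comment> \<open>The constraint covers all times before \<open>t\<close>, hence
        \<open>t0\<close> itself; this is what makes the subtraction possible even when
        \<open>t0\<close> is conjugate.\<close>
      have "u t0 \<in> shadow t0" using sh t0 t False by simp
      then obtain z where z: "z \<in> L0" "snd (\<Phi> t0 z) = u t0" "norm (fst (\<Phi> t0 z)) \<le> C * norm (u t0)"
        using C(2) by blast
      define p where "p = (\<lambda>r. fst (\<Phi> r z))"
      define y where "y = (\<lambda>r. snd (\<Phi> r z))"
      define k where "k = (\<lambda>r. snd (D r z))"
      have sol: "solution p y (\<lambda>r. fst (D r z)) k" unfolding p_def y_def k_def by (rule flow_solution)
      have y: "w12_pair 0 1 y k" using solution_w12_pair[OF sol] .
      define w where "w = (\<lambda>r. u r + (-1) *\<^sub>R y r)"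
      define h where "h = (\<lambda>r. g r + (-1) *\<^sub>R k r)"
      have w: "w12_pair 0 1 w h" unfolding w_def h_def by (rule w12_pair_add_scaleR[OF u y])
      have w0: "w t0 = 0" using z(2) by (simp add: w_def y_def)
      have wsh: "w s \<in> shadow s" if s: "0 \<le> s" "s < t" for s
      proof -
        have "s \<in> {0..1}" using s t by simp
        moreover have "y s \<in> shadow s" using shadow_mem[OF z(1)] by (simp add: y_def)
        ultimately show ?thesis unfolding w_def
          using sh s by (intro subspace_add subspace_scale subspace_shadow) auto
      qed
      have p0: "p 0 \<bullet> q = 0" if "q \<in> \<Delta>" for q using z(1) that by (simp add: p_def flow_0 L0_def)
      have "form 0 t0 y k w h = p t0 \<bullet> w t0 - p 0 \<bullet> w 0"
        by (rule form_solution[OF sol w]) (use t0 in auto)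
      also have "\<dots> = 0" using w0 p0[of "w 0"] wsh[of 0] t0 t False shadow_0 by simp
      finally have 1: "form 0 t0 y k w h = 0" .
      have 2: "form 0 t0 y k y k = p t0 \<bullet> u t0"
        using form_solution[OF sol y, of 0 t0] t0 z(2) p0[of "y 0"] z(1) by (simp add: y_def flow_0 L0_def)
      have "- (p t0 \<bullet> u t0) \<le> C * (norm (u t0))\<^sup>2"
        using Cauchy_Schwarz_ineq2[of "p t0" "u t0"] mult_right_mono[OF z(3), of "norm (u t0)"]
        by (simp add: p_def power2_eq_square)
      moreover have "C * (norm (u t0))\<^sup>2 \<le> form t0 t u g u g" using \<delta>(2)[OF u] t0 t ut by auto
      moreover have "0 \<le> form 0 t0 w h w h"
        using good w w0 wsh t False unfolding nonneg_upto_def by auto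
      moreover have "form 0 t u g u g = form 0 t0 u g u g + form t0 t u g u g"
        using form_combine[OF u u, of 0 t0 t] t0 t by simp
      moreover have "form 0 t0 u g u g = form 0 t0 w h w h + 2 * form 0 t0 y k w h + form 0 t0 y k y k"
        unfolding w_def h_def by (rule form_square_diff[OF u y]) (use t0 in auto)
      ultimately show "0 \<le> form 0 t u g u g" using 1 2 by linarith
    qed
  qed
  then show ?thesis using \<delta>(1) by blast
qed

text \<open>Passage to the limit: cut \<open>u\<close> off linearly on a short interval before \<open>\<tau>\<close>, at a cost which is
  controlled by the integral of \<open>|u'|\<^sup>2\<close> there.\<close>

lemma nonneg_upto_limit:
  assumes \<tau>: "0 < \<tau>" "\<tau> \<le> 1" and h: "h > 0"
    and full: "\<And>s. 0 < s \<Longrightarrow> \<tau> - h < s \<Longrightarrow> s < \<tau> \<Longrightarrow> shadow s = UNIV"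
    and good: "\<And>t. 0 \<le> t \<Longrightarrow> t < \<tau> \<Longrightarrow> nonneg_upto t"
  shows "nonneg_upto \<tau>"
  unfolding nonneg_upto_def
proof (intro allI impI)
  fix u g assume u: "w12_pair 0 1 u g" and u\<tau>: "u \<tau> = 0" and sh: "\<forall>s. 0 \<le> s \<longrightarrow> s < \<tau> \<longrightarrow> u s \<in> shadow s"
  obtain M where M: "M > 0"
    "\<And>t u g w h. t \<in> {0..1} \<Longrightarrow> \<bar>density t u g w h\<bar> \<le> M * ((norm u)\<^sup>2 + (norm g)\<^sup>2 + (norm w)\<^sup>2 + (norm h)\<^sup>2)"
    using density_bound by metis
  define N where "N = (\<lambda>s. integral {0..s} (\<lambda>x. (norm (g x))\<^sup>2))"
  have gi: "(\<lambda>x. (norm (g x))\<^sup>2) integrable_on {0..1}" using w12_pairD(2)[OF u] .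
  have lower: "- (6 * M * (N \<tau> - N s)) \<le> form 0 s u g u g" if s: "max 0 (\<tau> - h) < s" "s < \<tau>" for s
  proof -
    \<comment> \<open>The competitor keeps \<open>u\<close> up to \<open>s\<close> and runs linearly
      to \<open>0\<close> at the midpoint \<open>t\<close> of \<open>s\<close> and
      \<open>\<tau>\<close>. As \<open>t < \<tau>\<close>, nonnegativity up to \<open>t\<close> is
      available, and \<open>full\<close> supplies the constraint between \<open>s\<close> and
      \<open>t\<close>.\<close>
    define t where "t = (s + \<tau>) / 2"
    define d where "d = t - s"
    have st: "0 < s" "s < t" "t < \<tau>" "t < 1" "d > 0" "\<tau> - s = 2 * d" "d \<le> 1"
      using s \<tau> by (auto simp: t_def d_def)
    define l where "l = (\<lambda>r. ((t - r) / d) *\<^sub>R u s)"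
    define l' where "l' = (\<lambda>r::real. (- (1 / d)) *\<^sub>R u s)"
    have ld: "(l has_vector_derivative l' r) (at r within S)" for r S
    proof -
      have "((\<lambda>r. (t - r) / d) has_vector_derivative (- (1 / d))) (at r within S)"
        unfolding has_real_derivative_iff_has_vector_derivative[symmetric]
        using st(5) by (auto intro!: derivative_eq_intros)
      from bounded_linear.has_vector_derivative[OF bounded_linear_scaleR_left this, of "u s"]
      show ?thesis unfolding l_def l'_def .
    qed
    have l: "w12_pair a b l l'" for a b
      by (rule w12_pair_C1[OF ld]) (simp add: l'_def)
    have z: "w12_pair a b (\<lambda>_. 0) (\<lambda>_. 0 :: 'e)" for a b
      by (rule w12_pair_C1) auto
    define lz where "lz = (\<lambda>r. if r \<le> t then l r else 0)"
    define lz' where "lz' = (\<lambda>r. if r \<le> t then l' r else 0)"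
    have lz: "w12_pair s 1 lz lz'" unfolding lz_def lz'_def
      by (rule w12_pair_glue[OF _ _ l z]) (use st in \<open>auto simp: l_def\<close>)
    define v where "v = (\<lambda>r. if r \<le> s then u r else lz r)"
    define k where "k = (\<lambda>r. if r \<le> s then g r else lz' r)"
    have v: "w12_pair 0 1 v k" unfolding v_def k_def
      by (rule w12_pair_glue[OF _ _ w12_pair_subinterval[OF u] lz]) (use st in \<open>auto simp: lz_def l_def d_def\<close>)
    have "v r \<in> shadow r" if r: "0 \<le> r" "r < t" for r
    proof (cases "r \<le> s")
      case True then show ?thesis using sh r st by (simp add: v_def)
    next
      case False
      then have "shadow r = UNIV" using full[of r] r st s by auto
      then show ?thesis by simp
    qed
    moreover have "v t = 0" using st by (simp add: v_def lz_def l_def)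
    ultimately have "0 \<le> form 0 t v k v k" using good[of t] v st unfolding nonneg_upto_def by auto
    also have "\<dots> = form 0 s v k v k + form s t v k v k"
      by (rule form_combine[OF v v]) (use st in auto)
    also have "form 0 s v k v k = form 0 s u g u g"
      by (rule form_cong[of _ _ _ _ _ _ "{}"]) (auto simp: v_def k_def)
    also have "form s t v k v k \<le> 6 * M * (N \<tau> - N s)"
    proof -
      define U where "U = (norm (u s))\<^sup>2"
      have Nd: "N \<tau> - N s = integral {s..\<tau>} (\<lambda>x. (norm (g x))\<^sup>2)"
      proof -
        have "(\<lambda>x. (norm (g x))\<^sup>2) integrable_on {0..\<tau>}"
          by (rule integrable_on_subinterval[OF gi]) (use \<tau> in auto)
        then have "N s + integral {s..\<tau>} (\<lambda>x. (norm (g x))\<^sup>2) = N \<tau>"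
          unfolding N_def using st by (intro Henstock_Kurzweil_Integration.integral_combine) auto
        then show ?thesis by simp
      qed
      \<comment> \<open>As \<open>u \<tau> = 0\<close> and \<open>\<tau> - s = 2 * d\<close>, the
        cost \<open>U / d\<close> of the steep line is at most two tails
        \<open>N \<tau> - N s\<close>, and \<open>d * U\<close> is at most one more; with the factor
        \<open>2 * M\<close> this is the constant \<open>6 * M\<close>.\<close>
      have U: "U \<le> 2 * d * (N \<tau> - N s)"
        using norm_square_le_integral_deriv[OF u, of s s \<tau>] st \<tau> u\<tau> unfolding U_def Nd by auto
      have "form s t v k v k = form s t l l' l l'"
        by (rule form_cong[of _ _ _ _ _ _ "{s}"]) (use st in \<open>auto simp: v_def k_def lz_def lz'_def l_def d_def\<close>)
      also have "\<dots> \<le> integral {s..t} (\<lambda>r. 2 * M * (U + U / d\<^sup>2))"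
        unfolding form_def
      proof (rule integral_le)
        show "(\<lambda>r. density r (l r) (l' r) (l r) (l' r)) integrable_on {s..t}"
          by (rule density_integrable[OF l l]) (use st in auto)
        fix r assume r: "r \<in> {s..t}"
        have "(norm (l r))\<^sup>2 = ((t - r) / d)\<^sup>2 * U" by (simp add: l_def U_def power_mult_distrib power_divide)
        also have "\<dots> \<le> 1\<^sup>2 * U"
          using r st by (intro mult_right_mono power_mono) (auto simp: U_def d_def divide_simps)
        finally have "(norm (l r))\<^sup>2 \<le> U" by simp
        moreover have "(norm (l' r))\<^sup>2 = U / d\<^sup>2" by (simp add: l'_def U_def power_mult_distrib power_divide)
        ultimately have "(norm (l r))\<^sup>2 + (norm (l' r))\<^sup>2 + (norm (l r))\<^sup>2 + (norm (l' r))\<^sup>2 \<le> 2 * (U + U / d\<^sup>2)" by simp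
        from mult_left_mono[OF this, of M]
        have "M * ((norm (l r))\<^sup>2 + (norm (l' r))\<^sup>2 + (norm (l r))\<^sup>2 + (norm (l' r))\<^sup>2) \<le> 2 * M * (U + U / d\<^sup>2)"
          using less_imp_le[OF M(1)] by (simp only: mult.assoc mult.left_commute[of M 2] simp_thms)
        moreover have "\<bar>density r (l r) (l' r) (l r) (l' r)\<bar>
            \<le> M * ((norm (l r))\<^sup>2 + (norm (l' r))\<^sup>2 + (norm (l r))\<^sup>2 + (norm (l' r))\<^sup>2)"
          by (rule M(2)) (use r st in auto)
        ultimately show "density r (l r) (l' r) (l r) (l' r) \<le> 2 * M * (U + U / d\<^sup>2)"
          by (meson abs_ge_self order_trans)
      qed auto
      also have "\<dots> = 2 * M * (d * U + U / d)"
        using st by (simp add: d_def[symmetric] power2_eq_square field_simps)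
      also have "\<dots> \<le> 2 * M * (3 * (N \<tau> - N s))"
      proof (intro mult_left_mono)
        have N0: "0 \<le> N \<tau> - N s"
          unfolding Nd by (rule integral_nonneg) (use w12_pairD(2)[OF w12_pair_subinterval[OF u, of s \<tau>]] st \<tau> in auto)
        have d: "d \<le> 1 / 2" using st \<tau> by simp
        have "U / d \<le> 2 * (N \<tau> - N s)" using U st by (simp add: field_simps)
        moreover have "d * U \<le> 1 / 2 * U" using d by (intro mult_right_mono) (auto simp: U_def)
        moreover have "2 * d * (N \<tau> - N s) \<le> 1 * (N \<tau> - N s)" using d N0 by (intro mult_right_mono) auto
        moreover have "y + x \<le> 3 * E" if "x \<le> 2 * E" "y \<le> 1 / 2 * U" "e \<le> 1 * E" "U \<le> e" "0 \<le> E" for x y e E :: real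
          using that by simp
        ultimately show "d * U + U / d \<le> 3 * (N \<tau> - N s)" using U N0 by blast
      qed (use M in auto)
      finally show ?thesis by (simp add: algebra_simps)
    qed
    finally show ?thesis by simp
  qed
  have cN: "continuous_on {0..1} N" unfolding N_def using gi by (rule indefinite_integral_continuous_1)
  have cF: "continuous_on {0..1} (\<lambda>s. form 0 s u g u g)"
    unfolding form_def using density_integrable[OF u u, of 0 1] by (intro indefinite_integral_continuous_1) auto
  have nb: "at_left \<tau> \<noteq> bot" by simp
  have sub: "at_left \<tau> = at \<tau> within {0..\<tau>}"
    using at_within_Icc_at_left[OF \<tau>(1)] by simp
  have lim: "((\<lambda>s. form 0 s u g u g) \<longlongrightarrow> form 0 \<tau> u g u g) (at_left \<tau>)" "(N \<longlongrightarrow> N \<tau>) (at_left \<tau>)"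
  proof -
    have \<tau>01: "\<tau> \<in> {0..1}" "{0..\<tau>} \<subseteq> {0..1}" using \<tau> by auto
    show "((\<lambda>s. form 0 s u g u g) \<longlongrightarrow> form 0 \<tau> u g u g) (at_left \<tau>)"
      unfolding sub using cF \<tau>01 tendsto_within_subset continuous_on_def by blast
    show "(N \<longlongrightarrow> N \<tau>) (at_left \<tau>)"
      unfolding sub using cN \<tau>01 tendsto_within_subset continuous_on_def by blast
  qed
  have "((\<lambda>s. - (6 * M * (N \<tau> - N s))) \<longlongrightarrow> - (6 * M * (N \<tau> - N \<tau>))) (at_left \<tau>)"
    by (intro tendsto_intros lim)
  moreover have "eventually (\<lambda>s. - (6 * M * (N \<tau> - N s)) \<le> form 0 s u g u g) (at_left \<tau>)"
    unfolding eventually_at_left_field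
    using lower \<tau> h by (intro exI[of _ "max 0 (\<tau> - h)"]) simp
  ultimately have "- (6 * M * (N \<tau> - N \<tau>)) \<le> form 0 \<tau> u g u g"
    using tendsto_le[OF nb lim(1)] by blast
  then show "0 \<le> form 0 \<tau> u g u g" by simp
qed

end

section \<open>The Morse index theorem\<close>

text \<open>Differentiability almost everywhere ties \<open>g\<close> to \<open>edge_deriv\<close>
  off a null set, so that \<open>hess\<close> may be computed with whichever representative is
  explicit.\<close>

definition w12_rep :: "(real \<Rightarrow> 'a::euclidean_space) \<Rightarrow> (real \<Rightarrow> 'a) \<Rightarrow> bool" where
  "w12_rep u g \<longleftrightarrow> w12_pair 0 1 u g \<and> (\<exists>N. negligible N \<and>
     (\<forall>t\<in>{0..1} - N. (u has_vector_derivative g t) (at t within {0..1})))"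

lemma w12_rep_add_scaleR:
  assumes "w12_rep u g" "w12_rep v h"
  shows "w12_rep (u + c *\<^sub>R v) (\<lambda>t. g t + c *\<^sub>R h t)"
proof -
  obtain N where N: "negligible N" "\<And>t. t \<in> {0..1} - N \<Longrightarrow> (u has_vector_derivative g t) (at t within {0..1})"
    using assms(1) unfolding w12_rep_def by blast
  obtain N' where N': "negligible N'" "\<And>t. t \<in> {0..1} - N' \<Longrightarrow> (v has_vector_derivative h t) (at t within {0..1})"
    using assms(2) unfolding w12_rep_def by blast
  have eq: "u + c *\<^sub>R v = (\<lambda>t. u t + c *\<^sub>R v t)" by auto
  have "((\<lambda>t. u t + c *\<^sub>R v t) has_vector_derivative g t + c *\<^sub>R h t) (at t within {0..1})"
    if "t \<in> {0..1} - (N \<union> N')" for t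
    using N(2)[of t] N'(2)[of t] that
    by (intro has_vector_derivative_add bounded_linear.has_vector_derivative[OF bounded_linear_scaleR_right]) auto
  moreover have "negligible (N \<union> N')" using N(1) N'(1) by (rule negligible_Un)
  ultimately show ?thesis
    using w12_pair_add_scaleR assms unfolding w12_rep_def eq by blast
qed

lemma w12_rep_unique:
  assumes "w12_rep u g" "w12_rep u h"
  obtains N where "negligible N" "\<And>t. t \<in> {0..1} - N \<Longrightarrow> g t = h t"
proof -
  obtain N where N: "negligible N" "\<And>t. t \<in> {0..1} - N \<Longrightarrow> (u has_vector_derivative g t) (at t within {0..1})"
    using assms(1) unfolding w12_rep_def by blast
  obtain N' where N': "negligible N'" "\<And>t. t \<in> {0..1} - N' \<Longrightarrow> (u has_vector_derivative h t) (at t within {0..1})"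
    using assms(2) unfolding w12_rep_def by blast
  have "g t = h t" if "t \<in> {0..1} - (N \<union> N')" for t
    using vector_derivative_unique_within_closed_interval[of 0 1 t u "g t" "h t"] N(2)[of t] N'(2)[of t] that
    by (auto simp: cbox_interval)
  moreover have "negligible (N \<union> N')" using N(1) N'(1) by (rule negligible_Un)
  ultimately show ?thesis using that by blast
qed

lemma w12_rep_edge_deriv: "W12_on 0 1 u \<Longrightarrow> w12_rep u (edge_deriv 0 1 u)"
  unfolding w12_rep_def using W12_on_edge_deriv[of 0 1 u] by auto

lemma w12_rep_imp_W12_on: "w12_rep u g \<Longrightarrow> W12_on 0 1 u"
  unfolding w12_rep_def using W12_onI by blast

lemma primitive_on_cong:
  assumes "a \<le> b" "primitive_on a b u g" "\<And>t. t \<in> {a..b} \<Longrightarrow> u t = v t"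
  shows "primitive_on a b v g"
  unfolding primitive_on_def
proof (intro conjI ballI)
  show "g absolutely_integrable_on {a..b}" using primitive_onD(1)[OF assms(2)] .
  show "v t = v a + integral {a..t} g" if "t \<in> {a..b}" for t
    using primitive_onD(2)[OF assms(2) that] assms(3)[OF that] assms(3)[of a] assms(1) by simp
qed

lemma w12_rep_cong:
  assumes "w12_rep u g" "\<And>t. t \<in> {0..1} \<Longrightarrow> u t = v t"
  shows "w12_rep v g"
proof -
  have "w12_pair 0 1 v g"
    using assms primitive_on_cong[of 0 1 u g v] unfolding w12_rep_def w12_pair_def by simp
  moreover have "(v has_vector_derivative d) (at t within {0..1})"
    if "(u has_vector_derivative d) (at t within {0..1})" "t \<in> {0..1}" for t d
    using that(1) by (rule has_vector_derivative_transform[OF that(2), rotated]) (use assms(2) in auto)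
  ultimately show ?thesis using assms(1) unfolding w12_rep_def by blast
qed

text \<open>The Lagrange interpolation polynomial, built one factor
  \<open>(t - \<sigma>) / (\<tau> - \<sigma>)\<close> at a time.\<close>

lemma exists_separating_function:
  fixes A :: "real set"
  assumes "finite A" "\<tau> \<notin> A"
  shows "\<exists>h h'. (\<forall>t. (h has_real_derivative h' t) (at t)) \<and> continuous_on UNIV h' \<and> h \<tau> = 1 \<and> (\<forall>\<sigma>\<in>A. h \<sigma> = 0)"
  using assms
proof (induction A rule: finite_induct)
  case empty
  show ?case by (intro exI[of _ "\<lambda>_. 1"] exI[of _ "\<lambda>_. 0"]) auto
next
  case (insert \<sigma> A)
  then obtain h h' where h: "\<And>t. (h has_real_derivative h' t) (at t)" "continuous_on UNIV h'" "h \<tau> = 1"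
      "\<forall>\<sigma>\<in>A. h \<sigma> = 0" by auto
  have ch: "continuous_on UNIV h" using h(1) by (meson DERIV_isCont continuous_at_imp_continuous_on)
  show ?case
  proof (intro exI conjI allI ballI)
    show "((\<lambda>t. h t * ((t - \<sigma>) / (\<tau> - \<sigma>))) has_real_derivative h' t * ((t - \<sigma>) / (\<tau> - \<sigma>)) + h t * (1 / (\<tau> - \<sigma>))) (at t)" for t
      using insert.prems by (auto intro!: derivative_eq_intros h(1) simp: add_divide_distrib)
    show "continuous_on UNIV (\<lambda>t. h' t * ((t - \<sigma>) / (\<tau> - \<sigma>)) + h t * (1 / (\<tau> - \<sigma>)))"
      using insert.prems by (intro continuous_intros h(2) ch) auto
  qed (use insert.prems h in auto)
qed

section \<open>Lower and upper bounds for the Morse index of the flow\<close>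

context sturm_flow begin

definition variations :: "(real \<Rightarrow> 'e) set" where
  "variations = {u. W12_on 0 1 u \<and> u 0 \<in> \<Delta> \<and> u 1 = 0 \<and> (\<forall>t. t \<notin> {0..1} \<longrightarrow> u t = 0)}"

definition hess :: "(real \<Rightarrow> 'e) \<Rightarrow> (real \<Rightarrow> 'e) \<Rightarrow> real" where
  "hess u w = form 0 1 u (edge_deriv 0 1 u) w (edge_deriv 0 1 w)"

lemma variations_rep: "u \<in> variations \<Longrightarrow> w12_rep u (edge_deriv 0 1 u)"
  unfolding variations_def by (intro w12_rep_edge_deriv) auto

lemma hess_eq:
  assumes u: "w12_rep u g" and w: "w12_rep w h"
  shows "hess u w = form 0 1 u g w h"
proof -
  obtain N where N: "negligible N" "\<And>t. t \<in> {0..1} - N \<Longrightarrow> edge_deriv 0 1 u t = g t"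
    using w12_rep_unique[OF w12_rep_edge_deriv[OF w12_rep_imp_W12_on[OF u]] u] by metis
  obtain N' where N': "negligible N'" "\<And>t. t \<in> {0..1} - N' \<Longrightarrow> edge_deriv 0 1 w t = h t"
    using w12_rep_unique[OF w12_rep_edge_deriv[OF w12_rep_imp_W12_on[OF w]] w] by metis
  show ?thesis unfolding hess_def
    by (rule form_cong[OF _ _ negligible_Un[OF N(1) N'(1)]]) (use N N' in auto)
qed

lemma subspace_variations: "subspace variations"
proof (rule subspaceI)
  have *: "u + c *\<^sub>R v \<in> variations" if "u \<in> variations" "v \<in> variations" for u v c
    using w12_rep_imp_W12_on[OF w12_rep_add_scaleR[OF variations_rep[OF that(1)] variations_rep[OF that(2)]]] that
      subspace_add[OF subspace_\<Delta>] subspace_scale[OF subspace_\<Delta>]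
    unfolding variations_def by simp
  have "w12_rep (\<lambda>t. 0) (\<lambda>t. 0 :: 'e)"
    unfolding w12_rep_def by (intro conjI w12_pair_C1 exI[of _ "{}"]) auto
  then show 0: "0 \<in> variations"
    using w12_rep_imp_W12_on[of "\<lambda>t. 0"] subspace_0[OF subspace_\<Delta>] unfolding variations_def zero_fun_def by simp
  show "x + y \<in> variations" if "x \<in> variations" "y \<in> variations" for x y
    using *[OF that, of 1] by simp
  show "c *\<^sub>R x \<in> variations" if "x \<in> variations" for c x
    using *[OF 0 that, of c] by simp
qed

lemma hess_add_scaleR:
  assumes "u \<in> variations" "v \<in> variations" "w \<in> variations"
  shows "hess (u + c *\<^sub>R v) w = hess u w + c * hess v w"
proof -
  note r = variations_rep[OF assms(1)] variations_rep[OF assms(2)] variations_rep[OF assms(3)]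
  have "hess (u + c *\<^sub>R v) w = form 0 1 (u + c *\<^sub>R v) (\<lambda>t. edge_deriv 0 1 u t + c *\<^sub>R edge_deriv 0 1 v t) w (edge_deriv 0 1 w)"
    by (rule hess_eq[OF w12_rep_add_scaleR[OF r(1,2)] r(3)])
  also have "\<dots> = form 0 1 (\<lambda>t. u t + c *\<^sub>R v t) (\<lambda>t. edge_deriv 0 1 u t + c *\<^sub>R edge_deriv 0 1 v t) w (edge_deriv 0 1 w)"
    by (rule form_cong[of _ _ _ _ _ _ "{}"]) auto
  also have "form 0 1 (\<lambda>t. u t + c *\<^sub>R v t) (\<lambda>t. edge_deriv 0 1 u t + c *\<^sub>R edge_deriv 0 1 v t) w (edge_deriv 0 1 w)
      = hess u w + c * hess v w"
    unfolding hess_def by (rule form_add_scaleR) (use r in \<open>auto simp: w12_rep_def\<close>)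
  finally show ?thesis .
qed

lemma hess_sym: "hess u w = hess w u"
  unfolding hess_def by (rule form_sym) auto

definition truncated :: "real \<Rightarrow> 'e \<times> 'e \<Rightarrow> real \<Rightarrow> 'e" where
  "truncated \<tau> z t = (if t \<in> {0..\<tau>} then snd (\<Phi> t z) else 0)"

lemma truncated_rep:
  assumes \<tau>: "0 < \<tau>" "\<tau> < 1" and z: "snd (\<Phi> \<tau> z) = 0"
  shows "w12_rep (truncated \<tau> z) (\<lambda>t. if t \<le> \<tau> then snd (D t z) else 0)"
proof (rule w12_rep_cong)
  let ?u = "\<lambda>t. if t \<le> \<tau> then snd (\<Phi> t z) else 0" and ?g = "\<lambda>t. if t \<le> \<tau> then snd (D t z) else 0"
  have "w12_pair \<tau> 1 (\<lambda>_. 0) (\<lambda>_. 0 :: 'e)" by (rule w12_pair_C1) auto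
  then have "w12_pair 0 1 ?u ?g"
    by (intro w12_pair_glue w12_pair_subinterval[OF flow_pair]) (use \<tau> z in auto)
  moreover have "(?u has_vector_derivative ?g t) (at t within {0..1})" if t: "t \<in> {0..1} - {\<tau>}" for t
  proof (cases "t < \<tau>")
    case True
    have "((\<lambda>t. snd (\<Phi> t z)) has_vector_derivative snd (D t z)) (at t within {0..1})"
      using flow_solution[of z] t unfolding solution_def by auto
    then have "(?u has_vector_derivative snd (D t z)) (at t within {0..1})"
      by (rule has_vector_derivative_transform_within[where d="\<tau> - t"]) (use True t in \<open>auto simp: dist_real_def\<close>)
    with True show ?thesis by simp
  next
    case False
    have "((\<lambda>t. 0) has_vector_derivative (0::'e)) (at t within {0..1})" by simp
    then have "(?u has_vector_derivative 0) (at t within {0..1})"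
      by (rule has_vector_derivative_transform_within[where d="t - \<tau>"]) (use False t in \<open>auto simp: dist_real_def\<close>)
    with False t show ?thesis by simp
  qed
  moreover have "negligible {\<tau>}" by simp
  ultimately show "w12_rep ?u ?g" unfolding w12_rep_def by blast
qed (auto simp: truncated_def)

lemma truncated_variation:
  assumes "0 < \<tau>" "\<tau> < 1" "snd (\<Phi> \<tau> z) = 0" "z \<in> L0"
  shows "truncated \<tau> z \<in> variations"
  using w12_rep_imp_W12_on[OF truncated_rep[OF assms(1-3)]] assms
  by (auto simp: variations_def truncated_def flow_0 L0_def)

text \<open>Only the boundary terms survive, so the truncated Jacobi fields span an isotropic space.\<close>

lemma hess_truncated:
  assumes \<tau>: "0 < \<tau>" "\<tau> < 1" and z: "\<Phi> \<tau> z = (v, 0)" "z \<in> L0" and u: "u \<in> variations"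
  shows "hess (truncated \<tau> z) u = v \<bullet> u \<tau>"
proof -
  define g where "g = edge_deriv 0 1 u"
  have u': "w12_rep u g" using variations_rep[OF u] by (simp add: g_def)
  then have up: "w12_pair 0 1 u g" by (simp add: w12_rep_def)
  have tr: "w12_rep (truncated \<tau> z) (\<lambda>t. if t \<le> \<tau> then snd (D t z) else 0)"
    using truncated_rep[OF \<tau>, of z] z by simp
  then have trp: "w12_pair 0 1 (truncated \<tau> z) (\<lambda>t. if t \<le> \<tau> then snd (D t z) else 0)" by (simp add: w12_rep_def)
  have "hess (truncated \<tau> z) u = form 0 1 (truncated \<tau> z) (\<lambda>t. if t \<le> \<tau> then snd (D t z) else 0) u g"
    by (rule hess_eq[OF tr u'])
  also have "\<dots> = form 0 \<tau> (truncated \<tau> z) (\<lambda>t. if t \<le> \<tau> then snd (D t z) else 0) u g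
      + form \<tau> 1 (truncated \<tau> z) (\<lambda>t. if t \<le> \<tau> then snd (D t z) else 0) u g"
    by (rule form_combine[OF trp up]) (use \<tau> in auto)
  also have "form \<tau> 1 (truncated \<tau> z) (\<lambda>t. if t \<le> \<tau> then snd (D t z) else 0) u g = form \<tau> 1 (\<lambda>_. 0) (\<lambda>_. 0) u g"
    by (rule form_cong[of _ _ _ _ _ _ "{\<tau>}"]) (use z \<tau> in \<open>auto simp: truncated_def\<close>)
  also have "\<dots> = 0" by (simp add: form_def)
  also have "form 0 \<tau> (truncated \<tau> z) (\<lambda>t. if t \<le> \<tau> then snd (D t z) else 0) u g
      = form 0 \<tau> (\<lambda>t. snd (\<Phi> t z)) (\<lambda>t. snd (D t z)) u g"
    by (rule form_cong[of _ _ _ _ _ _ "{}"]) (auto simp: truncated_def)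
  also have "\<dots> = fst (\<Phi> \<tau> z) \<bullet> u \<tau> - fst (\<Phi> 0 z) \<bullet> u 0"
    by (rule form_solution[OF flow_solution up]) (use \<tau> in auto)
  also have "\<dots> = v \<bullet> u \<tau>" using z u by (simp add: flow_0 L0_def variations_def)
  finally show ?thesis by simp
qed

text \<open>The isotropic vectors are truncated Jacobi fields whose momenta at \<open>\<tau>\<close>
  run through an orthonormal basis of \<open>fibre \<tau>\<close>; the dual vectors are
  \<open>h \<tau> t *\<^sub>R v\<close> with an interpolation polynomial \<open>h \<tau>\<close>. By
  \<open>hess_truncated\<close> the pairing of \<open>(\<tau>, v)\<close> with
  \<open>(\<sigma>, w)\<close> is \<open>h \<sigma> \<tau> * (v \<bullet> w)\<close>, a Kronecker
  delta.\<close>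

lemma neg_index_ge_fibres:
  assumes F: "finite F" "F \<subseteq> {0<..<1}"
  shows "enat (\<Sum>\<tau>\<in>F. dim (fibre \<tau>)) \<le> neg_index (\<lambda>u. hess u u) variations"
proof -
  have "\<exists>B. B \<subseteq> fibre \<tau> \<and> pairwise orthogonal B \<and> (\<forall>x\<in>B. norm x = 1) \<and> finite B \<and> card B = dim (fibre \<tau>)"
    if "\<tau> \<in> F" for \<tau>
  proof -
    have "subspace (fibre \<tau>)" using subspace_fibre that F(2) by auto
    then obtain B where B: "B \<subseteq> fibre \<tau>" "pairwise orthogonal B" "\<And>x. x \<in> B \<Longrightarrow> norm x = 1" "independent B"
      "card B = dim (fibre \<tau>)" "span B = fibre \<tau>"
      using orthonormal_basis_subspace by metis
    then show ?thesis using independent_imp_finite by blast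
  qed
  then obtain B where B: "\<And>\<tau>. \<tau> \<in> F \<Longrightarrow> B \<tau> \<subseteq> fibre \<tau>" "\<And>\<tau>. \<tau> \<in> F \<Longrightarrow> pairwise orthogonal (B \<tau>)"
    "\<And>\<tau> x. \<tau> \<in> F \<Longrightarrow> x \<in> B \<tau> \<Longrightarrow> norm x = 1" "\<And>\<tau>. \<tau> \<in> F \<Longrightarrow> finite (B \<tau>)" "\<And>\<tau>. \<tau> \<in> F \<Longrightarrow> card (B \<tau>) = dim (fibre \<tau>)"
    by metis
  \<comment> \<open>The endpoints \<open>0\<close> and \<open>1\<close> are among the zeros so that
    the dual vectors vanish at both ends and are variations, whatever \<open>\<Delta>\<close>
    is.\<close>
  have "\<exists>h h'. (\<forall>t. (h has_real_derivative h' t) (at t)) \<and> continuous_on UNIV h' \<and> h \<tau> = 1 \<and> (\<forall>\<sigma>\<in>F \<union> {0, 1} - {\<tau>}. h \<sigma> = 0)" for \<tau>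
    by (rule exists_separating_function) (use F in auto)
  then obtain h h' where h: "\<And>\<tau> t. (h \<tau> has_real_derivative h' \<tau> t) (at t)" "\<And>\<tau>. continuous_on UNIV (h' \<tau>)"
    "\<And>\<tau>. h \<tau> \<tau> = 1" "\<And>\<tau> \<sigma>. \<sigma> \<in> F \<union> {0, 1} - {\<tau>} \<Longrightarrow> h \<tau> \<sigma> = 0"
    by metis
  have "\<exists>z\<in>L0. \<Phi> \<tau> z = (v, 0)" if "\<tau> \<in> F" "v \<in> B \<tau>" for \<tau> v
    using B(1) that by (auto simp: fibre_def)
  then obtain Z where Z: "\<And>\<tau> v. \<tau> \<in> F \<Longrightarrow> v \<in> B \<tau> \<Longrightarrow> Z \<tau> v \<in> L0 \<and> \<Phi> \<tau> (Z \<tau> v) = (v, 0)"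
    by metis
  define X where "X = (SIGMA \<tau>:F. B \<tau>)"
  define e where "e = (\<lambda>(\<tau>, v). truncated \<tau> (Z \<tau> v))"
  define f :: "real \<times> 'e \<Rightarrow> real \<Rightarrow> 'e" where "f = (\<lambda>(\<tau>, v) t. if t \<in> {0..1} then h \<tau> t *\<^sub>R v else 0)"
  have "enat (card X) \<le> neg_index (\<lambda>u. hess u u) variations"
  proof (rule neg_index_ge_isotropic[where I=hess and e=e and f=f])
    show "finite X" unfolding X_def using F(1) B(4) by blast
    show "subspace variations" by (rule subspace_variations)
    show "e i \<in> variations" if "i \<in> X" for i
      using that Z F(2) unfolding X_def e_def by (auto intro!: truncated_variation)
    show fv: "f i \<in> variations" if "i \<in> X" for i
    proof -
      obtain \<tau> v where i0: "i = (\<tau>, v)" by (metis surj_pair)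
      with that have i: "i = (\<tau>, v)" "\<tau> \<in> F" "v \<in> B \<tau>" by (auto simp: X_def)
      have "((\<lambda>t. h \<tau> t *\<^sub>R v) has_vector_derivative h' \<tau> t *\<^sub>R v) (at t within S)" for t S
        using bounded_linear.has_vector_derivative[OF bounded_linear_scaleR_left, of "h \<tau>" "h' \<tau> t" "at t within S" v]
          h(1)[of \<tau> t] by (simp add: has_real_derivative_iff_has_vector_derivative has_vector_derivative_at_within)
      moreover have "continuous_on {0..1} (\<lambda>t. h' \<tau> t *\<^sub>R v)"
        using h(2)[of \<tau>] by (auto intro!: continuous_intros intro: continuous_on_subset)
      ultimately have "w12_rep (\<lambda>t. h \<tau> t *\<^sub>R v) (\<lambda>t. h' \<tau> t *\<^sub>R v)"
        unfolding w12_rep_def by (intro conjI w12_pair_C1 exI[of _ "{}"]) auto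
      then have "w12_rep (f i) (\<lambda>t. h' \<tau> t *\<^sub>R v)"
        by (rule w12_rep_cong) (simp add: f_def i)
      moreover have "\<tau> \<noteq> 0" "\<tau> \<noteq> 1" using i F(2) by auto
      ultimately show ?thesis
        using w12_rep_imp_W12_on h(4)[of 0 \<tau>] h(4)[of 1 \<tau>] subspace_0[OF subspace_\<Delta>]
        unfolding variations_def by (auto simp: f_def i)
    qed
    show "hess (u + c *\<^sub>R v) w = hess u w + c * hess v w"
      if "u \<in> variations" "v \<in> variations" "w \<in> variations" for u v w c
      using hess_add_scaleR[OF that] .
    show "hess u v = hess v u" for u v by (rule hess_sym)
    have ev: "hess (e (\<tau>, v)) u = v \<bullet> u \<tau>" if "(\<tau>, v) \<in> X" "u \<in> variations" for \<tau> v u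
      using hess_truncated[of \<tau> "Z \<tau> v" v u] that Z F(2) unfolding X_def e_def by auto
    \<comment> \<open>The pairing samples the second field at the truncation time of the first. With
      the later truncation put first, the other field is already \<open>0\<close> there; symmetry
      covers the remaining order.\<close>
    have le: "hess (e (\<tau>, v)) (e (\<sigma>, w)) = 0" if "(\<tau>, v) \<in> X" "(\<sigma>, w) \<in> X" "\<sigma> \<le> \<tau>" for \<tau> v \<sigma> w
    proof -
      have "e (\<sigma>, w) \<in> variations" using that(2) Z F(2) unfolding X_def e_def by (auto intro!: truncated_variation)
      moreover have "e (\<sigma>, w) \<tau> = 0" using that Z unfolding X_def e_def truncated_def by auto
      ultimately show ?thesis using ev[OF that(1)] by simp
    qed
    show "hess (e i) (e j) = 0" if "i \<in> X" "j \<in> X" for i j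
    proof -
      obtain \<tau> v \<sigma> w where ij: "i = (\<tau>, v)" "j = (\<sigma>, w)" by (metis surj_pair)
      show ?thesis using le[of \<tau> v \<sigma> w] le[of \<sigma> w \<tau> v] that hess_sym unfolding ij by (metis linear)
    qed
    show "hess (e i) (f j) = (if i = j then 1 else 0)" if ij: "i \<in> X" "j \<in> X" for i j
    proof -
      obtain \<tau> v \<sigma> w where i: "i = (\<tau>, v)" and j: "j = (\<sigma>, w)" by (metis surj_pair)
      have m: "\<tau> \<in> F" "v \<in> B \<tau>" "\<sigma> \<in> F" "w \<in> B \<sigma>" using ij by (auto simp: i j X_def)
      have "hess (e i) (f j) = v \<bullet> f j \<tau>" using ev[of \<tau> v "f j"] fv[OF ij(2)] ij(1) i by simp
      also have "\<dots> = h \<sigma> \<tau> * (v \<bullet> w)" using m(1) F(2) by (auto simp: f_def j)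
      also have "\<dots> = (if i = j then 1 else 0)"
      proof (cases "\<tau> = \<sigma>")
        case True
        have "v \<bullet> w = (if v = w then 1 else 0)"
          using B(2)[OF m(1)] B(3)[OF m(1,2)] m True
          by (auto simp: pairwise_def orthogonal_def norm_eq_1)
        with True show ?thesis by (simp add: i j h(3))
      next
        case False
        then show ?thesis using h(4)[of \<tau> \<sigma>] m by (simp add: i j)
      qed
      finally show ?thesis .
    qed
  qed
  moreover have "card X = (\<Sum>\<tau>\<in>F. dim (fibre \<tau>))"
    unfolding X_def using F(1) B(4,5) by (simp add: card_SigmaI)
  ultimately show ?thesis by simp
qed

text \<open>Evaluation at the nodes of a grid of mesh \<open>1 / N \<le> \<delta>\<close> gives
  finitely many functionals. A variation killed by all of them vanishes at the right end of every
  cell, so each cell contributes a nonnegative amount to the form.\<close>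

lemma neg_index_finite: "\<exists>n. neg_index (\<lambda>u. hess u u) variations \<le> enat n"
proof -
  obtain \<delta> where \<delta>: "\<delta> > 0"
    "\<And>s t u g. w12_pair 0 1 u g \<Longrightarrow> 0 \<le> s \<Longrightarrow> s \<le> t \<Longrightarrow> t \<le> 1 \<Longrightarrow> t - s \<le> \<delta> \<Longrightarrow> u t = 0
      \<Longrightarrow> 0 * (norm (u s))\<^sup>2 \<le> form s t u g u g"
    using form_short_interval[of 0] by auto
  obtain N :: nat where N: "N > 0" "1 / real N \<le> \<delta>"
    using \<delta>(1) by (metis less_imp_le nat_approx_posE inverse_eq_divide of_nat_Suc zero_less_Suc)
  define X where "X = {..N} \<times> (Basis :: 'e set)"
  have "neg_index (\<lambda>u. hess u u) variations \<le> enat (card X)"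
  proof (rule neg_index_le)
    fix V assume V: "subspace V" "V \<subseteq> variations" and neg: "\<And>v. v \<in> V \<Longrightarrow> v \<noteq> 0 \<Longrightarrow> hess v v < 0"
    show "dim V \<le> card X"
    proof (rule dim_le_card_functionals[where \<phi>="\<lambda>(i, b) u. u (real i / real N) \<bullet> b"])
      show "finite X" by (simp add: X_def)
      show "linear ((\<lambda>(i, b) u. u (real i / real N) \<bullet> b) x)" for x :: "nat \<times> 'e"
        by (cases x) (auto intro!: linearI simp: inner_add_left)
      fix v assume v: "v \<in> V" and zero: "\<And>x. x \<in> X \<Longrightarrow> (\<lambda>(i, b) u. u (real i / real N) \<bullet> b) x v = 0"
      have z: "v (real i / real N) = 0" if "i \<le> N" for i
        using zero[of "(i, b)" for b] that by (auto simp: X_def intro: euclidean_eqI)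
      define g where "g = edge_deriv 0 1 v"
      have p: "w12_pair 0 1 v g" using variations_rep[of v] v V(2) unfolding w12_rep_def g_def by auto
      have "0 \<le> form 0 (real i / real N) v g v g" if "i \<le> N" for i
        using that
      proof (induction i)
        case 0 show ?case by (simp add: form_def)
      next
        case (Suc i)
        have b: "0 \<le> real i / real N" "real i / real N \<le> real (Suc i) / real N" "real (Suc i) / real N \<le> 1"
          "real (Suc i) / real N - real i / real N \<le> \<delta>"
          using Suc.prems N by (auto simp: divide_simps simp flip: diff_divide_distrib)
        have "form 0 (real (Suc i) / real N) v g v g
            = form 0 (real i / real N) v g v g + form (real i / real N) (real (Suc i) / real N) v g v g"
          by (rule form_combine[OF p p]) (use b in auto)
        moreover have "0 \<le> form (real i / real N) (real (Suc i) / real N) v g v g"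
          using \<delta>(2)[OF p b] z[OF Suc.prems] by simp
        ultimately show ?case using Suc by simp
      qed
      from this[of N] have "0 \<le> hess v v" using N(1) by (simp add: hess_def g_def)
      then show "v = 0" using neg[OF v] by force
    qed fact
  qed
  then show ?thesis by blast
qed

text \<open>Every conjugate instant adds at least one to the lower bound
  \<open>neg_index_ge_fibres\<close> of an index already known to be finite.\<close>

lemma finite_conjugate: "finite {\<tau> \<in> {0<..<1}. fibre \<tau> \<noteq> {0}}" (is "finite ?K")
proof (rule ccontr)
  assume inf: "infinite ?K"
  obtain n where n: "neg_index (\<lambda>u. hess u u) variations \<le> enat n" using neg_index_finite by blast
  obtain F where F: "F \<subseteq> ?K" "finite F" "card F = Suc n"
    using infinite_arbitrarily_large[OF inf, of "Suc n"] by auto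
  have "1 \<le> dim (fibre \<tau>)" if "\<tau> \<in> F" for \<tau>
  proof -
    have "subspace (fibre \<tau>)" "fibre \<tau> \<noteq> {0}" using F(1) that subspace_fibre[of \<tau>] by auto
    then show ?thesis using dim_eq_0[of "fibre \<tau>"] subspace_0 by (metis One_nat_def Suc_leI bot_nat_0.not_eq_extremum empty_iff subset_singletonD)
  qed
  then have "card F \<le> (\<Sum>\<tau>\<in>F. dim (fibre \<tau>))" using sum_mono[of F "\<lambda>_. 1::nat" "\<lambda>\<tau>. dim (fibre \<tau>)"] by simp
  moreover have "enat (\<Sum>\<tau>\<in>F. dim (fibre \<tau>)) \<le> enat n"
    using neg_index_ge_fibres[OF F(2)] F(1) n by (metis (no_types, lifting) mem_Collect_eq order_trans subset_iff)
  ultimately show False using F(3) by simp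
qed

text \<open>Continuous induction: \<open>nonneg_upto_limit\<close> shows that the supremum of the
  good times is good, and \<open>nonneg_upto_step\<close> moves beyond it unless it is
  \<open>1\<close>.\<close>

lemma nonneg_upto_1: "nonneg_upto 1"
proof -
  define K where "K = {\<tau> \<in> {0<..<1}. fibre \<tau> \<noteq> {0}}"
  have K: "finite K" unfolding K_def by (rule finite_conjugate)
  have full: "shadow s = UNIV" if "0 < s" "s < 1" "s \<notin> K" for s
    using shadowI[of s] that unfolding K_def by fastforce
  define S where "S = {t \<in> {0..1}. \<forall>s. 0 \<le> s \<longrightarrow> s \<le> t \<longrightarrow> nonneg_upto s}"
  define T where "T = Sup S"
  have S0: "0 \<in> S" using nonneg_upto_0 by (auto simp: S_def)
  have bdd: "bdd_above S" by (rule bdd_aboveI[of _ 1]) (auto simp: S_def)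
  have T0: "0 \<le> T" unfolding T_def by (rule cSup_upper[OF S0 bdd])
  have T1: "T \<le> 1" unfolding T_def 
  proof (rule cSup_least)
    show "S \<noteq> {}" using S0 by blast
  qed (simp add: S_def)
  note T = T0 T1
  have below: "nonneg_upto s" if "0 \<le> s" "s < T" for s
  proof -
    have "s < Sup S" using that(2) by (simp add: T_def)
    then obtain t where "t \<in> S" "s < t"
      using less_cSupE[of s S] S0 by blast
    then show ?thesis using that(1) unfolding S_def by simp
  qed
  have gT: "nonneg_upto T"
  proof (cases "T = 0")
    case False
    \<comment> \<open>Finitely many conjugate instants leave a gap below \<open>T\<close>, on which
      \<open>shadow\<close> is the whole space, as the limit lemma demands.\<close>
    obtain h where h: "h > 0" "\<And>x. x \<in> K \<Longrightarrow> x \<noteq> T \<Longrightarrow> h \<le> dist T x"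
      using finite_set_avoid[OF K] by blast
    show ?thesis
    proof (rule nonneg_upto_limit[OF _ T(2) h(1)])
      fix s assume s: "0 < s" "T - h < s" "s < T"
      show "shadow s = UNIV" by (rule full) (use s T h(2)[of s] in \<open>auto simp: dist_real_def\<close>)
    qed (use False T below in auto)
  qed (simp add: nonneg_upto_0)
  show ?thesis
  proof (cases "T = 1")
    case False
    then obtain \<delta> where \<delta>: "\<delta> > 0" "\<And>t. T \<le> t \<Longrightarrow> t \<le> T + \<delta> \<Longrightarrow> t \<le> 1 \<Longrightarrow> nonneg_upto t"
      using nonneg_upto_step[OF T(1) _ gT] T by auto
    define t where "t = min 1 (T + \<delta>)"
    have "nonneg_upto s" if "0 \<le> s" "s \<le> t" for s
      using below[of s] \<delta>(2)[of s] that by (cases "s < T") (auto simp: t_def)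
    then have "t \<in> S" using T \<delta>(1) by (simp add: S_def t_def)
    then have "t \<le> T" unfolding T_def using bdd by (rule cSup_upper)
    then show ?thesis using \<delta>(1) False T by (auto simp: t_def)
  qed (use gT in simp)
qed

text \<open>For the upper bound the functionals are \<open>b \<bullet> u \<tau>\<close> with
  \<open>b\<close> in a basis of \<open>fibre \<tau>\<close>: their vanishing makes
  \<open>u \<tau>\<close> orthogonal to the fibre, hence a point of the shadow, and
  \<open>nonneg_upto_1\<close> applies.\<close>

theorem neg_index_eq_sum_fibres:
  "neg_index (\<lambda>u. hess u u) variations = enat (\<Sum>\<tau>\<in>{\<tau> \<in> {0<..<1}. fibre \<tau> \<noteq> {0}}. dim (fibre \<tau>))"
proof (rule antisym)
  define K where "K = {\<tau> \<in> {0<..<1}. fibre \<tau> \<noteq> {0}}"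
  have K: "finite K" unfolding K_def by (rule finite_conjugate)
  have K01: "K \<subseteq> {0<..<1}" by (auto simp: K_def)
  show "enat (\<Sum>\<tau>\<in>K. dim (fibre \<tau>)) \<le> neg_index (\<lambda>u. hess u u) variations"
    using neg_index_ge_fibres[OF K K01] .
  have "\<exists>B. B \<subseteq> fibre \<tau> \<and> fibre \<tau> \<subseteq> span B \<and> finite B \<and> card B = dim (fibre \<tau>)" for \<tau>
    by (metis basis_exists independent_imp_finite)
  then obtain B where B: "\<And>\<tau>. fibre \<tau> \<subseteq> span (B \<tau>)" "\<And>\<tau>. finite (B \<tau>)" "\<And>\<tau>. card (B \<tau>) = dim (fibre \<tau>)"
    by metis
  define X where "X = (SIGMA \<tau>:K. B \<tau>)"
  have "neg_index (\<lambda>u. hess u u) variations \<le> enat (card X)"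
  proof (rule neg_index_le)
    fix V assume V: "subspace V" "V \<subseteq> variations" and neg: "\<And>v. v \<in> V \<Longrightarrow> v \<noteq> 0 \<Longrightarrow> hess v v < 0"
    show "dim V \<le> card X"
    proof (rule dim_le_card_functionals[where \<phi>="\<lambda>(\<tau>, b) u. b \<bullet> u \<tau>"])
      show "finite X" unfolding X_def using K B(2) by blast
      show "linear ((\<lambda>(\<tau>, b) u. b \<bullet> u \<tau>) x)" for x :: "real \<times> 'e"
        by (cases x) (auto intro!: linearI simp: inner_add_right)
      fix v assume v: "v \<in> V" and zero: "\<And>x. x \<in> X \<Longrightarrow> (\<lambda>(\<tau>, b) u. b \<bullet> u \<tau>) x v = 0"
      have vv: "v \<in> variations" using v V(2) by blast
      have "v s \<in> shadow s" if s: "0 \<le> s" "s < 1" for s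
      proof (cases "s = 0")
        case True then show ?thesis using vv shadow_0 by (simp add: variations_def)
      next
        case False
        show ?thesis
        proof (rule shadowI)
          show "s \<in> {0..1}" using s by simp
          fix p assume p: "p \<in> fibre s"
          show "p \<bullet> v s = 0"
          proof (cases "s \<in> K")
            case True
            have "orthogonal (v s) p"
            proof (rule orthogonal_to_span)
              show "p \<in> span (B s)" using B(1) p by blast
              show "orthogonal (v s) b" if "b \<in> B s" for b
                using zero[of "(s, b)"] that True by (simp add: X_def orthogonal_def inner_commute)
            qed
            then show ?thesis by (simp add: orthogonal_def inner_commute)
          next
            case False
            then have "p = 0" using p s \<open>s \<noteq> 0\<close> by (auto simp: K_def)
            then show ?thesis by simp
          qed
        qed
      qed
      moreover have "w12_pair 0 1 v (edge_deriv 0 1 v)" using variations_rep[OF vv] by (simp add: w12_rep_def)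
      ultimately have "0 \<le> hess v v"
        using nonneg_upto_1 vv unfolding nonneg_upto_def hess_def variations_def by auto
      then show "v = 0" using neg[OF v] by force
    qed fact
  qed
  moreover have "card X = (\<Sum>\<tau>\<in>K. dim (fibre \<tau>))"
    unfolding X_def using K B(2,3) by (simp add: card_SigmaI)
  ultimately show "neg_index (\<lambda>u. hess u u) variations \<le> enat (\<Sum>\<tau>\<in>K. dim (fibre \<tau>))" by simp
qed

end

section \<open>Differentiable Lagrangian paths\<close>

lemma closest_point_subspace:
  fixes U :: "'a::euclidean_space set"
  assumes U: "subspace U" and p: "p \<in> U" and o: "\<And>u. u \<in> U \<Longrightarrow> (v - p) \<bullet> u = 0"
  shows "closest_point U v = p"
proof -
  have "dist v p \<le> dist v z" if z: "z \<in> U" for z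
  proof -
    have "(v - p) \<bullet> (p - z) = 0" using o subspace_diff[OF U p z] by simp
    then have "(norm (v - p))\<^sup>2 + (norm (p - z))\<^sup>2 = (norm (v - z))\<^sup>2"
      using norm_add_Pythagorean[of "v - p" "p - z"] by (simp add: orthogonal_def)
    then have "(norm (v - p))\<^sup>2 \<le> (norm (v - z))\<^sup>2"
      by (metis le_add_same_cancel1 zero_le_power2)
    then show ?thesis by (simp add: dist_norm)
  qed
  then show ?thesis
    using closest_point_unique[OF subspace_imp_convex[OF U] closed_subspace[OF U] p] by metis
qed

lemma closest_point_subspaceD:
  fixes U :: "'a::euclidean_space set"
  assumes U: "subspace U"
  shows "closest_point U v \<in> U" "u \<in> U \<Longrightarrow> (v - closest_point U v) \<bullet> u = 0"
proof -
  obtain y z where yz: "y \<in> span U" "\<And>w. w \<in> span U \<Longrightarrow> orthogonal z w" "v = y + z"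
    using orthogonal_subspace_decomp_exists[of U v] by metis
  have "closest_point U v = y"
    by (rule closest_point_subspace[OF U]) (use yz span_eq_iff[THEN iffD2, OF U] in \<open>auto simp: orthogonal_def\<close>)
  with yz span_eq_iff[THEN iffD2, OF U]
  show "closest_point U v \<in> U" "u \<in> U \<Longrightarrow> (v - closest_point U v) \<bullet> u = 0"
    by (auto simp: orthogonal_def)
qed

lemma linear_closest_point:
  fixes U :: "'a::euclidean_space set"
  assumes U: "subspace U"
  shows "linear (closest_point U)"
proof (rule linearI)
  note c = closest_point_subspaceD[OF U]
  show "closest_point U (x + y) = closest_point U x + closest_point U y" for x y
  proof (rule closest_point_subspace[OF U])
    show "closest_point U x + closest_point U y \<in> U" using c(1) subspace_add[OF U] by blast
    show "(x + y - (closest_point U x + closest_point U y)) \<bullet> u = 0" if "u \<in> U" for u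
      using c(2)[OF that, of x] c(2)[OF that, of y] by (simp add: algebra_simps inner_diff_left inner_add_left)
  qed
  show "closest_point U (r *\<^sub>R x) = r *\<^sub>R closest_point U x" for r x
  proof (rule closest_point_subspace[OF U])
    show "r *\<^sub>R closest_point U x \<in> U" using c(1) subspace_scale[OF U] by blast
    show "(r *\<^sub>R x - r *\<^sub>R closest_point U x) \<bullet> u = 0" if "u \<in> U" for u
      using c(2)[OF that, of x] by (simp add: inner_diff_left)
  qed
qed

section \<open>Orthogonal projections onto the span of a moving frame\<close>

definition C1_curve :: "real \<Rightarrow> real \<Rightarrow> (real \<Rightarrow> 'a::real_normed_vector) \<Rightarrow> bool" where
  "C1_curve a b f \<longleftrightarrow> (\<exists>f'. continuous_on {a..b} f' \<and>
     (\<forall>t\<in>{a..b}. (f has_vector_derivative f' t) (at t within {a..b})))"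

lemma C1_curve_continuous: "C1_curve a b f \<Longrightarrow> continuous_on {a..b} f"
  unfolding C1_curve_def by (meson continuous_on_eq_continuous_within has_vector_derivative_continuous)

lemma C1_curve_const [simp]: "C1_curve a b (\<lambda>_. c)"
  unfolding C1_curve_def by (intro exI[of _ "\<lambda>_. 0"]) auto

lemma C1_curve_bilinear:
  assumes "bounded_bilinear h" "C1_curve a b f" "C1_curve a b g"
  shows "C1_curve a b (\<lambda>t. h (f t) (g t))"
proof -
  interpret bounded_bilinear h by fact
  obtain f' where f': "continuous_on {a..b} f'" "\<And>t. t \<in> {a..b} \<Longrightarrow> (f has_vector_derivative f' t) (at t within {a..b})"
    using assms(2) unfolding C1_curve_def by blast
  obtain g' where g': "continuous_on {a..b} g'" "\<And>t. t \<in> {a..b} \<Longrightarrow> (g has_vector_derivative g' t) (at t within {a..b})"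
    using assms(3) unfolding C1_curve_def by blast
  show ?thesis unfolding C1_curve_def
    by (intro exI[of _ "\<lambda>t. h (f t) (g' t) + h (f' t) (g t)"] conjI ballI has_vector_derivative f' g'
        continuous_on_add continuous_on C1_curve_continuous assms)
qed

lemmas C1_curve_scaleR = C1_curve_bilinear[OF bounded_bilinear_scaleR]
  and C1_curve_inner = C1_curve_bilinear[OF bounded_bilinear_inner]

lemma C1_curve_add:
  assumes "C1_curve a b f" "C1_curve a b g"
  shows "C1_curve a b (\<lambda>t. f t + g t)"
proof -
  obtain f' where f': "continuous_on {a..b} f'" "\<And>t. t \<in> {a..b} \<Longrightarrow> (f has_vector_derivative f' t) (at t within {a..b})"
    using assms(1) unfolding C1_curve_def by blast
  obtain g' where g': "continuous_on {a..b} g'" "\<And>t. t \<in> {a..b} \<Longrightarrow> (g has_vector_derivative g' t) (at t within {a..b})"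
    using assms(2) unfolding C1_curve_def by blast
  show ?thesis unfolding C1_curve_def
    by (intro exI[of _ "\<lambda>t. f' t + g' t"] conjI ballI has_vector_derivative_add f' g' continuous_on_add)
qed

lemma C1_curve_sum:
  assumes "\<And>i. i \<in> A \<Longrightarrow> C1_curve a b (f i)"
  shows "C1_curve a b (\<lambda>t. \<Sum>i\<in>A. f i t)"
  using assms by (induction A rule: infinite_finite_induct) (auto intro: C1_curve_add)

lemma C1_curve_inverse:
  fixes f :: "real \<Rightarrow> real"
  assumes "C1_curve a b f" "\<And>t. t \<in> {a..b} \<Longrightarrow> f t \<noteq> 0"
  shows "C1_curve a b (\<lambda>t. inverse (f t))"
proof -
  obtain f' where f': "continuous_on {a..b} f'" "\<And>t. t \<in> {a..b} \<Longrightarrow> (f has_real_derivative f' t) (at t within {a..b})"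
    using assms(1) unfolding C1_curve_def has_real_derivative_iff_has_vector_derivative by blast
  have "((\<lambda>t. inverse (f t)) has_real_derivative (- (inverse (f t) * f' t * inverse (f t)))) (at t within {a..b})"
    if "t \<in> {a..b}" for t
    using DERIV_inverse'[OF f'(2)[OF that] assms(2)[OF that]] .
  moreover have "continuous_on {a..b} (\<lambda>t. - (inverse (f t) * f' t * inverse (f t)))"
    using assms C1_curve_continuous[OF assms(1)] by (intro continuous_intros f'(1)) auto
  ultimately show ?thesis unfolding C1_curve_def has_real_derivative_iff_has_vector_derivative by blast
qed

text \<open>Gram--Schmidt: adding a vector \<open>c\<close> to the frame changes the projection by the projection
  onto the line of \<open>d = c - closest_point U c\<close>, so smoothness is inherited one vector at a time.\<close>

lemma closest_point_insert:
  fixes c v :: "'a::euclidean_space"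
  assumes "c \<notin> span S"
  defines "d \<equiv> c - closest_point (span S) c"
  shows "closest_point (span (insert c S)) v = closest_point (span S) v + ((v \<bullet> d) * inverse (d \<bullet> d)) *\<^sub>R d"
    and "d \<noteq> 0"
proof -
  let ?P = "closest_point (span S)"
  note c = closest_point_subspaceD[OF subspace_span[of S]]
  show d: "d \<noteq> 0" using c(1)[of c] assms(1) by (auto simp: d_def)
  let ?p = "?P v + ((v \<bullet> d) * inverse (d \<bullet> d)) *\<^sub>R d"
  have sub: "span S \<subseteq> span (insert c S)" by (rule span_mono) auto
  have du: "d \<bullet> u = 0" if "u \<in> span S" for u using c(2)[OF that, of c] by (simp add: d_def)
  have dc: "d \<bullet> c = d \<bullet> d" using du[OF c(1)[of c]] by (simp add: d_def inner_diff_right)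
  have vc: "(v - ?P v) \<bullet> c = v \<bullet> d"
    using c(2)[OF c(1)[of c], of v] du[OF c(1)[of v]] by (simp add: d_def inner_diff_right inner_diff_left inner_commute)
  show "closest_point (span (insert c S)) v = ?p"
  proof (rule closest_point_subspace[OF subspace_span])
    have "d \<in> span (insert c S)"
      unfolding d_def using c(1)[of c] sub by (metis insertI1 span_base span_diff subsetD)
    then show "?p \<in> span (insert c S)"
      using c(1)[of v] sub by (intro span_add span_scale) auto
    fix u assume u: "u \<in> span (insert c S)"
    have "orthogonal (v - ?p) u"
    proof (rule orthogonal_to_span[OF u])
      fix x assume "x \<in> insert c S"
      then consider "x = c" | "x \<in> span S" by (auto intro: span_base)
      then show "orthogonal (v - ?p) x"
      proof cases
        case 1
        have "(v - ?p) \<bullet> c = (v - ?P v) \<bullet> c - ((v \<bullet> d) * inverse (d \<bullet> d)) * (d \<bullet> c)"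
          by (simp add: inner_diff_left inner_add_left)
        then show ?thesis using 1 vc dc d by (simp add: orthogonal_def)
      next
        case 2
        have "(v - ?p) \<bullet> x = (v - ?P v) \<bullet> x - ((v \<bullet> d) * inverse (d \<bullet> d)) * (d \<bullet> x)"
          by (simp add: inner_diff_left inner_add_left)
        then show ?thesis using c(2)[OF 2, of v] du[OF 2] by (simp add: orthogonal_def)
      qed
    qed
    then show "(v - ?p) \<bullet> u = 0" by (simp add: orthogonal_def)
  qed
qed

text \<open>Induction over the images of the basis vectors with \<open>closest_point_insert\<close>.
  Injectivity of \<open>C t\<close> keeps the frame independent, so the divisor
  \<open>d t \<bullet> d t\<close> never vanishes.\<close>

lemma C1_curve_closest_point_image:
  fixes C :: "real \<Rightarrow> 'x::euclidean_space \<Rightarrow> 'v::euclidean_space"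
  assumes lin: "\<And>t. t \<in> {a..b} \<Longrightarrow> linear (C t)" and inj: "\<And>t. t \<in> {a..b} \<Longrightarrow> inj (C t)"
    and C1: "\<And>z. C1_curve a b (\<lambda>t. C t z)"
  shows "C1_curve a b (\<lambda>t. closest_point (range (C t)) v)"
proof -
  have *: "\<forall>v. C1_curve a b (\<lambda>t. closest_point (span (C t ` B)) v)" if "finite B" "B \<subseteq> Basis" for B
    using that
  proof (induction B rule: finite_induct)
    case empty
    have "closest_point {0::'v} v = 0" for v
      using closest_point_subspace[of "{0}" 0 v] by auto
    then show ?case by simp
  next
    case (insert x B)
    let ?P = "\<lambda>t. closest_point (span (C t ` B))"
    have IH: "C1_curve a b (\<lambda>t. ?P t v)" for v using insert by auto
    \<comment> \<open>Here both the projection and its argument move; expanding the argument in the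
      fixed basis reduces to projections of constant vectors.\<close>
    have PC: "C1_curve a b (\<lambda>t. ?P t (C t x))"
    proof -
      have "?P t (C t x) = (\<Sum>i\<in>Basis. (C t x \<bullet> i) *\<^sub>R ?P t i)" for t
      proof -
        have "?P t (C t x) = ?P t (\<Sum>i\<in>Basis. (C t x \<bullet> i) *\<^sub>R i)" by (simp add: euclidean_representation)
        then show ?thesis
          by (simp add: linear_sum[OF linear_closest_point[OF subspace_span]] linear_scale[OF linear_closest_point[OF subspace_span]])
      qed
      then show ?thesis
        using IH C1 by (simp add: C1_curve_sum C1_curve_scaleR C1_curve_inner)
    qed
    define d where "d = (\<lambda>t. C t x + (-1) *\<^sub>R ?P t (C t x))"
    have d1: "C1_curve a b d" unfolding d_def
      by (intro C1_curve_add C1_curve_scaleR C1 PC C1_curve_const)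
    have nin: "C t x \<notin> span (C t ` B)" if t: "t \<in> {a..b}" for t
    proof -
      have "x \<notin> span B" 
        using independent_Basis insert.hyps insert.prems dependent_def
        by (metis (no_types, lifting) independent_mono Diff_insert_absorb insertI1)
      then show ?thesis
        using linear_span_image[OF lin[OF t], of B] inj[OF t] by (auto simp: inj_def)
    qed
    have "C1_curve a b (\<lambda>t. ?P t v + ((v \<bullet> d t) * inverse (d t \<bullet> d t)) *\<^sub>R d t)" for v
    proof (intro C1_curve_add IH C1_curve_scaleR d1)
      have "C1_curve a b (\<lambda>t. inverse (d t \<bullet> d t))"
        using closest_point_insert(2)[OF nin] by (intro C1_curve_inverse C1_curve_inner d1) (auto simp: d_def)
      then show "C1_curve a b (\<lambda>t. (v \<bullet> d t) * inverse (d t \<bullet> d t))"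
        using C1_curve_bilinear[OF bounded_bilinear_mult] by (intro C1_curve_bilinear[OF bounded_bilinear_mult] C1_curve_inner d1) auto
    qed
    moreover have "closest_point (span (C t ` insert x B)) v = ?P t v + ((v \<bullet> d t) * inverse (d t \<bullet> d t)) *\<^sub>R d t"
      if "t \<in> {a..b}" for t v
      using closest_point_insert(1)[OF nin[OF that], of v] by (simp add: d_def)
    ultimately show ?case
      unfolding C1_curve_def
      by (smt (verit) has_vector_derivative_transform)
  qed
  have "span (C t ` Basis) = range (C t)" if "t \<in> {a..b}" for t
    using linear_span_image[OF lin[OF that], of Basis] by simp
  then show ?thesis
    using *[OF finite_Basis order_refl] unfolding C1_curve_def
    by (smt (verit) has_vector_derivative_transform)
qed

lemma dim_orthogonal_comp:
  fixes U :: "'a::euclidean_space set"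
  shows "subspace U \<Longrightarrow> dim (orthogonal_comp U) + dim U = DIM('a)"
  using dim_subspace_orthogonal_to_vectors[of U UNIV] by (simp add: orthogonal_comp_def)

text \<open>Pointwise continuity on the finitely many basis vectors is continuity in operator
  norm.\<close>

lemma linear_pointwise_limit_bound:
  fixes C :: "real \<Rightarrow> 'x::euclidean_space \<Rightarrow> 'v::real_normed_vector"
  assumes lin: "\<And>t. t \<in> S \<Longrightarrow> linear (C t)" and t: "t \<in> S"
    and cont: "\<And>z. continuous_on S (\<lambda>s. C s z)" and e: "e > 0"
  obtains d where "d > 0" "\<And>s z. s \<in> S \<Longrightarrow> dist s t < d \<Longrightarrow> norm (C s z - C t z) \<le> e * norm z"
proof -
  have "((\<lambda>s. \<Sum>b\<in>Basis. norm (C s b - C t b)) \<longlongrightarrow> (\<Sum>b\<in>(Basis::'x set). norm (C t b - C t b))) (at t within S)"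
    using cont t by (intro tendsto_intros) (auto simp: continuous_on_def)
  then have "eventually (\<lambda>s. (\<Sum>b\<in>Basis. norm (C s b - C t b)) < e) (at t within S)"
    using order_tendstoD(2)[of _ 0 _ e] e by simp
  then obtain d where d: "d > 0" "\<And>s. s \<in> S \<Longrightarrow> s \<noteq> t \<Longrightarrow> dist s t < d \<Longrightarrow> (\<Sum>b\<in>Basis. norm (C s b - C t b)) < e"
    unfolding eventually_at by blast
  have "norm (C s z - C t z) \<le> e * norm z" if s: "s \<in> S" "dist s t < d" for s z
  proof (cases "s = t")
    case True then show ?thesis using e by simp
  next
    case False
    have "C s z - C t z = (\<Sum>b\<in>Basis. (z \<bullet> b) *\<^sub>R (C s b - C t b))"
    proof -
      have r: "C r z = (\<Sum>b\<in>Basis. (z \<bullet> b) *\<^sub>R C r b)" if "r \<in> S" for r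
      proof -
        have "C r z = C r (\<Sum>b\<in>Basis. (z \<bullet> b) *\<^sub>R b)" by (simp add: euclidean_representation)
        then show ?thesis by (simp add: linear_sum[OF lin[OF that]] linear_scale[OF lin[OF that]])
      qed
      show ?thesis using r[OF s(1)] r[OF t] by (simp add: scaleR_diff_right sum_subtractf)
    qed
    also have "norm \<dots> \<le> (\<Sum>b\<in>Basis. norm z * norm (C s b - C t b))"
      by (intro sum_norm_le) (auto intro!: mult_right_mono simp: Basis_le_norm)
    also have "\<dots> = norm z * (\<Sum>b\<in>Basis. norm (C s b - C t b))" by (simp add: sum_distrib_left)
    also have "\<dots> \<le> norm z * e" using d(2)[OF s(1) False s(2)] by (intro mult_left_mono) auto
    finally show ?thesis by (simp add: mult.commute)
  qed
  with d(1) show ?thesis using that by blast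
qed

text \<open>A symplectic form \<open>\<omega>(u,w) = K u \<bullet> w\<close> given by an orthogonal complex structure \<open>K\<close>.\<close>

locale euclidean_symplectic =
  fixes \<omega> :: "'v::euclidean_space \<Rightarrow> 'v \<Rightarrow> real" and K :: "'v \<Rightarrow> 'v"
  assumes K_linear: "linear K" and K_K: "\<And>u. K (K u) = - u" and K_inner: "\<And>u w. K u \<bullet> K w = u \<bullet> w"
    and \<omega>_eq: "\<And>u w. \<omega> u w = K u \<bullet> w"
begin

lemma \<omega>_antisym: "\<omega> u w = - \<omega> w u"
  using K_inner[of "K u" w] by (simp add: \<omega>_eq K_K inner_commute)

lemma lagrangian_iff:
  assumes "lagrangian_subspace \<omega> U"
  shows "v \<in> U \<longleftrightarrow> K v \<in> orthogonal_comp U"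
  using assms unfolding lagrangian_subspace_def orthogonal_comp_def orthogonal_def \<omega>_eq
  by (auto simp: inner_commute)

text \<open>\<open>K\<close> exchanges a Lagrangian subspace with its orthogonal complement, and
  \<open>K (K u) = - u\<close>.\<close>

lemma lagrangian_orthogonal_comp:
  assumes U: "lagrangian_subspace \<omega> U"
  shows "lagrangian_subspace \<omega> (orthogonal_comp U)"
proof -
  have s: "subspace U" using U by (simp add: lagrangian_subspace_def)
  have "v \<in> orthogonal_comp U \<longleftrightarrow> (\<forall>u\<in>orthogonal_comp U. \<omega> v u = 0)" for v
  proof -
    have "(\<forall>u\<in>orthogonal_comp U. \<omega> v u = 0) \<longleftrightarrow> K v \<in> orthogonal_comp (orthogonal_comp U)"
      unfolding \<omega>_eq orthogonal_comp_def[of "orthogonal_comp U"] orthogonal_def by (auto simp: inner_commute)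
    also have "\<dots> \<longleftrightarrow> K v \<in> U" using orthogonal_comp_self[OF s] by simp
    also have "\<dots> \<longleftrightarrow> - v \<in> orthogonal_comp U" using lagrangian_iff[OF U, of "K v"] by (simp add: K_K)
    also have "\<dots> \<longleftrightarrow> v \<in> orthogonal_comp U"
      using subspace_neg[OF subspace_orthogonal_comp, of _ U] by (metis minus_minus)
    finally show ?thesis by simp
  qed
  then show ?thesis unfolding lagrangian_subspace_def using subspace_orthogonal_comp by blast
qed

text \<open>Gives the choice \<open>SOME W\<close> in \<open>lagrangian_velocity_form\<close> a
  witness.\<close>

lemma exists_lagrangian_complement:
  assumes U: "lagrangian_subspace \<omega> U"
  shows "\<exists>W. lagrangian_subspace \<omega> W \<and> W \<inter> U = {0}"
proof -
  have s: "subspace U" using U by (simp add: lagrangian_subspace_def)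
  have "orthogonal_comp U \<inter> U = {0}"
    using subspace_0[OF s] subspace_0[OF subspace_orthogonal_comp[of U]]
    by (auto simp: orthogonal_comp_def orthogonal_def)
  then show ?thesis using lagrangian_orthogonal_comp[OF U] by blast
qed

lemma inj_K: "inj K"
  by (metis K_K injI minus_minus)

lemma dim_lagrangian:
  assumes U: "lagrangian_subspace \<omega> U"
  shows "2 * dim U = DIM('v)"
proof -
  have s: "subspace U" using U by (simp add: lagrangian_subspace_def)
  have "K ` U = orthogonal_comp U"
  proof
    show "K ` U \<subseteq> orthogonal_comp U" using lagrangian_iff[OF U] by auto
    show "orthogonal_comp U \<subseteq> K ` U"
    proof
      fix x assume "x \<in> orthogonal_comp U"
      then have "- K x \<in> U" using lagrangian_iff[OF U, of "- K x"] by (simp add: linear_neg[OF K_linear] K_K)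
      moreover have "K (- K x) = x" by (simp add: linear_neg[OF K_linear] K_K)
      ultimately show "x \<in> K ` U" by (metis imageI)
    qed
  qed
  then have "dim (orthogonal_comp U) = dim U"
    using dim_image_inj_on[OF K_linear s] inj_K by (metis inj_on_subset subset_UNIV)
  then show ?thesis using dim_orthogonal_comp[OF s] by simp
qed

text \<open>The symplectic complement of \<open>U\<close> is the orthogonal complement of the image
  of \<open>U\<close> under \<open>K\<close>. It contains \<open>U\<close> and has the same
  dimension.\<close>

lemma isotropic_lagrangian:
  assumes s: "subspace U" and iso: "\<And>u v. u \<in> U \<Longrightarrow> v \<in> U \<Longrightarrow> \<omega> u v = 0" and dim: "2 * dim U = DIM('v)"
  shows "lagrangian_subspace \<omega> U"
proof -
  let ?O = "{v. \<forall>u\<in>U. \<omega> v u = 0}"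
  have "?O = orthogonal_comp (K ` U)"
  proof -
    have "\<omega> v u = - (K u \<bullet> v)" for u v using \<omega>_antisym[of v u] by (simp add: \<omega>_eq)
    then show ?thesis by (auto simp: orthogonal_comp_def orthogonal_def)
  qed
  moreover have "dim (K ` U) = dim U"
    using dim_image_inj_on[OF K_linear s] inj_K by (metis inj_on_subset subset_UNIV)
  ultimately have "dim ?O = dim U" "subspace ?O"
    using dim_orthogonal_comp[OF linear_subspace_image[OF K_linear s]] dim subspace_orthogonal_comp by auto
  then have "U = ?O" using iso s by (intro subspace_dim_equal) auto
  with s show ?thesis unfolding lagrangian_subspace_def by blast
qed

lemma velocity_form_const:
  assumes "lagrangian_subspace \<omega> U" "v \<in> U" "a < b" "t \<in> {a..b}"
  shows "lagrangian_velocity_form \<omega> a b (\<lambda>_. U) t v = 0"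
proof -
  have s: "subspace U" using assms(1) by (simp add: lagrangian_subspace_def)
  define W where "W = (SOME W. lagrangian_subspace \<omega> W \<and> W \<inter> U = {0})"
  have W: "lagrangian_subspace \<omega> W \<and> W \<inter> U = {0}"
    unfolding W_def by (rule someI_ex[OF exists_lagrangian_complement[OF assms(1)]])
  have "w \<in> W \<and> v + w \<in> U \<longleftrightarrow> w = 0" for w
  proof
    assume a: "w \<in> W \<and> v + w \<in> U"
    then have "(v + w) - v \<in> U" using subspace_diff[OF s _ assms(2)] by blast
    then show "w = 0" using a W by auto
  next
    assume "w = 0"
    then show "w \<in> W \<and> v + w \<in> U" using W assms(2) by auto
  qed
  then have "(THE w. w \<in> W \<and> v + w \<in> U) = 0" by simp
  then have "lagrangian_velocity_form \<omega> a b (\<lambda>_. U) t v = vector_derivative (\<lambda>s. 0) (at t within {a..b})"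
    unfolding lagrangian_velocity_form_def Let_def W_def[symmetric] by (simp add: \<omega>_eq)
  also have "\<dots> = 0"
    using assms(3,4) by (intro vector_derivative_within_closed_interval) auto
  finally show ?thesis .
qed

text \<open>The complement \<open>W\<close> is an unspecified choice, so \<open>w s\<close> is never
  computed. Isotropy of \<open>range (C s)\<close> gives
  \<open>\<omega> (v + w s) (C s z) = 0\<close>; expanded about \<open>t\<close>, this expresses
  \<open>\<omega> v (w s)\<close> by \<open>\<omega> v (C s z - v)\<close> up to a term that is
  quadratically small.\<close>

lemma velocity_form_image:
  fixes C C' :: "real \<Rightarrow> 'x::euclidean_space \<Rightarrow> 'v"
  assumes ab: "a < b" and t: "t \<in> {a..b}"
    and lin: "\<And>s. s \<in> {a..b} \<Longrightarrow> linear (C s)" and inj: "inj (C t)"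
    and lag: "\<And>s. s \<in> {a..b} \<Longrightarrow> lagrangian_subspace \<omega> (range (C s))"
    and cont: "\<And>z. continuous_on {a..b} (\<lambda>s. C s z)"
    and der: "((\<lambda>s. C s z) has_vector_derivative C' t z) (at t within {a..b})"
  shows "lagrangian_velocity_form \<omega> a b (\<lambda>s. range (C s)) t (C t z) = \<omega> (C t z) (C' t z)"
proof -
  define v where "v = C t z"
  define W where "W = (SOME W. lagrangian_subspace \<omega> W \<and> W \<inter> range (C t) = {0})"
  have W: "lagrangian_subspace \<omega> W" "W \<inter> range (C t) = {0}"
    using someI_ex[OF exists_lagrangian_complement[OF lag[OF t]]] unfolding W_def by auto
  have sW: "subspace W" using W(1) by (simp add: lagrangian_subspace_def)
  \<comment> \<open>\<open>A t\<close> is injective on \<open>?X\<close> because \<open>W\<close> is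
    transversal to \<open>range (C t)\<close>. The resulting lower bound persists for
    \<open>s\<close> near \<open>t\<close>, and by dimension \<open>A s\<close> then maps onto the
    whole space: this is existence and uniqueness of \<open>w s\<close>.\<close>
  define A where "A s x = C s (fst x) - snd x" for s :: real and x :: "'x \<times> 'v"
  let ?X = "(UNIV :: 'x set) \<times> W"
  have sX: "subspace ?X" using sW by (intro subspace_Times) auto
  have linA: "linear (A s)" if "s \<in> {a..b}" for s
    unfolding A_def using linear_add[OF lin[OF that]] linear_scale[OF lin[OF that]]
    by (intro linearI) (auto simp: algebra_simps)
  have ker: "x = 0" if "x \<in> ?X" "A t x = 0" for x
  proof -
    have "C t (fst x) = snd x" using that(2) by (simp add: A_def)
    then have "snd x \<in> W \<inter> range (C t)" using that(1) by (auto simp: mem_Times_iff) (metis rangeI)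
    then have "snd x = 0" using W(2) by auto
    then have "C t (fst x) = C t 0" using \<open>C t (fst x) = snd x\<close> linear_0[OF lin[OF t]] by simp
    then show "x = 0" using injD[OF inj] \<open>snd x = 0\<close> by (simp add: prod_eq_iff)
  qed
  obtain e where e: "e > 0" "\<And>x. x \<in> ?X \<Longrightarrow> e * norm x \<le> norm (A t x)"
    using injective_imp_isometric[of ?X "A t"] closed_subspace[OF sX] sX linA[OF t] ker
    by (metis linear_conv_bounded_linear)
  obtain d where d: "d > 0" "\<And>s z. s \<in> {a..b} \<Longrightarrow> dist s t < d \<Longrightarrow> norm (C s z - C t z) \<le> e / 2 * norm z"
    using linear_pointwise_limit_bound[OF lin t cont, of "e / 2"] e(1) by (metis half_gt_zero)
  have low: "e / 2 * norm x \<le> norm (A s x)" if s: "s \<in> {a..b}" "dist s t < d" and x: "x \<in> ?X" for s x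
  proof -
    have "norm (A s x - A t x) \<le> e / 2 * norm (fst x)" using d(2)[OF s] by (simp add: A_def)
    also have "\<dots> \<le> e / 2 * norm x" using e(1) norm_fst_le[of "fst x" "snd x"] by simp
    finally have "norm (A s x - A t x) \<le> e / 2 * norm x" .
    moreover have "norm (A t x) \<le> norm (A s x) + norm (A s x - A t x)"
      using norm_triangle_sub[of "A t x" "A s x"] by (simp add: norm_minus_commute)
    moreover have "e * norm x = e / 2 * norm x + e / 2 * norm x" by simp
    ultimately show ?thesis using e(2)[OF x] by linarith
  qed
  have ex: "\<exists>!w. w \<in> W \<and> v + w \<in> range (C s)" if s: "s \<in> {a..b}" "dist s t < d" for s
  proof -
    have injA: "inj_on (A s) ?X"
      unfolding linear_injective_on_subspace_0[OF linA[OF s(1)] sX]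
      using low[OF s] e(1) by (metis mult_le_0_iff norm_le_zero_iff norm_zero half_gt_zero not_le)
    have "dim (A s ` ?X) = dim ?X" by (rule dim_image_inj_on[OF linA[OF s(1)] sX injA])
    also have "\<dots> = DIM('x) + dim W" using dim_Times[of UNIV W] sW by simp
    also have "dim W = dim (range (C t))" using dim_lagrangian[OF W(1)] dim_lagrangian[OF lag[OF t]] by simp
    also have "DIM('x) = dim (range (C t))" using dim_image_inj_on[OF lin[OF t] subspace_UNIV inj] by simp
    also have "dim (range (C t)) + dim (range (C t)) = DIM('v)" using dim_lagrangian[OF lag[OF t]] by simp
    finally have "span (A s ` ?X) = UNIV" by (simp add: dim_eq_full)
    then have "A s ` ?X = UNIV" using linear_subspace_image[OF linA[OF s(1)] sX] by (metis span_eq_iff)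
    then obtain x where x: "x \<in> ?X" "A s x = v" by (metis UNIV_I imageE)
    show ?thesis
    proof (rule ex1I[of _ "snd x"])
      show "snd x \<in> W \<and> v + snd x \<in> range (C s)" using x by (auto simp: A_def)
      fix w assume w: "w \<in> W \<and> v + w \<in> range (C s)"
      then obtain y where "v + w = C s y" by blast
      then have "A s (y, w) = A s x" using x(2) by (simp add: A_def algebra_simps)
      then have "(y, w) = x" using inj_onD[OF injA] w x(1) by auto
      then show "w = snd x" by auto
    qed
  qed
  define w where "w s = (THE w. w \<in> W \<and> v + w \<in> range (C s))" for s
  have w: "w s \<in> W" "v + w s \<in> range (C s)" if "s \<in> {a..b}" "dist s t < d" for s
    using theI'[OF ex[OF that]] unfolding w_def by auto
  have wt: "w t = 0"
  proof -
    have "0 \<in> W \<and> v + 0 \<in> range (C t)" using subspace_0[OF sW] by (auto simp: v_def)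
    then show ?thesis using ex[OF t] w[OF t] d(1) by (metis dist_self)
  qed
  \<comment> \<open>\<open>A s\<close> sends \<open>(y - z, w s)\<close> to
    \<open>C t z - C s z\<close>, so the uniform lower bound makes \<open>w s\<close> as small as
    the displacement of the curve.\<close>
  have wb: "norm (w s) \<le> 2 / e * norm (C s z - C t z)" if s: "s \<in> {a..b}" "dist s t < d" for s
  proof -
    obtain y where y: "v + w s = C s y" using w(2)[OF s] by blast
    have "A s (y - z, w s) = C t z - C s z"
      using y by (simp add: A_def linear_diff[OF lin[OF s(1)]] v_def algebra_simps)
    then have "e / 2 * norm (y - z, w s) \<le> norm (C s z - C t z)"
      using low[OF s, of "(y - z, w s)"] w(1)[OF s] by (simp add: norm_minus_commute)
    moreover have "e / 2 * norm (w s) \<le> e / 2 * norm (y - z, w s)"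
      using e(1) norm_snd_le[of "w s" "y - z"] by simp
    ultimately have "e / 2 * norm (w s) \<le> norm (C s z - C t z)" by linarith
    then show ?thesis using e(1) by (simp add: field_simps)
  qed
  have \<omega>b: "\<bar>\<omega> x y\<bar> \<le> norm x * norm y" for x y
    using Cauchy_Schwarz_ineq2[of "K x" y] K_inner[of x x] by (simp add: \<omega>_eq norm_eq_sqrt_inner)
  have wid: "\<omega> v (w s) = \<omega> v (C s z - v) + \<omega> (w s) (C s z - v)" if s: "s \<in> {a..b}" "dist s t < d" for s
  proof -
    have "\<omega> (v + w s) (C s z) = 0"
      using lag[OF s(1)] w(2)[OF s] unfolding lagrangian_subspace_def by blast
    moreover have "\<omega> v v = 0" using \<omega>_antisym[of v v] by simp
    moreover have "\<omega> v (w s) = - \<omega> (w s) v" by (rule \<omega>_antisym)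
    ultimately show ?thesis
      by (simp add: \<omega>_eq linear_add[OF K_linear] inner_add_left inner_diff_right)
  qed
  define E where "E s = norm ((C s z - v) - (s - t) *\<^sub>R C' t z) / norm (s - t)" for s
  have E0: "(E \<longlongrightarrow> 0) (at t within {a..b})"
    using der unfolding has_vector_derivative_def has_derivative_iff_norm E_def v_def by simp
  have C0: "((\<lambda>s. norm (C s z - C t z)) \<longlongrightarrow> 0) (at t within {a..b})"
  proof -
    have "((\<lambda>s. norm (C s z - C t z)) \<longlongrightarrow> norm (C t z - C t z)) (at t within {a..b})"
      using cont[of z] t by (intro tendsto_intros) (auto simp: continuous_on_def)
    then show ?thesis by simp
  qed
  have "((\<lambda>s. \<omega> v (w s)) has_derivative (\<lambda>h. h *\<^sub>R \<omega> v (C' t z))) (at t within {a..b})"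
  proof (rule has_derivativeI_sandwich[OF d(1)])
    show "bounded_linear (\<lambda>h::real. h *\<^sub>R \<omega> v (C' t z))" by (rule bounded_linear_scaleR_left)
    have "((\<lambda>s. norm v * E s + 2 / e * norm (C s z - C t z) * (E s + norm (C' t z)))
        \<longlongrightarrow> norm v * 0 + 2 / e * 0 * (0 + norm (C' t z))) (at t within {a..b})"
      by (intro tendsto_intros E0 C0)
    then show "((\<lambda>s. norm v * E s + 2 / e * norm (C s z - C t z) * (E s + norm (C' t z))) \<longlongrightarrow> 0) (at t within {a..b})"
      by simp
    fix s assume s: "s \<in> {a..b}" "s \<noteq> t" "dist s t < d"
    have "\<omega> v (w s) - \<omega> v (w t) - (s - t) *\<^sub>R \<omega> v (C' t z)
        = \<omega> v ((C s z - v) - (s - t) *\<^sub>R C' t z) + \<omega> (w s) (C s z - v)"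
      unfolding wid[OF s(1,3)] wt by (simp add: \<omega>_eq inner_diff_right)
    also have "norm \<dots> \<le> norm v * norm ((C s z - v) - (s - t) *\<^sub>R C' t z) + norm (w s) * norm (C s z - v)"
      using \<omega>b[of v "(C s z - v) - (s - t) *\<^sub>R C' t z"] \<omega>b[of "w s" "C s z - v"] by simp
    finally have 1: "norm (\<omega> v (w s) - \<omega> v (w t) - (s - t) *\<^sub>R \<omega> v (C' t z)) / norm (s - t)
        \<le> (norm v * norm ((C s z - v) - (s - t) *\<^sub>R C' t z) + norm (w s) * norm (C s z - v)) / norm (s - t)"
      by (rule divide_right_mono) simp
    have "norm (C s z - v) \<le> norm ((C s z - v) - (s - t) *\<^sub>R C' t z) + norm (s - t) * norm (C' t z)"
      using norm_triangle_sub[of "C s z - v" "(s - t) *\<^sub>R C' t z"] by simp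
    then have 2: "norm (C s z - v) / norm (s - t) \<le> E s + norm (C' t z)"
      using s(2) unfolding E_def by (simp add: divide_simps mult.commute)
    have "norm (w s) * (norm (C s z - v) / norm (s - t)) \<le> 2 / e * norm (C s z - C t z) * (E s + norm (C' t z))"
      by (rule mult_mono[OF wb[OF s(1,3)] 2]) (use e(1) in auto)
    with 1 show "norm (\<omega> v (w s) - \<omega> v (w t) - (s - t) *\<^sub>R \<omega> v (C' t z)) / norm (s - t)
        \<le> norm v * E s + 2 / e * norm (C s z - C t z) * (E s + norm (C' t z))"
      by (simp add: add_divide_distrib E_def)
  qed
  then have "((\<lambda>s. \<omega> v (w s)) has_vector_derivative \<omega> v (C' t z)) (at t within {a..b})"
    by (simp add: has_vector_derivative_def)
  then have "vector_derivative (\<lambda>s. \<omega> v (w s)) (at t within {a..b}) = \<omega> v (C' t z)"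
    using ab t by (intro vector_derivative_within_closed_interval) auto
  then show ?thesis
    unfolding lagrangian_velocity_form_def Let_def W_def[symmetric] v_def[symmetric] w_def .
qed

end

section \<open>Regularity of critical points\<close>

text \<open>The second difference is symmetric in \<open>h\<close> and \<open>k\<close>, so its
  limit proves Schwarz's theorem. It is computed by the mean value theorem along \<open>k\<close>,
  followed by the first order expansion of \<open>\<phi>' x k\<close> at \<open>x0\<close>.\<close>

lemma second_difference_estimate:
  fixes \<phi> :: "'x::real_normed_vector \<Rightarrow> real"
  assumes d1: "\<And>x. (\<phi> has_derivative \<phi>' x) (at x)"
    and d2: "((\<lambda>x. \<phi>' x k) has_derivative \<phi>'') (at x0)"
  shows "((\<lambda>t. (\<phi> (x0 + t *\<^sub>R (h + k)) - \<phi> (x0 + t *\<^sub>R h) - \<phi> (x0 + t *\<^sub>R k) + \<phi> x0) / t\<^sup>2) \<longlongrightarrow> \<phi>'' h) (at_right (0::real))"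
proof (rule tendstoI)
  fix e :: real assume e: "e > 0"
  \<comment> \<open>\<open>t * c\<close> bounds both displacements from \<open>x0\<close>; with the
    tolerance \<open>e / (4 * c)\<close> the two expansion errors add up to
    \<open>e * t / 2\<close>.\<close>
  define c where "c = norm h + norm k + 1"
  have c: "c > 0" "norm h + norm k < c" by (auto simp: c_def add_nonneg_pos)
  have l2: "linear \<phi>''" using d2 has_derivative_linear by blast
  obtain d where d: "d > 0" "\<And>y. norm (y - x0) < d \<Longrightarrow>
      \<bar>\<phi>' y k - \<phi>' x0 k - \<phi>'' (y - x0)\<bar> \<le> e / (4 * c) * norm (y - x0)"
    using d2[unfolded has_derivative_at_alt] e c by (metis divide_pos_pos mult_pos_pos real_norm_def zero_less_numeral)
  have "\<bar>(\<phi> (x0 + t *\<^sub>R (h + k)) - \<phi> (x0 + t *\<^sub>R h) - \<phi> (x0 + t *\<^sub>R k) + \<phi> x0) / t\<^sup>2 - \<phi>'' h\<bar> < e"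
    if t: "0 < t" "t < d / c" for t
  proof -
    have tc: "t * c < d" using t c by (simp add: field_simps)
    define g where "g = (\<lambda>s. \<phi> (x0 + t *\<^sub>R h + s *\<^sub>R (t *\<^sub>R k)) - \<phi> (x0 + s *\<^sub>R (t *\<^sub>R k)))"
    have der: "((\<lambda>s. \<phi> (y + s *\<^sub>R (t *\<^sub>R k))) has_real_derivative t * \<phi>' (y + s *\<^sub>R (t *\<^sub>R k)) k) (at s)" for y s
    proof -
      have "((\<lambda>s. y + s *\<^sub>R (t *\<^sub>R k)) has_derivative (\<lambda>h. h *\<^sub>R (t *\<^sub>R k))) (at s)"
        by (auto intro!: derivative_eq_intros)
      from has_derivative_compose[OF this d1]
      have "((\<lambda>s. \<phi> (y + s *\<^sub>R (t *\<^sub>R k))) has_derivative (\<lambda>h. \<phi>' (y + s *\<^sub>R (t *\<^sub>R k)) (h *\<^sub>R (t *\<^sub>R k)))) (at s)" .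
      moreover have "\<phi>' z (h *\<^sub>R (t *\<^sub>R k)) = t * \<phi>' z k * h" for z h
        using linear_scale[OF has_derivative_linear[OF d1[of z]]] by simp
      ultimately show ?thesis by (simp add: has_field_derivative_def)
    qed
    have "\<exists>s. 0 < s \<and> s < 1 \<and> g 1 - g 0 = (1 - 0) *
        (t * \<phi>' (x0 + t *\<^sub>R h + s *\<^sub>R (t *\<^sub>R k)) k - t * \<phi>' (x0 + s *\<^sub>R (t *\<^sub>R k)) k)"
    proof (rule MVT2)
      show "(g has_real_derivative t * \<phi>' (x0 + t *\<^sub>R h + s *\<^sub>R (t *\<^sub>R k)) k - t * \<phi>' (x0 + s *\<^sub>R (t *\<^sub>R k)) k) (at s)" for s
        unfolding g_def by (intro DERIV_diff der)
    qed simp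
    then obtain s where s: "0 < s" "s < 1"
      "g 1 - g 0 = t * (\<phi>' (x0 + t *\<^sub>R h + s *\<^sub>R (t *\<^sub>R k)) k - \<phi>' (x0 + s *\<^sub>R (t *\<^sub>R k)) k)"
      by (auto simp: algebra_simps)
    have b: "norm (t *\<^sub>R h + s *\<^sub>R (t *\<^sub>R k)) \<le> t * c" "norm (s *\<^sub>R (t *\<^sub>R k)) \<le> t * c"
    proof -
      have sk: "norm (s *\<^sub>R (t *\<^sub>R k)) \<le> t * norm k"
        using s t mult_right_mono[of s 1 "t * norm k"] by simp
      have "norm (t *\<^sub>R h + s *\<^sub>R (t *\<^sub>R k)) \<le> t * norm h + t * norm k"
        using norm_triangle_ineq[of "t *\<^sub>R h" "s *\<^sub>R (t *\<^sub>R k)"] sk t by simp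
      also have "\<dots> = t * (norm h + norm k)" by (simp add: algebra_simps)
      also have "\<dots> \<le> t * c" using c t by (intro mult_left_mono) auto
      finally show "norm (t *\<^sub>R h + s *\<^sub>R (t *\<^sub>R k)) \<le> t * c" .
      have "t * norm k \<le> t * c" using c(2) t norm_ge_zero[of h] by (intro mult_left_mono) linarith+
      with sk show "norm (s *\<^sub>R (t *\<^sub>R k)) \<le> t * c" by linarith
    qed
    have e4: "e / (4 * c) * (t * c) = e * t / 4" using c(1) by simp
    have e1: "\<bar>\<phi>' (x0 + y) k - \<phi>' x0 k - \<phi>'' y\<bar> \<le> e * t / 4" if "norm y \<le> t * c" for y
    proof -
      have "\<bar>\<phi>' (x0 + y) k - \<phi>' x0 k - \<phi>'' y\<bar> \<le> e / (4 * c) * norm y"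
        using d(2)[of "x0 + y"] that tc by simp
      also have "\<dots> \<le> e / (4 * c) * (t * c)" using that e c(1) by (intro mult_left_mono) auto
      finally show ?thesis using e4 by simp
    qed
    have "\<phi>'' (t *\<^sub>R h + s *\<^sub>R (t *\<^sub>R k)) - \<phi>'' (s *\<^sub>R (t *\<^sub>R k)) = t * \<phi>'' h"
      using linear_add[OF l2] linear_scale[OF l2] by simp
    then have "\<bar>\<phi>' (x0 + t *\<^sub>R h + s *\<^sub>R (t *\<^sub>R k)) k - \<phi>' (x0 + s *\<^sub>R (t *\<^sub>R k)) k - t * \<phi>'' h\<bar> \<le> e * t / 2"
      using e1[OF b(1)] e1[OF b(2)] unfolding add.assoc[symmetric] by linarith
    from mult_left_mono[OF this, of t]
    moreover have "\<bar>g 1 - g 0 - t * (t * \<phi>'' h)\<bar>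
        = t * \<bar>\<phi>' (x0 + t *\<^sub>R h + s *\<^sub>R (t *\<^sub>R k)) k - \<phi>' (x0 + s *\<^sub>R (t *\<^sub>R k)) k - t * \<phi>'' h\<bar>"
      using t(1) unfolding s(3) right_diff_distrib[symmetric] by (simp add: abs_mult)
    ultimately have "\<bar>g 1 - g 0 - t * (t * \<phi>'' h)\<bar> \<le> t * (e * t / 2)" using t(1) by simp
    moreover have "g 1 - g 0 = \<phi> (x0 + t *\<^sub>R (h + k)) - \<phi> (x0 + t *\<^sub>R h) - \<phi> (x0 + t *\<^sub>R k) + \<phi> x0"
      by (simp add: g_def scaleR_add_right add.assoc)
    ultimately have "\<bar>(\<phi> (x0 + t *\<^sub>R (h + k)) - \<phi> (x0 + t *\<^sub>R h) - \<phi> (x0 + t *\<^sub>R k) + \<phi> x0) - t\<^sup>2 * \<phi>'' h\<bar> \<le> t\<^sup>2 * (e / 2)"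
      by (simp add: power2_eq_square algebra_simps)
    then have "\<bar>(\<phi> (x0 + t *\<^sub>R (h + k)) - \<phi> (x0 + t *\<^sub>R h) - \<phi> (x0 + t *\<^sub>R k) + \<phi> x0) - t\<^sup>2 * \<phi>'' h\<bar> / t\<^sup>2 \<le> e / 2"
      using t by (simp add: divide_le_eq mult.commute)
    then have "\<bar>((\<phi> (x0 + t *\<^sub>R (h + k)) - \<phi> (x0 + t *\<^sub>R h) - \<phi> (x0 + t *\<^sub>R k) + \<phi> x0) - t\<^sup>2 * \<phi>'' h) / t\<^sup>2\<bar> \<le> e / 2"
      by (simp add: abs_divide)
    then show ?thesis using t e by (simp add: diff_divide_distrib)
  qed
  then show "\<forall>\<^sub>F t in at_right 0. dist ((\<phi> (x0 + t *\<^sub>R (h + k)) - \<phi> (x0 + t *\<^sub>R h) - \<phi> (x0 + t *\<^sub>R k) + \<phi> x0) / t\<^sup>2) (\<phi>'' h) < e"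
    unfolding eventually_at_right_field dist_real_def
    using d(1) c(1) by (intro exI[of _ "d / c"]) auto
qed

lemma second_derivative_symmetric:
  fixes \<phi> :: "'x::real_normed_vector \<Rightarrow> real"
  assumes d1: "\<And>x. (\<phi> has_derivative \<phi>' x) (at x)"
    and d2: "\<And>k. ((\<lambda>x. \<phi>' x k) has_derivative (\<lambda>h. \<phi>'' h k)) (at x0)"
  shows "\<phi>'' h k = \<phi>'' k h"
proof -
  have "((\<lambda>t. (\<phi> (x0 + t *\<^sub>R (h + k)) - \<phi> (x0 + t *\<^sub>R h) - \<phi> (x0 + t *\<^sub>R k) + \<phi> x0) / t\<^sup>2) \<longlongrightarrow> \<phi>'' h k) (at_right (0::real))"
    by (rule second_difference_estimate[OF d1 d2])
  moreover have "((\<lambda>t. (\<phi> (x0 + t *\<^sub>R (h + k)) - \<phi> (x0 + t *\<^sub>R h) - \<phi> (x0 + t *\<^sub>R k) + \<phi> x0) / t\<^sup>2) \<longlongrightarrow> \<phi>'' k h) (at_right (0::real))"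
    using second_difference_estimate[OF d1 d2[of h], where h=k] by (simp add: algebra_simps)
  ultimately show ?thesis using tendsto_unique[OF trivial_limit_at_right_real] by blast
qed

section \<open>Derivatives as matrices, and measurability and continuity tools\<close>

lemma grad_inner:
  assumes "(f has_derivative f') (at x)"
  shows "grad f x \<bullet> e = f' e"
proof -
  have l: "linear f'" using assms has_derivative_linear by blast
  have "grad f x \<bullet> e = (\<Sum>i\<in>UNIV. f' (axis i 1) * e $ i)"
    unfolding grad_def inner_vec_def by (simp add: frechet_derivative_at[OF assms, symmetric])
  also have "\<dots> = f' (\<Sum>i\<in>UNIV. e $ i *\<^sub>R axis i 1)"
    by (simp add: linear_sum[OF l] linear_scale[OF l] mult.commute)
  also have "(\<Sum>i\<in>UNIV. e $ i *\<^sub>R axis i 1) = e"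
    using basis_expansion[of e] by (simp add: scalar_mult_eq_scaleR)
  finally show ?thesis .
qed

text \<open>One statement for \<open>D_vv\<close>, \<open>D_qv\<close> and \<open>D_qq\<close>:
  \<open>\<kappa>\<close> embeds a direction into the slot of the first differentiation, while
  \<open>h'\<close> belongs to the slot of the second.\<close>

lemma jacobian_inner:
  fixes G :: "real^'d::finite \<Rightarrow> real^'d" and h :: "real^'d \<Rightarrow> 'z::real_normed_vector \<Rightarrow>\<^sub>L real"
  assumes G: "\<And>y e. G y \<bullet> e = h y (\<kappa> e)" and h: "(h has_derivative h') (at x)" and \<kappa>: "linear \<kappa>"
  shows "(jacobian G (at x) *v u) \<bullet> e = h' u (\<kappa> e)"
proof -
  let ?G' = "\<lambda>u. \<Sum>b\<in>Basis. (h' u (\<kappa> b)) *\<^sub>R b"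
  have "G = (\<lambda>y. \<Sum>b\<in>Basis. (h y (\<kappa> b)) *\<^sub>R b)"
    using G euclidean_representation by (metis (no_types, lifting) ext sum.cong)
  moreover have "((\<lambda>y. \<Sum>b\<in>Basis. (h y (\<kappa> b)) *\<^sub>R b) has_derivative ?G') (at x)"
    by (intro has_derivative_sum has_derivative_scaleR_left
        bounded_linear.has_derivative[OF blinfun.bounded_linear_left h])
  ultimately have G': "(G has_derivative ?G') (at x)" by simp
  have "jacobian G (at x) *v u = ?G' u"
    unfolding jacobian_def frechet_derivative_at[OF G', symmetric]
    using matrix_works has_derivative_linear[OF G'] by (simp add: linear_matrix_vector_mul_eq)
  then have "(jacobian G (at x) *v u) \<bullet> e = (\<Sum>b\<in>Basis. h' u (\<kappa> b) * (b \<bullet> e))"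
    by (simp only: inner_sum_left inner_scaleR_left)
  also have "\<dots> = h' u (\<kappa> (\<Sum>b\<in>Basis. (e \<bullet> b) *\<^sub>R b))"
    by (simp add: inner_commute[of e] linear_sum[OF \<kappa>] linear_scale[OF \<kappa>] blinfun.sum_right blinfun.scaleR_right mult.commute)
  finally show ?thesis by (simp add: euclidean_representation)
qed

lemma continuous_on_inner_imp:
  fixes f :: "'a::t2_space \<Rightarrow> 'b::euclidean_space"
  assumes "\<And>e. continuous_on S (\<lambda>t. f t \<bullet> e)"
  shows "continuous_on S f"
  using assms continuous_on_componentwise[of S f] by blast

text \<open>\<open>M t\<close> is bounded below, the bound survives for \<open>s\<close> near
  \<open>t\<close>, and \<open>M s (y s - y t) = r s - M s (y t)\<close> tends to \<open>0\<close>.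
  This replaces continuity of matrix inversion.\<close>

lemma continuous_linear_solution:
  fixes M :: "real \<Rightarrow> 'e::euclidean_space \<Rightarrow> 'e"
  assumes lin: "\<And>t. t \<in> S \<Longrightarrow> linear (M t)" and inj: "\<And>t u. t \<in> S \<Longrightarrow> M t u = 0 \<Longrightarrow> u = 0"
    and cont: "\<And>u. continuous_on S (\<lambda>t. M t u)" and r: "continuous_on S r"
    and sol: "\<And>t. t \<in> S \<Longrightarrow> M t (y t) = r t"
  shows "continuous_on S y"
  unfolding continuous_on_def
proof
  fix t assume t: "t \<in> S"
  obtain e where e: "e > 0" "\<And>x. e * norm x \<le> norm (M t x)"
    using injective_imp_isometric[of UNIV "M t"] lin[OF t] inj[OF t]
    by (metis UNIV_I closed_UNIV linear_conv_bounded_linear subspace_UNIV)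
  obtain d where d: "d > 0" "\<And>s z. s \<in> S \<Longrightarrow> dist s t < d \<Longrightarrow> norm (M s z - M t z) \<le> e / 2 * norm z"
    using linear_pointwise_limit_bound[OF lin t cont, of "e / 2"] e(1) by (metis half_gt_zero)
  have b: "norm (y s - y t) \<le> 2 / e * norm (r s - M s (y t))" if s: "s \<in> S" "dist s t < d" for s
  proof -
    let ?x = "y s - y t"
    have "norm (M s ?x) = norm (r s - M s (y t))" using linear_diff[OF lin[OF s(1)]] sol[OF s(1)] by simp
    moreover have "norm (M t ?x) \<le> norm (M s ?x) + norm (M s ?x - M t ?x)"
      using norm_triangle_sub[of "M t ?x" "M s ?x"] by (simp add: norm_minus_commute)
    moreover have "e * norm ?x = e / 2 * norm ?x + e / 2 * norm ?x" by simp
    ultimately have "e / 2 * norm ?x \<le> norm (r s - M s (y t))" using d(2)[OF s, of ?x] e(2)[of ?x] by linarith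
    then show ?thesis using e(1) by (simp add: field_simps)
  qed
  have "((\<lambda>s. 2 / e * norm (r s - M s (y t))) \<longlongrightarrow> 2 / e * norm (r t - M t (y t))) (at t within S)"
    using cont[of "y t"] r t by (intro tendsto_intros) (auto simp: continuous_on_def)
  then have lim: "((\<lambda>s. 2 / e * norm (r s - M s (y t))) \<longlongrightarrow> 0) (at t within S)" using sol[OF t] by simp
  have "((\<lambda>s. y s - y t) \<longlongrightarrow> 0) (at t within S)"
  proof (rule Lim_null_comparison[OF _ lim])
    show "\<forall>\<^sub>F s in at t within S. norm (y s - y t) \<le> 2 / e * norm (r s - M s (y t))"
      unfolding eventually_at using d(1) b by (intro exI[of _ d]) auto
  qed
  then show "(y \<longlongrightarrow> y t) (at t within S)" by (simp add: LIM_zero_cancel)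
qed

text \<open>Lebesgue differentiation: off a null set the averages of \<open>f\<close> to the right
  of \<open>t\<close> converge to \<open>f t\<close>, and here all of them are
  \<open>0\<close>.\<close>

lemma integral_zero_imp_ae_zero:
  fixes f :: "real \<Rightarrow> real"
  assumes "a < b" "f integrable_on {a..b}" and zero: "\<And>s. s \<in> {a..b} \<Longrightarrow> integral {a..s} f = 0"
  obtains N where "negligible N" "\<And>t. t \<in> {a..b} - N \<Longrightarrow> f t = 0"
proof -
  define g where "g = (\<lambda>t. if t \<in> {a..b} then f t else 0)"
  have gi: "g integrable_on UNIV" unfolding g_def using assms(2) integrable_restrict_UNIV[of "{a..b}" f] by blast
  have "g integrable_on cbox c d" for c d
    using integrable_on_subcbox[OF gi] by simp
  then obtain N where N: "negligible N" "\<And>x e. \<lbrakk>x \<notin> N; 0 < e\<rbrakk> \<Longrightarrow>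
      \<exists>d>0. \<forall>h. 0 < h \<and> h < d \<longrightarrow> norm (integral (cbox x (x + h *\<^sub>R One)) g /\<^sub>R h ^ DIM(real) - g x) < e"
    using integrable_ccontinuous_explicit[of g] by metis
  \<comment> \<open>Averages to the right do not exist at \<open>b\<close>, so \<open>b\<close>
    joins the null set.\<close>
  have "f t = 0" if t: "t \<in> {a..b} - (N \<union> {b})" for t
  proof (rule ccontr)
    assume nz: "f t \<noteq> 0"
    then obtain d where d: "d > 0" "\<And>h. 0 < h \<Longrightarrow> h < d \<Longrightarrow> norm (integral {t..t + h} g / h - g t) < \<bar>f t\<bar>"
      using N(2)[of t "\<bar>f t\<bar>"] t by (auto simp: divide_inverse mult.commute)
    define h where "h = min (d / 2) (b - t)"
    have h: "0 < h" "h < d" "t + h \<le> b" using d(1) t by (auto simp: h_def)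
    have "integral {t..t + h} g = integral {t..t+h} f"
      by (rule integral_cong) (use h t in \<open>auto simp: g_def\<close>)
    also have "\<dots> = integral {a..t + h} f - integral {a..t} f"
    proof -
      have "f integrable_on {a..t+h}" by (rule integrable_on_subinterval[OF assms(2)]) (use h in auto)
      then have "integral {a..t} f + integral {t..t+h} f = integral {a..t+h} f"
        using t h by (intro Henstock_Kurzweil_Integration.integral_combine) auto
      then show ?thesis by simp
    qed
    also have "\<dots> = 0" using zero[of t] zero[of "t + h"] t h by simp
    finally have "norm (g t) < \<bar>f t\<bar>" using d(2)[OF h(1,2)] by simp
    then show False using t by (simp add: g_def)
  qed
  moreover have "negligible (N \<union> {b})" using N(1) by simp
  ultimately show ?thesis using that by blast
qed

lemma borel_measurable_continuous_compose:
  fixes h :: "real \<times> 'a::euclidean_space \<Rightarrow> 'c::euclidean_space" and y :: "real \<Rightarrow> 'a"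
  assumes h: "continuous_on ({a..b} \<times> UNIV) h" and y: "y \<in> borel_measurable (lebesgue_on {a..b})"
  shows "(\<lambda>t. h (t, y t)) \<in> borel_measurable (lebesgue_on {a..b})"
proof -
  let ?S = "{a..b} \<times> (UNIV :: 'a set)"
  have "closed ?S" by (intro closed_Times) auto
  then have "(\<lambda>z. indicator ?S z *\<^sub>R h z) \<in> borel_measurable borel"
    using h by (intro borel_measurable_continuous_on_indicator borel_closed)
  moreover have "(\<lambda>t. (t, y t)) \<in> borel_measurable (lebesgue_on {a..b})"
  proof (rule borel_measurable_Pair[OF _ y])
    show "(\<lambda>t. t) \<in> borel_measurable (lebesgue_on {a..b})"
      by (intro continuous_imp_measurable_on_sets_lebesgue continuous_intros) auto
  qed
  ultimately have 1: "(\<lambda>t. indicator ?S (t, y t) *\<^sub>R h (t, y t)) \<in> borel_measurable (lebesgue_on {a..b})"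
    by (rule measurable_compose[rotated])
  have "(\<lambda>t. indicator ?S (t, y t) *\<^sub>R h (t, y t)) \<in> borel_measurable (lebesgue_on {a..b})
      \<longleftrightarrow> (\<lambda>t. h (t, y t)) \<in> borel_measurable (lebesgue_on {a..b})"
    by (rule measurable_cong) simp
  from iffD1[OF this 1] show ?thesis .
qed

section \<open>The Lagrangian on a single edge\<close>

locale C2_edge =
  fixes a b :: real and L :: "'d::finite edge_lagrangian"
    and f' :: "real \<times> (real^'d) \<times> (real^'d) \<Rightarrow> (real \<times> (real^'d) \<times> (real^'d)) \<Rightarrow>\<^sub>L real"
    and f'' :: "real \<times> (real^'d) \<times> (real^'d) \<Rightarrow>
      (real \<times> (real^'d) \<times> (real^'d)) \<Rightarrow>\<^sub>L ((real \<times> (real^'d) \<times> (real^'d)) \<Rightarrow>\<^sub>L real)"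
  assumes ab: "a < b"
    and d1: "\<And>z. z \<in> {a..b} \<times> UNIV \<Longrightarrow>
      ((\<lambda>(t, q, v). L t q v) has_derivative blinfun_apply (f' z)) (at z within {a..b} \<times> UNIV)"
    and d2: "\<And>z. z \<in> {a..b} \<times> UNIV \<Longrightarrow>
      (f' has_derivative blinfun_apply (f'' z)) (at z within {a..b} \<times> UNIV)"
    and cont_f'': "continuous_on ({a..b} \<times> UNIV) f''"
    and quadratic: "\<And>t q. t \<in> {a..b} \<Longrightarrow>
      \<exists>(A :: real^'d^'d) B c. \<forall>v. L t q v = (A *v v) \<bullet> v + B \<bullet> v + c"
    and legendre: "\<And>t q v w. t \<in> {a..b} \<Longrightarrow> w \<noteq> 0 \<Longrightarrow> (D_vv L t q v *v w) \<bullet> w > 0"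
begin

lemma cont_L: "continuous_on ({a..b} \<times> UNIV) (\<lambda>(t, q, v). L t q v)"
  by (rule has_derivative_continuous_on) (rule d1)

lemma cont_f': "continuous_on ({a..b} \<times> UNIV) f'"
  by (rule has_derivative_continuous_on) (rule d2)

text \<open>Derivatives on the strip are one-sided in \<open>t\<close> at the ends of the edge. A
  slice of fixed \<open>t\<close> lies inside the strip and is a full linear space, so there the
  derivatives in \<open>q\<close> and \<open>v\<close> are two-sided.\<close>

lemma slice_derivative:
  assumes t: "t \<in> {a..b}"
  shows "((\<lambda>x. L t (fst x) (snd x)) has_derivative (\<lambda>y. f' (t, x) (0, y))) (at x)"
    and "((\<lambda>x. f' (t, x)) has_derivative (\<lambda>y. f'' (t, x) (0, y))) (at x)"
proof -
  have i: "((\<lambda>x. (t, x)) has_derivative (\<lambda>y. (0, y))) (at x)"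
    by (auto intro!: derivative_eq_intros)
  have m: "(t, x) \<in> {a..b} \<times> UNIV" "range (\<lambda>x. (t, x)) \<subseteq> {a..b} \<times> UNIV" using t by auto
  show "((\<lambda>x. L t (fst x) (snd x)) has_derivative (\<lambda>y. f' (t, x) (0, y))) (at x)"
    using diff_chain_within[OF i has_derivative_subset[OF d1[OF m(1)] m(2)]]
    by (simp add: o_def case_prod_beta)
  show "((\<lambda>x. f' (t, x)) has_derivative (\<lambda>y. f'' (t, x) (0, y))) (at x)"
    using diff_chain_within[OF i has_derivative_subset[OF d2[OF m(1)] m(2)]]
    by (simp add: o_def)
qed

lemma partial_derivative:
  assumes t: "t \<in> {a..b}"
  shows "((\<lambda>q. L t q v) has_derivative (\<lambda>u. f' (t, q, v) (0, u, 0))) (at q)"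
    and "((\<lambda>v. L t q v) has_derivative (\<lambda>u. f' (t, q, v) (0, 0, u))) (at v)"
    and "((\<lambda>q. f' (t, q, v)) has_derivative (\<lambda>u. f'' (t, q, v) (0, u, 0))) (at q)"
    and "((\<lambda>v. f' (t, q, v)) has_derivative (\<lambda>u. f'' (t, q, v) (0, 0, u))) (at v)"
proof -
  have i: "((\<lambda>q. (q, v)) has_derivative (\<lambda>u. (u, 0))) (at q)" "((\<lambda>v. (q, v)) has_derivative (\<lambda>u. (0, u))) (at v)"
    by (auto intro!: derivative_eq_intros)
  show "((\<lambda>q. L t q v) has_derivative (\<lambda>u. f' (t, q, v) (0, u, 0))) (at q)"
    using has_derivative_compose[OF i(1) slice_derivative(1)[OF t]] by simp
  show "((\<lambda>v. L t q v) has_derivative (\<lambda>u. f' (t, q, v) (0, 0, u))) (at v)"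
    using has_derivative_compose[OF i(2) slice_derivative(1)[OF t]] by simp
  show "((\<lambda>q. f' (t, q, v)) has_derivative (\<lambda>u. f'' (t, q, v) (0, u, 0))) (at q)"
    using has_derivative_compose[OF i(1) slice_derivative(2)[OF t]] by simp
  show "((\<lambda>v. f' (t, q, v)) has_derivative (\<lambda>u. f'' (t, q, v) (0, 0, u))) (at v)"
    using has_derivative_compose[OF i(2) slice_derivative(2)[OF t]] by simp
qed

lemma D_inner:
  assumes t: "t \<in> {a..b}"
  shows D_q_inner: "D_q L t q v \<bullet> e = f' (t, q, v) (0, e, 0)"
    and D_v_inner: "D_v L t q v \<bullet> e = f' (t, q, v) (0, 0, e)"
    and D_vv_inner: "(D_vv L t q v *v u) \<bullet> e = f'' (t, q, v) (0, 0, u) (0, 0, e)"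
    and D_qv_inner: "(D_qv L t q v *v u) \<bullet> e = f'' (t, q, v) (0, u, 0) (0, 0, e)"
    and D_qq_inner: "(D_qq L t q v *v u) \<bullet> e = f'' (t, q, v) (0, u, 0) (0, e, 0)"
proof -
  show q: "D_q L t q v \<bullet> e = f' (t, q, v) (0, e, 0)" for q v e
    unfolding D_q_def by (rule grad_inner[OF partial_derivative(1)[OF t]])
  show v: "D_v L t q v \<bullet> e = f' (t, q, v) (0, 0, e)" for q v e
    unfolding D_v_def by (rule grad_inner[OF partial_derivative(2)[OF t]])
  have l: "linear (\<lambda>e::real^'d. (0::real, 0::real^'d, e))" "linear (\<lambda>e::real^'d. (0::real, e, 0::real^'d))"
    by (auto intro!: linearI)
  show "(D_vv L t q v *v u) \<bullet> e = f'' (t, q, v) (0, 0, u) (0, 0, e)"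
    unfolding D_vv_def by (rule jacobian_inner[OF v partial_derivative(4)[OF t] l(1)])
  show "(D_qv L t q v *v u) \<bullet> e = f'' (t, q, v) (0, u, 0) (0, 0, e)"
    unfolding D_qv_def by (rule jacobian_inner[OF v partial_derivative(3)[OF t] l(1)])
  show "(D_qq L t q v *v u) \<bullet> e = f'' (t, q, v) (0, u, 0) (0, e, 0)"
    unfolding D_qq_def by (rule jacobian_inner[OF q partial_derivative(3)[OF t] l(2)])
qed

lemma f''_symmetric:
  assumes t: "t \<in> {a..b}"
  shows "f'' (t, x) (0, h) (0, k) = f'' (t, x) (0, k) (0, h)"
proof (rule second_derivative_symmetric[where \<phi>''="\<lambda>h k. f'' (t, x) (0, h) (0, k)"])
  show "((\<lambda>x. L t (fst x) (snd x)) has_derivative (\<lambda>y. f' (t, x) (0, y))) (at x)" for x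
    by (rule slice_derivative(1)[OF t])
  show "((\<lambda>x. f' (t, x) (0, k)) has_derivative (\<lambda>h. f'' (t, x) (0, h) (0, k))) (at x)" for k
    by (rule bounded_linear.has_derivative[OF blinfun.bounded_linear_left slice_derivative(2)[OF t]])
qed

lemma D_vv_sym: "t \<in> {a..b} \<Longrightarrow> (D_vv L t q v *v u) \<bullet> e = (D_vv L t q v *v e) \<bullet> u"
  and D_qq_sym: "t \<in> {a..b} \<Longrightarrow> (D_qq L t q v *v u) \<bullet> e = (D_qq L t q v *v e) \<bullet> u"
  using f''_symmetric by (simp_all add: D_inner)

lemma second_derivatives_continuous:
  assumes q: "continuous_on {a..b} q" and v: "continuous_on {a..b} v"
  shows "continuous_on {a..b} (\<lambda>t. D_vv L t (q t) (v t) *v u)"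
    and "continuous_on {a..b} (\<lambda>t. D_qv L t (q t) (v t) *v u)"
    and "continuous_on {a..b} (\<lambda>t. D_qq L t (q t) (v t) *v u)"
proof -
  have c: "continuous_on {a..b} (\<lambda>t. f'' (t, q t, v t) x y)" for x y
    by (intro continuous_intros continuous_on_compose2[OF cont_f''] q v) auto
  show "continuous_on {a..b} (\<lambda>t. D_vv L t (q t) (v t) *v u)"
  proof (rule continuous_on_inner_imp)
    show "continuous_on {a..b} (\<lambda>t. (D_vv L t (q t) (v t) *v u) \<bullet> e)" for e
      by (rule continuous_on_eq[OF c]) (rule D_vv_inner[symmetric])
  qed
  show "continuous_on {a..b} (\<lambda>t. D_qv L t (q t) (v t) *v u)"
  proof (rule continuous_on_inner_imp)
    show "continuous_on {a..b} (\<lambda>t. (D_qv L t (q t) (v t) *v u) \<bullet> e)" for e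
      by (rule continuous_on_eq[OF c]) (rule D_qv_inner[symmetric])
  qed
  show "continuous_on {a..b} (\<lambda>t. D_qq L t (q t) (v t) *v u)"
  proof (rule continuous_on_inner_imp)
    show "continuous_on {a..b} (\<lambda>t. (D_qq L t (q t) (v t) *v u) \<bullet> e)" for e
      by (rule continuous_on_eq[OF c]) (rule D_qq_inner[symmetric])
  qed
qed

text \<open>A quadratic Lagrangian has a momentum affine in the velocity, with a linear part
  independent of the base velocity \<open>w\<close>. Together with \<open>legendre\<close> the
  velocity can be solved for.\<close>

lemma D_v_affine:
  assumes t: "t \<in> {a..b}"
  shows "D_v L t q v = D_v L t q 0 + D_vv L t q w *v v"
proof -
  obtain A :: "real^'d^'d" and B c where A: "\<And>v. L t q v = (A *v v) \<bullet> v + B \<bullet> v + c"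
    using quadratic[OF t] by blast
  have 1: "D_v L t q v \<bullet> e = (A *v v) \<bullet> e + (A *v e) \<bullet> v + B \<bullet> e" for v e
  proof -
    have "((\<lambda>v. (A *v v) \<bullet> v + B \<bullet> v + c) has_derivative (\<lambda>e. (A *v v) \<bullet> e + (A *v e) \<bullet> v + B \<bullet> e)) (at v)"
      by (auto intro!: derivative_eq_intros bounded_linear.has_derivative[OF matrix_vector_mul_bounded_linear])
    then have "((\<lambda>v. L t q v) has_derivative (\<lambda>e. (A *v v) \<bullet> e + (A *v e) \<bullet> v + B \<bullet> e)) (at v)"
      by (simp add: A)
    from grad_inner[OF this] show ?thesis by (simp add: D_v_def)
  qed
  have 2: "(D_vv L t q w *v v) \<bullet> e = (A *v v) \<bullet> e + (A *v e) \<bullet> v" for v e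
  proof -
    have d: "((\<lambda>v. f' (t, q, v) (0, 0, e)) has_derivative (\<lambda>u. f'' (t, q, w) (0, 0, u) (0, 0, e))) (at w)"
      by (rule bounded_linear.has_derivative[OF blinfun.bounded_linear_left partial_derivative(4)[OF t]])
    have eq: "(\<lambda>v. f' (t, q, v) (0, 0, e)) = (\<lambda>v. (A *v v) \<bullet> e + (A *v e) \<bullet> v + B \<bullet> e)"
      using 1 D_v_inner[OF t] by (intro ext) metis
    have "((\<lambda>v. (A *v v) \<bullet> e + (A *v e) \<bullet> v + B \<bullet> e) has_derivative (\<lambda>u. (A *v u) \<bullet> e + (A *v e) \<bullet> u)) (at w)"
      by (auto intro!: derivative_eq_intros bounded_linear.has_derivative[OF matrix_vector_mul_bounded_linear])
    from has_derivative_unique[OF d[unfolded eq] this]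
    show ?thesis using D_vv_inner[OF t, of q w v e] by (simp add: fun_eq_iff)
  qed
  show ?thesis
  proof (rule vector_eq_ldot[THEN iffD1], intro allI)
    show "e \<bullet> D_v L t q v = e \<bullet> (D_v L t q 0 + D_vv L t q w *v v)" for e
      using 1[of v e] 1[of 0 e] 2[of v e] by (simp add: inner_add_right inner_commute)
  qed
qed

text \<open>Being quadratic, the Lagrangian is determined by velocities in the unit ball, where
  compactness gives bounds uniform in \<open>t\<close> and \<open>q\<close>. These bounds dominate
  the difference quotients of the action.\<close>

lemma growth:
  obtains K where "K > 0"
    "\<And>t q v. t \<in> {a..b} \<Longrightarrow> norm q \<le> r \<Longrightarrow> \<bar>L t q v\<bar> \<le> K * (1 + (norm v)\<^sup>2)"
    "\<And>t q v \<eta> \<nu>. t \<in> {a..b} \<Longrightarrow> norm q \<le> r \<Longrightarrow>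
       \<bar>f' (t, q, v) (0, \<eta>, \<nu>)\<bar> \<le> K * (1 + (norm v)\<^sup>2) * (norm \<eta> + norm \<nu>)"
proof -
  let ?K = "{a..b} \<times> cball (0::real^'d) r \<times> cball (0::real^'d) 1"
  have K: "compact ?K" "?K \<subseteq> {a..b} \<times> UNIV" by (auto intro!: compact_Times)
  have "bounded ((\<lambda>(t, q, v). L t q v) ` ?K)"
    by (rule compact_imp_bounded[OF compact_continuous_image[OF continuous_on_subset[OF cont_L K(2)] K(1)]])
  moreover have "bounded (f' ` ?K)"
    by (rule compact_imp_bounded[OF compact_continuous_image[OF continuous_on_subset[OF cont_f' K(2)] K(1)]])
  ultimately obtain M1 M2 where M1: "M1 > 0" "\<And>z. z \<in> ?K \<Longrightarrow> norm ((\<lambda>(t, q, v). L t q v) z) \<le> M1"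
    and M2: "M2 > 0" "\<And>z. z \<in> ?K \<Longrightarrow> norm (f' z) \<le> M2"
    unfolding bounded_pos by (auto simp del: split_paired_All)
  define M where "M = M1 + M2"
  have M: "M > 0" using M1 M2 by (simp add: M_def)
  have bdL: "\<bar>L t q w\<bar> \<le> M" if "t \<in> {a..b}" "norm q \<le> r" "norm w \<le> 1" for t q w
    using M1(2)[of "(t, q, w)"] that M2(1) by (simp add: M_def)
  have bdf: "\<bar>f' (t, q, w) (0, \<eta>, \<nu>)\<bar> \<le> M * (norm \<eta> + norm \<nu>)" if "t \<in> {a..b}" "norm q \<le> r" "norm w \<le> 1" for t q w \<eta> \<nu>
  proof -
    have "norm (0::real, \<eta>, \<nu>) \<le> norm \<eta> + norm \<nu>"
      using norm_Pair_le[of "0::real" "(\<eta>, \<nu>)"] norm_Pair_le[of \<eta> \<nu>] by simp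
    moreover have "norm (f' (t, q, w)) \<le> M" using M2(2)[of "(t, q, w)"] that M1(1) by (simp add: M_def)
    ultimately have "norm (f' (t, q, w)) * norm (0::real, \<eta>, \<nu>) \<le> M * (norm \<eta> + norm \<nu>)"
      by (intro mult_mono) (use M in auto)
    then show ?thesis using norm_blinfun[of "f' (t, q, w)" "(0, \<eta>, \<nu>)"] by simp
  qed
  \<comment> \<open>A polynomial of degree two in \<open>s\<close> is determined by its values at
    \<open>1\<close>, \<open>-1\<close> and \<open>0\<close>.\<close>
  have id: "L t q (s *\<^sub>R w) = s\<^sup>2 * ((L t q w + L t q (- w)) / 2 - L t q 0) + s * ((L t q w - L t q (- w)) / 2) + L t q 0"
    if t: "t \<in> {a..b}" for t q s w
  proof -
    obtain A :: "real^'d^'d" and B c where A: "\<And>v. L t q v = (A *v v) \<bullet> v + B \<bullet> v + c"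
      using quadratic[OF t] by blast
    have [simp]: "A *v (- w) = - (A *v w)" using linear_neg[OF matrix_vector_mul_linear] by metis
    show ?thesis
      unfolding A by (simp add: matrix_vector_mult_scaleR power2_eq_square algebra_simps)
  qed
  \<comment> \<open>The identity \<open>id\<close> differentiated along a line in
    \<open>(q, w)\<close>. The velocity direction carries the factor \<open>s\<close> so that the
    scaled curve stays a multiple of the unscaled one.\<close>
  have id': "f' (t, q, s *\<^sub>R w) (0, \<eta>, s *\<^sub>R \<nu>)
      = s\<^sup>2 * ((f' (t, q, w) (0, \<eta>, \<nu>) + f' (t, q, - w) (0, \<eta>, - \<nu>)) / 2 - f' (t, q, 0) (0, \<eta>, 0))
        + s * ((f' (t, q, w) (0, \<eta>, \<nu>) - f' (t, q, - w) (0, \<eta>, - \<nu>)) / 2) + f' (t, q, 0) (0, \<eta>, 0)"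
    if t: "t \<in> {a..b}" for t q s w \<eta> \<nu>
  proof -
    have d: "((\<lambda>l. L t (q + l *\<^sub>R \<eta>) (y + l *\<^sub>R z)) has_real_derivative f' (t, q, y) (0, \<eta>, z)) (at 0)" for y z
    proof -
      have i: "((\<lambda>l. (q + l *\<^sub>R \<eta>, y + l *\<^sub>R z)) has_derivative (\<lambda>h. (h *\<^sub>R \<eta>, h *\<^sub>R z))) (at (0::real))"
        by (auto intro!: derivative_eq_intros)
      have "((\<lambda>l. L t (q + l *\<^sub>R \<eta>) (y + l *\<^sub>R z)) has_derivative (\<lambda>h. f' (t, q, y) (0, h *\<^sub>R \<eta>, h *\<^sub>R z))) (at 0)"
        using has_derivative_compose[OF i slice_derivative(1)[OF t]] by simp
      moreover have "(0, h *\<^sub>R \<eta>, h *\<^sub>R z) = h *\<^sub>R (0::real, \<eta>, z)" for h by simp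
      ultimately show ?thesis
        by (simp only: blinfun.scaleR_right has_field_derivative_def real_scaleR_def mult.commute[of _ "f' (t, q, y) (0, \<eta>, z)"])
    qed
    have e: "(\<lambda>l. L t (q + l *\<^sub>R \<eta>) (s *\<^sub>R w + l *\<^sub>R (s *\<^sub>R \<nu>))) = (\<lambda>l. s\<^sup>2 * ((L t (q + l *\<^sub>R \<eta>) (w + l *\<^sub>R \<nu>)
        + L t (q + l *\<^sub>R \<eta>) (- w + l *\<^sub>R (- \<nu>))) / 2 - L t (q + l *\<^sub>R \<eta>) (0 + l *\<^sub>R 0))
        + s * ((L t (q + l *\<^sub>R \<eta>) (w + l *\<^sub>R \<nu>) - L t (q + l *\<^sub>R \<eta>) (- w + l *\<^sub>R (- \<nu>))) / 2)
        + L t (q + l *\<^sub>R \<eta>) (0 + l *\<^sub>R 0))"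
    proof
      fix l
      have r: "s *\<^sub>R w + l *\<^sub>R (s *\<^sub>R \<nu>) = s *\<^sub>R (w + l *\<^sub>R \<nu>)" "- w + l *\<^sub>R (- \<nu>) = - (w + l *\<^sub>R \<nu>)" "(0::real^'d) + l *\<^sub>R 0 = 0"
        by (simp_all add: algebra_simps)
      show "L t (q + l *\<^sub>R \<eta>) (s *\<^sub>R w + l *\<^sub>R (s *\<^sub>R \<nu>)) = s\<^sup>2 * ((L t (q + l *\<^sub>R \<eta>) (w + l *\<^sub>R \<nu>)
        + L t (q + l *\<^sub>R \<eta>) (- w + l *\<^sub>R (- \<nu>))) / 2 - L t (q + l *\<^sub>R \<eta>) (0 + l *\<^sub>R 0))
        + s * ((L t (q + l *\<^sub>R \<eta>) (w + l *\<^sub>R \<nu>) - L t (q + l *\<^sub>R \<eta>) (- w + l *\<^sub>R (- \<nu>))) / 2)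
        + L t (q + l *\<^sub>R \<eta>) (0 + l *\<^sub>R 0)"
        unfolding r by (rule id[OF t])
    qed
    show ?thesis
      by (rule DERIV_unique[OF d[of "s *\<^sub>R w" "s *\<^sub>R \<nu>", unfolded e]])
        (intro DERIV_add DERIV_cmult DERIV_cdivide DERIV_diff d)
  qed
  define K where "K = 4 * M"
  have "\<bar>L t q v\<bar> \<le> K * (1 + (norm v)\<^sup>2) \<and> \<bar>f' (t, q, v) (0, \<eta>, \<nu>)\<bar> \<le> K * (1 + (norm v)\<^sup>2) * (norm \<eta> + norm \<nu>)"
    if t: "t \<in> {a..b}" and q: "norm q \<le> r" for t q v \<eta> \<nu>
  proof (cases "norm v \<le> 1")
    case True
    have k: "M \<le> K * (1 + (norm v)\<^sup>2)"
    proof -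
      have "M * 1 \<le> K * (1 + (norm v)\<^sup>2)" unfolding K_def using M by (intro mult_mono) auto
      then show ?thesis by simp
    qed
    have "M * (norm \<eta> + norm \<nu>) \<le> K * (1 + (norm v)\<^sup>2) * (norm \<eta> + norm \<nu>)"
      using k by (intro mult_right_mono) auto
    then show ?thesis using bdL[OF t q True] bdf[OF t q True, of \<eta> \<nu>] k by linarith
  next
    case False
    define s where "s = norm v"
    define w where "w = v /\<^sub>R s"
    define \<nu>' where "\<nu>' = \<nu> /\<^sub>R s"
    have s: "s > 1" using False by (simp add: s_def)
    then have s0: "s \<noteq> 0" by simp
    have w: "norm w \<le> 1" "norm (- w) \<le> 1" "v = s *\<^sub>R w" "\<nu> = s *\<^sub>R \<nu>'"
      using s s0 by (simp_all add: w_def \<nu>'_def s_def[symmetric])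
    have ss: "s \<le> s\<^sup>2" "1 \<le> s\<^sup>2" using s by (auto simp: power2_eq_square mult_le_cancel_left1 intro: order_trans[OF less_imp_le[OF s]])
    have arith: "\<bar>s\<^sup>2 * ((x + y) / 2 - z) + s * ((x - y) / 2) + z\<bar> \<le> 4 * c * (1 + s\<^sup>2)"
      if "\<bar>x\<bar> \<le> c" "\<bar>y\<bar> \<le> c" "\<bar>z\<bar> \<le> c" for x y z c :: real
    proof -
      have c: "0 \<le> c" using that by linarith
      have b: "x \<le> c" "- x \<le> c" "y \<le> c" "- y \<le> c" "z \<le> c" "- z \<le> c"
        using that by (simp_all only: abs_le_iff)
      have a1: "\<bar>(x + y) / 2 - z\<bar> \<le> 2 * c" by (rule abs_leI; use b in \<open>simp add: field_simps\<close>)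
      have a2: "\<bar>(x - y) / 2\<bar> \<le> c" by (rule abs_leI; use b in \<open>simp add: field_simps\<close>)
      have 1: "\<bar>s\<^sup>2 * ((x + y) / 2 - z)\<bar> \<le> s\<^sup>2 * (2 * c)"
        unfolding abs_mult by (rule mult_mono[OF _ a1]) auto
      have 2: "\<bar>s * ((x - y) / 2)\<bar> \<le> s\<^sup>2 * c"
        unfolding abs_mult by (rule mult_mono[OF _ a2]) (use ss s in auto)
      have "\<bar>s\<^sup>2 * ((x + y) / 2 - z) + s * ((x - y) / 2) + z\<bar> \<le> s\<^sup>2 * (2 * c) + s\<^sup>2 * c + c"
        using 1 2 that(3) by linarith
      also have "\<dots> = (3 * s\<^sup>2 + 1) * c" by (simp add: algebra_simps)
      also have "\<dots> \<le> (4 * (1 + s\<^sup>2)) * c" using c ss by (intro mult_right_mono) auto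
      finally show ?thesis by (simp add: algebra_simps)
    qed
    have "norm \<nu>' \<le> norm \<nu>"
      using s mult_right_mono[of "inverse s" 1 "norm \<nu>"] by (simp add: \<nu>'_def inverse_le_1_iff)
    then have n: "M * (norm \<eta> + norm \<nu>') \<le> M * (norm \<eta> + norm \<nu>)" "M * (norm \<eta> + norm (0::real^'d)) \<le> M * (norm \<eta> + norm \<nu>)"
      using M by (auto intro!: mult_left_mono)
    have "\<bar>L t q v\<bar> \<le> 4 * M * (1 + s\<^sup>2)"
      unfolding w(3) id[OF t] using bdL[OF t q] w by (intro arith) auto
    moreover have "\<bar>f' (t, q, v) (0, \<eta>, \<nu>)\<bar> \<le> 4 * (M * (norm \<eta> + norm \<nu>)) * (1 + s\<^sup>2)"
    proof -
      have "\<bar>f' (t, q, s *\<^sub>R w) (0, \<eta>, s *\<^sub>R \<nu>')\<bar> \<le> 4 * (M * (norm \<eta> + norm \<nu>)) * (1 + s\<^sup>2)"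
        unfolding id'[OF t]
        using bdf[OF t q w(1), of \<eta> \<nu>'] bdf[OF t q w(2), of \<eta> "- \<nu>'"] bdf[OF t q, of 0 \<eta> 0] n
        by (intro arith) auto
      then show ?thesis using w(3,4) by simp
    qed
    ultimately show ?thesis unfolding K_def s_def by (simp add: algebra_simps)
  qed
  moreover have "K > 0" using M by (simp add: K_def)
  ultimately show ?thesis using that by blast
qed

end

lemma ramp_derivative:
  "((\<lambda>t. (t - a) / c) has_vector_derivative 1 / c) (at t within S)"
  "((\<lambda>t. (b - t) / c) has_vector_derivative - (1 / c)) (at t within S)"
proof -
  have "((\<lambda>t. t - a) has_real_derivative 1 - 0) (at t within S)" "((\<lambda>t. b - t) has_real_derivative 0 - 1) (at t within S)"
    by (intro DERIV_diff DERIV_const DERIV_ident)+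
  from this[THEN DERIV_cdivide, of c]
  show "((\<lambda>t. (t - a) / c) has_vector_derivative 1 / c) (at t within S)"
    "((\<lambda>t. (b - t) / c) has_vector_derivative - (1 / c)) (at t within S)"
    by (simp_all add: has_real_derivative_iff_has_vector_derivative)
qed

section \<open>First variation of the action and regularity of weak solutions\<close>

context C2_edge begin

lemma compose_measurable:
  assumes "q \<in> borel_measurable (lebesgue_on {a..b})" "v \<in> borel_measurable (lebesgue_on {a..b})"
  shows "(\<lambda>t. L t (q t) (v t)) \<in> borel_measurable (lebesgue_on {a..b})"
    and "\<eta> \<in> borel_measurable (lebesgue_on {a..b}) \<Longrightarrow> \<nu> \<in> borel_measurable (lebesgue_on {a..b}) \<Longrightarrow>
      (\<lambda>t. f' (t, q t, v t) (0, \<eta> t, \<nu> t)) \<in> borel_measurable (lebesgue_on {a..b})"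
proof -
  have qv: "(\<lambda>t. (q t, v t)) \<in> borel_measurable (lebesgue_on {a..b})"
    using assms by (rule borel_measurable_Pair)
  show "(\<lambda>t. L t (q t) (v t)) \<in> borel_measurable (lebesgue_on {a..b})"
    using borel_measurable_continuous_compose[OF cont_L qv] by simp
  assume e: "\<eta> \<in> borel_measurable (lebesgue_on {a..b})" "\<nu> \<in> borel_measurable (lebesgue_on {a..b})"
  have c: "(\<lambda>t. f' (t, q t, v t) x) \<in> borel_measurable (lebesgue_on {a..b})" for x
  proof -
    have "continuous_on ({a..b} \<times> UNIV) (\<lambda>z. f' z x)" by (intro continuous_intros cont_f')
    from borel_measurable_continuous_compose[OF this qv] show ?thesis .
  qed
  have dec: "f' z (0, x, y) = (\<Sum>i\<in>Basis. (x \<bullet> i) * f' z (0, i, 0)) + (\<Sum>i\<in>Basis. (y \<bullet> i) * f' z (0, 0, i))" for z x y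
  proof -
    have "linear (\<lambda>x::real^'d. (0::real, x, 0::real^'d))" "linear (\<lambda>x::real^'d. (0::real, 0::real^'d, x))"
      by (auto intro!: linearI)
    from this[THEN linear_compose, OF bounded_linear.linear[OF blinfun.bounded_linear_right], of "f' z"]
    have l1: "linear (\<lambda>x. f' z (0, x, 0))" and l2: "linear (\<lambda>x. f' z (0, 0, x))"
      by (simp_all add: o_def)
    have "f' z (0, x, y) = f' z (0, x, 0) + f' z (0, 0, y)" by (simp flip: blinfun.add_right)
    also have "f' z (0, x, 0) = f' z (0, \<Sum>i\<in>Basis. (x \<bullet> i) *\<^sub>R i, 0)" by (simp add: euclidean_representation)
    also have "\<dots> = (\<Sum>i\<in>Basis. (x \<bullet> i) * f' z (0, i, 0))" by (simp add: linear_sum[OF l1] linear_scale[OF l1])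
    also have "f' z (0, 0, y) = f' z (0, 0, \<Sum>i\<in>Basis. (y \<bullet> i) *\<^sub>R i)" by (simp add: euclidean_representation)
    also have "\<dots> = (\<Sum>i\<in>Basis. (y \<bullet> i) * f' z (0, 0, i))" by (simp add: linear_sum[OF l2] linear_scale[OF l2])
    finally show ?thesis .
  qed
  have eq: "(\<lambda>t. f' (t, q t, v t) (0, \<eta> t, \<nu> t)) =
      (\<lambda>t. (\<Sum>i\<in>Basis. (\<eta> t \<bullet> i) * f' (t, q t, v t) (0, i, 0)) + (\<Sum>i\<in>Basis. (\<nu> t \<bullet> i) * f' (t, q t, v t) (0, 0, i)))"
    by (rule ext) (rule dec)
  show "(\<lambda>t. f' (t, q t, v t) (0, \<eta> t, \<nu> t)) \<in> borel_measurable (lebesgue_on {a..b})"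
    unfolding eq using e
    by (intro borel_measurable_add borel_measurable_sum borel_measurable_times borel_measurable_inner
        borel_measurable_const c)
qed

lemma line_derivative:
  assumes t: "t \<in> {a..b}"
  shows "((\<lambda>l. L t (q + l *\<^sub>R \<eta>) (v + l *\<^sub>R \<nu>)) has_real_derivative
      f' (t, q + l *\<^sub>R \<eta>, v + l *\<^sub>R \<nu>) (0, \<eta>, \<nu>)) (at l)"
proof -
  have i: "((\<lambda>l. (q + l *\<^sub>R \<eta>, v + l *\<^sub>R \<nu>)) has_derivative (\<lambda>h. (h *\<^sub>R \<eta>, h *\<^sub>R \<nu>))) (at l)"
    by (auto intro!: derivative_eq_intros)
  have "((\<lambda>l. L t (q + l *\<^sub>R \<eta>) (v + l *\<^sub>R \<nu>)) has_derivative
      (\<lambda>h. f' (t, q + l *\<^sub>R \<eta>, v + l *\<^sub>R \<nu>) (0, h *\<^sub>R \<eta>, h *\<^sub>R \<nu>))) (at l)"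
    using has_derivative_compose[OF i slice_derivative(1)[OF t]] by simp
  moreover have "(0, h *\<^sub>R \<eta>, h *\<^sub>R \<nu>) = h *\<^sub>R (0::real, \<eta>, \<nu>)" for h by simp
  ultimately show ?thesis
    by (simp only: blinfun.scaleR_right has_field_derivative_def real_scaleR_def mult.commute[of _ "f' _ (0, \<eta>, \<nu>)"])
qed

lemma f'_integrable:
  assumes x: "w12_pair a b x g" and m: "\<eta> \<in> borel_measurable (lebesgue_on {a..b})" "\<nu> \<in> borel_measurable (lebesgue_on {a..b})"
    and bd: "\<And>t. t \<in> {a..b} \<Longrightarrow> norm (\<eta> t) + norm (\<nu> t) \<le> c"
  shows "(\<lambda>t. f' (t, x t, g t) (0, \<eta> t, \<nu> t)) absolutely_integrable_on {a..b}"
proof -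
  note mx = w12_pairD[OF x]
  have "bounded (x ` {a..b})"
    using compact_imp_bounded[OF compact_continuous_image[OF mx(5) compact_Icc]] .
  then obtain r where "\<forall>t\<in>{a..b}. norm (x t) \<le> r"
    unfolding bounded_iff by blast
  then have r: "\<And>t. t \<in> {a..b} \<Longrightarrow> norm (x t) \<le> r" by blast
  obtain K where K: "K > 0" "\<And>t q v \<eta> \<nu>. t \<in> {a..b} \<Longrightarrow> norm q \<le> r \<Longrightarrow>
      \<bar>f' (t, q, v) (0, \<eta>, \<nu>)\<bar> \<le> K * (1 + (norm v)\<^sup>2) * (norm \<eta> + norm \<nu>)"
    using growth[of r] by metis
  show ?thesis
  proof (rule measurable_bounded_by_integrable_imp_absolutely_integrable)
    show "(\<lambda>t. f' (t, x t, g t) (0, \<eta> t, \<nu> t)) \<in> borel_measurable (lebesgue_on {a..b})"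
      by (rule compose_measurable(2)[OF mx(6,4) m])
    show "(\<lambda>t. K * (1 + (norm (g t))\<^sup>2) * c) integrable_on {a..b}"
      using mx(2) by (intro integrable_on_mult_right integrable_on_mult_left integrable_add) auto
    show "norm (f' (t, x t, g t) (0, \<eta> t, \<nu> t)) \<le> K * (1 + (norm (g t))\<^sup>2) * c" if t: "t \<in> {a..b}" for t
    proof -
      have "K * (1 + (norm (g t))\<^sup>2) * (norm (\<eta> t) + norm (\<nu> t)) \<le> K * (1 + (norm (g t))\<^sup>2) * c"
        using bd[OF t] K(1) by (intro mult_left_mono) auto
      then show ?thesis using K(2)[OF t r[OF t], of "g t" "\<eta> t" "\<nu> t"] by simp
    qed
  qed auto
qed

text \<open>Dominated convergence works along sequences, hence the parameters
  \<open>1 / real (Suc n)\<close>; this is enough where the derivative of the action is already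
  known to exist. The mean value theorem and \<open>growth\<close> provide the majorant, as
  \<open>\<nu>\<close> is bounded.\<close>

lemma first_variation:
  assumes x: "w12_pair a b x g" and \<eta>: "w12_pair a b \<eta> \<nu>" and bd: "\<And>t. t \<in> {a..b} \<Longrightarrow> norm (\<nu> t) \<le> c"
  shows "((\<lambda>n. (integral {a..b} (\<lambda>t. L t (x t + (1 / real (Suc n)) *\<^sub>R \<eta> t) (g t + (1 / real (Suc n)) *\<^sub>R \<nu> t))
          - integral {a..b} (\<lambda>t. L t (x t) (g t))) / (1 / real (Suc n)))
        \<longlonglongrightarrow> integral {a..b} (\<lambda>t. f' (t, x t, g t) (0, \<eta> t, \<nu> t)))"
proof -
  note mx = w12_pairD[OF x] and m\<eta> = w12_pairD[OF \<eta>]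
  have "bounded (x ` {a..b})"
    using compact_imp_bounded[OF compact_continuous_image[OF mx(5) compact_Icc]] .
  moreover have "bounded (\<eta> ` {a..b})"
    using compact_imp_bounded[OF compact_continuous_image[OF m\<eta>(5) compact_Icc]] .
  ultimately obtain r1 r2 where "\<forall>t\<in>{a..b}. norm (x t) \<le> r1" "\<forall>t\<in>{a..b}. norm (\<eta> t) \<le> r2"
    unfolding bounded_iff by blast
  then have r: "\<And>t. t \<in> {a..b} \<Longrightarrow> norm (x t) \<le> r1" "\<And>t. t \<in> {a..b} \<Longrightarrow> norm (\<eta> t) \<le> r2" by blast+
  define C where "C = \<bar>c\<bar> + \<bar>r2\<bar>"
  obtain K where K: "K > 0"
    "\<And>t q v. t \<in> {a..b} \<Longrightarrow> norm q \<le> r1 + r2 \<Longrightarrow> \<bar>L t q v\<bar> \<le> K * (1 + (norm v)\<^sup>2)"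
    "\<And>t q v \<eta> \<nu>. t \<in> {a..b} \<Longrightarrow> norm q \<le> r1 + r2 \<Longrightarrow> \<bar>f' (t, q, v) (0, \<eta>, \<nu>)\<bar> \<le> K * (1 + (norm v)\<^sup>2) * (norm \<eta> + norm \<nu>)"
    using growth[of "r1 + r2"] by metis
  have le: "norm (x t + l *\<^sub>R \<eta> t) \<le> r1 + r2" "norm (\<nu> t) \<le> C" "norm (\<eta> t) + norm (\<nu> t) \<le> C"
      "1 + (norm (g t + l *\<^sub>R \<nu> t))\<^sup>2 \<le> 1 + 2 * (norm (g t))\<^sup>2 + 2 * C\<^sup>2"
    if t: "t \<in> {a..b}" and l: "0 \<le> l" "l \<le> 1" for t l
  proof -
    have "norm (l *\<^sub>R \<eta> t) \<le> norm (\<eta> t)" using l by (simp add: mult_left_le_one_le)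
    then show "norm (x t + l *\<^sub>R \<eta> t) \<le> r1 + r2"
      using norm_triangle_ineq[of "x t" "l *\<^sub>R \<eta> t"] r(1)[OF t] r(2)[OF t] by linarith
    show nu: "norm (\<nu> t) \<le> C" using bd[OF t] unfolding C_def by linarith
    show "norm (\<eta> t) + norm (\<nu> t) \<le> C" using bd[OF t] r(2)[OF t] unfolding C_def by linarith
    have "norm (l *\<^sub>R \<nu> t) \<le> 1 * norm (\<nu> t)" using l by (simp add: mult_left_le_one_le)
    then have "(norm (l *\<^sub>R \<nu> t))\<^sup>2 \<le> C\<^sup>2" using nu by (intro power_mono) auto
    then show "1 + (norm (g t + l *\<^sub>R \<nu> t))\<^sup>2 \<le> 1 + 2 * (norm (g t))\<^sup>2 + 2 * C\<^sup>2"
      using square_norm_add_le[of "g t" "l *\<^sub>R \<nu> t"] by linarith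
  qed
  define H where "H = (\<lambda>t. 1 + 2 * (norm (g t))\<^sup>2 + 2 * C\<^sup>2)"
  have Hi: "(\<lambda>t. k * H t) integrable_on {a..b}" for k
    unfolding H_def using mx(2) by (intro integrable_on_mult_right integrable_add) auto
  define e where "e n = 1 / real (Suc n)" for n
  have e: "0 < e n" "e n \<le> 1" for n by (auto simp: e_def)
  have Li: "(\<lambda>t. L t (x t + l *\<^sub>R \<eta> t) (g t + l *\<^sub>R \<nu> t)) integrable_on {a..b}" if l: "0 \<le> l" "l \<le> 1" for l
  proof (rule measurable_bounded_by_integrable_imp_integrable[OF _ Hi[of K]])
    show "(\<lambda>t. L t (x t + l *\<^sub>R \<eta> t) (g t + l *\<^sub>R \<nu> t)) \<in> borel_measurable (lebesgue_on {a..b})"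
      using mx m\<eta> by (intro compose_measurable borel_measurable_add borel_measurable_scaleR) auto
    show "norm (L t (x t + l *\<^sub>R \<eta> t) (g t + l *\<^sub>R \<nu> t)) \<le> K * H t" if t: "t \<in> {a..b}" for t
    proof -
      have "K * (1 + (norm (g t + l *\<^sub>R \<nu> t))\<^sup>2) \<le> K * H t"
        unfolding H_def using K(1) by (intro mult_left_mono le(4)[OF t l]) simp
      with K(2)[OF t le(1)[OF t l], of "g t + l *\<^sub>R \<nu> t"] show ?thesis by simp
    qed
  qed auto
  from Li[of 0] have L0: "(\<lambda>t. L t (x t) (g t)) integrable_on {a..b}" by simp
  define q where "q n t = (L t (x t + e n *\<^sub>R \<eta> t) (g t + e n *\<^sub>R \<nu> t) - L t (x t) (g t)) / e n" for n t
  have qi: "q n integrable_on {a..b}" for n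
    unfolding q_def divide_inverse using Li[of "e n"] e[of n] L0
    by (intro integrable_on_mult_left integrable_diff) auto
  have bound: "norm (q n t) \<le> K * C * H t" if t: "t \<in> {a..b}" for n t
  proof -
    let ?f = "\<lambda>l. L t (x t + l *\<^sub>R \<eta> t) (g t + l *\<^sub>R \<nu> t)"
    have "\<exists>l. 0 < l \<and> l < e n \<and> ?f (e n) - ?f 0 = (e n - 0) * f' (t, x t + l *\<^sub>R \<eta> t, g t + l *\<^sub>R \<nu> t) (0, \<eta> t, \<nu> t)"
      by (rule MVT2) (use e line_derivative[OF t] in auto)
    then obtain l where l: "0 < l" "l < e n" "?f (e n) - ?f 0 = e n * f' (t, x t + l *\<^sub>R \<eta> t, g t + l *\<^sub>R \<nu> t) (0, \<eta> t, \<nu> t)"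
      by auto
    have l1: "0 \<le> l" "l \<le> 1" using l e[of n] by auto
    have "q n t = f' (t, x t + l *\<^sub>R \<eta> t, g t + l *\<^sub>R \<nu> t) (0, \<eta> t, \<nu> t)"
      using l(3) e(1)[of n] by (simp add: q_def)
    also have "norm \<dots> \<le> K * (1 + (norm (g t + l *\<^sub>R \<nu> t))\<^sup>2) * (norm (\<eta> t) + norm (\<nu> t))"
      using K(3)[OF t le(1)[OF t l1]] by simp
    also have "\<dots> \<le> K * H t * C"
      using le(3,4)[OF t l1] K(1) by (intro mult_mono) (auto simp: H_def)
    finally show ?thesis by (simp add: mult_ac)
  qed
  have conv: "(\<lambda>n. q n t) \<longlonglongrightarrow> f' (t, x t, g t) (0, \<eta> t, \<nu> t)" if t: "t \<in> {a..b}" for t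
  proof -
    let ?f = "\<lambda>l. L t (x t + l *\<^sub>R \<eta> t) (g t + l *\<^sub>R \<nu> t)"
    have 1: "((\<lambda>l. (?f l - ?f 0) / (l - 0)) \<longlongrightarrow> f' (t, x t, g t) (0, \<eta> t, \<nu> t)) (at 0)"
      using line_derivative[OF t, of "x t" "\<eta> t" "g t" "\<nu> t" 0] unfolding has_field_derivative_iff by simp
    have "e \<longlonglongrightarrow> 0" unfolding e_def by (rule LIMSEQ_inverse_real_of_nat[unfolded inverse_eq_divide])
    moreover have "\<forall>n. e n \<in> UNIV \<and> e n \<noteq> 0" using e(1) by (metis UNIV_I less_irrefl)
    ultimately have "filterlim e (at 0) sequentially"
      unfolding filterlim_at by (simp add: always_eventually)
    from filterlim_compose[OF 1 this] show ?thesis by (simp add: q_def)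
  qed
  have dc: "(\<lambda>n. integral {a..b} (q n)) \<longlonglongrightarrow> integral {a..b} (\<lambda>t. f' (t, x t, g t) (0, \<eta> t, \<nu> t))"
    by (rule dominated_convergence(2)[OF qi Hi[of "K * C"] bound conv])
  have "integral {a..b} (q n) = (integral {a..b} (\<lambda>t. L t (x t + e n *\<^sub>R \<eta> t) (g t + e n *\<^sub>R \<nu> t))
      - integral {a..b} (\<lambda>t. L t (x t) (g t))) / e n" for n
    unfolding q_def using Li[of "e n"] less_imp_le[OF e(1)[of n]] e(2)[of n] L0
    by (simp add: integral_diff)
  with dc show "((\<lambda>n. (integral {a..b} (\<lambda>t. L t (x t + (1 / real (Suc n)) *\<^sub>R \<eta> t) (g t + (1 / real (Suc n)) *\<^sub>R \<nu> t))
          - integral {a..b} (\<lambda>t. L t (x t) (g t))) / (1 / real (Suc n)))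
        \<longlonglongrightarrow> integral {a..b} (\<lambda>t. f' (t, x t, g t) (0, \<eta> t, \<nu> t)))"
    by (simp add: e_def)
qed

text \<open>The hat function with peak \<open>1\<close> at \<open>s\<close>. It vanishes at both
  ends of the edge, so a variation built from it lives on one edge alone.\<close>

definition tent :: "real \<Rightarrow> real \<Rightarrow> real" where
  "tent s t = (if t \<le> s then (t - a) / (s - a) else (b - t) / (b - s))"

definition tent' :: "real \<Rightarrow> real \<Rightarrow> real" where
  "tent' s t = (if t \<le> s then 1 / (s - a) else - (1 / (b - s)))"

lemma tent_derivative:
  assumes s: "a < s" "s < b" and t: "t \<noteq> s"
  shows "((\<lambda>t. tent s t *\<^sub>R e) has_vector_derivative tent' s t *\<^sub>R e) (at t within S)"
proof -
  have 1: "((\<lambda>t. ((t - a) / (s - a)) *\<^sub>R e) has_vector_derivative (1 / (s - a)) *\<^sub>R e) (at t within T)" for T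
    by (rule bounded_linear.has_vector_derivative[OF bounded_linear_scaleR_left ramp_derivative(1)])
  have 2: "((\<lambda>t. ((b - t) / (b - s)) *\<^sub>R e) has_vector_derivative (- (1 / (b - s))) *\<^sub>R e) (at t within T)" for T
    by (rule bounded_linear.has_vector_derivative[OF bounded_linear_scaleR_left ramp_derivative(2)])
  show ?thesis
  proof (cases "t < s")
    case True
    have "((\<lambda>t. tent s t *\<^sub>R e) has_vector_derivative (1 / (s - a)) *\<^sub>R e) (at t within insert t S)"
      by (rule has_vector_derivative_transform_within[OF 1, where d="s - t"])
        (use True in \<open>auto simp: dist_real_def tent_def\<close>)
    then show ?thesis using True by (auto simp: tent'_def intro: has_vector_derivative_within_subset)
  next
    case False
    have "((\<lambda>t. tent s t *\<^sub>R e) has_vector_derivative (- (1 / (b - s))) *\<^sub>R e) (at t within insert t S)"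
      by (rule has_vector_derivative_transform_within[OF 2, where d="t - s"])
        (use False t in \<open>auto simp: dist_real_def tent_def\<close>)
    then show ?thesis using False t by (auto simp: tent'_def intro: has_vector_derivative_within_subset)
  qed
qed

lemma tent_w12_pair:
  assumes s: "a < s" "s < b"
  shows "w12_pair a b (\<lambda>t. tent s t *\<^sub>R e) (\<lambda>t. tent' s t *\<^sub>R (e::'e::euclidean_space))"
proof -
  have 1: "w12_pair a s (\<lambda>t. ((t - a) / (s - a)) *\<^sub>R e) (\<lambda>t. (1 / (s - a)) *\<^sub>R e)"
    by (intro w12_pair_C1 bounded_linear.has_vector_derivative[OF bounded_linear_scaleR_left] ramp_derivative) simp
  have 2: "w12_pair s b (\<lambda>t. ((b - t) / (b - s)) *\<^sub>R e) (\<lambda>t. (- (1 / (b - s))) *\<^sub>R e)"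
    by (intro w12_pair_C1 bounded_linear.has_vector_derivative[OF bounded_linear_scaleR_left] ramp_derivative) simp
  have "w12_pair a b (\<lambda>t. if t \<le> s then ((t - a) / (s - a)) *\<^sub>R e else ((b - t) / (b - s)) *\<^sub>R e)
      (\<lambda>t. if t \<le> s then (1 / (s - a)) *\<^sub>R e else (- (1 / (b - s))) *\<^sub>R e)"
    by (rule w12_pair_glue[OF _ _ 1 2]) (use s in auto)
  moreover have "(\<lambda>t. tent s t *\<^sub>R e) = (\<lambda>t. if t \<le> s then ((t - a) / (s - a)) *\<^sub>R e else ((b - t) / (b - s)) *\<^sub>R e)"
    "(\<lambda>t. tent' s t *\<^sub>R e) = (\<lambda>t. if t \<le> s then (1 / (s - a)) *\<^sub>R e else (- (1 / (b - s))) *\<^sub>R e)"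
    by (auto simp: tent_def tent'_def)
  ultimately show ?thesis by simp
qed

text \<open>Du Bois-Reymond: testing with tents shows that \<open>p - \<integral> q\<close> has the same mean on all
  intervals \<open>[a,s]\<close>.\<close>

lemma du_bois_reymond:
  fixes p q :: "real \<Rightarrow> real"
  assumes q: "q absolutely_integrable_on {a..b}" and p: "p integrable_on {a..b}"
    and weak: "\<And>s. a < s \<Longrightarrow> s < b \<Longrightarrow> ((\<lambda>t. tent s t * q t + tent' s t * p t) has_integral 0) {a..b}"
  obtains c N where "negligible N" "\<And>t. t \<in> {a..b} - N \<Longrightarrow> p t = integral {a..t} q + c"
proof -
  define I where "I t = integral {a..t} q" for t
  have prim: "primitive_on a b I q" unfolding primitive_on_def I_def using q by auto
  have cI: "continuous_on {a..b} I" by (rule primitive_on_continuous[OF prim])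
  define \<psi> where "\<psi> t = p t - I t" for t
  have \<psi>: "\<psi> integrable_on {a..b}"
    unfolding \<psi>_def by (rule integrable_diff[OF p integrable_continuous_real[OF cI]])
  define T where "T = integral {a..b} \<psi>"
  \<comment> \<open>The mean of \<open>\<psi>\<close> over the whole edge. Once every interval
    \<open>{a..s}\<close> has this mean, the indefinite integral of \<open>\<psi> t - c\<close>
    vanishes identically.\<close>
  define c where "c = T / (b - a)"
  have key: "integral {a..s} \<psi> = c * (s - a)" if s: "a < s" "s < b" for s
  proof -
    \<comment> \<open>Integration by parts on either side of the corner trades
      \<open>tent s * q\<close> for \<open>- tent' s * I\<close>; the boundary terms
      \<open>I s\<close> and \<open>- I s\<close> at the corner cancel.\<close>
    have 1: "((\<lambda>t. (1 / (s - a)) \<bullet> I t + ((t - a) / (s - a)) \<bullet> q t) has_integral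
        ((s - a) / (s - a)) \<bullet> I s - ((a - a) / (s - a)) \<bullet> I a) {a..s}"
      by (rule integration_by_parts_primitive[OF _ primitive_on_subinterval[OF prim]])
        (use s in \<open>auto intro: ramp_derivative\<close>)
    have 2: "((\<lambda>t. (- (1 / (b - s))) \<bullet> I t + ((b - t) / (b - s)) \<bullet> q t) has_integral
        ((b - b) / (b - s)) \<bullet> I b - ((b - s) / (b - s)) \<bullet> I s) {s..b}"
      by (rule integration_by_parts_primitive[OF _ primitive_on_subinterval[OF prim]])
        (use s in \<open>auto intro: ramp_derivative\<close>)
    have 3: "((\<lambda>t. if t \<le> s then (1 / (s - a)) \<bullet> I t + ((t - a) / (s - a)) \<bullet> q t
        else (- (1 / (b - s))) \<bullet> I t + ((b - t) / (b - s)) \<bullet> q t) has_integral 0) {a..b}"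
      using has_integral_glue[OF _ _ 1 2] s by simp
    have 4: "((\<lambda>t. tent' s t * \<psi> t) has_integral 0) {a..b}"
    proof -
      have "tent' s t * \<psi> t = (tent s t * q t + tent' s t * p t) - (if t \<le> s then (1 / (s - a)) \<bullet> I t + ((t - a) / (s - a)) \<bullet> q t
        else (- (1 / (b - s))) \<bullet> I t + ((b - t) / (b - s)) \<bullet> q t)" for t
        by (simp add: tent_def tent'_def \<psi>_def right_diff_distrib)
      then show ?thesis using has_integral_diff[OF weak[OF s] 3] by simp
    qed
    have \<psi>1: "\<psi> integrable_on {a..s}" and \<psi>2: "\<psi> integrable_on {s..b}"
      using integrable_on_subinterval[OF \<psi>] s by auto
    have "((\<lambda>t. if t \<le> s then (1 / (s - a)) * \<psi> t else (- (1 / (b - s))) * \<psi> t) has_integral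
        (1 / (s - a)) * integral {a..s} \<psi> + (- (1 / (b - s))) * integral {s..b} \<psi>) {a..b}"
      using s by (intro has_integral_glue has_integral_mult_right integrable_integral \<psi>1 \<psi>2) auto
    moreover have "(\<lambda>t. if t \<le> s then (1 / (s - a)) * \<psi> t else (- (1 / (b - s))) * \<psi> t) = (\<lambda>t. tent' s t * \<psi> t)"
      by (auto simp: tent'_def)
    ultimately have "(1 / (s - a)) * integral {a..s} \<psi> + (- (1 / (b - s))) * integral {s..b} \<psi> = 0"
      using has_integral_unique[OF 4] by metis
    moreover have "integral {a..s} \<psi> + integral {s..b} \<psi> = T"
      unfolding T_def by (rule Henstock_Kurzweil_Integration.integral_combine) (use s \<psi> in auto)
    ultimately have "integral {a..s} \<psi> / (s - a) = (T - integral {a..s} \<psi>) / (b - s)" by simp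
    then have "integral {a..s} \<psi> * (b - s) = (T - integral {a..s} \<psi>) * (s - a)"
      using s by (simp add: frac_eq_eq)
    then have "(b - a) * integral {a..s} \<psi> = T * (s - a)" by (simp add: algebra_simps)
    then show ?thesis using s by (simp add: c_def field_simps)
  qed
  have "integral {a..s} (\<lambda>t. \<psi> t - c) = 0" if s: "s \<in> {a..b}" for s
  proof -
    have \<psi>s: "\<psi> integrable_on {a..s}" by (rule integrable_on_subinterval[OF \<psi>]) (use s in auto)
    have "integral {a..s} \<psi> = c * (s - a)"
    proof (cases "s = a \<or> s = b")
      case True then show ?thesis using ab by (auto simp: c_def T_def)
    next
      case False then show ?thesis using key s by auto
    qed
    then show ?thesis
      using integral_diff[OF \<psi>s integrable_const_ivl[of c a s]] s by (simp add: algebra_simps)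
  qed
  moreover have "(\<lambda>t. \<psi> t - c) integrable_on {a..b}" using \<psi> by (intro integrable_diff) auto
  ultimately obtain N where "negligible N" "\<And>t. t \<in> {a..b} - N \<Longrightarrow> \<psi> t - c = 0"
    using integral_zero_imp_ae_zero[OF ab] by blast
  then show ?thesis using that[of N c] by (simp add: \<psi>_def I_def algebra_simps)
qed

text \<open>By du Bois-Reymond the momentum agrees almost everywhere with a continuous function. It
  is affine and invertible in the velocity, so the velocity agrees almost everywhere with a
  continuous \<open>y\<close>, and \<open>x\<close> is a primitive of \<open>y\<close>.\<close>

lemma weak_solution_C1:
  assumes x: "W12_on a b x"
    and weak: "\<And>s e. a < s \<Longrightarrow> s < b \<Longrightarrow>
      integral {a..b} (\<lambda>t. f' (t, x t, edge_deriv a b x t) (0, tent s t *\<^sub>R e, tent' s t *\<^sub>R e)) = 0"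
  shows "continuous_on {a..b} x" "continuous_on {a..b} (edge_deriv a b x)"
proof -
  define g where "g = edge_deriv a b x"
  have xg: "w12_pair a b x g" unfolding g_def by (rule W12_on_edge_deriv(1)[OF ab x])
  show cx: "continuous_on {a..b} x" using w12_pairD(5)[OF xg] .
  define k where "k e t = integral {a..t} (\<lambda>t. f' (t, x t, g t) (0, e, 0))" for e t
  have q: "(\<lambda>t. f' (t, x t, g t) (0, e, 0)) absolutely_integrable_on {a..b}" for e
    by (rule f'_integrable[OF xg, of "\<lambda>_. e" "\<lambda>_. 0"]) auto
  have p: "(\<lambda>t. f' (t, x t, g t) (0, 0, e)) absolutely_integrable_on {a..b}" for e
    by (rule f'_integrable[OF xg, of "\<lambda>_. 0" "\<lambda>_. e"]) auto
  have "\<exists>c N. negligible N \<and> (\<forall>t\<in>{a..b} - N. f' (t, x t, g t) (0, 0, e) = k e t + c)" for e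
  proof -
    have weak': "((\<lambda>t. tent s t * f' (t, x t, g t) (0, e, 0) + tent' s t * f' (t, x t, g t) (0, 0, e)) has_integral 0) {a..b}"
      if s: "a < s" "s < b" for s
    proof -
      have tp: "w12_pair a b (\<lambda>t. tent s t *\<^sub>R e) (\<lambda>t. tent' s t *\<^sub>R e)" by (rule tent_w12_pair[OF s])
      have b1: "\<bar>tent s t\<bar> \<le> 1" "\<bar>tent' s t\<bar> \<le> 1 / (s - a) + 1 / (b - s)" if "t \<in> {a..b}" for t
        using that s by (auto simp: tent_def tent'_def)
      have ai: "(\<lambda>t. f' (t, x t, g t) (0, tent s t *\<^sub>R e, tent' s t *\<^sub>R e)) absolutely_integrable_on {a..b}"
      proof (rule f'_integrable[OF xg w12_pairD(6,4)[OF tp]])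
        fix t assume "t \<in> {a..b}"
        from mult_right_mono[OF b1(1)[OF this], of "norm e"] mult_right_mono[OF b1(2)[OF this], of "norm e"]
        show "norm (tent s t *\<^sub>R e) + norm (tent' s t *\<^sub>R e) \<le> 1 * norm e + (1 / (s - a) + 1 / (b - s)) * norm e"
          by simp
      qed
      have w0: "integral {a..b} (\<lambda>t. f' (t, x t, g t) (0, tent s t *\<^sub>R e, tent' s t *\<^sub>R e)) = 0"
        unfolding g_def by (rule weak[OF s])
      have hi: "((\<lambda>t. f' (t, x t, g t) (0, tent s t *\<^sub>R e, tent' s t *\<^sub>R e)) has_integral 0) {a..b}"
        using integrable_integral[OF set_lebesgue_integral_eq_integral(1)[OF ai]] unfolding w0 .
      have spl: "(0::real, tent s t *\<^sub>R e, tent' s t *\<^sub>R e) = tent s t *\<^sub>R (0, e, 0) + tent' s t *\<^sub>R (0, 0, e)" for t by simp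
      show ?thesis using hi unfolding spl blinfun.add_right blinfun.scaleR_right real_scaleR_def .
    qed
    obtain c N where "negligible N"
      "\<And>t. t \<in> {a..b} - N \<Longrightarrow> f' (t, x t, g t) (0, 0, e) = integral {a..t} (\<lambda>t. f' (t, x t, g t) (0, e, 0)) + c"
      by (rule du_bois_reymond[OF q[of e] set_lebesgue_integral_eq_integral(1)[OF p[of e]] weak']) auto
    then show ?thesis unfolding k_def by (intro exI[of _ c] exI[of _ N]) simp
  qed
  then obtain c N where N: "\<And>e. negligible (N e)" "\<And>e t. t \<in> {a..b} - N e \<Longrightarrow> f' (t, x t, g t) (0, 0, e) = k e t + c e"
    by metis
  define N' where "N' = (\<Union>e\<in>Basis. N e)"
  have N': "negligible N'" unfolding N'_def using N(1) by (intro negligible_Union) auto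
  define M where "M t = (*v) (D_vv L t (x t) 0)" for t
  \<comment> \<open>The continuous version of the momentum minus the momentum at zero velocity: the
    right-hand side of the linear equation for the velocity.\<close>
  define r where "r t = (\<Sum>e\<in>Basis. (k e t + c e - f' (t, x t, 0) (0, 0, e)) *\<^sub>R e)" for t
  have linM: "linear (M t)" for t unfolding M_def by (rule matrix_vector_mul_linear)
  have injM: "u = 0" if "t \<in> {a..b}" "M t u = 0" for t u
    using legendre[of t u "x t" 0] that by (auto simp: M_def)
  have cM: "continuous_on {a..b} (\<lambda>t. M t u)" for u
    unfolding M_def by (rule second_derivatives_continuous(1)[OF cx continuous_on_const])
  have cr: "continuous_on {a..b} r"
  proof -
    have "continuous_on {a..b} (k e)" for e
      unfolding k_def using q[of e] by (intro indefinite_integral_continuous_1 set_lebesgue_integral_eq_integral(1))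
    moreover have "continuous_on {a..b} (\<lambda>t. f' (t, x t, 0))"
      by (intro continuous_intros continuous_on_compose2[OF cont_f'] cx) auto
    ultimately show ?thesis unfolding r_def by (intro continuous_intros)
  qed
  have Mg: "M t (g t) = r t" if t: "t \<in> {a..b} - N'" for t
  proof (rule euclidean_eqI)
    fix e :: "real^'d" assume e: "e \<in> Basis"
    have "M t (g t) \<bullet> e = D_v L t (x t) (g t) \<bullet> e - D_v L t (x t) 0 \<bullet> e"
      using D_v_affine[of t "x t" "g t" 0] t by (simp add: M_def inner_add_left)
    also have "\<dots> = k e t + c e - f' (t, x t, 0) (0, 0, e)"
      using t e N(2)[of t e] by (simp add: D_v_inner N'_def)
    finally show "M t (g t) \<bullet> e = r t \<bullet> e"
      using e by (simp add: r_def inner_sum_left_Basis)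
  qed
  have "\<exists>y. M t y = r t" if "t \<in> {a..b}" for t
  proof -
    have "inj (M t)" using injM[OF that] linear_injective_0[OF linM] by blast
    then have "surj (M t)" using linear_injective_imp_surjective[OF linM] by blast
    then show ?thesis by (metis surjD)
  qed
  then obtain y where y: "\<And>t. t \<in> {a..b} \<Longrightarrow> M t (y t) = r t" by metis
  have cy: "continuous_on {a..b} y"
    by (rule continuous_linear_solution[OF linM injM cM cr y])
  have gy: "g t = y t" if t: "t \<in> {a..b} - N'" for t
  proof -
    have "M t (g t - y t) = 0" using linear_diff[OF linM] Mg[OF t] y[of t] t by simp
    then show ?thesis using injM[of t "g t - y t"] t by auto
  qed
  have xy: "x t = x a + integral {a..t} y" if t: "t \<in> {a..b}" for t
  proof -
    have "integral {a..t} g = integral {a..t} y" by (rule integral_spike[OF N']) (use gy t in auto)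
    then show ?thesis using primitive_onD(2)[OF w12_pairD(1)[OF xg] t] by simp
  qed
  have "(x has_vector_derivative y t) (at t within {a..b})" if t: "t \<in> {a..b}" for t
  proof -
    have "((\<lambda>u. x a + integral {a..u} y) has_vector_derivative y t) (at t within {a..b})"
      using has_vector_derivative_add[OF has_vector_derivative_const integral_has_vector_derivative[OF cy t]] by simp
    then show ?thesis by (rule has_vector_derivative_transform[OF t xy, rotated])
  qed
  then have "edge_deriv a b x t = y t" if "t \<in> {a..b}" for t
    unfolding edge_deriv_def using ab that by (intro vector_derivative_within_closed_interval) auto
  then show "continuous_on {a..b} (edge_deriv a b x)"
    by (intro continuous_on_eq[OF cy]) simp
qed

end

section \<open>Reduction of the star to one system\<close>

lemma has_integral_affine_real:
  fixes f :: "real \<Rightarrow> 'a::euclidean_space"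
  assumes "(f has_integral i) {l * s + c..l * t + c}" "l > 0"
  shows "((\<lambda>r. f (l * r + c)) has_integral (i /\<^sub>R l)) {s..t}"
proof -
  have "(l * r + c - c) /\<^sub>R l = r" for r using assms(2) by simp
  with has_integral_affinity'[of f i "l * s + c" "l * t + c" l c] assms
  show ?thesis by (simp only: cbox_interval real_scaleR_def DIM_real power_one_right simp_thms)
qed

lemma integrable_affine_real:
  fixes f :: "real \<Rightarrow> 'a::euclidean_space"
  assumes "f integrable_on {l * s + c..l * t + c}" "l > 0"
  shows "(\<lambda>r. f (l * r + c)) integrable_on {s..t}"
  by (rule has_integral_integrable[OF has_integral_affine_real[OF integrable_integral[OF assms(1)] assms(2)]])

lemma negligible_affine_vimage:
  assumes "negligible N" "(l::real) \<noteq> 0"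
  shows "negligible {s. l * s + c \<in> N}"
proof -
  have "negligible ((\<lambda>t. (t - c) * (1 / l)) ` N)"
  proof (rule negligible_differentiable_image_negligible[OF order_refl assms(1)])
    show "(\<lambda>t. (t - c) * (1 / l)) differentiable_on N"
      by (intro differentiable_on_mult differentiable_on_diff differentiable_on_ident differentiable_on_const)
  qed
  moreover have "{s. l * s + c \<in> N} \<subseteq> (\<lambda>t. (t - c) * (1 / l)) ` N"
  proof
    fix s assume "s \<in> {s. l * s + c \<in> N}"
    then show "s \<in> (\<lambda>t. (t - c) * (1 / l)) ` N" using assms(2) by (intro image_eqI[of _ _ "l * s + c"]) auto
  qed
  ultimately show ?thesis using negligible_subset by blast
qed

text \<open>The linear map \<open>F\<close> lets one lemma serve both directions: a coordinate
  projection when a variation is cut into edges, an axis embedding when it is assembled from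
  them.\<close>

lemma W12_on_reparam:
  fixes u :: "real \<Rightarrow> 'a::euclidean_space" and F :: "'a \<Rightarrow> 'b::euclidean_space"
  assumes st: "s < t" and l: "l > 0" and F: "linear F" and u: "W12_on (l * s + c) (l * t + c) u"
  shows "W12_on s t (\<lambda>r. F (u (l * r + c)))"
    and "\<exists>N. negligible N \<and> (\<forall>r\<in>{s..t} - N. edge_deriv s t (\<lambda>r. F (u (l * r + c))) r
      = l *\<^sub>R F (edge_deriv (l * s + c) (l * t + c) u (l * r + c)))"
proof -
  let ?a = "l * s + c" and ?b = "l * t + c"
  have ab: "?a < ?b" using st l by simp
  define g where "g = edge_deriv ?a ?b u"
  have ug: "w12_pair ?a ?b u g" unfolding g_def by (rule W12_on_edge_deriv(1)[OF ab u])
  obtain N where N: "negligible N" "\<And>r. r \<in> {?a..?b} - N \<Longrightarrow> (u has_vector_derivative g r) (at r within {?a..?b})"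
    using W12_on_edge_deriv(2)[OF ab u] unfolding g_def by blast
  define N' where "N' = {r. l * r + c \<in> N}"
  have N': "negligible N'" unfolding N'_def by (rule negligible_affine_vimage[OF N(1)]) (use l in simp)
  have bF: "bounded_linear F" using F linear_conv_bounded_linear by blast
  have img: "l * r + c \<in> {?a..?b}" if "r \<in> {s..t}" for r using that l by (auto intro: mult_left_mono)
  let ?v = "\<lambda>r. F (u (l * r + c))" and ?h = "\<lambda>r. l *\<^sub>R F (g (l * r + c))"
  have der: "(?v has_vector_derivative ?h r) (at r within {s..t})" if r: "r \<in> {s..t} - N'" for r
  proof -
    have "((\<lambda>r. l * r + c) has_vector_derivative l) (at r within {s..t})"
      by (auto intro!: derivative_eq_intros simp flip: has_real_derivative_iff_has_vector_derivative)
    moreover have "(u has_vector_derivative g (l * r + c)) (at (l * r + c) within (\<lambda>r. l * r + c) ` {s..t})"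
      by (rule has_vector_derivative_within_subset[OF N(2)]) (use img r in \<open>auto simp: N'_def\<close>)
    ultimately have "(u \<circ> (\<lambda>r. l * r + c) has_vector_derivative l *\<^sub>R g (l * r + c)) (at r within {s..t})"
      by (rule vector_diff_chain_within)
    from bounded_linear.has_vector_derivative[OF bF this]
    show ?thesis by (simp add: o_def linear_scale[OF F])
  qed
  have "w12_pair s t ?v ?h"
    unfolding w12_pair_def primitive_on_def
  proof (intro conjI ballI)
    note gi = w12_pairD(3)[OF ug]
    have gF: "(\<lambda>r. F (g r)) absolutely_integrable_on {?a..?b}"
      using absolutely_integrable_linear[OF gi bF] by (simp add: o_def)
    have "(\<lambda>r. F (g (l * r + c))) absolutely_integrable_on {s..t}"
      using integrable_affine_real[OF _ l, of "\<lambda>r. F (g r)"] integrable_affine_real[OF _ l, of "\<lambda>r. norm (F (g r))"] gF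
      unfolding absolutely_integrable_on_def by blast
    then show "?h absolutely_integrable_on {s..t}" by (rule absolutely_integrable_scaleR_left)
    have bound: "(norm (?h r))\<^sup>2 \<le> (l * onorm F)\<^sup>2 * (norm (g (l * r + c)))\<^sup>2" for r
    proof -
      have "norm (?h r) \<le> l * onorm F * norm (g (l * r + c))"
        using onorm[OF bF, of "g (l * r + c)"] l by (simp add: mult.assoc)
      then have "(norm (?h r))\<^sup>2 \<le> (l * onorm F * norm (g (l * r + c)))\<^sup>2" by (intro power_mono) auto
      then show ?thesis by (simp add: power_mult_distrib)
    qed
    show "(\<lambda>r. (norm (?h r))\<^sup>2) integrable_on {s..t}"
    proof (rule measurable_bounded_by_integrable_imp_integrable[OF _ _ _ _])
      have "?h \<in> borel_measurable (lebesgue_on {s..t})"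
        using \<open>?h absolutely_integrable_on {s..t}\<close> by (simp add: absolutely_integrable_imp_borel_measurable)
      then show "(\<lambda>r. (norm (?h r))\<^sup>2) \<in> borel_measurable (lebesgue_on {s..t})" by measurable
      show "(\<lambda>r. (l * onorm F)\<^sup>2 * (norm (g (l * r + c)))\<^sup>2) integrable_on {s..t}"
        by (rule integrable_on_mult_right[OF integrable_affine_real[OF w12_pairD(2)[OF ug] l]])
    qed (use bound in auto)
    fix r assume r: "r \<in> {s..t}"
    have "(g has_integral (u (l * r + c) - u ?a)) {?a..l * r + c}"
    proof -
      have "g integrable_on {?a..l * r + c}"
        using w12_pairD(3)[OF w12_pair_subinterval[OF ug, of ?a "l * r + c"]] img[OF r] set_lebesgue_integral_eq_integral(1) by auto
      moreover have "u (l * r + c) - u ?a = integral {?a..l * r + c} g"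
        using primitive_onD(2)[OF w12_pairD(1)[OF ug] img[OF r]] by simp
      ultimately show ?thesis by (simp add: has_integral_integral)
    qed
    from has_integral_linear[OF has_integral_affine_real[OF this l] bF]
    have "((\<lambda>r. F (g (l * r + c))) has_integral F ((u (l * r + c) - u ?a) /\<^sub>R l)) {s..r}" by (simp add: o_def)
    from has_integral_cmul[OF this, of l]
    have "(?h has_integral (?v r - ?v s)) {s..r}"
      using l by (simp add: linear_scale[OF F] linear_diff[OF F])
    from integral_unique[OF this] show "?v r = ?v s + integral {s..r} ?h" by (simp only: add_diff_cancel_left' algebra_simps)
  qed
  then show "W12_on s t ?v" using W12_onI[OF _ N' der] by blast
  have "edge_deriv s t ?v r = ?h r" if "r \<in> {s..t} - N'" for r
    unfolding edge_deriv_def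
    using that st der[OF that] by (intro vector_derivative_within_closed_interval) auto
  then show "\<exists>N. negligible N \<and> (\<forall>r\<in>{s..t} - N. edge_deriv s t ?v r = l *\<^sub>R F (edge_deriv ?a ?b u (l * r + c)))"
    using N' unfolding g_def by blast
qed

lemma W12_on_cong:
  assumes ab: "a < b" and u: "W12_on a b u" and eq: "\<And>t. t \<in> {a..b} \<Longrightarrow> u t = v t"
  shows "W12_on a b v" "t \<in> {a..b} \<Longrightarrow> edge_deriv a b v t = edge_deriv a b u t"
proof -
  note r = W12_on_edge_deriv[OF ab u]
  have tr: "(v has_vector_derivative d) (at t within {a..b}) \<longleftrightarrow> (u has_vector_derivative d) (at t within {a..b})"
    if "t \<in> {a..b}" for t d
    using has_vector_derivative_transform[OF that, of u v] has_vector_derivative_transform[OF that, of v u] eq by metis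
  have "w12_pair a b v (edge_deriv a b u)"
    using r(1) primitive_on_cong[of a b u _ v] ab eq unfolding w12_pair_def by simp
  then show "W12_on a b v" using r(2) tr W12_onI by (metis (no_types, lifting) DiffD1)
  show "edge_deriv a b v t = edge_deriv a b u t" if "t \<in> {a..b}"
    unfolding edge_deriv_def vector_derivative_def using tr[OF that] by simp
qed

lemma linear_axis: "linear (axis j :: 'a::real_vector \<Rightarrow> 'a^'n)"
  by (rule linearI) (auto simp: axis_def vec_eq_iff)

lemma linear_vec_nth: "linear (\<lambda>v :: 'a::real_vector^'n. v $ j)"
  by (rule linearI) auto

lemma vec_lambda_eq_sum_axis: "(\<chi> j. f j) = (\<Sum>j\<in>UNIV. axis j (f j :: 'a::real_vector))"
  by (simp add: vec_eq_iff axis_def if_distrib cong: if_cong)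

lemma W12_on_sum:
  assumes "finite A" "\<And>j. j \<in> A \<Longrightarrow> W12_on 0 1 (u j)"
  shows "W12_on 0 1 (\<lambda>t. \<Sum>j\<in>A. u j t :: 'a::euclidean_space)"
  using assms
proof (induction A rule: finite_induct)
  case empty
  have "w12_rep (\<lambda>t. 0) (\<lambda>t. 0 :: 'a)" unfolding w12_rep_def by (intro conjI w12_pair_C1 exI[of _ "{}"]) auto
  then show ?case using w12_rep_imp_W12_on by simp
next
  case (insert j A)
  have "w12_rep (u j + 1 *\<^sub>R (\<lambda>t. \<Sum>j\<in>A. u j t)) (\<lambda>t. edge_deriv 0 1 (u j) t + 1 *\<^sub>R edge_deriv 0 1 (\<lambda>t. \<Sum>j\<in>A. u j t) t)"
    using insert by (intro w12_rep_add_scaleR w12_rep_edge_deriv) auto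
  then have "W12_on 0 1 (u j + 1 *\<^sub>R (\<lambda>t. \<Sum>j\<in>A. u j t))" by (rule w12_rep_imp_W12_on)
  moreover have "u j + 1 *\<^sub>R (\<lambda>t. \<Sum>j\<in>A. u j t) = (\<lambda>t. \<Sum>j\<in>insert j A. u j t)" using insert by auto
  ultimately show ?case by simp
qed

lemma matrix_inv_right_positive:
  fixes A :: "real^'d::finite^'d"
  assumes "\<And>w. w \<noteq> 0 \<Longrightarrow> (A *v w) \<bullet> w > 0"
  shows "A ** matrix_inv A = mat 1"
proof -
  have "inj ((*v) A)"
    unfolding linear_injective_0[OF matrix_vector_mul_linear] using assms by fastforce
  then obtain B where "B ** A = mat 1" using matrix_left_invertible_injective by blast
  then have "A ** B = mat 1 \<and> B ** A = mat 1" using matrix_left_right_inverse by blast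
  then show ?thesis unfolding matrix_inv_def by (metis (mono_tags, lifting) someI_ex)
qed

lemma transpose_inner: "(transpose A *v x) \<bullet> y = x \<bullet> (A *v y)" for A :: "real^'n::finite^'m::finite"
  by (simp add: dot_lmul_matrix)

lemma has_vector_derivative_vec_lambda:
  fixes f :: "'n::finite \<Rightarrow> real \<Rightarrow> 'a::euclidean_space"
  assumes "\<And>j. (f j has_vector_derivative f' j) F"
  shows "((\<lambda>t. \<chi> j. f j t) has_vector_derivative (\<chi> j. f' j)) F"
proof -
  have bl: "bounded_linear (axis j :: 'a \<Rightarrow> 'a^'n)" for j
    using linear_axis linear_conv_bounded_linear by blast
  have "((\<lambda>t. \<Sum>j\<in>UNIV. axis j (f j t)) has_vector_derivative (\<Sum>j\<in>UNIV. axis j (f' j))) F"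
    by (rule has_vector_derivative_sum) (rule bounded_linear.has_vector_derivative[OF bl assms])
  then show ?thesis unfolding vec_lambda_eq_sum_axis .
qed

section \<open>The star as a single Jacobi flow\<close>

locale star_bolza =
  fixes a b :: "'m::finite \<Rightarrow> real"
    and L :: "'m \<Rightarrow> 'd::finite edge_lagrangian"
    and y :: "'m \<Rightarrow> real^'d"
    and x :: "'m \<Rightarrow> real \<Rightarrow> real^'d"
    and \<gamma> :: "'m \<Rightarrow> real \<Rightarrow> 'd phase \<Rightarrow> 'd phase"
  assumes edges: "\<And>j. a j < b j"
    and lagrangian: "star_lagrangian a b L"
    and critical: "bolza_critical_point a b L y x"
    and fundamental: "\<And>j. is_fundamental_solution (a j) (b j)
                        (hamiltonian_matrix (L j) (a j) (b j) (x j)) (\<gamma> j)"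
begin

lemma C2_edge_exists: "\<exists>f' f''. C2_edge (a j) (b j) (L j) f' f''"
proof -
  note l = lagrangian[unfolded star_lagrangian_def]
  have C2: "\<forall>j. C2_on ({a j..b j} \<times> UNIV) (\<lambda>(t, q, v). L j t q v)"
    and L1: "\<forall>j. \<forall>t\<in>{a j..b j}. \<forall>q v w. w \<noteq> 0 \<longrightarrow> (D_vv (L j) t q v *v w) \<bullet> w > 0"
    and L2: "\<forall>j. \<forall>t\<in>{a j..b j}. \<forall>q. \<exists>(A :: real^'d^'d) B c. \<forall>v. L j t q v = (A *v v) \<bullet> v + B \<bullet> v + c"
    by (rule l[THEN conjunct2, THEN conjunct2, THEN conjunct1]
        l[THEN conjunct2, THEN conjunct2, THEN conjunct2, THEN conjunct1]
        l[THEN conjunct2, THEN conjunct2, THEN conjunct2, THEN conjunct2])+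
  from C2[THEN spec, of j, unfolded C2_on_def]
  obtain f' f'' where f: "\<forall>z\<in>{a j..b j} \<times> UNIV.
        ((\<lambda>(t, q, v). L j t q v) has_derivative blinfun_apply (f' z)) (at z within {a j..b j} \<times> UNIV)"
      "\<forall>z\<in>{a j..b j} \<times> UNIV. (f' has_derivative blinfun_apply (f'' z)) (at z within {a j..b j} \<times> UNIV)"
      "continuous_on ({a j..b j} \<times> UNIV) f''"
    by (elim exE conjE)
  have "C2_edge (a j) (b j) (L j) f' f''"
  proof
    show "a j < b j" by (rule edges)
    show "\<exists>(A :: real^'d^'d) B c. \<forall>v. L j t q v = (A *v v) \<bullet> v + B \<bullet> v + c" if "t \<in> {a j..b j}" for t q
      by (rule L2[THEN spec, THEN bspec, THEN spec, OF that])
    show "(D_vv (L j) t q v *v w) \<bullet> w > 0" if "t \<in> {a j..b j}" "w \<noteq> 0" for t q v w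
      by (rule L1[THEN spec, THEN bspec, THEN spec, THEN spec, THEN spec, THEN mp, OF that])
  qed (rule f(1)[THEN bspec] f(2)[THEN bspec] f(3); assumption?)+
  then show ?thesis by (intro exI)
qed

lemma x_W12: "W12_on (a j) (b j) (x j)"
  using critical unfolding bolza_critical_point_def bolza_paths_def by simp

text \<open>A tent on edge \<open>j\<close>, extended by \<open>0\<close>, is an admissible
  variation. The other edges contribute a constant to the action, so the sequence limit from
  \<open>first_variation\<close> is the derivative, which criticality makes
  \<open>0\<close>.\<close>

lemma weak_euler_lagrange:
  assumes E: "C2_edge (a j) (b j) (L j) f' f''" and s: "a j < s" "s < b j"
  shows "integral {a j..b j} (\<lambda>t. f' (t, x j t, edge_deriv (a j) (b j) (x j) t)
    (0, C2_edge.tent (a j) (b j) s t *\<^sub>R e, C2_edge.tent' (a j) (b j) s t *\<^sub>R e)) = 0" (is "?I = 0")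
proof -
  interpret E: C2_edge "a j" "b j" "L j" f' f'' by fact
  define \<eta> where "\<eta> t = E.tent s t *\<^sub>R e" for t
  define \<nu> where "\<nu> t = E.tent' s t *\<^sub>R e" for t
  define g where "g = edge_deriv (a j) (b j) (x j)"
  define \<xi> where "\<xi> i t = (if i = j \<and> t \<in> {a j..b j} then \<eta> t else 0)" for i t
  have \<eta>: "w12_pair (a j) (b j) \<eta> \<nu>" unfolding \<eta>_def \<nu>_def by (rule E.tent_w12_pair[OF s])
  have d\<eta>: "(\<eta> has_vector_derivative \<nu> t) (at t within S)" if "t \<noteq> s" for t S
    unfolding \<eta>_def \<nu>_def by (rule E.tent_derivative[OF s that])
  have \<eta>0: "\<eta> (a j) = 0" "\<eta> (b j) = 0" using s by (auto simp: \<eta>_def E.tent_def)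
  have "W12_on (a j) (b j) \<eta>"
    by (rule W12_onI[OF \<eta>, of "{s}"]) (use d\<eta> in auto)
  then have 1: "W12_on (a j) (b j) (\<xi> j)"
    by (rule W12_on_cong(1)[OF edges]) (simp add: \<xi>_def)
  have "W12_on (a i) (b i) (\<lambda>_. 0 :: real^'d)" for i
    by (rule W12_onI[OF w12_pair_C1, of _ _ _ "\<lambda>_. 0" "{}"]) auto
  moreover have "\<xi> i = (\<lambda>_. 0)" if "i \<noteq> j" for i using that by (auto simp: \<xi>_def)
  ultimately have W: "W12_on (a i) (b i) (\<xi> i)" for i using 1 by (cases "i = j") simp_all
  have "\<xi> i (a i) = 0" "\<xi> i (b i) = 0" for i using \<eta>0 by (auto simp: \<xi>_def)
  then have "\<xi> \<in> bolza_variations a b"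
    unfolding bolza_variations_def bolza_paths_def using W by (simp add: \<xi>_def)
  then have der: "((\<lambda>\<epsilon>. lagrangian_action a b L (x + \<epsilon> *\<^sub>R \<xi>)) has_real_derivative 0) (at 0)"
    by (rule critical[unfolded bolza_critical_point_def, THEN conjunct2, THEN bspec])
  define Act where "Act \<epsilon> = integral {a j..b j} (\<lambda>t. L j t (x j t + \<epsilon> *\<^sub>R \<eta> t) (g t + \<epsilon> *\<^sub>R \<nu> t))" for \<epsilon>
  define c where "c = (\<Sum>i\<in>UNIV - {j}. integral {a i..b i} (\<lambda>t. L i t (x i t) (edge_deriv (a i) (b i) (x i) t)))"
  obtain N where N: "negligible N" "\<And>t. t \<in> {a j..b j} - N \<Longrightarrow> (x j has_vector_derivative g t) (at t within {a j..b j})"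
    using W12_on_edge_deriv(2)[OF edges x_W12[of j]] unfolding g_def by (elim exE conjE) blast
  have act: "lagrangian_action a b L (x + \<epsilon> *\<^sub>R \<xi>) = Act \<epsilon> + c" for \<epsilon>
  proof -
    let ?f = "\<lambda>i. integral {a i..b i} (\<lambda>t. L i t ((x + \<epsilon> *\<^sub>R \<xi>) i t) (edge_deriv (a i) (b i) ((x + \<epsilon> *\<^sub>R \<xi>) i) t))"
    have "?f j = Act \<epsilon>"
      unfolding Act_def
    proof (rule integral_spike[of "N \<union> {s}"])
      fix t assume t: "t \<in> {a j..b j} - (N \<union> {s})"
      have "((\<lambda>t. x j t + \<epsilon> *\<^sub>R \<eta> t) has_vector_derivative g t + \<epsilon> *\<^sub>R \<nu> t) (at t within {a j..b j})"
        using t by (intro has_vector_derivative_add bounded_linear.has_vector_derivative[OF bounded_linear_scaleR_right] N(2) d\<eta>) auto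
      then have "((x + \<epsilon> *\<^sub>R \<xi>) j has_vector_derivative g t + \<epsilon> *\<^sub>R \<nu> t) (at t within {a j..b j})"
        by (rule has_vector_derivative_transform[rotated 2]) (use t in \<open>auto simp: \<xi>_def\<close>)
      then have "edge_deriv (a j) (b j) ((x + \<epsilon> *\<^sub>R \<xi>) j) t = g t + \<epsilon> *\<^sub>R \<nu> t"
        unfolding edge_deriv_def using t edges by (intro vector_derivative_within_closed_interval) auto
      then show "L j t (x j t + \<epsilon> *\<^sub>R \<eta> t) (g t + \<epsilon> *\<^sub>R \<nu> t) = L j t ((x + \<epsilon> *\<^sub>R \<xi>) j t) (edge_deriv (a j) (b j) ((x + \<epsilon> *\<^sub>R \<xi>) j) t)"
        using t by (simp add: \<xi>_def)
    qed (use N(1) in simp)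
    moreover have "?f i = integral {a i..b i} (\<lambda>t. L i t (x i t) (edge_deriv (a i) (b i) (x i) t))" if "i \<noteq> j" for i
    proof -
      have eq: "(x + \<epsilon> *\<^sub>R \<xi>) i = x i" using that by (auto simp: \<xi>_def)
      show ?thesis unfolding eq ..
    qed
    ultimately show ?thesis
      unfolding lagrangian_action_def c_def by (subst sum.remove[of UNIV j]) (auto intro: sum.cong)
  qed
  define k where "k n = 1 / real (Suc n)" for n
  have "((\<lambda>\<epsilon>. (Act \<epsilon> - Act 0) / (\<epsilon> - 0)) \<longlongrightarrow> 0) (at 0)"
    using der unfolding has_field_derivative_iff act by simp
  moreover have "filterlim k (at 0) sequentially"
  proof -
    have "k \<longlonglongrightarrow> 0" unfolding k_def by (rule LIMSEQ_inverse_real_of_nat[unfolded inverse_eq_divide])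
    moreover have "\<forall>n. k n \<in> UNIV \<and> k n \<noteq> 0" by (simp add: k_def)
    ultimately show ?thesis unfolding filterlim_at by (simp add: always_eventually)
  qed
  ultimately have "(\<lambda>n. (Act (k n) - Act 0) / (k n - 0)) \<longlonglongrightarrow> 0"
    by (rule filterlim_compose)
  moreover have "(\<lambda>n. (Act (k n) - Act 0) / (k n - 0)) \<longlonglongrightarrow> ?I"
  proof -
    have "norm (\<nu> t) \<le> (1 / (s - a j) + 1 / (b j - s)) * norm e" for t
      unfolding \<nu>_def norm_scaleR using s by (intro mult_right_mono) (auto simp: E.tent'_def)
    from E.first_variation[OF W12_on_edge_deriv(1)[OF edges x_W12] \<eta> this]
    show ?thesis by (simp add: Act_def k_def g_def \<eta>_def \<nu>_def)
  qed
  ultimately show ?thesis using LIMSEQ_unique by blast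
qed

lemma x_continuous: "continuous_on {a j..b j} (x j)" "continuous_on {a j..b j} (edge_deriv (a j) (b j) (x j))"
proof -
  obtain f' f'' where E: "C2_edge (a j) (b j) (L j) f' f''" using C2_edge_exists by blast
  interpret E: C2_edge "a j" "b j" "L j" f' f'' by fact
  show "continuous_on {a j..b j} (x j)" "continuous_on {a j..b j} (edge_deriv (a j) (b j) (x j))"
    using E.weak_solution_C1[OF x_W12 weak_euler_lagrange[OF E]] by auto
qed

definition tm :: "'m \<Rightarrow> real \<Rightarrow> real" where "tm j \<tau> = a j + \<tau> * (b j - a j)"

definition len :: "'m \<Rightarrow> real" where "len j = b j - a j"

lemma len_pos: "len j > 0"
  using edges by (simp add: len_def)

lemma tm_mem:
  assumes "\<tau> \<in> {0..1}"
  shows "tm j \<tau> \<in> {a j..b j}"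
proof -
  have "\<tau> * (b j - a j) \<le> 1 * (b j - a j)" "0 \<le> \<tau> * (b j - a j)"
    using assms edges[of j] by (auto intro!: mult_right_mono mult_nonneg_nonneg)
  then show ?thesis by (simp add: tm_def)
qed

lemma tm_continuous: "continuous_on S (tm j)"
  unfolding tm_def by (intro continuous_intros)

definition Pm where "Pm j t = along (D_vv (L j)) (a j) (b j) (x j) t"
definition Qm where "Qm j t = along (D_qv (L j)) (a j) (b j) (x j) t"
definition Rm where "Rm j t = along (D_qq (L j)) (a j) (b j) (x j) t"

lemma coefficients:
  shows "continuous_on {a j..b j} (\<lambda>t. Pm j t *v u)"
    and "continuous_on {a j..b j} (\<lambda>t. Qm j t *v u)"
    and "continuous_on {a j..b j} (\<lambda>t. Rm j t *v u)"
    and "t \<in> {a j..b j} \<Longrightarrow> (Pm j t *v u) \<bullet> v = (Pm j t *v v) \<bullet> u"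
    and "t \<in> {a j..b j} \<Longrightarrow> (Rm j t *v u) \<bullet> v = (Rm j t *v v) \<bullet> u"
    and "t \<in> {a j..b j} \<Longrightarrow> w \<noteq> 0 \<Longrightarrow> (Pm j t *v w) \<bullet> w > 0"
proof -
  obtain f' f'' where E: "C2_edge (a j) (b j) (L j) f' f''" using C2_edge_exists by blast
  interpret E: C2_edge "a j" "b j" "L j" f' f'' by fact
  note c = E.second_derivatives_continuous[OF x_continuous]
  show "continuous_on {a j..b j} (\<lambda>t. Pm j t *v u)"
    "continuous_on {a j..b j} (\<lambda>t. Qm j t *v u)"
    "continuous_on {a j..b j} (\<lambda>t. Rm j t *v u)"
    unfolding Pm_def Qm_def Rm_def along_def by (rule c)+
  show "(Pm j t *v u) \<bullet> v = (Pm j t *v v) \<bullet> u" "(Rm j t *v u) \<bullet> v = (Rm j t *v v) \<bullet> u" if "t \<in> {a j..b j}"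
    unfolding Pm_def Rm_def along_def by (rule E.D_vv_sym[OF that], rule E.D_qq_sym[OF that])
  show "(Pm j t *v w) \<bullet> w > 0" if "t \<in> {a j..b j}" "w \<noteq> 0"
    unfolding Pm_def along_def by (rule E.legendre[OF that])
qed

text \<open>All edges are rescaled to \<open>[0,1]\<close>: the star becomes one system on \<open>(\<real>\<^sup>d)\<^sup>m\<close> with separated
  boundary conditions.\<close>

definition P :: "real \<Rightarrow> ((real^'d)^'m) \<Rightarrow>\<^sub>L ((real^'d)^'m)" where
  "P \<tau> = Blinfun (\<lambda>u. \<chi> j. (1 / len j) *\<^sub>R (Pm j (tm j \<tau>) *v u $ j))"

definition Q :: "real \<Rightarrow> ((real^'d)^'m) \<Rightarrow>\<^sub>L ((real^'d)^'m)" where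
  "Q \<tau> = Blinfun (\<lambda>u. \<chi> j. Qm j (tm j \<tau>) *v u $ j)"

definition R :: "real \<Rightarrow> ((real^'d)^'m) \<Rightarrow>\<^sub>L ((real^'d)^'m)" where
  "R \<tau> = Blinfun (\<lambda>u. \<chi> j. len j *\<^sub>R (Rm j (tm j \<tau>) *v u $ j))"

text \<open>The weights \<open>1 / len j\<close>, \<open>1\<close> and \<open>len j\<close> are
  those of the substitution \<open>t = tm j \<tau>\<close>: each derivative brings a factor
  \<open>1 / len j\<close> and the measure a factor \<open>len j\<close>.\<close>

lemma P_apply: "P \<tau> u = (\<chi> j. (1 / len j) *\<^sub>R (Pm j (tm j \<tau>) *v u $ j))"
  and Q_apply: "Q \<tau> u = (\<chi> j. Qm j (tm j \<tau>) *v u $ j)"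
  and R_apply: "R \<tau> u = (\<chi> j. len j *\<^sub>R (Rm j (tm j \<tau>) *v u $ j))"
proof -
  have "linear (\<lambda>u. \<chi> j. (c j :: real) *\<^sub>R ((M j :: real^'d^'d) *v u $ j))" for c and M :: "'m \<Rightarrow> _"
    by (rule linearI) (auto simp: vec_eq_iff matrix_vector_right_distrib algebra_simps matrix_vector_mult_scaleR)
  note * = this[unfolded linear_conv_bounded_linear, THEN bounded_linear_Blinfun_apply]
  show "P \<tau> u = (\<chi> j. (1 / len j) *\<^sub>R (Pm j (tm j \<tau>) *v u $ j))" unfolding P_def by (subst *) simp
  show "R \<tau> u = (\<chi> j. len j *\<^sub>R (Rm j (tm j \<tau>) *v u $ j))" unfolding R_def by (subst *) simp
  show "Q \<tau> u = (\<chi> j. Qm j (tm j \<tau>) *v u $ j)"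
    unfolding Q_def using *[of "\<lambda>_. 1" "\<lambda>j. Qm j (tm j \<tau>)"] by simp
qed

lemma PQR_continuous: "continuous_on {0..1} P" "continuous_on {0..1} Q" "continuous_on {0..1} R"
proof -
  have c: "continuous_on {0..1} (\<lambda>\<tau>. f (tm j \<tau>))" if "continuous_on {a j..b j} f" for f :: "real \<Rightarrow> real^'d" and j
    by (rule continuous_on_compose2[OF that tm_continuous]) (use tm_mem in auto)
  show "continuous_on {0..1} P" "continuous_on {0..1} Q" "continuous_on {0..1} R"
    by (rule continuous_on_blinfun_componentwise;
        unfold P_apply Q_apply R_apply;
        intro continuous_on_vec_lambda continuous_on_scaleR continuous_on_const c coefficients)+
qed

text \<open>The edgewise flows with momenta and positions collected separately. Momenta are not
  rescaled, since the weight in \<open>P\<close> compensates the change of velocity.\<close>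

definition \<Phi> :: "real \<Rightarrow> ((real^'d)^'m) \<times> ((real^'d)^'m) \<Rightarrow> ((real^'d)^'m) \<times> ((real^'d)^'m)" where
  "\<Phi> \<tau> z = ((\<chi> j. fst (\<gamma> j (tm j \<tau>) (fst z $ j, snd z $ j))), (\<chi> j. snd (\<gamma> j (tm j \<tau>) (fst z $ j, snd z $ j))))"

definition \<gamma>' :: "'m \<Rightarrow> real \<Rightarrow> 'd phase \<Rightarrow> 'd phase" where
  "\<gamma>' j t z = sympl_J (hamiltonian_matrix (L j) (a j) (b j) (x j) t (\<gamma> j t z))"

definition D :: "real \<Rightarrow> ((real^'d)^'m) \<times> ((real^'d)^'m) \<Rightarrow> ((real^'d)^'m) \<times> ((real^'d)^'m)" where
  "D \<tau> z = ((\<chi> j. len j *\<^sub>R fst (\<gamma>' j (tm j \<tau>) (fst z $ j, snd z $ j))),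
            (\<chi> j. len j *\<^sub>R snd (\<gamma>' j (tm j \<tau>) (fst z $ j, snd z $ j))))"

definition \<Delta> :: "((real^'d)^'m) set" where
  "\<Delta> = {u. \<forall>i j. u $ i = u $ j}"

text \<open>Multiplication by \<open>Pm j t\<close> removes the inverse matrix and turns the
  Hamiltonian system back into the momentum form of \<open>solution\<close>.\<close>

lemma \<gamma>'_eq:
  assumes t: "t \<in> {a j..b j}"
  shows "Pm j t *v snd (\<gamma>' j t z) = fst (\<gamma> j t z) - Qm j t *v snd (\<gamma> j t z)"
    and "fst (\<gamma>' j t z) = transpose (Qm j t) *v snd (\<gamma>' j t z) + Rm j t *v snd (\<gamma> j t z)"
proof -
  define p q A where pqA: "p = fst (\<gamma> j t z)" "q = snd (\<gamma> j t z)" "A = matrix_inv (Pm j t)"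
  have PA: "Pm j t ** A = mat 1" unfolding pqA by (rule matrix_inv_right_positive) (rule coefficients(6)[OF t])
  have s: "snd (\<gamma>' j t z) = A *v p - (A ** Qm j t) *v q"
    and f: "fst (\<gamma>' j t z) = (transpose (Qm j t) ** A) *v p - (transpose (Qm j t) ** A ** Qm j t - Rm j t) *v q"
    unfolding \<gamma>'_def sympl_J_def hamiltonian_matrix_def Let_def pqA Pm_def Qm_def Rm_def
    by (simp_all add: case_prod_beta)
  show "Pm j t *v snd (\<gamma>' j t z) = fst (\<gamma> j t z) - Qm j t *v snd (\<gamma> j t z)"
    unfolding s using PA
    by (simp add: matrix_vector_mult_diff_distrib matrix_vector_mul_assoc matrix_mul_assoc pqA(1,2))
  show "fst (\<gamma>' j t z) = transpose (Qm j t) *v snd (\<gamma>' j t z) + Rm j t *v snd (\<gamma> j t z)"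
    unfolding s f
    by (simp add: matrix_vector_mult_diff_distrib matrix_vector_mult_diff_rdistrib matrix_vector_mul_assoc matrix_mul_assoc pqA(1,2)
        del: transpose_matrix_vector)
qed

lemma \<gamma>_derivative:
  assumes \<tau>: "\<tau> \<in> {0..1}"
  shows "((\<lambda>\<tau>. \<gamma> j (tm j \<tau>) z) has_vector_derivative len j *\<^sub>R \<gamma>' j (tm j \<tau>) z) (at \<tau> within {0..1})"
proof -
  have "(tm j has_vector_derivative len j) (at \<tau> within {0..1})"
    unfolding tm_def len_def
    by (auto intro!: derivative_eq_intros simp flip: has_real_derivative_iff_has_vector_derivative)
  moreover have "((\<lambda>t. \<gamma> j t z) has_vector_derivative \<gamma>' j (tm j \<tau>) z) (at (tm j \<tau>) within tm j ` {0..1})"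
  proof (rule has_vector_derivative_within_subset)
    show "((\<lambda>t. \<gamma> j t z) has_vector_derivative \<gamma>' j (tm j \<tau>) z) (at (tm j \<tau>) within {a j..b j})"
      using fundamental[of j] tm_mem[OF \<tau>, of j] unfolding is_fundamental_solution_def \<gamma>'_def by blast
  qed (use tm_mem in auto)
  ultimately show ?thesis
    using vector_diff_chain_within[of "tm j" "len j" \<tau> "{0..1}" "\<lambda>t. \<gamma> j t z"] by (simp add: o_def)
qed

lemma D_relations:
  assumes \<tau>: "\<tau> \<in> {0..1}"
  shows "fst (\<Phi> \<tau> z) = P \<tau> (snd (D \<tau> z)) + Q \<tau> (snd (\<Phi> \<tau> z))"
    and "fst (D \<tau> z) \<bullet> e = snd (D \<tau> z) \<bullet> Q \<tau> e + R \<tau> (snd (\<Phi> \<tau> z)) \<bullet> e"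
proof -
  note g = \<gamma>'_eq[OF tm_mem[OF \<tau>]]
  have l: "len j \<noteq> 0" for j using len_pos[of j] by simp
  show "fst (\<Phi> \<tau> z) = P \<tau> (snd (D \<tau> z)) + Q \<tau> (snd (\<Phi> \<tau> z))"
    by (simp add: \<Phi>_def D_def P_apply Q_apply vec_eq_iff[of "vec_lambda _"] matrix_vector_mult_scaleR g(1) l)
  have "fst (D \<tau> z) $ j \<bullet> e $ j = snd (D \<tau> z) $ j \<bullet> Q \<tau> e $ j + R \<tau> (snd (\<Phi> \<tau> z)) $ j \<bullet> e $ j" for j
    by (simp add: \<Phi>_def D_def Q_apply R_apply g(2) inner_add_left transpose_inner distrib_left del: transpose_matrix_vector)
  then show "fst (D \<tau> z) \<bullet> e = snd (D \<tau> z) \<bullet> Q \<tau> e + R \<tau> (snd (\<Phi> \<tau> z)) \<bullet> e"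
    unfolding inner_vec_def by (simp add: sum.distrib)
qed

lemma \<Phi>_derivative:
  assumes \<tau>: "\<tau> \<in> {0..1}"
  shows "((\<lambda>s. \<Phi> s z) has_vector_derivative D \<tau> z) (at \<tau> within {0..1})"
  unfolding \<Phi>_def D_def
  using bounded_linear.has_vector_derivative[OF bounded_linear_fst \<gamma>_derivative[OF \<tau>]]
    bounded_linear.has_vector_derivative[OF bounded_linear_snd \<gamma>_derivative[OF \<tau>]]
  by (intro has_vector_derivative_Pair has_vector_derivative_vec_lambda) simp_all

lemma P_positive:
  assumes \<tau>: "\<tau> \<in> {0..1}" and u: "u \<noteq> 0"
  shows "0 < P \<tau> u \<bullet> u"
proof -
  obtain i where i: "u $ i \<noteq> 0" using u by (auto simp: vec_eq_iff)
  have pos: "0 < P \<tau> u $ j \<bullet> u $ j" if "u $ j \<noteq> 0" for j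
    using coefficients(6)[OF tm_mem[OF \<tau>] that] len_pos[of j] by (simp add: P_apply)
  have "0 \<le> P \<tau> u $ j \<bullet> u $ j" for j
    using pos[of j] by (cases "u $ j = 0") (auto intro: less_imp_le)
  then show ?thesis using sum_pos2[of UNIV i "\<lambda>j. P \<tau> u $ j \<bullet> u $ j"] pos[OF i]
    by (simp add: inner_vec_def[of "P \<tau> u"])
qed

text \<open>A fundamental solution is only given as differentiable. Its derivative is continuous
  because the velocity solves a linear equation with the continuous, positive coefficient
  \<open>P\<close>, and the momentum equation then gives the other component.\<close>

lemma D_continuous: "continuous_on {0..1} (\<lambda>\<tau>. D \<tau> z)"
proof -
  have c\<Phi>: "continuous_on {0..1} (\<lambda>\<tau>. \<Phi> \<tau> z)"
    using \<Phi>_derivative by (meson continuous_on_eq_continuous_within has_vector_derivative_continuous)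
  have s: "continuous_on {0..1} (\<lambda>\<tau>. snd (D \<tau> z))"
  proof (rule continuous_linear_solution)
    show "linear (P \<tau>)" for \<tau> by (rule bounded_linear.linear[OF blinfun.bounded_linear_right])
    show "u = 0" if "\<tau> \<in> {0..1}" "P \<tau> u = 0" for \<tau> u using P_positive[OF that(1), of u] that(2) by auto
    show "continuous_on {0..1} (\<lambda>\<tau>. P \<tau> u)" for u by (intro continuous_intros PQR_continuous)
    show "continuous_on {0..1} (\<lambda>\<tau>. fst (\<Phi> \<tau> z) - Q \<tau> (snd (\<Phi> \<tau> z)))"
      by (intro continuous_intros PQR_continuous c\<Phi>)
    show "P \<tau> (snd (D \<tau> z)) = fst (\<Phi> \<tau> z) - Q \<tau> (snd (\<Phi> \<tau> z))" if "\<tau> \<in> {0..1}" for \<tau>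
      using D_relations(1)[OF that, of z] by simp
  qed
  have f: "continuous_on {0..1} (\<lambda>\<tau>. fst (D \<tau> z))"
  proof (rule continuous_on_inner_imp)
    have "continuous_on {0..1} (\<lambda>\<tau>. snd (D \<tau> z) \<bullet> Q \<tau> e + R \<tau> (snd (\<Phi> \<tau> z)) \<bullet> e)" for e
      by (intro continuous_intros PQR_continuous c\<Phi> s)
    then show "continuous_on {0..1} (\<lambda>\<tau>. fst (D \<tau> z) \<bullet> e)" for e
      by (rule continuous_on_eq) (rule D_relations(2)[symmetric])
  qed
  show ?thesis using continuous_on_Pair[OF f s] by simp
qed

lemma \<Phi>_linear:
  assumes "\<tau> \<in> {0..1}"
  shows "linear (\<Phi> \<tau>)"
proof -
  have l: "linear (\<gamma> j (tm j \<tau>))" for j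
    using fundamental[of j] tm_mem[OF assms, of j] unfolding is_fundamental_solution_def by blast
  show ?thesis
  proof (rule linearI)
    have "\<gamma> j (tm j \<tau>) (p + p', q + q') = \<gamma> j (tm j \<tau>) (p, q) + \<gamma> j (tm j \<tau>) (p', q')" for j p p' q q'
      using linear_add[OF l, of j "(p, q)" "(p', q')"] by simp
    then show "\<Phi> \<tau> (u + v) = \<Phi> \<tau> u + \<Phi> \<tau> v" for u v by (simp add: \<Phi>_def vec_eq_iff)
    have "\<gamma> j (tm j \<tau>) (c *\<^sub>R p, c *\<^sub>R q) = c *\<^sub>R \<gamma> j (tm j \<tau>) (p, q)" for j p q c
      using linear_scale[OF l, of j c "(p, q)"] by simp
    then show "\<Phi> \<tau> (c *\<^sub>R u) = c *\<^sub>R \<Phi> \<tau> u" for c u by (simp add: \<Phi>_def vec_eq_iff)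
  qed
qed

lemma subspace_\<Delta>': "subspace \<Delta>"
proof (rule subspaceI)
  have eq: "u $ i = u $ j" if "u \<in> \<Delta>" for u i j
    using that unfolding \<Delta>_def by blast
  show "0 \<in> \<Delta>" by (simp add: \<Delta>_def)
  show "u + v \<in> \<Delta>" if "u \<in> \<Delta>" "v \<in> \<Delta>" for u v
    unfolding \<Delta>_def mem_Collect_eq vector_add_component using eq[OF that(1)] eq[OF that(2)] by metis
  show "c *\<^sub>R u \<in> \<Delta>" if "u \<in> \<Delta>" for c u
    unfolding \<Delta>_def mem_Collect_eq vector_scaleR_component using eq[OF that] by metis
qed

sublocale sturm_flow P Q R \<Phi> D \<Delta>
proof (intro sturm_flow.intro sturm_form.intro sturm_flow_axioms.intro)
  show "continuous_on {0..1} P" "continuous_on {0..1} Q" "continuous_on {0..1} R" by (rule PQR_continuous)+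
  show "P t u \<bullet> v = P t v \<bullet> u" if "t \<in> {0..1}" for t u v
  proof -
    have "P t u $ j \<bullet> v $ j = P t v $ j \<bullet> u $ j" for j
      by (simp add: P_apply coefficients(4)[OF tm_mem[OF that], of j "u $ j" "v $ j"])
    then show ?thesis unfolding inner_vec_def[of "P t u"] inner_vec_def[of "P t v"] by (rule sum.cong[OF refl])
  qed
  show "R t u \<bullet> v = R t v \<bullet> u" if "t \<in> {0..1}" for t u v
  proof -
    have "R t u $ j \<bullet> v $ j = R t v $ j \<bullet> u $ j" for j
      by (simp add: R_apply coefficients(5)[OF tm_mem[OF that], of j "u $ j" "v $ j"])
    then show ?thesis unfolding inner_vec_def[of "R t u"] inner_vec_def[of "R t v"] by (rule sum.cong[OF refl])
  qed
  show "0 < P t v \<bullet> v" if "t \<in> {0..1}" "v \<noteq> 0" for t v by (rule P_positive[OF that])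
  show "linear (\<Phi> t)" if "t \<in> {0..1}" for t by (rule \<Phi>_linear[OF that])
  show "\<Phi> 0 z = z" for z
    using fundamental unfolding is_fundamental_solution_def by (simp add: \<Phi>_def tm_def prod_eq_iff)
  show "((\<lambda>s. \<Phi> s z) has_vector_derivative D t z) (at t within {0..1})" if "t \<in> {0..1}" for t z
    by (rule \<Phi>_derivative[OF that])
  show "continuous_on {0..1} (\<lambda>t. D t z)" for z by (rule D_continuous)
  show "fst (\<Phi> t z) = P t (snd (D t z)) + Q t (snd (\<Phi> t z))" if "t \<in> {0..1}" for t z by (rule D_relations(1)[OF that])
  show "fst (D t z) \<bullet> e = snd (D t z) \<bullet> Q t e + R t (snd (\<Phi> t z)) \<bullet> e" if "t \<in> {0..1}" for t z e
    by (rule D_relations(2)[OF that])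
  show "subspace \<Delta>" by (rule subspace_\<Delta>')
qed

end

lemma w12_pair_linear:
  fixes F :: "'a::euclidean_space \<Rightarrow> 'b::euclidean_space"
  assumes F: "linear F" and u: "w12_pair a b u g"
  shows "w12_pair a b (\<lambda>t. F (u t)) (\<lambda>t. F (g t))"
  unfolding w12_pair_def primitive_on_def
proof (intro conjI ballI)
  have bF: "bounded_linear F" using F linear_conv_bounded_linear by blast
  note gi = w12_pairD(3)[OF u]
  show ai: "(\<lambda>t. F (g t)) absolutely_integrable_on {a..b}"
    using absolutely_integrable_linear[OF gi bF] by (simp add: o_def)
  show "F (u t) = F (u a) + integral {a..t} (\<lambda>t. F (g t))" if t: "t \<in> {a..b}" for t
  proof -
    have "g integrable_on {a..t}"
      using w12_pairD(3)[OF w12_pair_subinterval[OF u, of a t]] t set_lebesgue_integral_eq_integral(1) by auto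
    from integral_linear[OF this bF] have "integral {a..t} (\<lambda>t. F (g t)) = F (integral {a..t} g)" by (simp add: o_def)
    then show ?thesis
      using primitive_onD(2)[OF w12_pairD(1)[OF u] t] linear_add[OF F, of "u a" "integral {a..t} g"] by simp
  qed
  show "(\<lambda>t. (norm (F (g t)))\<^sup>2) integrable_on {a..b}"
  proof (rule measurable_bounded_by_integrable_imp_integrable)
    show "(\<lambda>t. (norm (F (g t)))\<^sup>2) \<in> borel_measurable (lebesgue_on {a..b})"
    proof -
      have "(\<lambda>t. F (g t)) \<in> borel_measurable (lebesgue_on {a..b})"
        using ai by (simp add: absolutely_integrable_imp_borel_measurable)
      then show ?thesis by measurable
    qed
    show "(\<lambda>t. (onorm F)\<^sup>2 * (norm (g t))\<^sup>2) integrable_on {a..b}"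
      by (rule integrable_on_mult_right[OF w12_pairD(2)[OF u]])
    show "norm ((norm (F (g t)))\<^sup>2) \<le> (onorm F)\<^sup>2 * (norm (g t))\<^sup>2" for t
      using power_mono[OF onorm[OF bF, of "g t"], of 2] by (simp add: power_mult_distrib)
  qed auto
qed

section \<open>Identification of the index form of the star with that of the flow\<close>

context star_bolza begin

definition unscale :: "(real \<Rightarrow> (real^'d)^'m) \<Rightarrow> 'm \<Rightarrow> real \<Rightarrow> real^'d" where
  "unscale u j t = (if t \<in> {a j..b j} then u ((t - a j) / len j) $ j else 0)"

lemma linear_unscale: "linear unscale"
  by (rule linearI) (auto simp: unscale_def fun_eq_iff)

lemma rescale_tm: "(tm j \<tau> - a j) / len j = \<tau>" "tm j ((t - a j) / len j) = t"
  using len_pos[of j] edges[of j] by (auto simp: tm_def len_def)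

lemma rescale_mem: "t \<in> {a j..b j} \<Longrightarrow> (t - a j) / len j \<in> {0..1}"
  using len_pos[of j] by (auto simp: len_def)

lemma inj_unscale: "inj_on unscale variations"
proof (rule inj_onI)
  fix u v assume uv: "u \<in> variations" "v \<in> variations" "unscale u = unscale v"
  show "u = v"
  proof
    fix \<tau>
    show "u \<tau> = v \<tau>"
    proof (cases "\<tau> \<in> {0..1}")
      case True
      have "u \<tau> $ j = v \<tau> $ j" for j
        using fun_cong[OF fun_cong[OF uv(3), of j], of "tm j \<tau>"] tm_mem[OF True, of j]
        unfolding unscale_def rescale_tm(1) by (simp only: if_True)
      then show ?thesis by (simp add: vec_eq_iff)
    next
      case False then show ?thesis using uv(1,2) by (simp add: variations_def)
    qed
  qed
qed

lemma unscale_edge: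
  assumes u: "W12_on 0 1 u"
  shows "W12_on (a j) (b j) (unscale u j)"
    and "\<exists>N. negligible N \<and> (\<forall>t\<in>{a j..b j} - N. edge_deriv (a j) (b j) (unscale u j) t
      = (1 / len j) *\<^sub>R (edge_deriv 0 1 u ((t - a j) / len j) $ j))"
proof -
  define l where "l = 1 / len j"
  define c where "c = - a j / len j"
  have l: "l > 0" using len_pos by (simp add: l_def)
  have e: "l * t + c = (t - a j) / len j" for t by (simp add: l_def c_def diff_divide_distrib)
  have ends: "l * a j + c = 0" "l * b j + c = 1" using len_pos[of j] unfolding e by (simp_all add: len_def)
  note W = W12_on_reparam[OF edges l linear_vec_nth[of j], of j c u, unfolded ends, OF u, unfolded e]
  have cong: "u ((t - a j) / len j) $ j = unscale u j t" if "t \<in> {a j..b j}" for t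
    using that by (simp add: unscale_def)
  show "W12_on (a j) (b j) (unscale u j)" by (rule W12_on_cong(1)[OF edges W(1) cong])
  obtain N where N: "negligible N" "\<forall>t\<in>{a j..b j} - N. edge_deriv (a j) (b j) (\<lambda>r. u ((r - a j) / len j) $ j) t
      = l *\<^sub>R (edge_deriv 0 1 u ((t - a j) / len j) $ j)"
    using W(2) by blast
  have "edge_deriv (a j) (b j) (unscale u j) t = edge_deriv (a j) (b j) (\<lambda>r. u ((r - a j) / len j) $ j) t" if "t \<in> {a j..b j}" for t
    by (rule W12_on_cong(2)[OF edges W(1) cong that])
  then show "\<exists>N. negligible N \<and> (\<forall>t\<in>{a j..b j} - N. edge_deriv (a j) (b j) (unscale u j) t
      = (1 / len j) *\<^sub>R (edge_deriv 0 1 u ((t - a j) / len j) $ j))"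
    using N by (intro exI[of _ N]) (simp add: l_def)
qed

lemma unscale_mem:
  assumes u: "u \<in> variations"
  shows "unscale u \<in> bolza_variations a b"
proof -
  have "W12_on 0 1 u" "u 0 \<in> \<Delta>" "u 1 = 0" using u by (auto simp: variations_def)
  moreover have "unscale u j (a j) = u 0 $ j" "unscale u j (b j) = u 1 $ j" for j
    using edges[of j] len_pos[of j] by (auto simp: unscale_def len_def)
  ultimately have "W12_on (a j) (b j) (unscale u j)" "unscale u i (a i) = unscale u j (a j)" "unscale u j (b j) = 0" for i j
    using unscale_edge(1) unfolding \<Delta>_def by auto
  then show ?thesis unfolding bolza_variations_def bolza_paths_def by (simp add: unscale_def)
qed

text \<open>The edges are assembled as a sum of axis embeddings, as reparametrization handles one
  edge at a time.\<close>

lemma unscale_surj: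
  assumes \<xi>: "\<xi> \<in> bolza_variations a b"
  shows "\<xi> \<in> unscale ` variations"
proof -
  have W: "W12_on (a j) (b j) (\<xi> j)" and c: "\<xi> i (a i) = \<xi> j (a j)" and e: "\<xi> j (b j) = 0"
    and out: "t \<notin> {a j..b j} \<Longrightarrow> \<xi> j t = 0" for i j t
    using \<xi> unfolding bolza_variations_def bolza_paths_def by blast+
  define u where "u \<tau> = (if \<tau> \<in> {0..1} then \<chi> j. \<xi> j (tm j \<tau>) else 0)" for \<tau>
  have "W12_on 0 1 (\<lambda>\<tau>. axis j (\<xi> j (len j * \<tau> + a j)) :: (real^'d)^'m)" for j
  proof -
    have ends: "len j * 0 + a j = a j" "len j * 1 + a j = b j" by (simp_all add: len_def)
    show ?thesis
      by (rule W12_on_reparam(1)[OF zero_less_one len_pos linear_axis]) (simp only: ends W)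
  qed
  then have "W12_on 0 1 (\<lambda>\<tau>. \<Sum>j\<in>UNIV. axis j (\<xi> j (len j * \<tau> + a j)) :: (real^'d)^'m)"
    by (intro W12_on_sum) auto
  then have "W12_on 0 1 u"
  proof (rule W12_on_cong(1)[OF zero_less_one])
    fix \<tau> assume "\<tau> \<in> {0..1::real}"
    then show "(\<Sum>j\<in>UNIV. axis j (\<xi> j (len j * \<tau> + a j))) = u \<tau>"
      unfolding vec_lambda_eq_sum_axis[symmetric] by (simp add: u_def tm_def len_def mult.commute add.commute)
  qed
  moreover have "u 0 \<in> \<Delta>"
    unfolding \<Delta>_def mem_Collect_eq u_def using c by (simp add: tm_def)
  moreover have "u 1 = 0" using e by (simp add: u_def tm_def vec_eq_iff)
  ultimately have "u \<in> variations" by (simp add: variations_def u_def)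
  moreover have "unscale u = \<xi>"
  proof (intro ext)
    fix j t
    show "unscale u j t = \<xi> j t"
      using rescale_mem[of t j] rescale_tm(2)[of j t] out[of t j] unfolding unscale_def u_def by (cases "t \<in> {a j..b j}") simp_all
  qed
  ultimately show ?thesis by blast
qed

text \<open>The coefficients are block diagonal, so pairing with the \<open>j\<close>-th component
  alone extracts the integrand of edge \<open>j\<close>; the factor \<open>len j\<close> is the
  Jacobian of the rescaling.\<close>

lemma density_axis:
  "density \<tau> u g (axis j (u $ j)) (axis j (g $ j)) =
    len j * ((Pm j (tm j \<tau>) *v ((1 / len j) *\<^sub>R g $ j) + Qm j (tm j \<tau>) *v u $ j) \<bullet> ((1 / len j) *\<^sub>R g $ j)
      + (transpose (Qm j (tm j \<tau>)) *v ((1 / len j) *\<^sub>R g $ j)) \<bullet> u $ j + (Rm j (tm j \<tau>) *v u $ j) \<bullet> u $ j)"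
proof -
  have l: "len j \<noteq> 0" using len_pos[of j] by simp
  have Qa: "Q \<tau> (axis j w) = axis j (Qm j (tm j \<tau>) *v w)" for w
    by (simp add: Q_apply vec_eq_iff axis_def)
  have "density \<tau> u g (axis j (u $ j)) (axis j (g $ j))
      = (P \<tau> g $ j + Q \<tau> u $ j) \<bullet> g $ j + g $ j \<bullet> (Qm j (tm j \<tau>) *v u $ j) + R \<tau> u $ j \<bullet> u $ j"
    by (simp add: density_def Qa inner_axis)
  also have "\<dots> = len j * ((Pm j (tm j \<tau>) *v ((1 / len j) *\<^sub>R g $ j) + Qm j (tm j \<tau>) *v u $ j) \<bullet> ((1 / len j) *\<^sub>R g $ j)
      + (1 / len j) * (g $ j \<bullet> (Qm j (tm j \<tau>) *v u $ j)) + (Rm j (tm j \<tau>) *v u $ j) \<bullet> u $ j)"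
    using l by (simp add: P_apply Q_apply R_apply matrix_vector_mult_scaleR inner_add_left distrib_left)
  also have "(1 / len j) * (g $ j \<bullet> (Qm j (tm j \<tau>) *v u $ j)) = (transpose (Qm j (tm j \<tau>)) *v ((1 / len j) *\<^sub>R g $ j)) \<bullet> u $ j"
    unfolding transpose_inner by simp
  finally show ?thesis .
qed

lemma density_sum_axis:
  "(\<Sum>j\<in>UNIV. density \<tau> u g (axis j (u $ j)) (axis j (g $ j))) = density \<tau> u g u g"
proof -
  have s: "(\<Sum>j\<in>UNIV. axis j (w $ j)) = w" for w :: "(real^'d)^'m"
    using vec_lambda_eq_sum_axis[of "\<lambda>j. w $ j"] by simp
  have "(\<Sum>j\<in>UNIV. density \<tau> u g (axis j (u $ j)) (axis j (g $ j)))
      = (P \<tau> g + Q \<tau> u) \<bullet> (\<Sum>j\<in>UNIV. axis j (g $ j)) + g \<bullet> Q \<tau> (\<Sum>j\<in>UNIV. axis j (u $ j)) + R \<tau> u \<bullet> (\<Sum>j\<in>UNIV. axis j (u $ j))"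
    by (simp only: density_def sum.distrib inner_sum_right blinfun.sum_right)
  then show ?thesis unfolding s density_def .
qed

text \<open>Substitution on each edge, with derivatives matching off a null set, followed by
  bilinearity to reassemble the components.\<close>

lemma index_form_unscale:
  assumes u: "u \<in> variations"
  shows "index_form a b L x (unscale u) (unscale u) = hess u u"
proof -
  define g where "g = edge_deriv 0 1 u"
  have W: "W12_on 0 1 u" using u by (simp add: variations_def)
  have ug: "w12_pair 0 1 u g" using variations_rep[OF u] by (simp add: w12_rep_def g_def)
  let ?J = "\<lambda>j. integral {0..1} (\<lambda>\<tau>. density \<tau> (u \<tau>) (g \<tau>) (axis j (u \<tau> $ j)) (axis j (g \<tau> $ j)))"
  have di: "(\<lambda>\<tau>. density \<tau> (u \<tau>) (g \<tau>) (axis j (u \<tau> $ j)) (axis j (g \<tau> $ j))) integrable_on {0..1}" for j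
  proof -
    have "linear (\<lambda>v :: (real^'d)^'m. axis j (v $ j) :: (real^'d)^'m)"
      using linear_compose[OF linear_vec_nth linear_axis] by (simp add: o_def)
    from w12_pair_linear[OF this ug] show ?thesis by (intro density_integrable[OF ug]) auto
  qed
  have edge: "integral {a j..b j} (\<lambda>t.
        let P = along (D_vv (L j)) (a j) (b j) (x j) t;
            Q = along (D_qv (L j)) (a j) (b j) (x j) t;
            R = along (D_qq (L j)) (a j) (b j) (x j) t;
            \<xi>' = edge_deriv (a j) (b j) (unscale u j) t;
            \<eta>' = edge_deriv (a j) (b j) (unscale u j) t
        in (P *v \<xi>' + Q *v unscale u j t) \<bullet> \<eta>' + (transpose Q *v \<xi>') \<bullet> unscale u j t + (R *v unscale u j t) \<bullet> unscale u j t) = ?J j"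
    (is "integral _ ?f = _") for j
  proof -
    let ?d = "\<lambda>\<tau>. density \<tau> (u \<tau>) (g \<tau>) (axis j (u \<tau> $ j)) (axis j (g \<tau> $ j))"
    define l where "l = 1 / len j"
    define c where "c = - a j / len j"
    have l: "l > 0" using len_pos by (simp add: l_def)
    have e: "l * t + c = (t - a j) / len j" for t by (simp add: l_def c_def diff_divide_distrib)
    have ends: "l * a j + c = 0" "l * b j + c = 1" using len_pos[of j] unfolding e by (simp_all add: len_def)
    have "(?d has_integral ?J j) {l * a j + c..l * b j + c}" unfolding ends by (rule integrable_integral[OF di])
    from has_integral_mult_right[OF has_integral_affine_real[OF this l], of l]
    have hi: "((\<lambda>t. l * ?d ((t - a j) / len j)) has_integral ?J j) {a j..b j}"
      unfolding e using l by (simp flip: mult.assoc)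
    obtain N where N: "negligible N" "\<forall>t\<in>{a j..b j} - N. edge_deriv (a j) (b j) (unscale u j) t
      = (1 / len j) *\<^sub>R (g ((t - a j) / len j) $ j)"
      using unscale_edge(2)[OF W] unfolding g_def by blast
    have hf: "?f t = l * ?d ((t - a j) / len j)" if t: "t \<in> {a j..b j} - N" for t
    proof -
      have 1: "edge_deriv (a j) (b j) (unscale u j) t = (1 / len j) *\<^sub>R (g ((t - a j) / len j) $ j)"
        using N(2) t by blast
      have 2: "unscale u j t = u ((t - a j) / len j) $ j" using t by (simp add: unscale_def)
      have "len j \<noteq> 0" using len_pos[of j] by simp
      then show ?thesis
        unfolding density_axis rescale_tm(2) Let_def 1 2 Pm_def[symmetric] Qm_def[symmetric] Rm_def[symmetric]
        by (simp add: l_def)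
    qed
    have "(?f has_integral ?J j) {a j..b j}" by (rule has_integral_spike[OF N(1) hf hi])
    then show ?thesis by (rule integral_unique)
  qed
  have "index_form a b L x (unscale u) (unscale u) = (\<Sum>j\<in>UNIV. ?J j)"
    unfolding index_form_def by (rule sum.cong[OF refl edge])
  also have "\<dots> = integral {0..1} (\<lambda>\<tau>. \<Sum>j\<in>UNIV. density \<tau> (u \<tau>) (g \<tau>) (axis j (u \<tau> $ j)) (axis j (g \<tau> $ j)))"
    by (rule integral_sum[symmetric]) (auto intro: di)
  also have "\<dots> = hess u u" unfolding density_sum_axis hess_def form_def g_def ..
  finally show ?thesis .
qed

lemma morse_index_eq: "morse_index a b L x = neg_index (\<lambda>u. hess u u) variations"
proof -
  have "bolza_variations a b = unscale ` variations"
    using unscale_mem unscale_surj by blast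
  then show ?thesis
    unfolding morse_index_def
    using neg_index_linear_image[OF linear_unscale subspace_variations inj_unscale,
        of "\<lambda>\<xi>. index_form a b L x \<xi> \<xi>" "\<lambda>u. hess u u"] index_form_unscale by simp
qed

end

section \<open>The Maslov index of the star\<close>

lemma neg_index_positive:
  fixes q :: "'v::euclidean_space \<Rightarrow> real"
  assumes U: "subspace U" and pos: "\<And>v. v \<in> U \<Longrightarrow> v \<noteq> 0 \<Longrightarrow> 0 < q v"
  shows "n_plus q U = int (dim U)" "n_minus q U = 0"
proof -
  have "neg_index (\<lambda>v. - q v) U = enat (dim U)"
  proof (rule antisym)
    show "neg_index (\<lambda>v. - q v) U \<le> enat (dim U)" by (rule neg_index_le) (rule dim_subset)
    show "enat (dim U) \<le> neg_index (\<lambda>v. - q v) U" by (rule neg_index_ge[OF U]) (use pos in auto)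
  qed
  then show "n_plus q U = int (dim U)" by (simp add: n_plus_def n_minus_def)
  have "neg_index q U \<le> enat 0"
  proof (rule neg_index_le)
    fix V assume V: "subspace V" "V \<subseteq> U" and neg: "\<And>v. v \<in> V \<Longrightarrow> v \<noteq> 0 \<Longrightarrow> q v < 0"
    have "V \<subseteq> {0}"
    proof
      fix v assume v: "v \<in> V"
      show "v \<in> {0}" using neg[OF v] pos[of v] V(2) v by force
    qed
    then show "dim V \<le> 0" by simp
  qed
  then have "neg_index q U = enat 0" by (simp add: zero_enat_def[symmetric])
  then show "n_minus q U = 0" unfolding n_minus_def by (simp only: the_enat.simps of_nat_0)
qed

text \<open>The sign on the first copy is that of \<open>-\<Omega>\<close> in the symplectic form of
  the sum; with it \<open>star_J\<close> is orthogonal and squares to minus the identity.\<close>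

definition star_J :: "('d::finite, 'm::finite) star_space \<Rightarrow> ('d, 'm) star_space" where
  "star_J u = (\<chi> j. (- sympl_J (fst (u $ j)), sympl_J (snd (u $ j))))"

lemma euclidean_symplectic_star:
  "euclidean_symplectic (star_form :: ('d::finite, 'm::finite) star_space \<Rightarrow> _) star_J"
proof (rule euclidean_symplectic.intro)
  show "linear star_J" by (rule linearI) (auto simp: star_J_def sympl_J_def vec_eq_iff)
  show "star_J (star_J u) = - u" for u :: "('d, 'm) star_space"
    by (simp add: star_J_def sympl_J_def vec_eq_iff prod_eq_iff)
  show "star_J u \<bullet> star_J w = u \<bullet> w" for u w :: "('d, 'm) star_space"
    unfolding inner_vec_def[of "star_J u"] inner_vec_def[of u]
    by (rule sum.cong[OF refl]) (simp add: star_J_def sympl_J_def inner_prod_def)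
  show "star_form u w = star_J u \<bullet> w" for u w :: "('d, 'm) star_space"
    unfolding inner_vec_def[of "star_J u"] star_form_def
    by (rule sum.cong[OF refl]) (simp add: star_J_def sympl_\<Omega>_def inner_prod_def)
qed

lemma star_boundary_space_iff:
  "u \<in> star_boundary_space \<longleftrightarrow> (\<forall>j. snd (snd (u $ j)) = 0) \<and> (\<forall>i j. snd (fst (u $ i)) = snd (fst (u $ j)))
    \<and> (\<Sum>j\<in>UNIV. fst (fst (u $ j))) = 0"
proof
  assume "u \<in> star_boundary_space"
  then show "(\<forall>j. snd (snd (u $ j)) = 0) \<and> (\<forall>i j. snd (fst (u $ i)) = snd (fst (u $ j)))
    \<and> (\<Sum>j\<in>UNIV. fst (fst (u $ j))) = 0" unfolding star_boundary_space_def by auto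
next
  assume *: "(\<forall>j. snd (snd (u $ j)) = 0) \<and> (\<forall>i j. snd (fst (u $ i)) = snd (fst (u $ j)))
    \<and> (\<Sum>j\<in>UNIV. fst (fst (u $ j))) = 0"
  have "u = (\<chi> j. ((fst (fst (u $ j)), snd (fst (u $ j))), (fst (snd (u $ j)), snd (snd (u $ j)))))"
    by (simp add: vec_eq_iff)
  with * show "u \<in> star_boundary_space"
    unfolding star_boundary_space_def mem_Collect_eq
    by (intro exI[of _ "\<lambda>j. fst (fst (u $ j))"] exI[of _ "\<lambda>j. snd (fst (u $ j))"]
        exI[of _ "\<lambda>j. fst (snd (u $ j))"] exI[of _ "\<lambda>j. snd (snd (u $ j))"]) simp
qed

lemma star_form_components:
  "star_form u w = (\<Sum>j\<in>UNIV. (snd (fst (u $ j)) \<bullet> fst (fst (w $ j)) - fst (fst (u $ j)) \<bullet> snd (fst (w $ j)))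
     + (fst (snd (u $ j)) \<bullet> snd (snd (w $ j)) - snd (snd (u $ j)) \<bullet> fst (snd (w $ j))))"
  unfolding star_form_def sympl_\<Omega>_def sympl_J_def inner_prod_def by simp

text \<open>Three kinds of test vectors return the three boundary conditions: a final momentum on
  one edge, opposite initial momenta on two edges, and a common initial position on all
  edges.\<close>

lemma lagrangian_star_boundary_space:
  "lagrangian_subspace star_form (star_boundary_space :: ('d::finite, 'm::finite) star_space set)" (is "lagrangian_subspace _ ?B")
  unfolding lagrangian_subspace_def
proof (intro conjI subset_antisym subsetI)
  show "subspace ?B"
  proof (rule subspaceI)
    show "0 \<in> ?B" by (simp add: star_boundary_space_iff)
    show "u + v \<in> ?B" if "u \<in> ?B" "v \<in> ?B" for u v
    proof -
      have "snd (fst (u $ i)) = snd (fst (u $ j))" "snd (fst (v $ i)) = snd (fst (v $ j))" for i j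
        using that unfolding star_boundary_space_iff by blast+
      then have "snd (fst ((u + v) $ i)) = snd (fst ((u + v) $ j))" for i j
        unfolding vector_add_component fst_add snd_add by metis
      then show ?thesis using that unfolding star_boundary_space_iff by (simp add: sum.distrib)
    qed
    show "c *\<^sub>R u \<in> ?B" if "u \<in> ?B" for c u
    proof -
      have "snd (fst (u $ i)) = snd (fst (u $ j))" for i j
        using that unfolding star_boundary_space_iff by blast
      then have "snd (fst ((c *\<^sub>R u) $ i)) = snd (fst ((c *\<^sub>R u) $ j))" for i j
        unfolding vector_scaleR_component fst_scaleR snd_scaleR by metis
      then show ?thesis using that unfolding star_boundary_space_iff by (simp add: scaleR_right.sum[symmetric])
    qed
  qed
  show "v \<in> {v. \<forall>u\<in>?B. star_form v u = 0}" if v: "v \<in> ?B" for v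
  proof -
    have "star_form v u = 0" if u: "u \<in> ?B" for u
    proof -
      define j0 :: 'm where "j0 = undefined"
      have c: "snd (fst (v $ j)) = snd (fst (v $ j0))" "snd (fst (u $ j)) = snd (fst (u $ j0))" for j
        using v u unfolding star_boundary_space_iff by blast+
      have z: "snd (snd (v $ j)) = 0" "snd (snd (u $ j)) = 0" for j
        using v u unfolding star_boundary_space_iff by blast+
      have s: "(\<Sum>j\<in>UNIV. fst (fst (v $ j))) = 0" "(\<Sum>j\<in>UNIV. fst (fst (u $ j))) = 0"
        using v u unfolding star_boundary_space_iff by blast+
      have "star_form v u = (\<Sum>j\<in>UNIV. snd (fst (v $ j0)) \<bullet> fst (fst (u $ j)) - fst (fst (v $ j)) \<bullet> snd (fst (u $ j0)))"
        unfolding star_form_components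
      proof (rule sum.cong[OF refl])
        fix j
        show "(snd (fst (v $ j)) \<bullet> fst (fst (u $ j)) - fst (fst (v $ j)) \<bullet> snd (fst (u $ j)))
            + (fst (snd (v $ j)) \<bullet> snd (snd (u $ j)) - snd (snd (v $ j)) \<bullet> fst (snd (u $ j)))
          = snd (fst (v $ j0)) \<bullet> fst (fst (u $ j)) - fst (fst (v $ j)) \<bullet> snd (fst (u $ j0))"
          unfolding z c(1)[of j] c(2)[of j] by simp
      qed
      also have "\<dots> = snd (fst (v $ j0)) \<bullet> (\<Sum>j\<in>UNIV. fst (fst (u $ j))) - (\<Sum>j\<in>UNIV. fst (fst (v $ j))) \<bullet> snd (fst (u $ j0))"
        by (simp add: sum_subtractf inner_sum_left inner_sum_right)
      finally show ?thesis by (simp add: s)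
    qed
    then show ?thesis by simp
  qed
  show "v \<in> ?B" if v: "v \<in> {v. \<forall>u\<in>?B. star_form v u = 0}" for v
  proof -
    have v0: "star_form v u = 0" if "u \<in> ?B" for u using v that by blast
    have 1: "snd (snd (v $ i)) = 0" for i
    proof -
      define e where "e = snd (snd (v $ i))"
      define u :: "('d, 'm) star_space" where "u = (\<chi> j. ((0, 0), (if j = i then e else 0, 0)))"
      have "star_form v u = (\<Sum>j\<in>UNIV. if j = i then - (snd (snd (v $ i)) \<bullet> e) else 0)"
        unfolding star_form_components by (rule sum.cong[OF refl]) (simp add: u_def)
      moreover have "u \<in> ?B" by (simp add: star_boundary_space_iff u_def)
      ultimately show ?thesis using v0[of u] by (simp add: e_def)
    qed
    have 2: "snd (fst (v $ i)) = snd (fst (v $ k))" for i k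
    proof (cases "i = k")
      case False
      define e where "e = snd (fst (v $ i)) - snd (fst (v $ k))"
      define u :: "('d, 'm) star_space" where "u = (\<chi> j. (((if j = i then e else 0) - (if j = k then e else 0), 0), (0, 0)))"
      have "star_form v u = (\<Sum>j\<in>UNIV. (if j = i then snd (fst (v $ i)) \<bullet> e else 0) - (if j = k then snd (fst (v $ k)) \<bullet> e else 0))"
        unfolding star_form_components by (rule sum.cong[OF refl]) (use False in \<open>auto simp: u_def\<close>)
      also have "\<dots> = e \<bullet> e" unfolding sum_subtractf by (simp add: e_def inner_diff_left)
      finally have "star_form v u = e \<bullet> e" .
      moreover have "u \<in> ?B" by (simp add: star_boundary_space_iff u_def sum_subtractf)
      ultimately show ?thesis using v0[of u] by (simp add: e_def)
    qed simp
    have 3: "(\<Sum>j\<in>UNIV. fst (fst (v $ j))) = 0"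
    proof -
      define e where "e = (\<Sum>j\<in>UNIV. fst (fst (v $ j)))"
      define u :: "('d, 'm) star_space" where "u = (\<chi> j. ((0, e), (0, 0)))"
      have "star_form v u = (\<Sum>j\<in>UNIV. - (fst (fst (v $ j)) \<bullet> e))"
        unfolding star_form_components by (rule sum.cong[OF refl]) (simp add: u_def)
      also have "\<dots> = - (e \<bullet> e)" by (simp add: sum_negf e_def inner_sum_left)
      finally have "star_form v u = - (e \<bullet> e)" .
      moreover have "u \<in> ?B" by (simp add: star_boundary_space_iff u_def)
      ultimately show ?thesis using v0[of u] by (simp add: e_def)
    qed
    show ?thesis unfolding star_boundary_space_iff using 1 2 3 by blast
  qed
qed

section \<open>Crossings of the graph path with the boundary conditions\<close>

context star_bolza begin

definition graph :: "real \<Rightarrow> ((real^'d)^'m) \<times> ((real^'d)^'m) \<Rightarrow> ('d, 'm) star_space" where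
  "graph \<tau> z = (\<chi> j. ((fst z $ j, snd z $ j), (fst (\<Phi> \<tau> z) $ j, snd (\<Phi> \<tau> z) $ j)))"

definition graph' :: "real \<Rightarrow> ((real^'d)^'m) \<times> ((real^'d)^'m) \<Rightarrow> ('d, 'm) star_space" where
  "graph' \<tau> z = (\<chi> j. ((0, 0), (fst (D \<tau> z) $ j, snd (D \<tau> z) $ j)))"

lemma range_graph: "range (graph \<tau>) = star_graph_path a b \<gamma> \<tau>"
proof (intro subset_antisym subsetI)
  show "u \<in> star_graph_path a b \<gamma> \<tau>" if u: "u \<in> range (graph \<tau>)" for u
  proof -
    from u obtain z where "u = graph \<tau> z" ..
    then show ?thesis
      unfolding star_graph_path_def mem_Collect_eq
      by (intro exI[of _ "\<lambda>j. (fst z $ j, snd z $ j)"]) (simp add: graph_def \<Phi>_def tm_def)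
  qed
  show "u \<in> range (graph \<tau>)" if u: "u \<in> star_graph_path a b \<gamma> \<tau>" for u
  proof -
    from u obtain z where "u = (\<chi> j. (z j, \<gamma> j (a j + \<tau> * (b j - a j)) (z j)))"
      unfolding star_graph_path_def by blast
    then have "u = graph \<tau> ((\<chi> j. fst (z j)), (\<chi> j. snd (z j)))" by (simp add: graph_def \<Phi>_def tm_def)
    then show ?thesis by blast
  qed
qed

lemma linear_graph:
  assumes "\<tau> \<in> {0..1}"
  shows "linear (graph \<tau>)"
  using linear_add[OF \<Phi>_linear[OF assms]] linear_scale[OF \<Phi>_linear[OF assms]]
  by (intro linearI) (simp_all add: graph_def vec_eq_iff)

lemma inj_graph: "inj (graph \<tau>)"
  by (rule injI) (auto simp: graph_def vec_eq_iff prod_eq_iff)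

lemma star_form_graph:
  "star_form (graph \<tau> z) (graph \<tau> w) = (snd z \<bullet> fst w - fst z \<bullet> snd w)
    + (fst (\<Phi> \<tau> z) \<bullet> snd (\<Phi> \<tau> w) - snd (\<Phi> \<tau> z) \<bullet> fst (\<Phi> \<tau> w))"
  "star_form (graph \<tau> z) (graph' \<tau> w) = fst (\<Phi> \<tau> z) \<bullet> snd (D \<tau> w) - snd (\<Phi> \<tau> z) \<bullet> fst (D \<tau> w)"
  unfolding star_form_components graph_def graph'_def inner_vec_def[of "snd z"] inner_vec_def[of "fst z"]
    inner_vec_def[of "fst (\<Phi> \<tau> z)"] inner_vec_def[of "snd (\<Phi> \<tau> z)"]
  by (simp_all add: sum.distrib sum_subtractf)

text \<open>Isotropy of a graph under the form with opposite signs is invariance of the symplectic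
  pairing under the flow; the dimension is that of the domain.\<close>

lemma lagrangian_graph:
  assumes \<tau>: "\<tau> \<in> {0..1}"
  shows "lagrangian_subspace star_form (range (graph \<tau>))"
proof (rule euclidean_symplectic.isotropic_lagrangian[OF euclidean_symplectic_star])
  show "subspace (range (graph \<tau>))" by (rule linear_subspace_image[OF linear_graph[OF \<tau>] subspace_UNIV])
  show "star_form u v = 0" if u: "u \<in> range (graph \<tau>)" and v: "v \<in> range (graph \<tau>)" for u v
  proof -
    from u obtain z where "u = graph \<tau> z" ..
    moreover from v obtain w where "v = graph \<tau> w" ..
    ultimately show ?thesis using flow_symplectic[OF \<tau>, of z w] star_form_graph(1)[of \<tau> z w] by (simp add: inner_commute)
  qed
  have "dim (range (graph \<tau>)) = DIM(((real^'d)^'m) \<times> ((real^'d)^'m))"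
    using dim_image_inj_on[OF linear_graph[OF \<tau>] subspace_UNIV inj_graph] by simp
  then show "2 * dim (range (graph \<tau>)) = DIM(('d phase \<times> 'd phase)^'m)" by simp
qed

lemma graph_derivative:
  assumes \<tau>: "\<tau> \<in> {0..1}"
  shows "((\<lambda>s. graph s z) has_vector_derivative graph' \<tau> z) (at \<tau> within {0..1})"
proof -
  have "((\<lambda>s. fst (\<Phi> s z) $ j) has_vector_derivative fst (D \<tau> z) $ j) (at \<tau> within {0..1})"
    "((\<lambda>s. snd (\<Phi> s z) $ j) has_vector_derivative snd (D \<tau> z) $ j) (at \<tau> within {0..1})" for j
    by (intro bounded_linear.has_vector_derivative[OF bounded_linear_vec_nth]
        bounded_linear.has_vector_derivative[OF bounded_linear_fst]
        bounded_linear.has_vector_derivative[OF bounded_linear_snd] \<Phi>_derivative[OF \<tau>])+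
  note D = this
  have c: "((\<lambda>s. (fst z $ j, snd z $ j)) has_vector_derivative (0, 0)) (at \<tau> within {0..1})" for j
    unfolding zero_prod_def[symmetric] by (rule has_vector_derivative_const)
  show ?thesis
    unfolding graph_def graph'_def
    by (rule has_vector_derivative_vec_lambda) (intro has_vector_derivative_Pair c D)
qed

lemma graph'_continuous: "continuous_on {0..1} (\<lambda>\<tau>. graph' \<tau> z)"
  unfolding graph'_def by (intro continuous_intros D_continuous)

lemma C1_graph: "C1_curve 0 1 (\<lambda>\<tau>. graph \<tau> z)"
  unfolding C1_curve_def using graph_derivative graph'_continuous by blast

lemma C1_lagrangian_graph: "C1_lagrangian_path star_form 0 1 (star_graph_path a b \<gamma>)"
  unfolding C1_lagrangian_path_def range_graph[symmetric]
proof (intro conjI ballI allI)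
  show "lagrangian_subspace star_form (range (graph t))" if "t \<in> {0..1}" for t by (rule lagrangian_graph[OF that])
  show "\<exists>D. continuous_on {0..1} D \<and>
      (\<forall>t\<in>{0..1}. ((\<lambda>s. closest_point (range (graph s)) v) has_vector_derivative D t) (at t within {0..1}))" for v
    using C1_curve_closest_point_image[of 0 1 graph v, OF linear_graph inj_graph C1_graph] unfolding C1_curve_def by blast
qed

lemma C1_lagrangian_boundary: "C1_lagrangian_path star_form 0 1 (\<lambda>_. star_boundary_space :: ('d, 'm) star_space set)"
  unfolding C1_lagrangian_path_def
  by (intro conjI ballI allI lagrangian_star_boundary_space exI[of _ "\<lambda>_. 0"]) auto

definition jacobi_kernel :: "real \<Rightarrow> (((real^'d)^'m) \<times> ((real^'d)^'m)) set" where
  "jacobi_kernel \<tau> = {z \<in> L0. snd (\<Phi> \<tau> z) = 0}"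

text \<open>Testing \<open>fst z\<close> against the constant vector whose entries are the sum of
  its components gives the squared norm of that sum, so orthogonality to \<open>\<Delta>\<close> is
  the Kirchhoff condition.\<close>

lemma L0_iff: "z \<in> L0 \<longleftrightarrow> (\<forall>i j. snd z $ i = snd z $ j) \<and> (\<Sum>j\<in>UNIV. fst z $ j) = 0"
proof -
  have "(\<forall>e\<in>\<Delta>. fst z \<bullet> e = 0) \<longleftrightarrow> (\<Sum>j\<in>UNIV. fst z $ j) = 0"
  proof
    assume z: "\<forall>e\<in>\<Delta>. fst z \<bullet> e = 0"
    let ?s = "\<Sum>j\<in>UNIV. fst z $ j"
    have "(\<chi> j. ?s) \<in> \<Delta>" by (simp add: \<Delta>_def)
    with z have "fst z \<bullet> (\<chi> j. ?s) = 0" by blast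
    moreover have "fst z \<bullet> (\<chi> j. ?s) = ?s \<bullet> ?s" unfolding inner_vec_def[of "fst z"] inner_sum_left by simp
    ultimately show "?s = 0" by simp
  next
    assume s: "(\<Sum>j\<in>UNIV. fst z $ j) = 0"
    show "\<forall>e\<in>\<Delta>. fst z \<bullet> e = 0"
    proof
      fix e assume e: "e \<in> \<Delta>"
      define j0 :: 'm where "j0 = undefined"
      have c: "e $ j = e $ j0" for j using e unfolding \<Delta>_def by blast
      have "fst z \<bullet> e = (\<Sum>j\<in>UNIV. fst z $ j \<bullet> e $ j0)"
        unfolding inner_vec_def[of "fst z"] by (rule sum.cong[OF refl]) (rule arg_cong[OF c])
      also have "\<dots> = (\<Sum>j\<in>UNIV. fst z $ j) \<bullet> e $ j0" by (simp only: inner_sum_left)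
      finally show "fst z \<bullet> e = 0" using s by simp
    qed
  qed
  moreover have "snd z \<in> \<Delta> \<longleftrightarrow> (\<forall>i j. snd z $ i = snd z $ j)" unfolding \<Delta>_def by simp
  ultimately show ?thesis unfolding L0_def mem_Collect_eq by blast
qed

lemma intersection_eq: "star_boundary_space \<inter> star_graph_path a b \<gamma> \<tau> = graph \<tau> ` jacobi_kernel \<tau>"
proof -
  have "graph \<tau> z \<in> star_boundary_space \<longleftrightarrow> z \<in> jacobi_kernel \<tau>" for z
    unfolding star_boundary_space_iff jacobi_kernel_def mem_Collect_eq L0_iff
    by (auto simp: graph_def vec_eq_iff[of "snd (\<Phi> \<tau> z)"])
  then show ?thesis unfolding range_graph[symmetric] by auto
qed

lemma subspace_jacobi_kernel:
  assumes \<tau>: "\<tau> \<in> {0..1}"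
  shows "subspace (jacobi_kernel \<tau>)"
proof -
  have "linear (\<lambda>z. snd (\<Phi> \<tau> z))"
    using linear_compose[OF \<Phi>_linear[OF \<tau>] bounded_linear.linear[OF bounded_linear_snd]] by (simp add: o_def)
  then have "subspace (L0 \<inter> {z. snd (\<Phi> \<tau> z) = 0})" by (intro subspace_inter subspace_L0 linear_subspace_kernel)
  then show ?thesis unfolding jacobi_kernel_def by (simp add: Int_def)
qed

text \<open>Both spaces are injective linear images of \<open>jacobi_kernel \<tau>\<close>: one
  under the graph map, the other under the final momentum, which determines a solution with zero
  final position.\<close>

lemma dim_intersection:
  assumes \<tau>: "\<tau> \<in> {0..1}"
  shows "dim (star_boundary_space \<inter> star_graph_path a b \<gamma> \<tau>) = dim (fibre \<tau>)"
proof -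
  have lf: "linear (\<lambda>z. fst (\<Phi> \<tau> z))"
    using linear_compose[OF \<Phi>_linear[OF \<tau>] bounded_linear.linear[OF bounded_linear_fst]] by (simp add: o_def)
  have "inj_on (\<lambda>z. fst (\<Phi> \<tau> z)) (jacobi_kernel \<tau>)"
    unfolding linear_injective_on_subspace_0[OF lf subspace_jacobi_kernel[OF \<tau>]]
  proof (intro ballI impI)
    fix z assume z: "z \<in> jacobi_kernel \<tau>" "fst (\<Phi> \<tau> z) = 0"
    from z(1) have "snd (\<Phi> \<tau> z) = 0" unfolding jacobi_kernel_def by blast
    with z(2) have "\<Phi> \<tau> z = 0" unfolding prod_eq_iff fst_zero snd_zero by blast
    then show "z = 0" by (rule flow_inj[OF \<tau>])
  qed
  moreover have "fibre \<tau> = (\<lambda>z. fst (\<Phi> \<tau> z)) ` jacobi_kernel \<tau>"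
  proof (intro set_eqI iffI)
    fix p assume "p \<in> fibre \<tau>"
    then obtain z where z: "z \<in> L0" "\<Phi> \<tau> z = (p, 0)" unfolding fibre_def by blast
    have "z \<in> jacobi_kernel \<tau>" unfolding jacobi_kernel_def mem_Collect_eq z(2) using z(1) by simp
    moreover have "p = fst (\<Phi> \<tau> z)" unfolding z(2) by simp
    ultimately show "p \<in> (\<lambda>z. fst (\<Phi> \<tau> z)) ` jacobi_kernel \<tau>" by (rule rev_image_eqI)
  next
    fix p assume "p \<in> (\<lambda>z. fst (\<Phi> \<tau> z)) ` jacobi_kernel \<tau>"
    then obtain z where "z \<in> L0" "snd (\<Phi> \<tau> z) = 0" "p = fst (\<Phi> \<tau> z)" unfolding jacobi_kernel_def by blast
    then have "z \<in> L0" "\<Phi> \<tau> z = (p, 0)" by (simp_all add: prod_eq_iff)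
    then show "p \<in> fibre \<tau>" unfolding fibre_def by blast
  qed
  ultimately have "dim (fibre \<tau>) = dim (jacobi_kernel \<tau>)"
    using dim_image_inj_on[OF lf subspace_jacobi_kernel[OF \<tau>]] by simp
  moreover have "dim (graph \<tau> ` jacobi_kernel \<tau>) = dim (jacobi_kernel \<tau>)"
    by (rule dim_image_inj_on[OF linear_graph[OF \<tau>] subspace_jacobi_kernel[OF \<tau>]]) (rule inj_on_subset[OF inj_graph subset_UNIV])
  ultimately show ?thesis unfolding intersection_eq by simp
qed

text \<open>At time \<open>0\<close> the fibre is the orthogonal complement of the diagonal
  \<open>\<Delta>\<close>. This is where the term \<open>(m - 1) d\<close> of the theorem
  originates.\<close>

lemma dim_fibre_0: "dim (fibre 0) + CARD('d) = CARD('m) * CARD('d)"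
proof -
  have "fibre 0 = orthogonal_comp \<Delta>"
    unfolding fibre_def L0_def orthogonal_comp_def orthogonal_def
    using subspace_0[OF subspace_\<Delta>'] by (auto simp: flow_0 inner_commute)
  moreover have "dim (orthogonal_comp \<Delta>) + dim \<Delta> = DIM((real^'d)^'m)" by (rule dim_orthogonal_comp[OF subspace_\<Delta>'])
  moreover have "dim \<Delta> = CARD('d)"
  proof -
    let ?T = "\<lambda>c :: real^'d. (\<chi> j. c) :: (real^'d)^'m"
    have T: "linear ?T" by (rule linearI) (auto simp: vec_eq_iff)
    have "inj ?T" by (rule injI) (simp add: vec_eq_iff)
    then have "dim (range ?T) = dim (UNIV :: (real^'d) set)" by (rule dim_image_inj_on[OF T subspace_UNIV])
    moreover have "range ?T = \<Delta>"
    proof (intro subset_antisym subsetI)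
      show "u \<in> range ?T" if "u \<in> \<Delta>" for u
      proof -
        have "u = ?T (u $ undefined)" using that unfolding \<Delta>_def by (simp add: vec_eq_iff)
        then show ?thesis by blast
      qed
    qed (auto simp: \<Delta>_def)
    ultimately show ?thesis by simp
  qed
  ultimately show ?thesis by simp
qed

text \<open>The constant path contributes \<open>0\<close>. At a crossing the final position
  vanishes, so the symplectic pairing reduces to momentum times velocity, and the momentum is
  \<open>P\<close> applied to the velocity.\<close>

lemma crossing_form_graph:
  assumes \<tau>: "\<tau> \<in> {0..1}" and z: "z \<in> jacobi_kernel \<tau>"
  shows "crossing_form star_form 0 1 (star_graph_path a b \<gamma>) (\<lambda>_. star_boundary_space) \<tau> (graph \<tau> z)
    = P \<tau> (snd (D \<tau> z)) \<bullet> snd (D \<tau> z)"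
proof -
  interpret S: euclidean_symplectic "star_form :: ('d, 'm) star_space \<Rightarrow> _" star_J by (rule euclidean_symplectic_star)
  have mem: "graph \<tau> z \<in> star_boundary_space" using z intersection_eq[of \<tau>] by blast
  have p: "star_graph_path a b \<gamma> = (\<lambda>s. range (graph s))" using range_graph by (intro ext) simp
  have c: "continuous_on {0..1} (\<lambda>s. graph s w)" for w by (rule C1_curve_continuous[OF C1_graph])
  have "lagrangian_velocity_form star_form 0 1 (star_graph_path a b \<gamma>) \<tau> (graph \<tau> z) = star_form (graph \<tau> z) (graph' \<tau> z)"
    unfolding p by (rule S.velocity_form_image[where a=0 and b=1 and t=\<tau> and C=graph and C'=graph' and z=z,
          OF zero_less_one \<tau> linear_graph inj_graph lagrangian_graph c graph_derivative[OF \<tau>]])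
  moreover have "lagrangian_velocity_form star_form 0 1 (\<lambda>_. star_boundary_space) \<tau> (graph \<tau> z) = 0"
    by (rule S.velocity_form_const[OF lagrangian_star_boundary_space mem zero_less_one \<tau>])
  moreover have "snd (\<Phi> \<tau> z) = 0" using z by (simp add: jacobi_kernel_def)
  ultimately show ?thesis
    unfolding crossing_form_def star_form_graph using D_relations(1)[OF \<tau>, of z] by simp
qed

text \<open>With zero final position, zero velocity would mean zero momentum, hence
  \<open>z = 0\<close> by injectivity of the flow. The second claim serves nondegeneracy, which is
  tested with \<open>v = u\<close> on the polar expression.\<close>

lemma crossing_form_positive:
  assumes \<tau>: "\<tau> \<in> {0..1}" and v: "v \<in> star_boundary_space \<inter> star_graph_path a b \<gamma> \<tau>" "v \<noteq> 0"
  shows "0 < crossing_form star_form 0 1 (star_graph_path a b \<gamma>) (\<lambda>_. star_boundary_space) \<tau> v"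
    and "crossing_form star_form 0 1 (star_graph_path a b \<gamma>) (\<lambda>_. star_boundary_space) \<tau> (v + v)
      = 4 * crossing_form star_form 0 1 (star_graph_path a b \<gamma>) (\<lambda>_. star_boundary_space) \<tau> v"
proof -
  obtain z where z: "z \<in> jacobi_kernel \<tau>" "v = graph \<tau> z" using v(1) unfolding intersection_eq by blast
  have z0: "z \<noteq> 0" using v(2) linear_0[OF linear_graph[OF \<tau>]] z(2) by auto
  have \<Phi>z: "snd (\<Phi> \<tau> z) = 0" using z(1) by (simp add: jacobi_kernel_def)
  have Pz: "fst (\<Phi> \<tau> z) = P \<tau> (snd (D \<tau> z))" using D_relations(1)[OF \<tau>, of z] \<Phi>z by simp
  have "snd (D \<tau> z) \<noteq> 0" using flow_inj[OF \<tau>, of z] z0 \<Phi>z Pz by (auto simp: prod_eq_iff)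
  then show "0 < crossing_form star_form 0 1 (star_graph_path a b \<gamma>) (\<lambda>_. star_boundary_space) \<tau> v"
    unfolding z(2) crossing_form_graph[OF \<tau> z(1)] by (rule P_positive[OF \<tau>])
  have zz: "z + z \<in> jacobi_kernel \<tau>" by (rule subspace_add[OF subspace_jacobi_kernel[OF \<tau>] z(1) z(1)])
  \<comment> \<open>Homogeneity of \<open>D \<tau>\<close> is recovered from linearity of
    \<open>\<Phi> \<tau>\<close> and injectivity of \<open>P \<tau>\<close>.\<close>
  have vv: "v + v = graph \<tau> (z + z)" using linear_add[OF linear_graph[OF \<tau>]] z(2) by simp
  have "P \<tau> (snd (D \<tau> (z + z)) - 2 *\<^sub>R snd (D \<tau> z)) = 0"
  proof -
    have "fst (\<Phi> \<tau> (z + z)) = P \<tau> (snd (D \<tau> (z + z)))"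
      using D_relations(1)[OF \<tau>, of "z + z"] zz by (simp add: jacobi_kernel_def)
    moreover have "fst (\<Phi> \<tau> (z + z)) = 2 *\<^sub>R fst (\<Phi> \<tau> z)"
      using linear_add[OF \<Phi>_linear[OF \<tau>], of z z] by (simp add: scaleR_2)
    ultimately show ?thesis using Pz by (simp add: blinfun.diff_right blinfun.scaleR_right)
  qed
  then have "snd (D \<tau> (z + z)) = 2 *\<^sub>R snd (D \<tau> z)"
    using P_positive[OF \<tau>, of "snd (D \<tau> (z + z)) - 2 *\<^sub>R snd (D \<tau> z)"] by fastforce
  then have "P \<tau> (snd (D \<tau> (z + z))) \<bullet> snd (D \<tau> (z + z)) = 4 * (P \<tau> (snd (D \<tau> z)) \<bullet> snd (D \<tau> z))"
    by (simp add: blinfun.scaleR_right)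
  then show "crossing_form star_form 0 1 (star_graph_path a b \<gamma>) (\<lambda>_. star_boundary_space) \<tau> (v + v)
      = 4 * crossing_form star_form 0 1 (star_graph_path a b \<gamma>) (\<lambda>_. star_boundary_space) \<tau> v"
    unfolding vv crossing_form_graph[OF \<tau> zz] unfolding z(2) crossing_form_graph[OF \<tau> z(1)] .
qed

lemma maslov_index_eq:
  assumes clm: "is_clm_index star_form \<mu>CLM"
  shows "maslov_index \<mu>CLM a b \<gamma> = int (dim (fibre 0))
    + (\<Sum>\<tau>\<in>{\<tau> \<in> {0<..<1}. fibre \<tau> \<noteq> {0}}. int (dim (fibre \<tau>)))"
proof -
  let ?l = "star_graph_path a b \<gamma>" and ?B = "\<lambda>_::real. star_boundary_space :: ('d, 'm) star_space set"
  let ?U = "\<lambda>t. star_boundary_space \<inter> ?l t" and ?q = "crossing_form star_form 0 1 ?l ?B"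
  note pos = crossing_form_positive
  have sub: "subspace (?U t)" if "t \<in> {0..1}" for t
    unfolding intersection_eq by (rule linear_subspace_image[OF linear_graph[OF that] subspace_jacobi_kernel[OF that]])
  have nd: "\<forall>t\<in>{0..1}. nondegenerate_form (?q t) (?B t \<inter> ?l t)"
    unfolding nondegenerate_form_def
  proof (intro ballI impI)
    fix t u assume t: "t \<in> {0..1::real}" and u: "u \<in> ?U t" and 0: "\<forall>v\<in>?U t. ?q t (u + v) - ?q t u - ?q t v = 0"
    show "u = 0"
    proof (rule ccontr)
      assume "u \<noteq> 0"
      from pos[OF t u this] have "0 < ?q t u" "?q t (u + u) = 4 * ?q t u" .
      with bspec[OF 0 u] show False by simp
    qed
  qed
  have "maslov_index \<mu>CLM a b \<gamma> = n_plus (?q 0) (?U 0)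
      + (\<Sum>t | 0 < t \<and> t < 1 \<and> ?U t \<noteq> {0}. form_signature (?q t) (?U t)) - n_minus (?q 1) (?U 1)"
    unfolding maslov_index_def
    by (rule clm[unfolded is_clm_index_def, THEN conjunct2, THEN conjunct2, THEN spec, THEN spec, THEN spec, THEN spec, THEN mp])
      (intro conjI zero_less_one C1_lagrangian_boundary C1_lagrangian_graph nd)
  also have "n_plus (?q 0) (?U 0) = int (dim (fibre 0))"
    using neg_index_positive(1)[OF sub pos(1), of 0 0] dim_intersection[of 0] by simp
  \<comment> \<open>The final endpoint counts negative directions only and there are none, so
    conjugacy at \<open>1\<close> enters the Maslov index no more than it enters the Morse
    index.\<close>
  also have "n_minus (?q 1) (?U 1) = 0"
    using neg_index_positive(2)[OF sub pos(1), of 1 1] by simp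
  also have "(\<Sum>t | 0 < t \<and> t < 1 \<and> ?U t \<noteq> {0}. form_signature (?q t) (?U t))
      = (\<Sum>\<tau>\<in>{\<tau> \<in> {0<..<1}. fibre \<tau> \<noteq> {0}}. int (dim (fibre \<tau>)))"
  proof (rule sum.cong)
    have eq: "?U t = {0} \<longleftrightarrow> fibre t = {0}" if t: "t \<in> {0..1}" for t
    proof -
      have "?U t = {0} \<longleftrightarrow> dim (?U t) = 0" using dim_eq_0[of "?U t"] subspace_0[OF sub[OF t]] by auto
      moreover have "fibre t = {0} \<longleftrightarrow> dim (fibre t) = 0" using dim_eq_0[of "fibre t"] subspace_0[OF subspace_fibre[OF t]] by auto
      ultimately show ?thesis using dim_intersection[OF t] by simp
    qed
    show "{t. 0 < t \<and> t < 1 \<and> ?U t \<noteq> {0}} = {\<tau> \<in> {0<..<1}. fibre \<tau> \<noteq> {0}}"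
    proof (intro Collect_cong)
      fix t :: real
      show "(0 < t \<and> t < 1 \<and> ?U t \<noteq> {0}) = (t \<in> {0<..<1} \<and> fibre t \<noteq> {0})"
      proof (cases "0 < t \<and> t < 1")
        case True
        then have "t \<in> {0..1}" by simp
        from eq[OF this] True show ?thesis by simp
      next
        case False
        then show ?thesis by auto
      qed
    qed
    fix t assume "t \<in> {\<tau> \<in> {0<..<1}. fibre \<tau> \<noteq> {0}}"
    then have t: "t \<in> {0..1}" by simp
    show "form_signature (?q t) (?U t) = int (dim (fibre t))"
      unfolding form_signature_def
      using neg_index_positive[OF sub[OF t] pos(1)[OF t]] dim_intersection[OF t] by simp
  qed
  finally show ?thesis by simp
qed

theorem morse_maslov:
  assumes clm: "is_clm_index star_form \<mu>CLM"
  shows "\<exists>n. morse_index a b L x = enat n \<and>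
    int n - maslov_index \<mu>CLM a b \<gamma> = - ((int CARD('m) - 1) * int CARD('d))"
proof (intro exI conjI)
  show "morse_index a b L x = enat (\<Sum>\<tau>\<in>{\<tau> \<in> {0<..<1}. fibre \<tau> \<noteq> {0}}. dim (fibre \<tau>))"
    unfolding morse_index_eq by (rule neg_index_eq_sum_fibres)
  have "int (dim (fibre 0)) + int CARD('d) = int CARD('m) * int CARD('d)"
    using dim_fibre_0 by (metis of_nat_add of_nat_mult)
  then show "int (\<Sum>\<tau>\<in>{\<tau> \<in> {0<..<1}. fibre \<tau> \<noteq> {0}}. dim (fibre \<tau>)) - maslov_index \<mu>CLM a b \<gamma>
      = - ((int CARD('m) - 1) * int CARD('d))"
    unfolding maslov_index_eq[OF clm] by (simp add: algebra_simps)
qed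

end

theorem theorem5p4:
  fixes a b :: "'m::finite \<Rightarrow> real"
    and L :: "'m \<Rightarrow> 'd::finite edge_lagrangian"
    and y :: "'m \<Rightarrow> real^'d"
    and x :: "'m \<Rightarrow> real \<Rightarrow> real^'d"
    and \<gamma> :: "'m \<Rightarrow> real \<Rightarrow> 'd phase \<Rightarrow> 'd phase"
    and \<mu>CLM :: "real \<Rightarrow> real \<Rightarrow> (real \<Rightarrow> ('d, 'm) star_space set)
                  \<Rightarrow> (real \<Rightarrow> ('d, 'm) star_space set) \<Rightarrow> int"
  assumes edges: "\<And>j. a j < b j"
    and lagrangian: "star_lagrangian a b L"
    and critical: "bolza_critical_point a b L y x"
    and fundamental: "\<And>j. is_fundamental_solution (a j) (b j)
                        (hamiltonian_matrix (L j) (a j) (b j) (x j)) (\<gamma> j)"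
    and clm: "is_clm_index star_form \<mu>CLM"
  shows "\<exists>n. morse_index a b L x = enat n \<and>
             int n - maslov_index \<mu>CLM a b \<gamma> = - ((int CARD('m) - 1) * int CARD('d))"
proof -
  interpret star_bolza a b L y x \<gamma>
    by (rule star_bolza.intro[OF edges lagrangian critical fundamental])
  show ?thesis by (rule morse_maslov[OF clm])
qed

end
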